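(* Let $d\ge1$, $p>0$, and let one of the three settings (Legendre, Chebyshev, Trigonometric) described in the context be fixed, with its domain $\mathcal X$, measure $\mu$ and regressors, truncated at maximum degree $\alpha_{max}$, so $N=(\alpha_{max}+1)^d$. Let $f$ be a $p$-smooth function on $\mathcal X$ with $\mathbb V_\mu[f]>0$ (in the Trigonometric setting, it is additionally required that $f$ can be extended to a $1$-periodic function in each of its arguments, which is equivalent to additional boundary conditions). Suppose the design points $x_1,\dots,x_n$ are sampled i.i.d. from $\mu$. For each of the items below there is a choice of maximum degree $\alpha_{max}=\alpha_{max}(n)$, depending only on $n,p,d$ and the item and setting considered, such that for every such $f$ there is a constant $C$ independent of $n$ for which, for all $U\subseteq\{1,\dots,d\}$ and all $n\ge2$, the quadratic risk $\mathbb E(S_U-\hat S_U)^2$ of the Sobol' index estimate, as well as the quadratic risk $\mathbb E(T_U-\hat T_U)^2$ of the total-effect index estimate, is bounded as follows: (i) Noiseless observations ($\sigma^2=0$), ordinary least squares: by $C\left(\frac{n}{\ln n}\right)^{-p/d}$ in the Legendre setting, and by $C\left(\frac{n}{\ln n}\right)^{-2p/d}$ in the Chebyshev and Trigonometric settings. (ii) Noisy or noiseless observations (any fixed $\sigma^2\ge0$), projection method: by $C\,n^{-\frac{2p}{2p+d}}$ in all three settings. (iii) Noisy observations (fixed $\sigma^2>0$), ordinary least squares: by $C\,n^{-\frac{2p}{2p+d}}$ in the Chebyshev and Trigonometric settings; in the Legendre setting by $C\,n^{-\frac{2p}{2p+d}}$ if $p/d>1/2$, and by $C\left(\frac{n}{\ln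 n}\right)^{-p/d}$ if $p/d\le1/2$.
   Context: Smoothness: for $m\in\{0,1,2,\dots\}$, $\beta\in(0,1]$ and $p=m+\beta$, a function $f$ on $\mathcal X$ is $p$-smooth if it is $m$ times continuously differentiable on $\mathcal X$ and each partial derivative $D^\alpha f$ of order $|\alpha|=m$ satisfies a Hölder condition $|D^\alpha f(x)-D^\alpha f(x_0)|\le\gamma\|x-x_0\|^\beta$ for all $x,x_0\in\mathcal X$, for some $\gamma>0$. Settings. Regressors are $\Psi_\alpha(x)=\prod_{i=1}^d\psi_{\alpha_i}(x_i)$ with $\alpha$ in the maximum degree truncation set $\mathcal L_N=\{\alpha\in\mathbb N^d:\max_i\alpha_i\le\alpha_{max}\}$, where $\mathbb N=\{0,1,2,\dots\}$. Legendre: $\mathcal X=[-1,1]^d$, $\mu$ uniform, $\psi_\alpha$ the univariate Legendre polynomial of degree $\alpha$ normalized to unit $L^2$ norm under the uniform probability measure on $[-1,1]$. Chebyshev: $\mathcal X=[-1,1]^d$, $\mu$ with density $\prod_{i=1}^d(\pi\sqrt{1-x_i^2})^{-1}$, $\psi_0=1$, $\psi_\alpha(x)=\sqrt2\cos(\alpha\arccos x)$ for $\alpha\ge1$. Trigonometric: $\mathcal X=[0,1]^d$, $\mu$ uniform, $\psi_0=1$, $\psi_{2k-1}(x)=\sqrt2\sin(2\pi kx)$, $\psi_{2k}(x)=\sqrt2\cos(2\pi kx)$ for $k\ge1$, with $\alpha_{max}$ even. Indices: every $f\in L^2(\mathcal X,\mu)$ has a unique Sobol-Hoeffding decomposition $f(x)=\sum_{U\subseteq\{1,\dots,d\}}f_U(x_U)$,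 where $f_U$ depends only on $x_U=(x_i)_{i\in U}$, $f_\emptyset=\mathbb E_\mu[f]$, and the integral of $f_U$ over $x_i$ with respect to the $i$-th marginal of $\mu$ vanishes for every $i\in U$. Here $\mathbb E_\mu,\mathbb V_\mu$ are mean and variance under $\mu$. When $\mathbb V_\mu[f]>0$, $S_U=\mathbb V_\mu[f_U]/\mathbb V_\mu[f]$ and $T_U=\sum_{V:\,V\cap U\ne\emptyset}S_V$ ($S_\emptyset=T_\emptyset=0$). $\hat S_U,\hat T_U$ are the corresponding indices of the approximation $\hat f$; if $\mathbb V_\mu[\hat f]=0$ they are by convention set equal to $2^{-d}$. Estimators: $y_i=f(x_i)+\eta_i$, $i=1,\dots,n$, with $\eta_i$ i.i.d., $\mathbb E\eta_i=0$, $\mathbb V\eta_i=\sigma^2<\infty$, independent of the design; $Y=(y_1,\dots,y_n)^T$; $\Phi\in\mathbb R^{n\times N}$ has entries $\Psi_\alpha(x_i)$, $\alpha\in\mathcal L_N$. The approximation is $\hat f=\sum_{\alpha\in\mathcal L_N}\hat c_\alpha\Psi_\alpha$, where for the projection method $\hat c=\frac1n\Phi^TY$, and for ordinary least squares $\hat c=(\Phi^T\Phi)^{-1}\Phi^TY$ if $\det(\Phi^T\Phi)\ne0$ and $\hat c=0$ otherwise. $\mathbb E$ is expectation over design and noise. *)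

theory Defs
  imports
    "HOL-Probability.Probability"
    "HOL-Computational_Algebra.Polynomial"
    "Jordan_Normal_Form.Determinant"
    "Jordan_Normal_Form.Gauss_Jordan_Elimination"
begin

no_notation Matrix.vec_index (infixl "$" 100)

section \<open>Smoothness\<close>

text \<open>
  Partial derivatives are taken within \<open>X\<close>, hence are one-sided at boundary points of a cube.
  \<open>D \<alpha>\<close> is the partial derivative of \<open>f\<close> with multi-index \<open>\<alpha>\<close>. On a cube (and on the whole
  space) the family \<open>D\<close> is determined by \<open>f\<close> on \<open>X\<close>, and mixed partials up to order \<open>m\<close>
  commute since they are all required to be continuous.
\<close>

definition p_smooth_on :: "real \<Rightarrow> (real ^ 'd) set \<Rightarrow> (real ^ 'd \<Rightarrow> real) \<Rightarrow> bool" where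
  "p_smooth_on p X f \<longleftrightarrow>
     (\<exists>(m::nat) (\<beta>::real) (D :: ('d::finite \<Rightarrow> nat) \<Rightarrow> real ^ 'd \<Rightarrow> real).
        0 < \<beta> \<and> \<beta> \<le> 1 \<and> p = real m + \<beta> \<and>
        (\<forall>x\<in>X. D (\<lambda>_. 0) x = f x) \<and>
        (\<forall>\<alpha> i. (\<Sum>j\<in>UNIV. \<alpha> j) < m \<longrightarrow>
           (\<forall>x\<in>X. ((\<lambda>t. D \<alpha> (x + t *\<^sub>R axis i 1)) has_real_derivative D (\<alpha>(i := Suc (\<alpha> i))) x)
                     (at 0 within {t. x + t *\<^sub>R axis i 1 \<in> X}))) \<and>
        (\<forall>\<alpha>. (\<Sum>j\<in>UNIV. \<alpha> j) \<le> m \<longrightarrow> continuous_on X (D \<alpha>)) \<and>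
        (\<forall>\<alpha>. (\<Sum>j\<in>UNIV. \<alpha> j) = m \<longrightarrow>
           (\<exists>\<gamma>>0. \<forall>x\<in>X. \<forall>x0\<in>X. \<bar>D \<alpha> x - D \<alpha> x0\<bar> \<le> \<gamma> * norm (x - x0) powr \<beta>)))"


section \<open>The three settings\<close>

datatype setting = Legendre | Chebyshev | Trigonometric

fun interval1 :: "setting \<Rightarrow> real set" where
  "interval1 Legendre = {-1..1}"
| "interval1 Chebyshev = {-1..1}"
| "interval1 Trigonometric = {0..1}"

definition cube :: "setting \<Rightarrow> (real ^ 'd) set" where
  "cube s = {x. \<forall>i. x $ i \<in> interval1 s}"

text \<open>
  The measures live on the cube itself (their \<^term>\<open>space\<close> is the cube), so that the values
  of a function outside the cube, in particular its measurability there, play no role.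
\<close>

fun design_measure :: "setting \<Rightarrow> (real ^ 'd) measure" where
  "design_measure Legendre =
     uniform_measure (restrict_space lborel (cube Legendre)) (cube Legendre)"
| "design_measure Chebyshev =
     density (restrict_space lborel (cube Chebyshev))
       (\<lambda>x. ennreal (\<Prod>i\<in>UNIV. 1 / (pi * sqrt (1 - (x $ i)\<^sup>2))))"
| "design_measure Trigonometric =
     uniform_measure (restrict_space lborel (cube Trigonometric)) (cube Trigonometric)"

definition marginal :: "setting \<Rightarrow> 'd::finite \<Rightarrow> real measure" where
  "marginal s i =
     distr (design_measure s :: (real ^ 'd) measure) (restrict_space borel (interval1 s)) (\<lambda>x. x $ i)"

definition legendre_poly :: "nat \<Rightarrow> real poly" where \<comment> \<open>Rodrigues' formula\<close>
  "legendre_poly k = Polynomial.smult (1 / (2 ^ k * fact k)) ((Polynomial.pderiv ^^ k) ([:-1, 0, 1:] ^ k))"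

fun psi :: "setting \<Rightarrow> nat \<Rightarrow> real \<Rightarrow> real" where
  "psi Legendre k x =
     poly (legendre_poly k) x /
       sqrt (\<integral>t. (poly (legendre_poly k) t)\<^sup>2 \<partial>(uniform_measure lborel {-1..1}))"
| "psi Chebyshev k x = (if k = 0 then 1 else sqrt 2 * cos (real k * arccos x))"
| "psi Trigonometric k x =
     (if k = 0 then 1
      else if odd k then sqrt 2 * sin (2 * pi * real ((k + 1) div 2) * x)
      else sqrt 2 * cos (2 * pi * real (k div 2) * x))"

definition Psi :: "setting \<Rightarrow> ('d::finite \<Rightarrow> nat) \<Rightarrow> real ^ 'd \<Rightarrow> real" where
  "Psi s \<alpha> x = (\<Prod>i\<in>UNIV. psi s (\<alpha> i) (x $ i))"

definition trunc_set :: "nat \<Rightarrow> ('d::finite \<Rightarrow> nat) set" where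
  "trunc_set k = {\<alpha>. \<forall>i. \<alpha> i \<le> k}"

definition admissible_degree :: "setting \<Rightarrow> (nat \<Rightarrow> nat) \<Rightarrow> bool" where
  "admissible_degree s amax \<longleftrightarrow> (s = Trigonometric \<longrightarrow> (\<forall>n. even (amax n)))"

text \<open>
  In the trigonometric setting the boundary conditions say that the periodic extension
  is itself \<open>p\<close>-smooth, not merely that it exists.
\<close>

definition target_class :: "setting \<Rightarrow> real \<Rightarrow> (real ^ 'd \<Rightarrow> real) \<Rightarrow> bool" where
  "target_class s p f \<longleftrightarrow>
     p_smooth_on p (cube s) f \<and>
     (s = Trigonometric \<longrightarrow>
        (\<exists>g. p_smooth_on p UNIV g \<and> (\<forall>x i. g (x + axis i 1) = g x) \<and> (\<forall>x\<in>cube s. g x = f x)))"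


section \<open>Sobol indices\<close>

abbreviation mean :: "setting \<Rightarrow> (real ^ 'd \<Rightarrow> real) \<Rightarrow> real" where
  "mean s \<equiv> prob_space.expectation (design_measure s)"

abbreviation var :: "setting \<Rightarrow> (real ^ 'd \<Rightarrow> real) \<Rightarrow> real" where
  "var s \<equiv> prob_space.variance (design_measure s)"

text \<open>The components are unique up to null sets, so identities in \<open>L\<^sup>2\<close> are stated almost everywhere.\<close>

definition sobol_hoeffding ::
  "setting \<Rightarrow> (real ^ 'd \<Rightarrow> real) \<Rightarrow> (('d::finite) set \<Rightarrow> real ^ 'd \<Rightarrow> real) \<Rightarrow> bool" where
  "sobol_hoeffding s f F \<longleftrightarrow>
     (\<forall>U. F U \<in> borel_measurable (design_measure s) \<and>
          integrable (design_measure s) (\<lambda>x. (F U x)\<^sup>2)) \<and>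
     (AE x in design_measure s. f x = (\<Sum>U\<in>UNIV. F U x)) \<and>
     (\<forall>U. \<forall>x\<in>cube s. \<forall>y\<in>cube s. (\<forall>i\<in>U. x $ i = y $ i) \<longrightarrow> F U x = F U y) \<and>
     (\<forall>x\<in>cube s. F {} x = mean s f) \<and>
     (\<forall>U. \<forall>i\<in>U. AE x in design_measure s.
        (\<integral>t. F U (\<chi> j. if j = i then t else x $ j) \<partial>(marginal s i)) = 0)"

definition sobol_component ::
  "setting \<Rightarrow> (real ^ 'd \<Rightarrow> real) \<Rightarrow> ('d::finite) set \<Rightarrow> real ^ 'd \<Rightarrow> real" where
  "sobol_component s f = (SOME F. sobol_hoeffding s f F)"

definition sobol_index :: "setting \<Rightarrow> (real ^ 'd \<Rightarrow> real) \<Rightarrow> ('d::finite) set \<Rightarrow> real" where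
  "sobol_index s f U = var s (sobol_component s f U) / var s f"

definition total_index :: "setting \<Rightarrow> (real ^ 'd \<Rightarrow> real) \<Rightarrow> ('d::finite) set \<Rightarrow> real" where
  "total_index s f U = (\<Sum>V | V \<inter> U \<noteq> {}. sobol_index s f V)"

definition est_sobol_index :: "setting \<Rightarrow> (real ^ 'd \<Rightarrow> real) \<Rightarrow> ('d::finite) set \<Rightarrow> real" where
  "est_sobol_index s g U = (if var s g = 0 then 1 / 2 ^ CARD('d) else sobol_index s g U)"

definition est_total_index :: "setting \<Rightarrow> (real ^ 'd \<Rightarrow> real) \<Rightarrow> ('d::finite) set \<Rightarrow> real" where
  "est_total_index s g U = (if var s g = 0 then 1 / 2 ^ CARD('d) else total_index s g U)"


section \<open>Estimators\<close>

text \<open>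
  The columns of \<open>\<Phi>\<close> follow an arbitrary fixed enumeration of the truncation set, which the
  approximation \<open>fhat\<close> does not depend on. Rows are numbered from 0, so the sample is
  \<open>x 0, \<dots>, x (n - 1)\<close>.
\<close>

definition trunc_enum :: "nat \<Rightarrow> nat \<Rightarrow> ('d::finite \<Rightarrow> nat)" where
  "trunc_enum k = from_nat_into (trunc_set k)"

definition Phi :: "setting \<Rightarrow> nat \<Rightarrow> nat \<Rightarrow> (nat \<Rightarrow> real ^ 'd) \<Rightarrow> real Matrix.mat" where
  "Phi s k n x =
     Matrix.mat n (card (trunc_set k :: ('d::finite \<Rightarrow> nat) set)) (\<lambda>(i, j). Psi s (trunc_enum k j) (x i))"

definition observations ::
  "(real ^ 'd \<Rightarrow> real) \<Rightarrow> nat \<Rightarrow> (nat \<Rightarrow> real ^ 'd) \<Rightarrow> (nat \<Rightarrow> real) \<Rightarrow> real Matrix.vec" where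
  "observations f n x \<eta> = Matrix.vec n (\<lambda>i. f (x i) + \<eta> i)"

type_synonym coef_estimator = "real Matrix.mat \<Rightarrow> real Matrix.vec \<Rightarrow> real Matrix.vec"

definition projection :: coef_estimator where
  "projection A y = (1 / real (dim_row A)) \<cdot>\<^sub>v (transpose_mat A *\<^sub>v y)"

definition least_squares :: coef_estimator where
  "least_squares A y =
     (let G = transpose_mat A * A
      in if Determinant.det G \<noteq> 0 then the (mat_inverse G) *\<^sub>v (transpose_mat A *\<^sub>v y)
         else 0\<^sub>v (dim_col A))"

definition fhat ::
  "setting \<Rightarrow> coef_estimator \<Rightarrow> (real ^ 'd \<Rightarrow> real) \<Rightarrow> nat \<Rightarrow> nat
     \<Rightarrow> (nat \<Rightarrow> real ^ 'd) \<times> (nat \<Rightarrow> real) \<Rightarrow> real ^ 'd \<Rightarrow> real" where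
  "fhat s est f k n = (\<lambda>(x, \<eta>).
     let c = est (Phi s k n x) (observations f n x \<eta>)
     in (\<lambda>z. \<Sum>j < card (trunc_set k :: ('d::finite \<Rightarrow> nat) set). vec_index c j * Psi s (trunc_enum k j) z))"


section \<open>Sampling model and risks\<close>

definition noise_law :: "real measure \<Rightarrow> real \<Rightarrow> bool" where
  "noise_law \<nu> \<sigma>2 \<longleftrightarrow>
     prob_space \<nu> \<and> sets \<nu> = sets borel \<and>
     integrable \<nu> (\<lambda>t. t) \<and> integrable \<nu> (\<lambda>t. t\<^sup>2) \<and>
     prob_space.expectation \<nu> (\<lambda>t. t) = 0 \<and> prob_space.variance \<nu> (\<lambda>t. t) = \<sigma>2"

text \<open>
  The joint law of the design and the noise: i.i.d. design, i.i.d. noise, independent of each other.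
\<close>

definition sample_measure ::
  "setting \<Rightarrow> real measure \<Rightarrow> nat \<Rightarrow> ((nat \<Rightarrow> real ^ 'd) \<times> (nat \<Rightarrow> real)) measure" where
  "sample_measure s \<nu> n = (\<Pi>\<^sub>M i\<in>{..<n}. design_measure s) \<Otimes>\<^sub>M (\<Pi>\<^sub>M i\<in>{..<n}. \<nu>)"

text \<open>
  Both quadratic risks are at most \<open>B\<close>. Integrability is included because the Bochner integral of a
  non-integrable function is 0, which would make the bound vacuous.
\<close>

definition risks_le ::
  "setting \<Rightarrow> coef_estimator \<Rightarrow> (real ^ 'd \<Rightarrow> real) \<Rightarrow> real measure \<Rightarrow> nat \<Rightarrow> nat \<Rightarrow> ('d::finite) set
     \<Rightarrow> real \<Rightarrow> bool" where
  "risks_le s est f \<nu> k n U B \<longleftrightarrow>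
     (let P = sample_measure s \<nu> n;
          errS = (\<lambda>\<omega>. (sobol_index s f U - est_sobol_index s (fhat s est f k n \<omega>) U)\<^sup>2);
          errT = (\<lambda>\<omega>. (total_index s f U - est_total_index s (fhat s est f k n \<omega>) U)\<^sup>2)
      in integrable P errS \<and> prob_space.expectation P errS \<le> B \<and>
         integrable P errT \<and> prob_space.expectation P errT \<le> B)"

end

theory Submission
  imports Defs "HOL-Real_Asymp.Real_Asymp"
begin

text \<open>
  The Sobol indices are normalized energies of orthogonal projections, so all index errors are at
  most a multiple of the squared \<open>L\<^sup>2\<close> error of the approximation, which splits into the truncation
  error of the orthonormal expansion and the error of the coefficients.

  Truncation: in the trigonometric setting the coefficients of the symmetric difference of \<open>f\<close> along a
  coordinate are those of \<open>f\<close> with sine and cosine exchanged, times \<open>2 sin (2 \<pi> j h)\<close>; Bessel's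
  inequality then bounds the dyadic blocks of coefficients. The Chebyshev expansion of \<open>f\<close> is the
  Fourier expansion of \<open>f (cos (2 \<pi> x))\<close>, and the Legendre projection is no worse than the Chebyshev one
  because the uniform density is dominated by the Chebyshev density.

  Coefficients: the projection estimator is an average of independent terms. For least squares the
  empirical norm has to dominate the \<open>L\<^sup>2\<close> norm on the whole span. If the cube is divided into
  \<open>m ^ d\<close> equal cells, Bernstein's inequality (with a constant quadratic in the degree for Legendre) allows
  one to replace, coordinate by coordinate, the integral over the cube by the average over one
  arbitrary point in each cell, provided that \<open>m\<close> is a large multiple of that constant; and by a Chernoff bound
  each cell contains a fair share of the sample, except with probability \<open>m ^ d exp (- n / (10 m ^ d))\<close>.
  Chebyshev designs are images of trigonometric ones.
\<close>

section \<open>The design measures as product measures\<close>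

text \<open>A uniform bound on residuals or basis functions would cost rate, so errors are measured
  in mean square throughout: the residual at a design point has expected square equal to the
  truncation error, and basis functions enter the variance through their unit norm. Bad designs cost
  no more than their probability, because an index error never exceeds 1.

  Their probability is what separates the Legendre rates. Stability takes a number m of cells per
  coordinate of the order of k if derivatives grow like k, and of the order of
  \<open>k\<^sup>2\<close> if they grow like \<open>k\<^sup>2\<close>, while the number of cells m^d
  may reach about n / ln n. Without noise the largest such k is used, and k^(-2p) becomes (n / ln
  n)^(-2p/d), or (n / ln n)^(-p/d) for Legendre. With noise the variance k^d / n balances k^(-2p) at
  k = n^(1/(2p+d)). For Legendre this k is stable exactly if 2d < 2p + d, that is p/d > 1/2;
  otherwise the stability limit decides.

  The points picked from the cells depend on the expansion under test, which is why the sampling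
  inequality is deterministic and holds for all choices of points.\<close>

abbreviation bcube :: "setting \<Rightarrow> (real ^ 'd::finite) measure" where
  "bcube s \<equiv> restrict_space borel (cube s)"

abbreviation bint :: "setting \<Rightarrow> real measure" where
  "bint s \<equiv> restrict_space borel (interval1 s)"

abbreviation Trig :: setting where
  "Trig \<equiv> Trigonometric"

lemmas cart_eq_iff = Finite_Cartesian_Product.vec_eq_iff

text \<open>At the ends of [-1, 1] the Chebyshev weight is 0, since division by zero gives 0; later
  proofs discard these points as a null set.\<close>

fun wt :: "setting \<Rightarrow> real \<Rightarrow> real" where
  "wt Legendre t = 1 / 2"
| "wt Chebyshev t = 1 / (pi * sqrt (1 - t\<^sup>2))"
| "wt Trig t = 1"

definition nu :: "setting \<Rightarrow> real measure" where
  "nu s = density (restrict_space lborel (interval1 s)) (\<lambda>t. ennreal (wt s t))"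

definition upd :: "real ^ 'd \<Rightarrow> 'd \<Rightarrow> real \<Rightarrow> real ^ 'd" where
  "upd x i t = (\<chi> j. if j = i then t else x $ j)"

lemma upd_nth: "upd x i t $ j = (if j = i then t else x $ j)"
  by (simp add: upd_def)

lemma upd_same [simp]: "upd x i (x $ i) = x"
  by (auto simp: upd_nth cart_eq_iff)

lemma upd_upd [simp]: "upd (upd x i t) i r = upd x i r"
  by (auto simp: upd_nth cart_eq_iff)

lemma interval1_eq: "interval1 s = (if s = Trig then {0..1} else {-1..1})"
  by (cases s) auto

lemma interval1_borel [measurable, simp]: "interval1 s \<in> sets borel"
  by (simp add: interval1_eq)

lemma borel_measurable_wt [measurable]: "wt s \<in> borel_measurable borel"
proof -
  have "wt Legendre = (\<lambda>_. 1 / 2)" "wt Chebyshev = (\<lambda>t. 1 / (pi * sqrt (1 - t\<^sup>2)))" "wt Trig = (\<lambda>_. 1)"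
    by auto
  then show ?thesis
    by (cases s) simp_all
qed

lemma wt_nonneg: "t \<in> interval1 s \<Longrightarrow> 0 \<le> wt s t"
  by (cases s) (auto simp: abs_le_square_iff[symmetric] power_le_one_iff abs_square_le_1)

lemma cube_borel [measurable, simp]: "(cube s :: (real ^ 'd::finite) set) \<in> sets borel"
proof -
  have "(cube s :: (real ^ 'd) set) = (\<Inter>i\<in>UNIV. (\<lambda>x. x $ i) -` interval1 s \<inter> space borel)"
    by (auto simp: cube_def)
  also have "\<dots> \<in> sets borel"
    by (intro sets.finite_INT measurable_sets[where A=borel and M=borel]) auto
  finally show ?thesis .
qed

lemma upd_cube: "x \<in> cube s \<Longrightarrow> t \<in> interval1 s \<Longrightarrow> upd x i t \<in> cube s"
  by (auto simp: cube_def upd_nth)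

lemma space_design [simp]: "space (design_measure s :: (real ^ 'd::finite) measure) = cube s"
  by (cases s) (auto simp: space_restrict_space)

lemma sets_design [measurable_cong, simp]:
  "sets (design_measure s :: (real ^ 'd::finite) measure) = sets (bcube s)"
  by (cases s) (auto simp: sets_restrict_space)

lemma space_nu [simp]: "space (nu s) = interval1 s"
  by (simp add: nu_def space_restrict_space)

lemma sets_nu [measurable_cong, simp]: "sets (nu s) = sets (bint s)"
  by (simp add: nu_def sets_restrict_space)

lemma nn_integral_nu:
  assumes [measurable]: "h \<in> borel_measurable (bint s)"
  shows "(\<integral>\<^sup>+t. h t \<partial>nu s) = (\<integral>\<^sup>+t. ennreal (wt s t) * h t * indicator (interval1 s) t \<partial>lborel)"
  unfolding nu_def
  by (subst nn_integral_density) (auto simp: nn_integral_restrict_space intro!: measurable_restrict_space1)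

lemma nn_integral_lborel_prod_vec:
  assumes [measurable]: "\<And>i. f i \<in> borel_measurable borel"
  shows "(\<integral>\<^sup>+x. (\<Prod>i\<in>UNIV. f i (x $ i)) \<partial>(lborel :: (real ^ 'd::finite) measure))
          = (\<Prod>i\<in>UNIV. (\<integral>\<^sup>+t. f i t \<partial>lborel) :: ennreal)"
proof -
  have B: "(Basis :: (real ^ 'd) set) = range (\<lambda>i. axis i 1)"
    by (auto simp: Basis_vec_def)
  have inj: "inj (\<lambda>i::'d. axis i (1::real))"
    by (auto simp: inj_def axis_eq_axis)
  \<comment> \<open>The product rule for \<open>lborel\<close> is indexed by basis vectors;
    \<open>g\<close> transports the factors along \<open>i \<mapsto> axis i 1\<close>.\<close>
  define g where "g b = f (the_inv (\<lambda>i::'d. axis i (1::real)) b)" for b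
  have g: "g (axis i 1) = f i" for i
    by (simp add: g_def the_inv_f_f[OF inj])
  have "(\<integral>\<^sup>+x. (\<Prod>b\<in>Basis. g b (x \<bullet> b)) \<partial>(lborel :: (real ^ 'd) measure))
      = (\<Prod>b\<in>Basis. (\<integral>\<^sup>+t. g b t \<partial>lborel))"
    by (rule nn_integral_lborel_prod) (auto simp: g_def)
  then show ?thesis
    unfolding B by (simp add: prod.reindex[OF inj] g inner_axis)
qed

lemma emeasure_cube:
  "emeasure lborel (cube s :: (real ^ 'd::finite) set) = (\<Prod>i\<in>(UNIV :: 'd set). emeasure lborel (interval1 s))"
proof -
  have "emeasure lborel (cube s :: (real ^ 'd::finite) set) =
        (\<integral>\<^sup>+x. (\<Prod>i\<in>UNIV. indicator (interval1 s) (x $ i)) \<partial>(lborel :: (real ^ 'd::finite) measure))"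
  proof -
    have "(\<Prod>i\<in>UNIV. indicator (interval1 s) (x $ i)) = (indicator (cube s) x :: ennreal)" for x :: "real ^ 'd"
      by (auto simp: cube_def split: split_indicator)
    then show ?thesis by simp
  qed
  also have "\<dots> = (\<Prod>i\<in>(UNIV :: 'd set). emeasure lborel (interval1 s))"
    by (subst nn_integral_lborel_prod_vec) auto
  finally show ?thesis .
qed

lemma design_measure_density:
  "(design_measure s :: (real ^ 'd::finite) measure) =
     density (restrict_space lborel (cube s)) (\<lambda>x. ennreal (\<Prod>i\<in>UNIV. wt s (x $ i)))"
proof (cases s)
  case Legendre
  have e: "emeasure (restrict_space lborel (cube Legendre)) (cube Legendre :: (real ^ 'd) set) = 2 ^ CARD('d)"
    by (subst emeasure_restrict_space) (auto simp: emeasure_cube)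
  have "1 / 2 ^ CARD('d) = ennreal ((1/2) ^ CARD('d))"
    by (simp add: power_one_over ennreal_1 divide_ennreal[symmetric] ennreal_power[symmetric])
  then show ?thesis
    unfolding Legendre design_measure.simps uniform_measure_def e
    by (intro density_cong) (auto simp: space_restrict_space sets_restrict_space split: split_indicator
       intro!: measurable_restrict_space1)
next
  case Trigonometric
  have e: "emeasure (restrict_space lborel (cube Trig)) (cube Trig :: (real ^ 'd) set) = 1"
    by (subst emeasure_restrict_space) (auto simp: emeasure_cube)
  then show ?thesis
    unfolding Trigonometric design_measure.simps uniform_measure_def e
    by (intro density_cong) (auto simp: space_restrict_space sets_restrict_space split: split_indicator
       intro!: measurable_restrict_space1)
qed simp

lemma nn_integral_design_prod:
  assumes [measurable]: "\<And>i. h i \<in> borel_measurable (bint s)"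
  shows "(\<integral>\<^sup>+x. (\<Prod>i\<in>UNIV. h i (x $ i)) \<partial>(design_measure s :: (real ^ 'd::finite) measure))
          = (\<Prod>i\<in>UNIV. (\<integral>\<^sup>+t. h i t \<partial>nu s) :: ennreal)"
proof -
  \<comment> \<open>Each factor carries the indicator of its interval, so that the product vanishes
    off the cube by itself.\<close>
  define h' where "h' i t = ennreal (wt s t) * (h i t * indicator (interval1 s) t)" for i t
  have m [measurable]: "(\<lambda>t. h i t * indicator (interval1 s) t) \<in> borel_measurable borel" for i
    using assms[of i] by (subst (asm) borel_measurable_restrict_space_iff_ennreal) auto
  have [measurable]: "h' i \<in> borel_measurable borel" for i
    unfolding h'_def by measurable
  have mh: "(\<lambda>x. \<Prod>i\<in>UNIV. h i (x $ i)) \<in> borel_measurable (restrict_space lborel (cube s :: (real ^ 'd) set))"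
  proof (rule borel_measurable_prod_ennreal)
    fix i :: 'd
    have "(\<lambda>x. x $ i) \<in> restrict_space lborel (cube s :: (real ^ 'd) set) \<rightarrow>\<^sub>M bint s"
      by (intro measurable_restrict_space3) (auto simp: cube_def)
    then show "(\<lambda>x. h i (x $ i)) \<in> borel_measurable (restrict_space lborel (cube s :: (real ^ 'd) set))"
      by measurable
  qed
  have "(\<integral>\<^sup>+x. (\<Prod>i\<in>UNIV. h i (x $ i)) \<partial>(design_measure s :: (real ^ 'd::finite) measure)) =
     (\<integral>\<^sup>+x. ennreal (\<Prod>i\<in>UNIV. wt s (x $ i)) * (\<Prod>i\<in>UNIV. h i (x $ i)) * indicator (cube s) x \<partial>lborel)"
    unfolding design_measure_density
    using mh by (subst nn_integral_density) (auto simp: nn_integral_restrict_space intro!: measurable_restrict_space1)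
  also have "\<dots> = (\<integral>\<^sup>+x. (\<Prod>i\<in>UNIV. h' i (x $ i)) \<partial>lborel)"
  proof (rule nn_integral_cong)
    fix x :: "real ^ 'd"
    show "ennreal (\<Prod>i\<in>UNIV. wt s (x $ i)) * (\<Prod>i\<in>UNIV. h i (x $ i)) * indicator (cube s) x = (\<Prod>i\<in>UNIV. h' i (x $ i))"
    proof (cases "x \<in> cube s")
      case True
      then show ?thesis
        by (auto simp: cube_def h'_def prod.distrib prod_ennreal[symmetric] wt_nonneg)
    next
      case False
      then obtain i where "x $ i \<notin> interval1 s" by (auto simp: cube_def)
      then have "h' i (x $ i) = 0" by (simp add: h'_def)
      then have "(\<Prod>i\<in>UNIV. h' i (x $ i)) = 0" by (intro prod_zero) auto
      then show ?thesis using False by simp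
    qed
  qed
  also have "\<dots> = (\<Prod>i\<in>UNIV. (\<integral>\<^sup>+t. h' i t \<partial>lborel))"
    by (rule nn_integral_lborel_prod_vec) auto
  also have "\<dots> = (\<Prod>i\<in>UNIV. (\<integral>\<^sup>+t. h i t \<partial>nu s))"
    unfolding h'_def by (subst nn_integral_nu) (simp_all add: mult_ac)
  finally show ?thesis .
qed

text \<open>The arcsine law. The cosine covers [-1, 1] twice during one period, so the substitution
  is made on \<open>{1/2..1}\<close>, where it increases, and the other half follows by
  reflection.\<close>

lemma nn_integral_chebyshev:
  assumes [measurable]: "h \<in> borel_measurable borel"
  shows "(\<integral>\<^sup>+t. h (cos (2 * pi * t)) \<partial>nu Trig) = (\<integral>\<^sup>+t. h t \<partial>nu Chebyshev)"
proof -
  define g where "g t = cos (2 * pi * t)" for t :: real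
  define f where "f x = ennreal (1 / (pi * sqrt (1 - x\<^sup>2))) * h x" for x
  have [measurable]: "f \<in> borel_measurable borel" "g \<in> borel_measurable borel"
    unfolding f_def g_def by measurable
  have gen: "(\<integral>\<^sup>+x. f x * indicator {-1..1} x \<partial>lborel) = 
      (\<integral>\<^sup>+t. 2 * h (g t) * indicator {1/2..1} t \<partial>lborel)"
  proof -
    have sinpos: "sin (2 * pi * t) < 0" if "1/2 < t" "t < 1" for t
    proof -
      have "2 * pi * t - pi > 0" "2 * pi * t - pi < pi"
        using that by (auto simp: field_simps)
      then have "sin (2 * pi * t - pi) > 0" by (rule sin_gt_zero)
      then show ?thesis by (simp add: sin_diff)
    qed
    have "(\<integral>\<^sup>+x. f x * indicator {g (1/2)..g 1} x \<partial>lborel) =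
        (\<integral>\<^sup>+t. f (g t) * ennreal (- (2 * pi * sin (2 * pi * t))) * indicator {1/2..1} t \<partial>lborel)"
    proof (rule nn_integral_substitution_aux)
      fix x :: real assume x: "x \<in> {1/2..1}"
      show "(g has_real_derivative - (2 * pi * sin (2 * pi * x))) (at x)"
        unfolding g_def by (auto intro!: derivative_eq_intros)
      show "0 \<le> - (2 * pi * sin (2 * pi * x))"
      proof -
        consider "x = 1/2" | "x = 1" | "1/2 < x" "x < 1" using x by fastforce
        then have "sin (2 * pi * x) \<le> 0"
        proof cases
          case 1
          then have "2 * pi * x = pi" by simp
          then show ?thesis by (simp only: sin_pi)
        qed (use sinpos[of x] in auto)
        then show ?thesis by (simp add: mult_le_0_iff)
      qed
    qed (auto intro!: continuous_intros)
    also have "\<dots> = (\<integral>\<^sup>+t. 2 * h (g t) * indicator {1/2..1} t \<partial>lborel)"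
    proof (rule nn_integral_cong_AE)
      \<comment> \<open>At both ends the sine vanishes and the weight, a division by zero, is 0; the
        two sides may differ there.\<close>
      have "AE t in lborel. t \<noteq> 1/2 \<and> t \<noteq> (1::real)"
        using AE_lborel_singleton[of "1/2::real"] AE_lborel_singleton[of "1::real"] by auto
      then show "AE t in lborel. f (g t) * ennreal (- (2 * pi * sin (2 * pi * t))) * indicator {1/2..1} t
          = 2 * h (g t) * indicator {1/2..1} t"
      proof eventually_elim
        case (elim t)
        show ?case
        proof (cases "t \<in> {1/2..1}")
          case True
          then have s: "sin (2 * pi * t) < 0" using elim sinpos[of t] by auto
          have "sqrt (1 - (g t)\<^sup>2) = \<bar>sin (2 * pi * t)\<bar>"
            by (simp add: g_def sin_squared_eq[symmetric])
          then have q: "sqrt (1 - (g t)\<^sup>2) = - sin (2 * pi * t)" using s by simp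
          have "ennreal (1 / (pi * - sin (2 * pi * t))) * ennreal (- (2 * pi * sin (2 * pi * t)))
             = ennreal ((1 / (pi * - sin (2 * pi * t))) * (- (2 * pi * sin (2 * pi * t))))"
            using s by (subst ennreal_mult') (auto simp: zero_le_mult_iff mult_le_0_iff divide_le_0_iff)
          also have "(1 / (pi * - sin (2 * pi * t))) * (- (2 * pi * sin (2 * pi * t))) = 2"
            using s by (simp add: field_simps)
          finally show ?thesis
            unfolding f_def q by (simp add: mult_ac mult.left_commute)
        qed simp
      qed
    qed
    finally show ?thesis by (simp add: g_def)
  qed
  have refl: "(\<integral>\<^sup>+t. h (g t) * indicator {0..1/2} t \<partial>lborel) = (\<integral>\<^sup>+t. h (g t) * indicator {1/2..1} t \<partial>lborel)"
  proof -
    have "(\<integral>\<^sup>+t. h (g t) * indicator {1/2..1} t \<partial>lborel) = 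
       ennreal \<bar>-1\<bar> * (\<integral>\<^sup>+t. h (g (1 + (-1) * t)) * indicator {1/2..1} (1 + (-1) * t) \<partial>lborel)"
      by (rule nn_integral_real_affine) auto
    also have "\<dots> = (\<integral>\<^sup>+t. h (g t) * indicator {0..1/2} t \<partial>lborel)"
    proof -
      have "g (1 - t) = g t" for t
        by (simp add: g_def right_diff_distrib cos_diff)
      then show ?thesis
        by (auto intro!: nn_integral_cong split: split_indicator)
    qed
    finally show ?thesis by simp
  qed
  have "(\<integral>\<^sup>+t. h (cos (2 * pi * t)) \<partial>nu Trig) = (\<integral>\<^sup>+t. h (g t) * indicator {0..1} t \<partial>lborel)"
    by (subst nn_integral_nu) (auto simp: g_def intro!: measurable_restrict_space1)
  also have "\<dots> = (\<integral>\<^sup>+t. h (g t) * indicator {0..1/2} t + h (g t) * indicator {1/2..1} t \<partial>lborel)"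
  proof (rule nn_integral_cong_AE)
    show "AE t in lborel. h (g t) * indicator {0..1} t = h (g t) * indicator {0..1/2} t + h (g t) * indicator {1/2..1} t"
      using AE_lborel_singleton[of "1/2::real"]
      by eventually_elim (auto split: split_indicator)
  qed
  also have "\<dots> = 2 * (\<integral>\<^sup>+t. h (g t) * indicator {1/2..1} t \<partial>lborel)"
    by (subst nn_integral_add) (auto simp: refl mult_2)
  also have "\<dots> = (\<integral>\<^sup>+x. f x * indicator {-1..1} x \<partial>lborel)"
    by (subst gen) (auto simp: nn_integral_cmult[symmetric] mult_ac)
  also have "\<dots> = (\<integral>\<^sup>+t. h t \<partial>nu Chebyshev)"
    by (subst nn_integral_nu) (auto simp: f_def intro!: measurable_restrict_space1)
  finally show ?thesis .
qed

lemma prob_space_nu: "prob_space (nu s)"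
proof
  have T: "(\<integral>\<^sup>+t. 1 \<partial>nu Trig) = 1"
    by (subst nn_integral_nu) auto
  have "(\<integral>\<^sup>+t. 1 \<partial>nu s) = 1"
  proof (cases s)
    case Legendre
    have "(\<integral>\<^sup>+t. 1 \<partial>nu Legendre) = ennreal (1/2) * 2"
      by (subst nn_integral_nu) (auto simp: nn_integral_cmult)
    also have "\<dots> = 1"
      using ennreal_mult'[of "1/2" 2, symmetric] by simp
    finally show ?thesis using Legendre by simp
  next
    case Chebyshev
    then show ?thesis using nn_integral_chebyshev[of "\<lambda>_. 1"] T by simp
  qed (use T in simp)
  then show "emeasure (nu s) (space (nu s)) = 1" by simp
qed

lemma prob_space_design: "prob_space (design_measure s :: (real ^ 'd::finite) measure)"
proof
  interpret prob_space "nu s" by (rule prob_space_nu)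
  show "emeasure (design_measure s :: (real ^ 'd) measure) (space (design_measure s)) = 1"
    using nn_integral_design_prod[of "\<lambda>(_::'d) _. 1" s] emeasure_space_1
    by simp
qed

interpretation design: prob_space "design_measure s :: (real ^ 'd::finite) measure" for s
  by (rule prob_space_design)

interpretation nu: prob_space "nu s" for s
  by (rule prob_space_nu)

lemma nth_measurable [measurable]:
  "(\<lambda>x. x $ i) \<in> (bcube s :: (real ^ 'd::finite) measure) \<rightarrow>\<^sub>M bint s"
  by (intro measurable_restrict_space3) (auto simp: cube_def)

lemma vec_measurable_iff:
  "f \<in> M \<rightarrow>\<^sub>M (bcube s :: (real ^ 'd::finite) measure) \<longleftrightarrow>
     (\<forall>i. (\<lambda>x. f x $ i) \<in> M \<rightarrow>\<^sub>M bint s)"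
proof
  assume "f \<in> M \<rightarrow>\<^sub>M (bcube s :: (real ^ 'd) measure)"
  then show "\<forall>i. (\<lambda>x. f x $ i) \<in> M \<rightarrow>\<^sub>M bint s"
    using nth_measurable by (auto intro: measurable_compose)
next
  assume a: "\<forall>i. (\<lambda>x. f x $ i) \<in> M \<rightarrow>\<^sub>M bint s"
  have "(\<lambda>x. f x \<bullet> b) \<in> borel_measurable M" if "b \<in> Basis" for b
  proof -
    from that obtain i where "b = axis i 1" by (auto simp: Basis_vec_def)
    then show ?thesis using a by (auto simp: inner_axis measurable_restrict_space2_iff)
  qed
  then have "f \<in> borel_measurable M"
    by (subst borel_measurable_euclidean_space) auto
  then show "f \<in> M \<rightarrow>\<^sub>M bcube s"
    using a by (auto simp: measurable_restrict_space2_iff cube_def Pi_iff)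
qed

lemma upd_measurable [measurable]:
  assumes "f \<in> M \<rightarrow>\<^sub>M (bcube s :: (real ^ 'd::finite) measure)"
    and "g \<in> M \<rightarrow>\<^sub>M bint s"
  shows "(\<lambda>x. upd (f x) i (g x)) \<in> M \<rightarrow>\<^sub>M bcube s"
  unfolding vec_measurable_iff
proof
  fix j
  show "(\<lambda>x. upd (f x) i (g x) $ j) \<in> M \<rightarrow>\<^sub>M bint s"
    using assms by (cases "j = i") (simp_all add: upd_nth vec_measurable_iff)
qed

text \<open>Product measures on function spaces are determined by rectangles, but here the points
  are vectors. Both measures are carried to the function space by
  \<open>\<lambda>x i. x $ i\<close>, identified there, and carried back by
  \<open>vec_lambda\<close>.\<close>

lemma eq_design_measureI:
  fixes P :: "(real ^ 'd::finite) measure"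
  assumes sP [measurable_cong, simp]: "sets P = sets (bcube s)"
    and prod: "\<And>A. (\<And>i. A i \<in> sets (nu s)) \<Longrightarrow>
        (\<integral>\<^sup>+x. (\<Prod>i\<in>UNIV. indicator (A i) (x $ i)) \<partial>P) = (\<Prod>i\<in>UNIV. emeasure (nu s) (A i))"
  shows "P = design_measure s"
proof -
  interpret pp: product_prob_space "\<lambda>_::'d. nu s"
    by (rule product_prob_spaceI) (rule prob_space_nu)
  let ?\<Pi> = "\<Pi>\<^sub>M i\<in>(UNIV::'d set). nu s"
  have m: "(\<lambda>x i. x $ i) \<in> bcube s \<rightarrow>\<^sub>M ?\<Pi>"
  proof (rule measurable_PiM_single')
    fix i :: 'd
    show "(\<lambda>x. x $ i) \<in> (bcube s :: (real ^ 'd) measure) \<rightarrow>\<^sub>M nu s"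
      by (subst measurable_cong_sets[OF refl sets_nu]) (rule nth_measurable)
  qed (auto simp: space_restrict_space cube_def)
  have v: "vec_lambda \<in> ?\<Pi> \<rightarrow>\<^sub>M (bcube s :: (real ^ 'd) measure)"
    by (subst vec_measurable_iff) simp
  have *: "distr Q ?\<Pi> (\<lambda>x i. x $ i) = ?\<Pi>" 
    if [measurable_cong, simp]: "sets Q = sets (bcube s)"
      and p: "\<And>A. (\<And>i. A i \<in> sets (nu s)) \<Longrightarrow>
        (\<integral>\<^sup>+x. (\<Prod>i\<in>UNIV. indicator (A i) (x $ i)) \<partial>Q) = (\<Prod>i\<in>UNIV. emeasure (nu s) (A i))"
    for Q :: "(real ^ 'd) measure"
  proof (rule pp.PiM_eqI)
    fix A :: "'d \<Rightarrow> real set" assume A: "\<And>i. i \<in> UNIV \<Longrightarrow> A i \<in> sets (nu s)"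
    have mQ: "(\<lambda>x i. x $ i) \<in> Q \<rightarrow>\<^sub>M ?\<Pi>" using m by (simp add: measurable_cong_sets[OF that(1) refl])
    have sp: "Pi\<^sub>E UNIV A \<in> sets ?\<Pi>"
      using A by (intro sets_PiM_I_finite) auto
    have "emeasure (distr Q ?\<Pi> (\<lambda>x i. x $ i)) (Pi\<^sub>E UNIV A) = (\<integral>\<^sup>+y. indicator (Pi\<^sub>E UNIV A) y \<partial>distr Q ?\<Pi> (\<lambda>x i. x $ i))"
      using sp by simp
    also have "\<dots> = (\<integral>\<^sup>+x. indicator (Pi\<^sub>E UNIV A) (\<lambda>i. x $ i) \<partial>Q)"
      using sp mQ by (subst nn_integral_distr) auto
    also have "\<dots> = (\<integral>\<^sup>+x. (\<Prod>i\<in>UNIV. indicator (A i) (x $ i)) \<partial>Q)"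
      by (auto intro!: nn_integral_cong simp: PiE_iff prod_zero_iff split: split_indicator)
    also have "\<dots> = (\<Prod>i\<in>UNIV. emeasure (nu s) (A i))"
      using A by (intro p) auto
    finally show "emeasure (distr Q ?\<Pi> (\<lambda>x i. x $ i)) (Pi\<^sub>E UNIV A) = (\<Prod>i\<in>UNIV. emeasure (nu s) (A i))" .
  qed auto
  have undo: "distr (distr Q ?\<Pi> (\<lambda>x i. x $ i)) (bcube s) vec_lambda = Q"
    if [measurable_cong, simp]: "sets Q = sets (bcube s)" for Q :: "(real ^ 'd) measure"
  proof -
    have mQ: "(\<lambda>x i. x $ i) \<in> Q \<rightarrow>\<^sub>M ?\<Pi>" using m by (simp add: measurable_cong_sets[OF that(1) refl])
    have "distr (distr Q ?\<Pi> (\<lambda>x i. x $ i)) (bcube s) vec_lambda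
       = distr Q (bcube s) (vec_lambda \<circ> (\<lambda>x i. x $ i))"
      by (rule distr_distr[OF v mQ])
    also have "vec_lambda \<circ> (\<lambda>x i. x $ i) = (\<lambda>x :: real ^ 'd. x)"
      by (auto simp: fun_eq_iff)
    also have "distr Q (bcube s) (\<lambda>x. x) = Q"
      by (rule distr_id2) simp
    finally show ?thesis .
  qed
  have d: "(\<integral>\<^sup>+x. (\<Prod>i\<in>UNIV. indicator (A i) (x $ i)) \<partial>(design_measure s :: (real ^ 'd) measure)) = (\<Prod>i\<in>UNIV. emeasure (nu s) (A i))"
    if "\<And>i. A i \<in> sets (nu s)" for A
    using that by (subst nn_integral_design_prod) auto
  show ?thesis
    using undo[OF sP] undo[OF sets_design[of s]] *[OF sP prod] *[OF sets_design[of s] d] by simp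
qed

lemma marginal_eq_nu: "marginal s (i :: 'd::finite) = nu s"
proof (rule measure_eqI)
  fix A assume "A \<in> sets (marginal s i)"
  then have A [measurable]: "A \<in> sets (bint s)" by (simp add: marginal_def)
  have "emeasure (marginal s i) A = (\<integral>\<^sup>+t. indicator A t \<partial>marginal s i)"
    using A by (simp add: marginal_def)
  also have "\<dots> = (\<integral>\<^sup>+x. indicator A (x $ i) \<partial>(design_measure s :: (real ^ 'd) measure))"
    unfolding marginal_def by (subst nn_integral_distr) auto
  also have "\<dots> = (\<integral>\<^sup>+x. (\<Prod>j\<in>UNIV. if j = i then indicator A (x $ j) else 1) \<partial>(design_measure s :: (real ^ 'd) measure))"
    by (simp add: prod.delta)
  also have "\<dots> = (\<Prod>j\<in>UNIV. (\<integral>\<^sup>+t. (if j = i then indicator A t else 1) \<partial>nu s))"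
    by (subst nn_integral_design_prod[where h="\<lambda>j t. if j = i then indicator A t else 1", symmetric]) auto
  also have "\<dots> = (\<Prod>j\<in>UNIV. if j = i then emeasure (nu s) A else 1)"
    using A nu.emeasure_space_1 by (intro prod.cong) auto
  finally show "emeasure (marginal s i) A = emeasure (nu s) A" by (simp add: prod.delta)
qed (simp add: marginal_def)

text \<open>Fubini's theorem for one coordinate, phrased as resampling so that the vector space is
  never split into a product. The coordinatewise arguments go through its corollaries on
  integrals.\<close>

lemma distr_upd:
  "distr (design_measure s \<Otimes>\<^sub>M nu s) (bcube s) (\<lambda>(x, t). upd x i t)
     = (design_measure s :: (real ^ 'd::finite) measure)"
proof (rule eq_design_measureI)
  fix A :: "'d \<Rightarrow> real set" assume A [measurable]: "\<And>i. A i \<in> sets (nu s)"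
  have "(\<integral>\<^sup>+x. (\<Prod>j\<in>UNIV. indicator (A j) (x $ j)) \<partial>distr (design_measure s \<Otimes>\<^sub>M nu s) (bcube s) (\<lambda>(x, t). upd x i t))
    = (\<integral>\<^sup>+z. (\<Prod>j\<in>UNIV. indicator (A j) (upd (fst z) i (snd z) $ j)) \<partial>((design_measure s :: (real ^ 'd) measure) \<Otimes>\<^sub>M nu s))"
    by (subst nn_integral_distr) (auto simp: case_prod_beta)
  also have "\<dots> = (\<integral>\<^sup>+x. \<integral>\<^sup>+t. (\<Prod>j\<in>UNIV. indicator (A j) (upd x i t $ j)) \<partial>nu s \<partial>(design_measure s :: (real ^ 'd) measure))"
    by (subst nu.nn_integral_fst[symmetric]) auto
  also have "\<dots> = (\<integral>\<^sup>+x. \<integral>\<^sup>+t. indicator (A i) t * (\<Prod>j\<in>UNIV - {i}. indicator (A j) (x $ j)) \<partial>nu s \<partial>(design_measure s :: (real ^ 'd) measure))"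
    by (intro nn_integral_cong) (simp add: prod.remove[of UNIV i] upd_nth)
  also have "\<dots> = (\<integral>\<^sup>+x. emeasure (nu s) (A i) * (\<Prod>j\<in>UNIV. (if j = i then 1 else indicator (A j) (x $ j))) \<partial>(design_measure s :: (real ^ 'd) measure))"
    using A[of i] by (intro nn_integral_cong) (simp add: nn_integral_multc nn_integral_indicator prod.remove[of UNIV i] del: sets_nu)
  also have "\<dots> = emeasure (nu s) (A i) * (\<Prod>j\<in>UNIV. \<integral>\<^sup>+t. (if j = i then 1 else indicator (A j) t) \<partial>nu s)"
    by (subst nn_integral_cmult)
       (auto simp: nn_integral_design_prod[where h="\<lambda>j t. if j = i then 1 else indicator (A j) t", symmetric])
  also have "\<dots> = (\<Prod>i\<in>UNIV. emeasure (nu s) (A i))"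
    using nu.emeasure_space_1[of s] A
    by (simp add: prod.remove[of UNIV i] nn_integral_indicator del: sets_nu)
  finally show "(\<integral>\<^sup>+x. (\<Prod>j\<in>UNIV. indicator (A j) (x $ j)) \<partial>distr (design_measure s \<Otimes>\<^sub>M nu s) (bcube s) (\<lambda>(x, t). upd x i t))
     = (\<Prod>i\<in>UNIV. emeasure (nu s) (A i))" .
qed simp

lemma nn_integral_upd:
  assumes h [measurable]: "h \<in> borel_measurable (design_measure s :: (real ^ 'd::finite) measure)"
  shows "(\<integral>\<^sup>+x. \<integral>\<^sup>+t. h (upd x i t) \<partial>nu s \<partial>design_measure s) = (\<integral>\<^sup>+x. h x \<partial>design_measure s)"
proof -
  have "(\<integral>\<^sup>+x. h x \<partial>design_measure s) =
     (\<integral>\<^sup>+z. h ((\<lambda>(x, t). upd x i t) z) \<partial>((design_measure s :: (real ^ 'd) measure) \<Otimes>\<^sub>M nu s))"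
    by (subst (1) distr_upd[of s i, symmetric], subst nn_integral_distr) (use h in auto)
  also have "\<dots> = (\<integral>\<^sup>+x. \<integral>\<^sup>+t. h (upd x i t) \<partial>nu s \<partial>design_measure s)"
    by (subst nu.nn_integral_fst[symmetric]) auto
  finally show ?thesis by simp
qed

lemma integrable_upd:
  fixes h :: "real ^ 'd::finite \<Rightarrow> real"
  assumes h: "integrable (design_measure s) h"
  shows "integrable (design_measure s \<Otimes>\<^sub>M nu s) (\<lambda>(x, t). h (upd x i t))"
  using h by (subst (asm) distr_upd[of s i, symmetric], subst (asm) integrable_distr_eq)
    (auto simp: case_prod_beta')

lemma integral_upd:
  fixes h :: "real ^ 'd::finite \<Rightarrow> real"
  assumes h: "integrable (design_measure s) h"
  shows "(\<integral>x. \<integral>t. h (upd x i t) \<partial>nu s \<partial>design_measure s) = (\<integral>x. h x \<partial>design_measure s)"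
proof -
  interpret pair_prob_space "design_measure s :: (real ^ 'd) measure" "nu s" ..
  have [measurable]: "h \<in> borel_measurable (design_measure s)" using h by auto
  have "(\<integral>x. h x \<partial>design_measure s) =
     (\<integral>z. h ((\<lambda>(x, t). upd x i t) z) \<partial>((design_measure s :: (real ^ 'd) measure) \<Otimes>\<^sub>M nu s))"
    by (subst (1) distr_upd[of s i, symmetric], subst integral_distr) auto
  also have "\<dots> = (\<integral>x. \<integral>t. h (upd x i t) \<partial>nu s \<partial>design_measure s)"
    using integral_fst'[OF integrable_upd[OF h, of i]] by (simp add: case_prod_beta')
  finally show ?thesis by simp
qed

lemma distr_cos:
  "distr (design_measure Trig) (bcube Chebyshev) (\<lambda>x. \<chi> i. cos (2 * pi * x $ i))
     = (design_measure Chebyshev :: (real ^ 'd::finite) measure)"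
proof (rule eq_design_measureI)
  have m [measurable]: "(\<lambda>t. cos (2 * pi * t)) \<in> restrict_space borel {0..1} \<rightarrow>\<^sub>M restrict_space borel {-1..1}"
    by (intro measurable_restrict_space3) auto
  have mm [measurable]: "(\<lambda>x. \<chi> i. cos (2 * pi * x $ i)) \<in> 
      (bcube Trig :: (real ^ 'd) measure) \<rightarrow>\<^sub>M bcube Chebyshev"
    unfolding vec_measurable_iff
  proof
    fix i :: 'd
    have "(\<lambda>x. cos (2 * pi * x $ i)) \<in> 
      (bcube Trig :: (real ^ 'd) measure) \<rightarrow>\<^sub>M restrict_space borel {-1..1}"
      using nth_measurable[where s=Trigonometric] by (intro measurable_compose[OF _ m]) simp
    then show "(\<lambda>x. (\<chi> i. cos (2 * pi * x $ i)) $ i) \<in> 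
      (bcube Trig :: (real ^ 'd) measure) \<rightarrow>\<^sub>M bint Chebyshev"
      by simp
  qed
  fix A :: "'d \<Rightarrow> real set" assume A: "\<And>i. A i \<in> sets (nu Chebyshev)"
  have A1 [measurable]: "A i \<in> sets borel" for i
    using A[of i] by (auto simp: sets_restrict_space)
  have A2 [measurable]: "A i \<in> sets (restrict_space borel {-1..1})" for i
    using A[of i] by auto
  have "(\<integral>\<^sup>+x. (\<Prod>i\<in>UNIV. indicator (A i) (x $ i)) \<partial>distr (design_measure Trig) (bcube Chebyshev) (\<lambda>x. \<chi> i. cos (2 * pi * x $ i)))
    = (\<integral>\<^sup>+x. (\<Prod>i\<in>UNIV. indicator (A i) (cos (2 * pi * x $ i))) \<partial>(design_measure Trig :: (real ^ 'd) measure))"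
    by (subst nn_integral_distr) (auto simp: measurable_restrict_space1 intro!: borel_measurable_prod)
  also have "\<dots> = (\<Prod>i\<in>UNIV. \<integral>\<^sup>+t. indicator (A i) (cos (2 * pi * t)) \<partial>nu Trig)"
    by (rule nn_integral_design_prod) auto
  also have "\<dots> = (\<Prod>i\<in>UNIV. emeasure (nu Chebyshev) (A i))"
    using A by (subst nn_integral_chebyshev) auto
  finally show "(\<integral>\<^sup>+x. (\<Prod>i\<in>UNIV. indicator (A i) (x $ i)) \<partial>distr (design_measure Trig) (bcube Chebyshev) (\<lambda>x. \<chi> i. cos (2 * pi * x $ i)))
     = (\<Prod>i\<in>UNIV. emeasure (nu Chebyshev) (A i))" .
qed simp

section \<open>The univariate bases\<close>

declare psi.simps [simp del]

definition lo :: "setting \<Rightarrow> real" where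
  "lo s = (if s = Trig then 0 else -1)"

definition len :: "setting \<Rightarrow> real" where
  "len s = (if s = Trig then 1 else 2)"

lemma interval1_lo_len: "interval1 s = {lo s..lo s + len s}"
  by (simp add: interval1_eq lo_def len_def)

lemma len_pos [simp]: "len s > 0"
  by (simp add: len_def)

lemma integrable_nu_continuous:
  fixes f :: "real \<Rightarrow> real"
  assumes "continuous_on (interval1 s) f"
  shows "integrable (nu s) f"
proof -
  have "compact (interval1 s)" by (simp add: interval1_eq)
  then have "bounded (f ` interval1 s)"
    using assms compact_continuous_image compact_imp_bounded by blast
  then obtain B where "\<And>t. t \<in> interval1 s \<Longrightarrow> norm (f t) \<le> B"
    by (auto simp: bounded_iff)
  moreover have "f \<in> borel_measurable (nu s)"
    using borel_measurable_continuous_on_restrict[OF assms] by simp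
  ultimately show ?thesis
    by (intro nu.integrable_const_bound[where B=B]) auto
qed

lemma integral_nu_lborel:
  assumes "s \<noteq> Chebyshev" and "f \<in> borel_measurable (bint s)"
  shows "(\<integral>t. f t \<partial>nu s) = (\<integral>t. indicator (interval1 s) t *\<^sub>R f t \<partial>lborel) / len s"
proof -
  have w: "wt s t = 1 / len s" for t
    using assms(1) by (cases s) (auto simp: len_def)
  have m: "f \<in> borel_measurable (restrict_space lborel (interval1 s))"
    using assms(2) by (subst measurable_cong_sets[OF _ refl]) (auto simp: sets_restrict_space)
  have "(\<integral>t. f t \<partial>nu s) = (\<integral>t. (1 / len s) *\<^sub>R f t \<partial>restrict_space lborel (interval1 s))"
    unfolding nu_def w using m
    by (subst integral_density) (auto simp: less_imp_le)
  also have "\<dots> = (\<integral>t. f t \<partial>restrict_space lborel (interval1 s)) / len s"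
    by simp
  also have "(\<integral>t. f t \<partial>restrict_space lborel (interval1 s)) = (\<integral>t. indicator (interval1 s) t *\<^sub>R f t \<partial>lborel)"
    by (subst integral_restrict_space) auto
  finally show ?thesis .
qed

text \<open>In these two settings the density of \<open>nu s\<close> is the constant
  \<open>1 / len s\<close>, so integrals of derivatives are boundary values up to that
  factor.\<close>

lemma integral_nu_FTC:
  fixes F f :: "real \<Rightarrow> real"
  assumes s: "s \<noteq> Chebyshev"
    and F: "\<And>t. t \<in> interval1 s \<Longrightarrow> (F has_real_derivative f t) (at t within interval1 s)"
    and f: "continuous_on (interval1 s) f"
  shows "(\<integral>t. f t \<partial>nu s) = (F (lo s + len s) - F (lo s)) / len s"
proof -
  have "(\<integral>t. f t \<partial>nu s) = (\<integral>t. indicator (interval1 s) t *\<^sub>R f t \<partial>lborel) / len s"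
    by (rule integral_nu_lborel[OF s borel_measurable_continuous_on_restrict[OF f]])
  also have "(\<integral>t. indicator (interval1 s) t *\<^sub>R f t \<partial>lborel) = F (lo s + len s) - F (lo s)"
    unfolding interval1_lo_len
    by (rule integral_FTC_atLeastAtMost)
       (use F f len_pos[of s] in \<open>auto simp: interval1_lo_len has_real_derivative_iff_has_vector_derivative less_imp_le\<close>)
  finally show ?thesis .
qed

subsection \<open>Trigonometric and Chebyshev\<close>

text \<open>\<open>arccos (cos (2 * pi * t))\<close> is the angle itself up to
  \<open>t = 1/2\<close> and its reflection \<open>2 * pi - 2 * pi * t\<close> beyond; the cosine of
  an integer multiple does not see the difference. This reduces Chebyshev questions to the even
  trigonometric indices.\<close>

lemma psi_chebyshev_cos:
  assumes "t \<in> {0..1}"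
  shows "psi Chebyshev k (cos (2 * pi * t)) = psi Trig (2 * k) t"
proof -
  have "cos (real k * arccos (cos (2 * pi * t))) = cos (2 * pi * real k * t)"
  proof (cases "t \<le> 1/2")
    case True
    then have "arccos (cos (2 * pi * t)) = 2 * pi * t"
      using assms by (intro arccos_cos) (auto simp: field_simps)
    then show ?thesis by (simp add: mult_ac)
  next
    case False
    have "cos (2 * pi * t) = cos (2 * pi - 2 * pi * t)" by (simp add: cos_diff)
    moreover have "arccos (cos (2 * pi - 2 * pi * t)) = 2 * pi - 2 * pi * t"
      using assms False by (intro arccos_cos) (auto simp: field_simps)
    ultimately have "arccos (cos (2 * pi * t)) = 2 * pi - 2 * pi * t" by simp
    moreover have "real k * (2 * pi - 2 * pi * t) = 2 * pi * real k - 2 * pi * real k * t"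
      by (simp add: algebra_simps)
    ultimately have "cos (real k * arccos (cos (2 * pi * t))) = cos (2 * pi * real k - 2 * pi * real k * t)"
      by (simp only:)
    also have "\<dots> = cos (2 * pi * real k * t)"
      using cos_int_2pin[of "int k"] sin_int_2pin[of "int k"] by (simp add: cos_diff)
    finally show ?thesis .
  qed
  then show ?thesis by (simp add: psi.simps mult_ac)
qed

lemma continuous_on_psi: "continuous_on (interval1 s) (psi s k)"
proof (cases s)
  case Legendre
  have "psi Legendre k = (\<lambda>x. poly (legendre_poly k) x /
       sqrt (\<integral>t. (poly (legendre_poly k) t)\<^sup>2 \<partial>(uniform_measure lborel {-1..1})))" by (auto simp: psi.simps)
  then show ?thesis unfolding Legendre 
    by (auto intro!: continuous_intros simp: divide_inverse)
next
  case Chebyshev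
  have "psi Chebyshev k = (\<lambda>x. if k = 0 then 1 else sqrt 2 * cos (real k * arccos x))" by (auto simp: psi.simps)
  then show ?thesis unfolding Chebyshev
    by (cases "k = 0") (auto intro!: continuous_intros continuous_on_arccos')
next
  case Trigonometric
  have "psi Trig k = (\<lambda>x. if k = 0 then 1
      else if odd k then sqrt 2 * sin (2 * pi * real ((k + 1) div 2) * x)
      else sqrt 2 * cos (2 * pi * real (k div 2) * x))" by (auto simp: psi.simps)
  then show ?thesis unfolding Trigonometric
    by (cases "k = 0"; cases "odd k") (auto intro!: continuous_intros)
qed

lemma integral_cos_sin:
  assumes "r \<in> \<int>" "c = 2 * pi * r"
  shows "(\<integral>t. cos (c * t) \<partial>nu Trig) = (if r = 0 then 1 else 0)"
    and "(\<integral>t. sin (c * t) \<partial>nu Trig) = 0"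
proof -
  obtain n where n: "r = of_int n" using assms(1) Ints_cases by blast
  have "(\<integral>t. cos (c * t) \<partial>nu Trig) = (if r = 0 then 1 else 0) \<and> (\<integral>t. sin (c * t) \<partial>nu Trig) = 0"
  proof (cases "r = 0")
    case True
    then show ?thesis using nu.prob_space[of Trigonometric] by (simp add: assms(2))
  next
    case False
    then have c: "c \<noteq> 0" by (simp add: assms(2))
    have "(\<integral>t. cos (c * t) \<partial>nu Trig) = (sin (c * (lo Trig + len Trig)) / c - sin (c * lo Trig) / c) / len Trig"
      by (rule integral_nu_FTC[where F="\<lambda>t. sin (c * t) / c"])
         (auto intro!: derivative_eq_intros continuous_intros simp: c)
    moreover have "sin c = 0" using sin_int_2pin[of n] by (simp add: assms(2) n)
    moreover have "(\<integral>t. sin (c * t) \<partial>nu Trig) = (- cos (c * (lo Trig + len Trig)) / c - - cos (c * lo Trig) / c) / len Trig"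
      by (rule integral_nu_FTC[where F="\<lambda>t. - cos (c * t) / c"])
         (auto intro!: derivative_eq_intros continuous_intros simp: c)
    moreover have "cos c = 1" using cos_int_2pin[of n] by (simp add: assms(2) n)
    ultimately show ?thesis using False by (simp add: lo_def len_def)
  qed
  then show "(\<integral>t. cos (c * t) \<partial>nu Trig) = (if r = 0 then 1 else 0)"
    and "(\<integral>t. sin (c * t) \<partial>nu Trig) = 0" by auto
qed

lemma psi_trig_cases:
  fixes k :: nat
  obtains "k = 0" | j where "k = 2 * j - 1" "j \<ge> 1" | j where "k = 2 * j" "j \<ge> 1"
proof -
  have "k = 0 \<or> (\<exists>j\<ge>1. k = 2 * j - 1) \<or> (\<exists>j\<ge>1. k = 2 * j)" by presburger
  then show thesis using that by blast
qed

lemma psi_trig_0: "psi Trig 0 = (\<lambda>_. 1)"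
  by (auto simp: psi.simps)

lemma psi_trig_sin: "j \<ge> 1 \<Longrightarrow> psi Trig (2 * j - 1) x = sqrt 2 * sin (2 * pi * real j * x)"
  by (auto simp: psi.simps)

lemma psi_trig_cos: "j \<ge> 1 \<Longrightarrow> psi Trig (2 * j) x = sqrt 2 * cos (2 * pi * real j * x)"
  by (auto simp: psi.simps)

lemma integrable_cos_sin:
  "integrable (nu s) (\<lambda>t. cos (c * t))" "integrable (nu s) (\<lambda>t. sin (c * t))"
  by (auto intro!: integrable_nu_continuous continuous_intros)

text \<open>The product-to-sum formulas turn every product into sines and cosines of integer
  frequencies, whose integrals vanish unless the frequency is 0.\<close>

lemma integral_psi_trig:
  "(\<integral>t. psi Trig a t * psi Trig b t \<partial>nu Trig) = (if a = b then 1 else 0)"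
proof -
  \<comment> \<open>The second frequency is a real number, so that one pattern serves sums and
    differences of frequencies.\<close>
  let ?c = "\<lambda>i j t. cos ((2 * pi * (real i + (j :: real))) * t)" and ?s = "\<lambda>i j t. sin ((2 * pi * (real i + (j :: real))) * t)"
  have q: "sqrt 2 * (sqrt 2 * x) = 2 * x" for x
    by (simp flip: mult.assoc)
  have C: "(\<integral>t. ?c i (real j) t \<partial>nu Trig) = (if i = 0 \<and> j = 0 then 1 else 0)"
     and C': "(\<integral>t. ?c i (- real j) t \<partial>nu Trig) = (if i = j then 1 else 0)" for i j
    using integral_cos_sin(1)[of "real i + real j" "2 * pi * (real i + real j)"]
      integral_cos_sin(1)[of "real i + - real j" "2 * pi * (real i + - real j)"] by auto
  have S: "(\<integral>t. ?s i (real j) t \<partial>nu Trig) = 0"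
     and S': "(\<integral>t. ?s i (- real j) t \<partial>nu Trig) = 0" for i j
    using integral_cos_sin(2)[of "real i + real j" "2 * pi * (real i + real j)"]
      integral_cos_sin(2)[of "real i + - real j" "2 * pi * (real i + - real j)"] by auto
  have c1: "(\<integral>t. psi Trig (2 * j) t \<partial>nu Trig) = 0" if "j \<ge> 1" for j
    using C[of 0 j] that by (simp add: psi_trig_cos)
  have s1: "(\<integral>t. psi Trig (2 * j - 1) t \<partial>nu Trig) = 0" if "j \<ge> 1" for j
  proof -
    have "psi Trig (2 * j - 1) = (\<lambda>x. sqrt 2 * sin (2 * pi * real j * x))"
      using that psi_trig_sin by auto
    then show ?thesis using S[of 0 j] by simp
  qed
  have cc: "(\<integral>t. psi Trig (2 * i) t * psi Trig (2 * j) t \<partial>nu Trig) = (if i = j then 1 else 0)"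
    if "i \<ge> 1" "j \<ge> 1" for i j
  proof -
    have "psi Trig (2 * i) t * psi Trig (2 * j) t = ?c i (- real j) t + ?c i (real j) t" for t
      unfolding psi_trig_cos[OF that(1)] psi_trig_cos[OF that(2)]
      by (simp add: cos_times_cos q algebra_simps)
    then show ?thesis
      using that by (simp only: Bochner_Integration.integral_add integrable_cos_sin C C') auto
  qed
  have ss: "(\<integral>t. psi Trig (2 * i - 1) t * psi Trig (2 * j - 1) t \<partial>nu Trig) = (if i = j then 1 else 0)"
    if "i \<ge> 1" "j \<ge> 1" for i j
  proof -
    have "psi Trig (2 * i - 1) t * psi Trig (2 * j - 1) t = ?c i (- real j) t - ?c i (real j) t" for t
      unfolding psi_trig_sin[OF that(1)] psi_trig_sin[OF that(2)]
    proof -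
      have "(sqrt 2 * x) * (sqrt 2 * y) = 2 * (x * y)" for x y
        using q[of "x * y"] by (simp add: mult_ac)
      moreover have "2 * (sin x * sin y) = cos (x - y) - cos (x + y)" for x y :: real
        using sin_times_sin[of x y] by simp
      ultimately show "(sqrt 2 * sin (2 * pi * real i * t)) * (sqrt 2 * sin (2 * pi * real j * t)) = ?c i (- real j) t - ?c i (real j) t"
        by (simp only:) (simp add: algebra_simps)
    qed
    then show ?thesis
      using that by (simp only: Bochner_Integration.integral_diff integrable_cos_sin C C') auto
  qed
  have sc: "(\<integral>t. psi Trig (2 * i - 1) t * psi Trig (2 * j) t \<partial>nu Trig) = 0"
    if "i \<ge> 1" "j \<ge> 1" for i j
  proof -
    have "psi Trig (2 * i - 1) t * psi Trig (2 * j) t = ?s i (real j) t + ?s i (- real j) t" for t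
      unfolding psi_trig_sin[OF that(1)] psi_trig_cos[OF that(2)]
    proof -
      have "(sqrt 2 * x) * (sqrt 2 * y) = 2 * (x * y)" for x y
        using q[of "x * y"] by (simp add: mult_ac)
      moreover have "2 * (sin x * cos y) = sin (x + y) + sin (x - y)" for x y :: real
        using sin_times_cos[of x y] by simp
      ultimately show "(sqrt 2 * sin (2 * pi * real i * t)) * (sqrt 2 * cos (2 * pi * real j * t)) = ?s i (real j) t + ?s i (- real j) t"
        by (simp only:) (simp add: algebra_simps)
    qed
    then show ?thesis
      using that by (simp only: Bochner_Integration.integral_add integrable_cos_sin S S')
  qed
  have cs: "(\<integral>t. psi Trig (2 * j) t * psi Trig (2 * i - 1) t \<partial>nu Trig) = 0"
    if "i \<ge> 1" "j \<ge> 1" for i j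
    using sc[OF that] by (simp only: mult.commute)
  have z: "psi Trig 0 = (\<lambda>_. 1)" by (auto simp: psi.simps)
  have odd: "2 * i - 1 \<noteq> 2 * j" "2 * j \<noteq> 2 * i - 1" if "i \<ge> 1" for i j :: nat using that by presburger+
  have inj: "2 * i - 1 = 2 * j - 1 \<longleftrightarrow> i = j" if "i \<ge> 1" "j \<ge> 1" for i j :: nat using that by presburger
  consider "a = 0" | i where "a = 2 * i - 1" "i \<ge> 1" | i where "a = 2 * i" "i \<ge> 1" by (rule psi_trig_cases)
  then show ?thesis
  proof cases
    case 1
    consider "b = 0" | j where "b = 2 * j - 1" "j \<ge> 1" | j where "b = 2 * j" "j \<ge> 1" by (rule psi_trig_cases)
    then show ?thesis
    proof cases
      case 1
      with \<open>a = 0\<close> show ?thesis using nu.prob_space[of Trigonometric] by (simp add: z)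
    next
      case (2 j)
      with \<open>a = 0\<close> show ?thesis using s1[of j] by (simp add: z del: One_nat_def)
    next
      case (3 j)
      with \<open>a = 0\<close> show ?thesis using c1[of j] by (simp add: z)
    qed
  next
    case (2 i)
    note i = 2
    consider "b = 0" | j where "b = 2 * j - 1" "j \<ge> 1" | j where "b = 2 * j" "j \<ge> 1" by (rule psi_trig_cases)
    then show ?thesis
    proof cases
      case (2 j)
      then show ?thesis using ss[of i j] i inj[of i j] by (simp only: refl)
    next
      case (3 j)
      then show ?thesis using sc[of i j] i odd[of i j] by (simp only: refl if_False)
    next
      case 1
      with i show ?thesis using s1[of i] by (simp add: z del: One_nat_def)
    qed
  next
    case (3 i)
    note i = 3
    consider "b = 0" | j where "b = 2 * j - 1" "j \<ge> 1" | j where "b = 2 * j" "j \<ge> 1" by (rule psi_trig_cases)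
    then show ?thesis
    proof cases
      case (2 j)
      then show ?thesis using cs[of j i] i odd[of j i] by (simp only: refl if_False)
    next
      case (3 j)
      then show ?thesis using cc[of i j] i by simp
    next
      case 1
      with i show ?thesis using c1[of i] by (simp add: z)
    qed
  qed
qed

subsection \<open>Legendre\<close>

definition leg_int :: "real poly \<Rightarrow> real" where
  "leg_int p = (\<integral>t. poly p t \<partial>nu Legendre)"

lemma integrable_poly: "integrable (nu s) (poly p)"
  by (rule integrable_nu_continuous) (auto intro!: continuous_intros)

lemma leg_int_add: "leg_int (p + q) = leg_int p + leg_int q"
  by (simp add: leg_int_def integrable_poly)

lemma leg_int_smult: "leg_int (Polynomial.smult c p) = c * leg_int p"
  by (simp add: leg_int_def)

lemma leg_int_pderiv: "leg_int (pderiv p) = (poly p 1 - poly p (-1)) / 2"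
  unfolding leg_int_def
  by (subst integral_nu_FTC[where F="poly p"])
     (auto intro!: continuous_intros DERIV_subset[OF poly_DERIV] simp: lo_def len_def)

lemma leg_int_by_parts:
  "leg_int (pderiv p * q) = (poly (p * q) 1 - poly (p * q) (-1)) / 2 - leg_int (p * pderiv q)"
proof -
  have "leg_int (p * pderiv q) + leg_int (pderiv p * q) = (poly (p * q) 1 - poly (p * q) (-1)) / 2"
    using leg_int_pderiv[of "p * q"] by (simp add: pderiv_mult leg_int_add mult.commute)
  then show ?thesis by linarith
qed

lemma leg_int_square_pos:
  assumes "p \<noteq> 0"
  shows "leg_int (p * p) > 0"
proof -
  have nn: "leg_int (p * p) \<ge> 0"
    unfolding leg_int_def by simp
  have "leg_int (p * p) \<noteq> 0"
  proof
    assume "leg_int (p * p) = 0"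
    then have "AE t in nu Legendre. poly (p * p) t = 0"
      unfolding leg_int_def using integrable_poly
      by (subst (asm) integral_nonneg_eq_0_iff_AE) auto
    then have A: "AE t in nu Legendre. poly p t = 0" by auto
    have f: "finite {t. poly p t = 0}" using assms by (rule poly_roots_finite)
    have "AE t in lborel. t \<notin> {t. poly p t = 0}"
      by (rule AE_not_in[OF finite_imp_null_set_lborel[OF f]])
    then have "AE t in restrict_space lborel (interval1 Legendre). poly p t \<noteq> 0"
      by (subst AE_restrict_space_iff) (auto elim: eventually_mono)
    then have B: "AE t in nu Legendre. poly p t \<noteq> 0"
      unfolding nu_def by (subst AE_density) (auto elim: eventually_mono simp del: interval1.simps)
    from A B have "AE t in nu Legendre. False" by eventually_elim auto
    then show False using nu.prob_space_completion by (simp add: nu.AE_False)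
  qed
  then show ?thesis using nn by linarith
qed

lemma dvd_pderiv_power:
  assumes "[:- c, 1:] ^ Suc n dvd (p :: real poly)"
  shows "[:- c, 1:] ^ n dvd pderiv p"
proof -
  define l where "l = [:- c, 1:]"
  from assms obtain r where "p = l ^ Suc n * r" unfolding l_def by (auto elim: dvdE)
  then have "pderiv p = l ^ Suc n * pderiv r + r * (Polynomial.smult (of_nat (Suc n)) (l ^ n) * pderiv l)"
    by (simp only: pderiv_mult pderiv_power_Suc)
  also have "\<dots> = l ^ n * (l * pderiv r + r * Polynomial.smult (of_nat (Suc n)) (pderiv l))"
    by (simp add: algebra_simps del: of_nat_Suc)
  finally show ?thesis unfolding l_def by (rule dvdI)
qed

abbreviation legendre_kernel :: "nat \<Rightarrow> real poly" where
  "legendre_kernel k \<equiv> [:-1, 0, 1:] ^ k"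

text \<open>The points 1 and -1 are roots of multiplicity k of the kernel, and each derivative
  lowers the multiplicity by at most one. Hence integrating Rodrigues' formula by parts leaves no
  boundary terms.\<close>

lemma higher_pderiv_kernel_root:
  assumes "j < k" "c = 1 \<or> c = -1"
  shows "poly ((pderiv ^^ j) (legendre_kernel k)) c = 0"
proof -
  have "[:- c, 1:] dvd [:-1, 0, 1:]"
    using assms(2) by (auto simp: poly_eq_0_iff_dvd[symmetric])
  then have k: "[:- c, 1:] ^ k dvd legendre_kernel k" by (rule dvd_power_same)
  have "[:- c, 1:] ^ (k - j) dvd (pderiv ^^ j) (legendre_kernel k)" if "j \<le> k" for j
    using that
  proof (induction j)
    case (Suc j)
    then have "[:- c, 1:] ^ Suc (k - Suc j) dvd (pderiv ^^ j) (legendre_kernel k)"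
      by (simp only: Suc_diff_Suc Suc_le_eq)
    then show ?case by (simp only: dvd_pderiv_power funpow.simps comp_apply)
  qed (use k in auto)
  note d = this[of j]
  have "[:- c, 1:] dvd [:- c, 1:] ^ (k - j)"
    by (rule dvd_power) (use assms(1) in simp)
  from dvd_trans[OF this d] have "[:- c, 1:] dvd (pderiv ^^ j) (legendre_kernel k)"
    using assms(1) by simp
  then show ?thesis by (simp add: poly_eq_0_iff_dvd)
qed

text \<open>Each integration by parts moves one derivative onto \<open>q\<close>; after j of them
  nothing is left of it, its degree being below j.\<close>

lemma higher_pderiv_kernel_orth:
  assumes "j \<le> k" "q = 0 \<or> Polynomial.degree q < j"
  shows "leg_int ((pderiv ^^ j) (legendre_kernel k) * q) = 0"
  using assms
proof (induction j arbitrary: q)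
  case 0
  then show ?case by (simp add: leg_int_def)
next
  case (Suc j)
  have "leg_int (pderiv ((pderiv ^^ j) (legendre_kernel k)) * q) =
     - leg_int ((pderiv ^^ j) (legendre_kernel k) * pderiv q)"
    using Suc.prems(1) by (subst leg_int_by_parts) (simp add: higher_pderiv_kernel_root)
  moreover have "pderiv q = 0 \<or> Polynomial.degree (pderiv q) < j"
    using Suc.prems(2) by (auto simp: pderiv_eq_0_iff degree_pderiv)
  ultimately show ?case using Suc by simp
qed

lemma degree_kernel: "Polynomial.degree (legendre_kernel k) = 2 * k"
  by (simp add: degree_power_eq)

lemma degree_legendre_poly: "Polynomial.degree (legendre_poly k) = k"
  by (simp add: legendre_poly_def degree_higher_pderiv degree_kernel)

lemma legendre_poly_nonzero: "legendre_poly k \<noteq> 0"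
proof (cases "k = 0")
  case True
  then show ?thesis by (simp add: legendre_poly_def)
next
  case False
  then show ?thesis using degree_legendre_poly[of k] by auto
qed

lemma legendre_poly_orth:
  assumes "q = 0 \<or> Polynomial.degree q < k"
  shows "leg_int (legendre_poly k * q) = 0"
  using higher_pderiv_kernel_orth[of k k q] assms
  by (simp add: legendre_poly_def leg_int_smult mult_smult_left)

definition leg_sqnorm :: "nat \<Rightarrow> real" where
  "leg_sqnorm k = leg_int (legendre_poly k * legendre_poly k)"

lemma leg_sqnorm_pos: "leg_sqnorm k > 0"
  unfolding leg_sqnorm_def by (rule leg_int_square_pos[OF legendre_poly_nonzero])

text \<open>Orthogonality to all lower degrees lets only the leading coefficient of \<open>q\<close>
  count.\<close>

lemma leg_int_lead:
  assumes "Polynomial.degree q \<le> k"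
  shows "leg_int (legendre_poly k * q) = Polynomial.coeff q k / Polynomial.coeff (legendre_poly k) k * leg_sqnorm k"
proof -
  let ?P = "legendre_poly k"
  let ?c = "Polynomial.coeff q k / Polynomial.coeff ?P k"
  have l: "Polynomial.coeff ?P k \<noteq> 0"
    using legendre_poly_nonzero[of k] degree_legendre_poly[of k] by (metis leading_coeff_0_iff)
  define r where "r = q - Polynomial.smult ?c ?P"
  have "Polynomial.coeff r k = 0" using l by (simp add: r_def)
  moreover have "Polynomial.degree r \<le> k"
    unfolding r_def using assms degree_legendre_poly[of k]
    by (intro degree_diff_le) auto
  ultimately have "r = 0 \<or> Polynomial.degree r < k"
    by (metis le_neq_implies_less leading_coeff_0_iff)
  then have "leg_int (?P * r) = 0" by (rule legendre_poly_orth)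
  moreover have "?P * q = ?P * r + Polynomial.smult ?c (?P * ?P)"
    unfolding r_def right_diff_distrib mult_smult_right by simp
  ultimately show ?thesis by (simp add: leg_int_add leg_int_smult leg_sqnorm_def)
qed

text \<open>Legendre's differential equation. The left-hand side R has degree below k, as its
  coefficient at k cancels. The operator is symmetric, because its weight vanishes at 1 and -1, and
  it does not raise degrees, so orthogonality of \<open>P\<close> to lower degrees gives
  \<open>leg_int (R * R) = 0\<close>.\<close>

lemma leg_ode:
  fixes k defines "P \<equiv> legendre_poly k"
  shows "pderiv ((1 - Polynomial.monom 1 2) * pderiv P) + Polynomial.smult (real (k * Suc k)) P = 0"
proof -
  let ?W = "(1 - Polynomial.monom 1 2) :: real poly"
  define R where "R = pderiv (?W * pderiv P) + Polynomial.smult (real (k * Suc k)) P"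
  have coefW: "Polynomial.coeff (pderiv (?W * pderiv q)) n =
      real (Suc n) * (real (Suc (Suc n)) * Polynomial.coeff q (Suc (Suc n))) - real n * real (Suc n) * Polynomial.coeff q n" for q n
  proof -
    have a: "Polynomial.coeff (?W * D) (Suc n) =
        Polynomial.coeff D (Suc n) - (if n = 0 then 0 else Polynomial.coeff D (n - 1))" for D
      unfolding left_diff_distrib coeff_diff coeff_monom_mult by auto
    have "Polynomial.coeff (pderiv (?W * pderiv q)) n = real (Suc n) * Polynomial.coeff (?W * pderiv q) (Suc n)"
      by (rule coeff_pderiv)
    then show ?thesis
      unfolding a by (cases n) (simp_all add: coeff_pderiv algebra_simps)
  qed
  have degW: "Polynomial.degree (pderiv (?W * pderiv q)) \<le> n" if "Polynomial.degree q \<le> n" for q n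
    using that by (intro degree_le allI impI, simp only: coefW) (simp add: coeff_eq_0)
  have dP: "Polynomial.degree P = k" by (simp add: P_def degree_legendre_poly)
  have "Polynomial.degree R \<le> k"
    unfolding R_def using degW[of P k] dP by (intro degree_add_le) auto
  moreover have "Polynomial.coeff R k = 0"
  proof -
    have "Polynomial.coeff P (Suc (Suc k)) = 0" by (rule coeff_eq_0) (simp add: dP)
    then show ?thesis
      unfolding R_def coeff_add coeff_smult coefW of_nat_mult by simp
  qed
  ultimately have R: "R = 0 \<or> Polynomial.degree R < k"
    by (metis le_neq_implies_less leading_coeff_0_iff)
  have "leg_int (R * R) = leg_int (pderiv (?W * pderiv P) * R) + real (k * Suc k) * leg_int (P * R)"
    by (subst (1) R_def) (simp add: algebra_simps leg_int_add leg_int_smult)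
  also have "leg_int (P * R) = 0" unfolding P_def by (rule legendre_poly_orth[OF R])
  also have "leg_int (pderiv (?W * pderiv P) * R) = - leg_int (pderiv P * (?W * pderiv R))"
    by (subst leg_int_by_parts) (simp add: mult_ac poly_monom)
  also have "\<dots> = leg_int (P * pderiv (?W * pderiv R))"
    by (subst leg_int_by_parts) (simp add: poly_monom)
  also have "\<dots> = 0"
  proof (cases "R = 0")
    case False
    then have "Polynomial.degree (pderiv (?W * pderiv R)) < k"
      using degW[of R "Polynomial.degree R"] R by auto
    then show ?thesis unfolding P_def by (intro legendre_poly_orth) simp
  qed (simp add: leg_int_def)
  finally have "leg_int (R * R) = 0" by simp
  then have "R = 0" using leg_int_square_pos[of R] by fastforce
  then show ?thesis by (simp add: R_def)
qed

text \<open>Integration by parts leaves boundary values only, since the second derivative has degree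
  below k. The differential equation at 1 and -1 expresses the derivative there through
  \<open>P\<close>, and integrating the derivative of \<open>x * P\<^sup>2\<close> yields the sum of
  the two squared boundary values, which is all that enters.\<close>

lemma leg_deriv_sqnorm:
  fixes k defines "P \<equiv> legendre_poly k"
  shows "leg_int (pderiv P * pderiv P) = real (k * Suc k * (2 * k + 1)) / 2 * leg_sqnorm k"
proof -
  have dP: "Polynomial.degree P = k" by (simp add: P_def degree_legendre_poly)
  have l: "Polynomial.coeff P k \<noteq> 0"
    using legendre_poly_nonzero[of k] dP unfolding P_def by (metis leading_coeff_0_iff)
  let ?X = "[:0, 1:] :: real poly"
  \<comment> \<open>The second factor has degree at most k and k times the leading coefficient of
    \<open>P\<close>.\<close>
  have 1: "leg_int (P * (?X * pderiv P)) = real k * leg_sqnorm k"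
  proof -
    have c: "Polynomial.coeff (?X * pderiv P) n = real n * Polynomial.coeff P n" for n
      by (cases n) (auto simp: coeff_pderiv)
    have "Polynomial.degree (?X * pderiv P) \<le> k"
      by (intro degree_le allI impI, simp only: c) (simp add: coeff_eq_0 dP)
    then show ?thesis
      unfolding P_def using leg_int_lead[of "?X * pderiv P" k] l c[of k] by (simp add: P_def)
  qed
  have a: "leg_int (pderiv (?X * (P * P))) = ((poly P 1)\<^sup>2 + (poly P (-1))\<^sup>2) / 2"
    by (subst leg_int_pderiv) (simp add: power2_eq_square)
  have N: "leg_int (P * P) = leg_sqnorm k" by (simp add: leg_sqnorm_def P_def)
  have X: "pderiv (X * (P * P)) = P * P + (P * (X * pderiv P) + P * (X * pderiv P))"
    if "pderiv X = 1" for X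
    unfolding pderiv_mult that by (simp add: ring_distribs mult_ac)
  have "pderiv (?X * (P * P)) = P * P + (P * (?X * pderiv P) + P * (?X * pderiv P))"
    by (rule X) (simp add: pderiv_pCons)
  then have "leg_int (pderiv (?X * (P * P))) = leg_sqnorm k + (real k * leg_sqnorm k + real k * leg_sqnorm k)"
    by (simp only: leg_int_add 1 N)
  then have 2: "(poly P 1)\<^sup>2 + (poly P (-1))\<^sup>2 = 2 * real (2 * k + 1) * leg_sqnorm k"
    unfolding a by (simp add: field_simps)
  have ode: "poly (pderiv ((1 - Polynomial.monom 1 2) * pderiv P) + Polynomial.smult (real (k * Suc k)) P) x = 0" for x
    using leg_ode[of k] by (simp add: P_def)
  have e1: "2 * poly (pderiv P) 1 = real (k * Suc k) * poly P 1"
    using ode[of 1] by (simp add: pderiv_mult pderiv_diff pderiv_monom poly_monom)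
  have e2: "2 * poly (pderiv P) (-1) = - real (k * Suc k) * poly P (-1)"
  proof -
    have "2 * poly (pderiv P) (-1) + real (k * Suc k) * poly P (-1) = 0"
      using ode[of "-1"] by (simp add: pderiv_mult pderiv_diff pderiv_monom poly_monom)
    then show ?thesis by linarith
  qed
  have 3: "leg_int (P * pderiv (pderiv P)) = 0"
    unfolding P_def
    by (rule legendre_poly_orth) (auto simp: pderiv_eq_0_iff degree_pderiv degree_legendre_poly)
  have "leg_int (pderiv P * pderiv P) = (poly P 1 * poly (pderiv P) 1 - poly P (-1) * poly (pderiv P) (-1)) / 2"
    by (subst leg_int_by_parts) (simp add: 3)
  also have "\<dots> = (poly P 1 * (2 * poly (pderiv P) 1) - poly P (-1) * (2 * poly (pderiv P) (-1))) / 4"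
    by simp
  also have "\<dots> = real (k * Suc k) / 4 * ((poly P 1)\<^sup>2 + (poly P (-1))\<^sup>2)"
    unfolding e1 e2 by (simp add: power2_eq_square field_simps)
  also have "\<dots> = real (k * Suc k * (2 * k + 1)) / 2 * leg_sqnorm k"
    unfolding 2 by (simp add: field_simps)
  finally show ?thesis .
qed

lemma psi_legendre: "psi Legendre k x = poly (legendre_poly k) x / sqrt (leg_sqnorm k)"
proof -
  have u: "uniform_measure lborel {-1..1::real} = density lborel (\<lambda>t. ennreal (indicator {-1..1} t / 2))"
    unfolding uniform_measure_def
    using divide_ennreal[of 1 2] by (intro density_cong) (auto split: split_indicator)
  have "(\<integral>t. (poly (legendre_poly k) t)\<^sup>2 \<partial>(uniform_measure lborel {-1..1})) =
     (\<integral>t. indicator {-1..1} t / 2 * (poly (legendre_poly k) t)\<^sup>2 \<partial>lborel)"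
    unfolding u by (subst integral_density) (auto intro!: borel_measurable_continuous_onI continuous_intros)
  also have "\<dots> = (\<integral>t. indicator (interval1 Legendre) t *\<^sub>R (poly (legendre_poly k) t)\<^sup>2 \<partial>lborel) / len Legendre"
    by (simp add: len_def)
  also have "\<dots> = leg_sqnorm k"
    unfolding leg_sqnorm_def leg_int_def
    by (subst integral_nu_lborel)
       (auto simp: power2_eq_square intro!: borel_measurable_continuous_on_restrict continuous_intros)
  finally show ?thesis by (simp add: psi.simps)
qed

lemma integral_psi_legendre:
  "(\<integral>t. psi Legendre a t * psi Legendre b t \<partial>nu Legendre) = (if a = b then 1 else 0)"
proof -
  have e: "(\<integral>t. psi Legendre a t * psi Legendre b t \<partial>nu Legendre) =
     leg_int (legendre_poly a * legendre_poly b) / (sqrt (leg_sqnorm a) * sqrt (leg_sqnorm b))" for a b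
    by (simp add: psi_legendre leg_int_def)
  have "leg_int (legendre_poly a * legendre_poly b) = 0" if "a \<noteq> b"
  proof (cases "b < a")
    case True
    then show ?thesis by (intro legendre_poly_orth) (simp add: degree_legendre_poly)
  next
    case False
    then show ?thesis using that legendre_poly_orth[of "legendre_poly a" b]
      by (simp add: degree_legendre_poly mult.commute)
  qed
  then show ?thesis
    using leg_sqnorm_pos[of b] by (auto simp: e leg_sqnorm_def[symmetric])
qed

lemma poly_legendre_expansion:
  assumes "Polynomial.degree q \<le> k"
  shows "\<exists>c. \<forall>x. poly q x = (\<Sum>a\<le>k. c a * psi Legendre a x)"
  using assms
proof (induction k arbitrary: q)
  case 0
  then obtain c where q: "q = [:c:]" by (metis degree_0_id le_zero_eq)
  obtain d where P: "legendre_poly 0 = [:d:]" by (metis degree_0_id degree_legendre_poly)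
  have "d \<noteq> 0" using legendre_poly_nonzero[of 0] P by auto
  then have "poly q x = (c / d * sqrt (leg_sqnorm 0)) * psi Legendre 0 x" for x
    using leg_sqnorm_pos[of 0] by (simp add: q P psi_legendre)
  then show ?case by (intro exI[of _ "\<lambda>_. c / d * sqrt (leg_sqnorm 0)"]) simp
next
  case (Suc k)
  let ?P = "legendre_poly (Suc k)"
  let ?c = "Polynomial.coeff q (Suc k) / Polynomial.coeff ?P (Suc k)"
  have l: "Polynomial.coeff ?P (Suc k) \<noteq> 0"
    using legendre_poly_nonzero[of "Suc k"] degree_legendre_poly[of "Suc k"] by (metis leading_coeff_0_iff)
  define r where "r = q - Polynomial.smult ?c ?P"
  have "Polynomial.coeff r (Suc k) = 0" using l by (simp add: r_def)
  moreover have "Polynomial.degree r \<le> Suc k"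
    unfolding r_def using Suc.prems degree_legendre_poly[of "Suc k"]
    by (intro degree_diff_le) auto
  ultimately have "Polynomial.degree r \<le> k"
    by (metis le_SucE le_zero_eq leading_coeff_0_iff degree_0 le0)
  then obtain c where c: "\<And>x. poly r x = (\<Sum>a\<le>k. c a * psi Legendre a x)" using Suc.IH by blast
  have "poly q x = (\<Sum>a\<le>Suc k. (c(Suc k := ?c * sqrt (leg_sqnorm (Suc k)))) a * psi Legendre a x)" for x
  proof -
    have "poly q x = poly r x + ?c * poly ?P x" by (simp add: r_def)
    also have "?c * poly ?P x = (?c * sqrt (leg_sqnorm (Suc k))) * psi Legendre (Suc k) x"
      using leg_sqnorm_pos[of "Suc k"] by (simp add: psi_legendre)
    also have "poly r x = (\<Sum>a\<le>k. (c(Suc k := ?c * sqrt (leg_sqnorm (Suc k)))) a * psi Legendre a x)"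
      unfolding c by (intro sum.cong) auto
    finally show ?thesis by simp
  qed
  then show ?case by blast
qed

lemma integral_psi:
  "(\<integral>t. psi s a t * psi s b t \<partial>nu s) = (if a = b then 1 else 0)"
proof (cases s)
  case Chebyshev
  have d: "distr (nu Trig) (nu Chebyshev) (\<lambda>t. cos (2 * pi * t)) = nu Chebyshev"
  proof (rule measure_eqI)
    fix A assume "A \<in> sets (distr (nu Trig) (nu Chebyshev) (\<lambda>t. cos (2 * pi * t)))"
    then have A: "A \<in> sets (nu Chebyshev)" by simp
    then have A': "A \<in> sets borel" by (auto simp: sets_restrict_space)
    have m: "(\<lambda>t. cos (2 * pi * t)) \<in> nu Trig \<rightarrow>\<^sub>M nu Chebyshev"
      by (subst measurable_cong_sets[OF sets_nu sets_nu]) (intro measurable_restrict_space3, auto)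
    have "emeasure (distr (nu Trig) (nu Chebyshev) (\<lambda>t. cos (2 * pi * t))) A =
       (\<integral>\<^sup>+t. indicator A t \<partial>distr (nu Trig) (nu Chebyshev) (\<lambda>t. cos (2 * pi * t)))"
      using A by simp
    also have "\<dots> = (\<integral>\<^sup>+t. indicator A (cos (2 * pi * t)) \<partial>nu Trig)"
      by (rule nn_integral_distr[OF m]) (use A in \<open>simp del: sets_nu\<close>)
    also have "\<dots> = (\<integral>\<^sup>+t. indicator A t \<partial>nu Chebyshev)"
      using A' by (intro nn_integral_chebyshev) auto
    finally show "emeasure (distr (nu Trig) (nu Chebyshev) (\<lambda>t. cos (2 * pi * t))) A = emeasure (nu Chebyshev) A"
      using A by simp
  qed simp
  have m: "(\<lambda>t. cos (2 * pi * t)) \<in> nu Trig \<rightarrow>\<^sub>M nu Chebyshev"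
    by (subst measurable_cong_sets[OF sets_nu sets_nu]) (intro measurable_restrict_space3, auto)
  have mp: "(\<lambda>t. psi Chebyshev a t * psi Chebyshev b t) \<in> borel_measurable (nu Chebyshev)"
    by (subst measurable_cong_sets[OF sets_nu refl])
       (intro borel_measurable_continuous_on_restrict continuous_intros continuous_on_psi)
  have "(\<integral>t. psi Chebyshev a t * psi Chebyshev b t \<partial>nu Chebyshev) =
     (\<integral>t. psi Chebyshev a (cos (2 * pi * t)) * psi Chebyshev b (cos (2 * pi * t)) \<partial>nu Trig)"
    by (subst (1) d[symmetric], subst integral_distr[OF m mp]) simp
  also have "\<dots> = (\<integral>t. psi Trig (2 * a) t * psi Trig (2 * b) t \<partial>nu Trig)"
    by (intro Bochner_Integration.integral_cong) (simp_all add: psi_chebyshev_cos)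
  also have "\<dots> = (if a = b then 1 else 0)"
    by (subst integral_psi_trig) simp
  finally show ?thesis using Chebyshev by simp
qed (use integral_psi_trig integral_psi_legendre in simp_all)

subsection \<open>Derivatives\<close>

text \<open>Only in the non-Chebyshev settings is the span of the first basis functions closed under
  differentiation; in the trigonometric one the degree has to be even.\<close>

definition bern :: "setting \<Rightarrow> nat \<Rightarrow> real" where
  "bern s k = (if s = Trig then 2 * pi * real k else (real k + 1)\<^sup>2)"

text \<open>Exchanges the indices of the sine and the cosine of one frequency and fixes the index of
  the constant.\<close>

definition partner :: "nat \<Rightarrow> nat" where
  "partner a = (if a = 0 then 0 else if odd a then a + 1 else a - 1)"

definition freq :: "nat \<Rightarrow> nat" where
  "freq a = (a + 1) div 2"

text \<open>The sign that differentiation produces. Its value -1 at the index 0 is harmless: it is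
  multiplied there by a factor that vanishes with the frequency.\<close>

definition sgn_partner :: "nat \<Rightarrow> real" where
  "sgn_partner a = (if odd a then 1 else -1)"

lemma partner_partner [simp]: "partner (partner a) = a"
  by (auto simp: partner_def)

lemma freq_partner [simp]: "freq (partner a) = freq a"
  by (auto simp: partner_def freq_def elim!: evenE oddE)

lemma has_derivative_psi_trig:
  "(psi Trig a has_real_derivative sgn_partner a * (2 * pi * real (freq a)) * psi Trig (partner a) t) (at t)"
proof -
  consider "a = 0" | j where "a = 2 * j - 1" "j \<ge> 1" | j where "a = 2 * j" "j \<ge> 1" by (rule psi_trig_cases)
  then show ?thesis
  proof cases
    case 1
    then show ?thesis by (simp add: freq_def partner_def psi_trig_0)
  next
    case (2 j)
    then have p: "partner a = 2 * j" "freq a = j" "sgn_partner a = 1"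
      by (auto simp: partner_def freq_def sgn_partner_def)
    have "psi Trig a = (\<lambda>x. sqrt 2 * sin (2 * pi * real j * x))"
      using 2 psi_trig_sin by (auto)
    then show ?thesis
      unfolding p using 2 by (auto simp: psi_trig_cos intro!: derivative_eq_intros)
  next
    case (3 j)
    then have p: "partner a = 2 * j - 1" "freq a = j" "sgn_partner a = -1"
      by (auto simp: partner_def freq_def sgn_partner_def)
    have "psi Trig a = (\<lambda>x. sqrt 2 * cos (2 * pi * real j * x))"
      using 3 psi_trig_cos by (auto)
    then show ?thesis
      unfolding p using 3 psi_trig_sin[of j] by (auto intro!: derivative_eq_intros)
  qed
qed

text \<open>An odd k would be the index of a sine whose cosine has index \<open>k + 1\<close>,
  outside the range.\<close>

lemma partner_le: "even k \<Longrightarrow> a \<le> k \<Longrightarrow> partner a \<le> k"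
  by (auto simp: partner_def) (metis Suc_leI le_neq_implies_less)

lemma bij_betw_partner: "even k \<Longrightarrow> bij_betw partner {..k} {..k}"
  by (rule bij_betw_byWitness[where f'=partner]) (auto simp: partner_le)

lemma psi_derivative_expansion:
  assumes s: "s \<noteq> Chebyshev" and k: "s = Trig \<Longrightarrow> even k" and a: "a \<le> k"
  shows "\<exists>e. \<forall>t. (psi s a has_real_derivative (\<Sum>b\<le>k. e b * psi s b t)) (at t)"
proof (cases s)
  case Legendre
  have "Polynomial.degree (pderiv (legendre_poly a)) \<le> k"
    using a by (simp add: degree_pderiv degree_legendre_poly)
  from poly_legendre_expansion[OF this]
  obtain e where e: "\<And>x. poly (pderiv (legendre_poly a)) x = (\<Sum>b\<le>k. e b * psi Legendre b x)"
    by blast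
  have p: "psi Legendre a = (\<lambda>x. poly (legendre_poly a) x / sqrt (leg_sqnorm a))"
    using psi_legendre by auto
  have "(psi Legendre a has_real_derivative (\<Sum>b\<le>k. (e b / sqrt (leg_sqnorm a)) * psi Legendre b t)) (at t)" for t
  proof -
    have "((\<lambda>x. poly (legendre_poly a) x / sqrt (leg_sqnorm a)) has_real_derivative poly (pderiv (legendre_poly a)) t / sqrt (leg_sqnorm a)) (at t)"
      by (intro DERIV_cdivide poly_DERIV)
    then show ?thesis
      unfolding p[symmetric] e by (simp add: sum_divide_distrib)
  qed
  then show ?thesis unfolding Legendre by (intro exI[of _ "\<lambda>b. e b / sqrt (leg_sqnorm a)"] allI)
next
  case Trigonometric
  let ?e = "\<lambda>b. if b = partner a then sgn_partner a * (2 * pi * real (freq a)) else 0"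
  have "(psi Trig a has_real_derivative (\<Sum>b\<le>k. ?e b * psi Trig b t)) (at t)" for t
  proof -
    have "partner a \<le> k" using partner_le k a Trigonometric by auto
    have "(\<Sum>b\<le>k. ?e b * psi Trig b t) = (\<Sum>b\<le>k. if b = partner a then sgn_partner a * (2 * pi * real (freq a)) * psi Trig b t else 0)"
      by (intro sum.cong) auto
    also have "\<dots> = sgn_partner a * (2 * pi * real (freq a)) * psi Trig (partner a) t"
      using \<open>partner a \<le> k\<close> by (subst sum.delta) auto
    finally show ?thesis using has_derivative_psi_trig[of a t] by (simp)
  qed
  then show ?thesis unfolding Trigonometric by (intro exI[of _ ?e] allI)
qed (use s in simp)

lemma integral_square_psi_sum:
  "(\<integral>t. (\<Sum>a\<in>A. c a * psi s a t)\<^sup>2 \<partial>nu s) = (\<Sum>a\<in>A. (c a)\<^sup>2)" if "finite A" for A :: "nat set"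
proof -
  have i: "integrable (nu s) (\<lambda>t. psi s a t * psi s b t)" for a b
    by (intro integrable_nu_continuous continuous_intros continuous_on_psi)
  have "(\<Sum>a\<in>A. c a * psi s a t)\<^sup>2 = (\<Sum>a\<in>A. \<Sum>b\<in>A. (c a * c b) * (psi s a t * psi s b t))" for t
    by (simp add: power2_eq_square sum_product mult_ac)
  then have "(\<integral>t. (\<Sum>a\<in>A. c a * psi s a t)\<^sup>2 \<partial>nu s) = (\<Sum>a\<in>A. \<Sum>b\<in>A. (c a * c b) * (\<integral>t. psi s a t * psi s b t \<partial>nu s))"
    using i by (simp)
  also have "\<dots> = (\<Sum>a\<in>A. \<Sum>b\<in>A. if a = b then c a * c b else 0)"
    by (intro sum.cong) (auto simp: integral_psi)
  also have "\<dots> = (\<Sum>a\<in>A. (c a)\<^sup>2)"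
    using that by (simp add: power2_eq_square)
  finally show ?thesis .
qed

text \<open>In the Legendre setting the squared norms of the derivatives add up to order \<open>k ^ 4\<close>, so that
  Cauchy-Schwarz already gives Markov's inequality with the right power of \<open>k\<close>.\<close>

lemma bernstein:
  assumes s: "s \<noteq> Chebyshev" and k: "s = Trig \<Longrightarrow> even k"
    and \<phi>: "\<And>t. \<phi> t = (\<Sum>a\<le>k. c a * psi s a t)"
    and d: "\<And>t. (\<phi> has_real_derivative \<phi>' t) (at t)"
  shows "(\<integral>t. (\<phi>' t)\<^sup>2 \<partial>nu s) \<le> (bern s k)\<^sup>2 * (\<integral>t. (\<phi> t)\<^sup>2 \<partial>nu s)"
proof -
  have n: "(\<integral>t. (\<phi> t)\<^sup>2 \<partial>nu s) = (\<Sum>a\<le>k. (c a)\<^sup>2)"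
    unfolding \<phi> by (rule integral_square_psi_sum) simp
  have \<phi>e: "\<phi> = (\<lambda>t. \<Sum>a\<le>k. c a * psi s a t)"
    by (rule ext) (rule \<phi>)
  show ?thesis
  proof (cases s)
    case Legendre
    define P' where "P' a t = poly (pderiv (legendre_poly a)) t / sqrt (leg_sqnorm a)" for a t
    have p: "psi Legendre a = (\<lambda>x. poly (legendre_poly a) x / sqrt (leg_sqnorm a))" for a
      using psi_legendre by auto
    have "((\<lambda>x. \<Sum>a\<le>k. c a * psi s a x) has_real_derivative (\<Sum>a\<le>k. c a * P' a t)) (at t)" for t
      unfolding Legendre p P'_def by (intro DERIV_sum DERIV_cmult DERIV_cdivide poly_DERIV)
    then have "(\<phi> has_real_derivative (\<Sum>a\<le>k. c a * P' a t)) (at t)" for t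
      unfolding \<phi>e .
    then have \<phi>': "\<phi>' t = (\<Sum>a\<le>k. c a * P' a t)" for t
      by (rule DERIV_unique[OF d])
    have P'_int: "integrable (nu s) (\<lambda>t. (P' a t)\<^sup>2)" "integrable (nu s) (\<lambda>t. (\<Sum>a\<le>k. c a * P' a t)\<^sup>2)" for a
      unfolding P'_def by (auto intro!: integrable_nu_continuous continuous_intros simp: divide_inverse)
    have P'_val: "(\<integral>t. (P' a t)\<^sup>2 \<partial>nu s) = real (a * Suc a * (2 * a + 1)) / 2" for a
    proof -
      have "(\<integral>t. (P' a t)\<^sup>2 \<partial>nu s) = leg_int (pderiv (legendre_poly a) * pderiv (legendre_poly a)) / leg_sqnorm a"
      proof -
        have pp: "poly (q * q) = (\<lambda>t. (poly q t)\<^sup>2)" for q :: "real poly"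
          by (rule ext) (simp add: power2_eq_square)
        show ?thesis
          unfolding leg_int_def pp P'_def Legendre power_divide using leg_sqnorm_pos[of a] by simp
      qed
      then show ?thesis using leg_sqnorm_pos[of a] by (simp add: leg_deriv_sqnorm)
    qed
    have "(\<integral>t. (\<phi>' t)\<^sup>2 \<partial>nu s) \<le> (\<integral>t. (\<Sum>a\<le>k. (c a)\<^sup>2) * (\<Sum>a\<le>k. (P' a t)\<^sup>2) \<partial>nu s)"
      unfolding \<phi>'
      by (intro integral_mono) (auto simp: P'_int intro!: Cauchy_Schwarz_ineq_sum)
    also have "\<dots> = (\<Sum>a\<le>k. (c a)\<^sup>2) * (\<Sum>a\<le>k. real (a * Suc a * (2 * a + 1)) / 2)"
      by (simp add: P'_int P'_val)
    also have "\<dots> \<le> (\<Sum>a\<le>k. (c a)\<^sup>2) * ((real k + 1)\<^sup>2)\<^sup>2"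
    proof (intro mult_left_mono)
      have "(\<Sum>a\<le>k. real (a * Suc a * (2 * a + 1)) / 2) \<le> (\<Sum>a\<le>k. (real k + 1) ^ 3)"
      proof (intro sum_mono)
        fix a assume "a \<in> {..k}"
        then have a: "real a \<le> real k" by simp
        have "real (a * Suc a * (2 * a + 1)) / 2 \<le> (real a + 1) ^ 3"
          by (simp add: field_simps power3_eq_cube)
        also have "\<dots> \<le> (real k + 1) ^ 3" using a by (intro power_mono) auto
        finally show "real (a * Suc a * (2 * a + 1)) / 2 \<le> (real k + 1) ^ 3" .
      qed
      also have "\<dots> = ((real k + 1)\<^sup>2)\<^sup>2"
        by (simp add: power2_eq_square power3_eq_cube algebra_simps)
      finally show "(\<Sum>a\<le>k. real (a * Suc a * (2 * a + 1)) / 2) \<le> ((real k + 1)\<^sup>2)\<^sup>2" .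
    qed (simp add: sum_nonneg)
    finally show ?thesis unfolding n by (simp add: bern_def Legendre mult.commute)
  next
    case Trigonometric
    define w where "w a = sgn_partner a * (2 * pi * real (freq a))" for a
    have "((\<lambda>x. \<Sum>a\<le>k. c a * psi s a x) has_real_derivative (\<Sum>a\<le>k. c a * (w a * psi s (partner a) t))) (at t)" for t
      unfolding Trigonometric w_def by (intro DERIV_sum DERIV_cmult has_derivative_psi_trig)
    then have "(\<phi> has_real_derivative (\<Sum>a\<le>k. c a * (w a * psi s (partner a) t))) (at t)" for t
      unfolding \<phi>e .
    then have "\<phi>' t = (\<Sum>a\<le>k. c a * (w a * psi s (partner a) t))" for t
      by (rule DERIV_unique[OF d])
    \<comment> \<open>Differentiation scales the coefficients by \<open>w\<close> and permutes them
      within each frequency, so the norm stays a plain sum of squares.\<close>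
    also have "\<dots> t = (\<Sum>a\<le>k. (c (partner a) * w (partner a)) * psi s a t)" for t
      using k Trigonometric by (subst sum.reindex_bij_betw[OF bij_betw_partner, symmetric]) (auto simp: mult_ac)
    finally have "(\<integral>t. (\<phi>' t)\<^sup>2 \<partial>nu s) = (\<Sum>a\<le>k. (c (partner a) * w (partner a))\<^sup>2)"
      by (simp only: integral_square_psi_sum[OF finite_atMost])
    also have "\<dots> = (\<Sum>a\<le>k. (c a * w a)\<^sup>2)"
      using k Trigonometric sum.reindex_bij_betw[OF bij_betw_partner, of k "\<lambda>a. (c a * w a)\<^sup>2"] by simp
    also have "\<dots> \<le> (\<Sum>a\<le>k. (bern s k)\<^sup>2 * (c a)\<^sup>2)"
    proof (intro sum_mono)
      fix a assume a: "a \<in> {..k}"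
      have "freq a \<le> k" using a by (auto simp: freq_def)
      then have "(w a)\<^sup>2 \<le> (bern s k)\<^sup>2"
        by (auto simp: w_def sgn_partner_def bern_def Trigonometric power_mult_distrib intro!: mult_left_mono power_mono)
      then show "(c a * w a)\<^sup>2 \<le> (bern s k)\<^sup>2 * (c a)\<^sup>2"
        by (simp add: power_mult_distrib mult.commute mult_left_mono)
    qed
    finally show ?thesis unfolding n by (simp add: sum_distrib_left)
  qed (use s in simp)
qed

section \<open>Orthonormal expansions on the cube\<close>

lemma cube_eq_cbox: "(cube s :: (real ^ 'd::finite) set) = cbox (\<chi> i. lo s) (\<chi> i. lo s + len s)"
  by (auto simp: cube_def mem_box_cart interval1_lo_len)

lemma compact_cube: "compact (cube s :: (real ^ 'd::finite) set)"
  by (simp add: cube_eq_cbox compact_cbox)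

lemma measure_cube [simp]: "measure (design_measure s :: (real ^ 'd::finite) measure) (cube s) = 1"
  using design.prob_space[of s] by simp

text \<open>Most integrands are bounded and measurable on the cube. The class is closed under sums
  and products, so their integrability takes no separate argument.\<close>

definition bdm :: "setting \<Rightarrow> (real ^ 'd::finite \<Rightarrow> real) \<Rightarrow> bool" where
  "bdm s f \<longleftrightarrow> f \<in> borel_measurable (design_measure s) \<and> (\<exists>B. \<forall>x\<in>cube s. \<bar>f x\<bar> \<le> B)"

lemma bdm_measurable: "bdm s f \<Longrightarrow> f \<in> borel_measurable (design_measure s)"
  by (simp add: bdm_def)

lemma bdm_integrable: "bdm s f \<Longrightarrow> integrable (design_measure s) f"
proof -
  assume f: "bdm s f"
  then obtain B where "\<forall>x\<in>cube s. \<bar>f x\<bar> \<le> B" by (auto simp: bdm_def)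
  then show ?thesis
    using bdm_measurable[OF f] by (intro design.integrable_const_bound[where B=B]) auto
qed

lemma bdm_continuous:
  assumes "continuous_on (cube s) f"
  shows "bdm s f"
proof -
  have "bounded (f ` cube s)"
    using assms compact_cube compact_continuous_image compact_imp_bounded by blast
  then obtain B where "\<And>x. x \<in> cube s \<Longrightarrow> \<bar>f x\<bar> \<le> B"
    by (auto simp: bounded_iff)
  then show ?thesis
    using borel_measurable_continuous_on_restrict[OF assms] by (auto simp: bdm_def)
qed

lemma bdm_add: "bdm s f \<Longrightarrow> bdm s g \<Longrightarrow> bdm s (\<lambda>x. f x + g x)"
  unfolding bdm_def
  by (auto intro!: borel_measurable_add) (meson abs_triangle_ineq add_mono order_trans)

lemma bdm_mult: "bdm s f \<Longrightarrow> bdm s g \<Longrightarrow> bdm s (\<lambda>x. f x * g x)"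
proof -
  assume f: "bdm s f" and g: "bdm s g"
  obtain A B where "\<And>x. x \<in> cube s \<Longrightarrow> \<bar>f x\<bar> \<le> A" "\<And>x. x \<in> cube s \<Longrightarrow> \<bar>g x\<bar> \<le> B"
    using f g by (auto simp: bdm_def)
  then have "\<bar>f x * g x\<bar> \<le> A * B" if "x \<in> cube s" for x
    unfolding abs_mult using that by (intro mult_mono') auto
  then show ?thesis
    using f g unfolding bdm_def by (auto intro!: borel_measurable_times)
qed

lemma bdm_const: "bdm s (\<lambda>x. c)"
  by (auto simp: bdm_def)

lemma bdm_diff: "bdm s f \<Longrightarrow> bdm s g \<Longrightarrow> bdm s (\<lambda>x. f x - g x)"
  using bdm_add[of s f "\<lambda>x. -1 * g x"] bdm_mult[OF bdm_const, of s g "-1"] by simp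

lemma bdm_power2: "bdm s f \<Longrightarrow> bdm s (\<lambda>x. (f x)\<^sup>2)"
  using bdm_mult[of s f f] by (simp add: power2_eq_square)

lemma bdm_sum: "(\<And>i. i \<in> I \<Longrightarrow> bdm s (f i)) \<Longrightarrow> bdm s (\<lambda>x. \<Sum>i\<in>I. f i x)"
  by (induction I rule: infinite_finite_induct) (auto simp: bdm_const bdm_add)

lemma continuous_on_nth_psi: "continuous_on (cube s) (\<lambda>x. psi s k (x $ i))"
  by (rule continuous_on_compose2[OF continuous_on_psi[of s k]])
     (auto intro!: continuous_intros simp: cube_def)

lemma continuous_on_Psi: "continuous_on (cube s) (Psi s \<alpha>)"
  unfolding Psi_def by (intro continuous_on_prod continuous_on_nth_psi)

lemma bdm_Psi: "bdm s (Psi s \<alpha>)"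
  by (rule bdm_continuous[OF continuous_on_Psi])

lemma integral_design_prod:
  fixes h :: "'d::finite \<Rightarrow> real \<Rightarrow> real"
  assumes h: "\<And>i. integrable (nu s) (h i)"
  shows "(\<integral>x. (\<Prod>i\<in>UNIV. h i (x $ i)) \<partial>(design_measure s :: (real ^ 'd) measure)) = (\<Prod>i\<in>UNIV. \<integral>t. h i t \<partial>nu s)"
proof -
  interpret pp: product_prob_space "\<lambda>_::'d. nu s"
    by (rule product_prob_spaceI) (rule prob_space_nu)
  let ?\<Pi> = "\<Pi>\<^sub>M i\<in>(UNIV::'d set). nu s"
  have v: "vec_lambda \<in> ?\<Pi> \<rightarrow>\<^sub>M (bcube s :: (real ^ 'd) measure)"
    by (subst vec_measurable_iff) simp
  have d: "distr ?\<Pi> (bcube s) vec_lambda = (design_measure s :: (real ^ 'd) measure)"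
  proof (rule eq_design_measureI)
    fix A :: "'d \<Rightarrow> real set" assume A: "\<And>i. A i \<in> sets (nu s)"
    have "(\<lambda>x. \<Prod>i\<in>UNIV. indicator (A i) (x $ i) :: ennreal) \<in> borel_measurable (bcube s :: (real ^ 'd) measure)"
      by (intro borel_measurable_prod_ennreal measurable_compose[OF nth_measurable] borel_measurable_indicator)
         (use A in simp)
    then have "(\<integral>\<^sup>+x. (\<Prod>i\<in>UNIV. indicator (A i) (x $ i)) \<partial>distr ?\<Pi> (bcube s) vec_lambda) =
       (\<integral>\<^sup>+x. (\<Prod>i\<in>UNIV. indicator (A i) (x i)) \<partial>?\<Pi>)"
      by (subst nn_integral_distr[OF v]) simp_all
    also have "\<dots> = (\<Prod>i\<in>UNIV. emeasure (nu s) (A i))"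
      using A by (subst pp.product_nn_integral_prod) (simp_all add: nn_integral_indicator del: sets_nu)
    finally show "(\<integral>\<^sup>+x. (\<Prod>i\<in>UNIV. indicator (A i) (x $ i)) \<partial>distr ?\<Pi> (bcube s) vec_lambda)
       = (\<Prod>i\<in>UNIV. emeasure (nu s) (A i))" .
  qed simp
  have m: "(\<lambda>x. \<Prod>i\<in>UNIV. h i (x $ i)) \<in> borel_measurable (bcube s :: (real ^ 'd) measure)"
  proof (intro borel_measurable_prod measurable_compose[OF nth_measurable])
    fix i show "h i \<in> borel_measurable (bint s)"
      using borel_measurable_integrable[OF h[of i]] by simp
  qed
  have "(\<integral>x. (\<Prod>i\<in>UNIV. h i (x $ i)) \<partial>(design_measure s :: (real ^ 'd) measure)) = (\<integral>x. (\<Prod>i\<in>UNIV. h i (x i)) \<partial>?\<Pi>)"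
    by (subst d[symmetric], subst integral_distr[OF v m]) simp
  also have "\<dots> = (\<Prod>i\<in>UNIV. \<integral>t. h i t \<partial>nu s)"
    by (rule pp.product_integral_prod) (use h in auto)
  finally show ?thesis .
qed

lemma integral_Psi_Psi:
  "(\<integral>x. Psi s \<alpha> x * Psi s \<beta> x \<partial>design_measure s) = (if \<alpha> = \<beta> then 1 else 0)"
proof -
  have "(\<integral>x. Psi s \<alpha> x * Psi s \<beta> x \<partial>design_measure s) =
      (\<integral>x. (\<Prod>i\<in>UNIV. psi s (\<alpha> i) (x $ i) * psi s (\<beta> i) (x $ i)) \<partial>design_measure s)"
    by (simp add: Psi_def prod.distrib)
  also have "\<dots> = (\<Prod>i\<in>UNIV. \<integral>t. psi s (\<alpha> i) t * psi s (\<beta> i) t \<partial>nu s)"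
    by (rule integral_design_prod) (intro integrable_nu_continuous continuous_intros continuous_on_psi)
  also have "\<dots> = (\<Prod>i\<in>UNIV. if \<alpha> i = \<beta> i then 1 else 0)"
    by (simp add: integral_psi)
  also have "\<dots> = (if \<alpha> = \<beta> then 1 else 0)"
    by (auto intro!: prod_zero)
  finally show ?thesis .
qed

definition lin :: "setting \<Rightarrow> ('d::finite \<Rightarrow> nat) set \<Rightarrow> (('d \<Rightarrow> nat) \<Rightarrow> real) \<Rightarrow> real ^ 'd \<Rightarrow> real" where
  "lin s A c x = (\<Sum>\<alpha>\<in>A. c \<alpha> * Psi s \<alpha> x)"

definition coef :: "setting \<Rightarrow> (real ^ 'd::finite \<Rightarrow> real) \<Rightarrow> ('d \<Rightarrow> nat) \<Rightarrow> real" where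
  "coef s f \<alpha> = (\<integral>x. f x * Psi s \<alpha> x \<partial>design_measure s)"

lemma bdm_lin: "bdm s (lin s A c)"
  unfolding lin_def by (intro bdm_sum bdm_mult bdm_const bdm_Psi)

lemma integral_lin_mult:
  assumes "bdm s f"
  shows "(\<integral>x. f x * lin s A c x \<partial>design_measure s) = (\<Sum>\<alpha>\<in>A. c \<alpha> * coef s f \<alpha>)"
proof -
  have "(\<integral>x. f x * lin s A c x \<partial>design_measure s) = (\<integral>x. (\<Sum>\<alpha>\<in>A. c \<alpha> * (f x * Psi s \<alpha> x)) \<partial>design_measure s)"
    by (simp add: lin_def sum_distrib_left mult_ac)
  also have "\<dots> = (\<Sum>\<alpha>\<in>A. (\<integral>x. c \<alpha> * (f x * Psi s \<alpha> x) \<partial>design_measure s))"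
    by (intro Bochner_Integration.integral_sum integrable_mult_right bdm_integrable bdm_mult bdm_Psi assms)
  finally show ?thesis by (simp add: coef_def)
qed

lemma coef_Psi: "coef s (Psi s \<beta>) \<alpha> = (if \<alpha> = \<beta> then 1 else 0)"
  unfolding coef_def integral_Psi_Psi by auto

lemma coef_lin: "finite A \<Longrightarrow> coef s (lin s A c) \<alpha> = (if \<alpha> \<in> A then c \<alpha> else 0)"
proof -
  assume A: "finite A"
  have "coef s (lin s A c) \<alpha> = (\<integral>x. Psi s \<alpha> x * lin s A c x \<partial>design_measure s)"
    by (simp add: coef_def mult.commute)
  also have "\<dots> = (\<Sum>\<beta>\<in>A. c \<beta> * (if \<beta> = \<alpha> then 1 else 0))"
    by (subst integral_lin_mult[OF bdm_Psi]) (simp add: coef_Psi)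
  also have "\<dots> = (\<Sum>\<beta>\<in>A. if \<beta> = \<alpha> then c \<beta> else 0)"
    by (intro sum.cong) auto
  finally show ?thesis using A by simp
qed

lemma integral_lin_square:
  assumes "finite A"
  shows "(\<integral>x. (lin s A c x)\<^sup>2 \<partial>design_measure s) = (\<Sum>\<alpha>\<in>A. (c \<alpha>)\<^sup>2)"
  using integral_lin_mult[OF bdm_lin[of s A c], of A c] assms
  by (simp add: power2_eq_square coef_lin)

text \<open>The error separates exactly into the squared distance of f from the span and the squared
  error of the coefficients. As \<open>c\<close> is arbitrary, estimated coefficients can be
  inserted for each sample.\<close>

lemma pythagoras:
  assumes f: "bdm s f" and A: "finite A"
  shows "(\<integral>x. (f x - lin s A c x)\<^sup>2 \<partial>design_measure s) =
     (\<integral>x. (f x)\<^sup>2 \<partial>design_measure s) - (\<Sum>\<alpha>\<in>A. (coef s f \<alpha>)\<^sup>2) + (\<Sum>\<alpha>\<in>A. (c \<alpha> - coef s f \<alpha>)\<^sup>2)"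
proof -
  have i: "integrable (design_measure s) (\<lambda>x. (f x)\<^sup>2)"
       "integrable (design_measure s) (\<lambda>x. (lin s A c x)\<^sup>2)"
       "integrable (design_measure s) (\<lambda>x. f x * lin s A c x)"
    by (intro bdm_integrable bdm_power2 bdm_mult bdm_lin f)+
  have "(\<integral>x. (f x - lin s A c x)\<^sup>2 \<partial>design_measure s) =
      (\<integral>x. ((f x)\<^sup>2 + (lin s A c x)\<^sup>2) - 2 * (f x * lin s A c x) \<partial>design_measure s)"
    by (simp add: power2_diff mult.assoc)
  also have "\<dots> = (\<integral>x. (f x)\<^sup>2 \<partial>design_measure s) + (\<Sum>\<alpha>\<in>A. (c \<alpha>)\<^sup>2) - 2 * (\<Sum>\<alpha>\<in>A. c \<alpha> * coef s f \<alpha>)"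
    using i by (simp add: integral_lin_square[OF A] integral_lin_mult[OF f])
  finally have 1: "(\<integral>x. (f x - lin s A c x)\<^sup>2 \<partial>design_measure s) =
     (\<integral>x. (f x)\<^sup>2 \<partial>design_measure s) + (\<Sum>\<alpha>\<in>A. (c \<alpha>)\<^sup>2) - 2 * (\<Sum>\<alpha>\<in>A. c \<alpha> * coef s f \<alpha>)" .
  have 2: "(\<Sum>\<alpha>\<in>A. (c \<alpha>)\<^sup>2) - 2 * (\<Sum>\<alpha>\<in>A. c \<alpha> * coef s f \<alpha>) =
      (\<Sum>\<alpha>\<in>A. (c \<alpha> - coef s f \<alpha>)\<^sup>2) - (\<Sum>\<alpha>\<in>A. (coef s f \<alpha>)\<^sup>2)"
    by (simp add: power2_diff sum.distrib sum_subtractf sum_distrib_left mult.assoc)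
  show ?thesis using 1 2 by linarith
qed

lemma bessel:
  assumes f: "bdm s f" and A: "finite A"
  shows "(\<Sum>\<alpha>\<in>A. (coef s f \<alpha>)\<^sup>2) \<le> (\<integral>x. (f x)\<^sup>2 \<partial>design_measure s)"
proof -
  have "0 \<le> (\<integral>x. (f x - lin s A (coef s f) x)\<^sup>2 \<partial>design_measure s)" by simp
  then show ?thesis using pythagoras[OF f A, of "coef s f"] by simp
qed

lemma finite_trunc_set [simp]: "finite (trunc_set k :: ('d::finite \<Rightarrow> nat) set)"
proof -
  have "(trunc_set k :: ('d \<Rightarrow> nat) set) = PiE UNIV (\<lambda>_. {..k})"
    by (auto simp: trunc_set_def PiE_def)
  then show ?thesis by (simp add: finite_PiE)
qed

lemma card_trunc_set: "card (trunc_set k :: ('d::finite \<Rightarrow> nat) set) = (k + 1) ^ CARD('d)"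
proof -
  have "(trunc_set k :: ('d \<Rightarrow> nat) set) = PiE UNIV (\<lambda>_. {..k})"
    by (auto simp: trunc_set_def PiE_def)
  then show ?thesis by (simp add: card_PiE)
qed

section \<open>Stability of the Sobol indices\<close>

definition sq_int :: "'a measure \<Rightarrow> ('a \<Rightarrow> real) \<Rightarrow> bool" where
  "sq_int M f \<longleftrightarrow> f \<in> borel_measurable M \<and> integrable M (\<lambda>x. (f x)\<^sup>2)"

lemma sq_int_mult:
  assumes "sq_int M f" "sq_int M g"
  shows "integrable M (\<lambda>x. f x * g x)"
proof (rule Bochner_Integration.integrable_bound)
  show "integrable M (\<lambda>x. (f x)\<^sup>2 + (g x)\<^sup>2)" "(\<lambda>x. f x * g x) \<in> borel_measurable M"
    using assms by (auto simp: sq_int_def)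
  show "AE x in M. norm (f x * g x) \<le> norm ((f x)\<^sup>2 + (g x)\<^sup>2)"
  proof (rule AE_I2)
    fix x
    have "2 * (\<bar>f x\<bar> * \<bar>g x\<bar>) \<le> (f x)\<^sup>2 + (g x)\<^sup>2"
      using sum_squares_bound[of "\<bar>f x\<bar>" "\<bar>g x\<bar>"] by simp
    moreover have "0 \<le> \<bar>f x\<bar> * \<bar>g x\<bar>" by simp
    ultimately have "\<bar>f x\<bar> * \<bar>g x\<bar> \<le> (f x)\<^sup>2 + (g x)\<^sup>2" by linarith
    then show "norm (f x * g x) \<le> norm ((f x)\<^sup>2 + (g x)\<^sup>2)"
      by (simp add: abs_mult)
  qed
qed

lemma sq_int_lincomb:
  assumes "sq_int M f" "sq_int M g"
  shows "sq_int M (\<lambda>x. f x - c * g x)"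
    and "(\<integral>x. (f x - c * g x)\<^sup>2 \<partial>M) = (\<integral>x. (f x)\<^sup>2 \<partial>M) - 2 * c * (\<integral>x. f x * g x \<partial>M) + c\<^sup>2 * (\<integral>x. (g x)\<^sup>2 \<partial>M)"
proof -
  have i: "integrable M (\<lambda>x. (f x)\<^sup>2)" "integrable M (\<lambda>x. (g x)\<^sup>2)" "integrable M (\<lambda>x. f x * g x)"
    using assms sq_int_mult[OF assms] by (auto simp: sq_int_def)
  have e: "(f x - c * g x)\<^sup>2 = (f x)\<^sup>2 - 2 * c * (f x * g x) + c\<^sup>2 * (g x)\<^sup>2" for x
    by (simp add: power2_diff power_mult_distrib)
  show "sq_int M (\<lambda>x. f x - c * g x)"
    using assms i unfolding sq_int_def e by auto
  show "(\<integral>x. (f x - c * g x)\<^sup>2 \<partial>M) = (\<integral>x. (f x)\<^sup>2 \<partial>M) - 2 * c * (\<integral>x. f x * g x \<partial>M) + c\<^sup>2 * (\<integral>x. (g x)\<^sup>2 \<partial>M)"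
    unfolding e using i by simp
qed

text \<open>The squared norm of \<open>f - c * g\<close> is a nonnegative quadratic function of c,
  evaluated at its minimum.\<close>

lemma cauchy_schwarz:
  assumes f: "sq_int M f" and g: "sq_int M g"
  shows "(\<integral>x. f x * g x \<partial>M) \<le> sqrt (\<integral>x. (f x)\<^sup>2 \<partial>M) * sqrt (\<integral>x. (g x)\<^sup>2 \<partial>M)"
proof -
  define P where "P = (\<integral>x. (f x)\<^sup>2 \<partial>M)"
  define Q where "Q = (\<integral>x. f x * g x \<partial>M)"
  define R where "R = (\<integral>x. (g x)\<^sup>2 \<partial>M)"
  have nn: "0 \<le> P - 2 * c * Q + c\<^sup>2 * R" for c
    using sq_int_lincomb(2)[OF f g, of c] Bochner_Integration.integral_nonneg[of M "\<lambda>x. (f x - c * g x)\<^sup>2"]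
    unfolding P_def Q_def R_def by simp
  have P: "0 \<le> P" and R: "0 \<le> R" unfolding P_def R_def by auto
  have "Q\<^sup>2 \<le> P * R"
  proof (cases "R = 0")
    case True
    have "Q = 0"
    proof (rule ccontr)
      assume "Q \<noteq> 0"
      \<comment> \<open>Without a quadratic term the function of c is affine, and this c makes it
        negative.\<close>
      then have "P - 2 * ((P + 1) / Q) * Q = - P - 2" by (simp add: field_simps)
      then show False using nn[of "(P + 1) / Q"] P True by simp
    qed
    then show ?thesis using P R by simp
  next
    case False
    then have "R > 0" using R by simp
    have "0 \<le> (P - 2 * (Q / R) * Q + (Q / R)\<^sup>2 * R) * R"
      using nn[of "Q / R"] R by (rule mult_nonneg_nonneg)
    also have "\<dots> = P * R - Q\<^sup>2"
      using \<open>R > 0\<close> by (simp add: field_simps power2_eq_square)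
    finally show ?thesis by simp
  qed
  then have "\<bar>Q\<bar> \<le> sqrt (P * R)" by (rule real_le_rsqrt[of "\<bar>Q\<bar>", simplified])
  then show ?thesis unfolding P_def[symmetric] Q_def[symmetric] R_def[symmetric]
    by (simp add: real_sqrt_mult)
qed

lemma minkowski_diff:
  assumes f: "sq_int M f" and g: "sq_int M g"
  shows "\<bar>sqrt (\<integral>x. (f x)\<^sup>2 \<partial>M) - sqrt (\<integral>x. (g x)\<^sup>2 \<partial>M)\<bar> \<le> sqrt (\<integral>x. (f x - g x)\<^sup>2 \<partial>M)"
proof -
  define a where "a = sqrt (\<integral>x. (f x)\<^sup>2 \<partial>M)"
  define b where "b = sqrt (\<integral>x. (g x)\<^sup>2 \<partial>M)"
  have ab: "a\<^sup>2 = (\<integral>x. (f x)\<^sup>2 \<partial>M)" "b\<^sup>2 = (\<integral>x. (g x)\<^sup>2 \<partial>M)"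
    unfolding a_def b_def by simp_all
  have "(\<integral>x. (f x - g x)\<^sup>2 \<partial>M) = a\<^sup>2 - 2 * (\<integral>x. f x * g x \<partial>M) + b\<^sup>2"
    using sq_int_lincomb(2)[OF f g, of 1] unfolding ab by simp
  moreover have "(\<integral>x. f x * g x \<partial>M) \<le> a * b"
    using cauchy_schwarz[OF f g] by (simp add: a_def b_def)
  ultimately have "(a - b)\<^sup>2 \<le> (\<integral>x. (f x - g x)\<^sup>2 \<partial>M)"
    by (simp add: power2_diff)
  then show ?thesis unfolding a_def[symmetric] b_def[symmetric]
    by (intro real_le_rsqrt) simp
qed

section \<open>Orthogonality of the Sobol-Hoeffding components\<close>

lemma sobol_sq_int: "sobol_hoeffding s f F \<Longrightarrow> sq_int (design_measure s) (F U)"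
  by (auto simp: sobol_hoeffding_def sq_int_def)

lemma sobol_empty: "sobol_hoeffding s f F \<Longrightarrow> x \<in> cube s \<Longrightarrow> F {} x = mean s f"
  unfolding sobol_hoeffding_def by blast

lemma sobol_sum: "sobol_hoeffding s f F \<Longrightarrow> AE x in design_measure s. f x = (\<Sum>U\<in>UNIV. F U x)"
  unfolding sobol_hoeffding_def by blast

text \<open>Integrate over coordinate i first: \<open>G\<close> is constant along it, and the inner
  integral of \<open>F U\<close> vanishes almost everywhere.\<close>

lemma sobol_orth_aux:
  assumes F: "sobol_hoeffding s f F" and i: "i \<in> U"
    and G: "sq_int (design_measure s) G" "\<And>x t. x \<in> cube s \<Longrightarrow> t \<in> interval1 s \<Longrightarrow> G (upd x i t) = G x"
  shows "(\<integral>x. F U x * G x \<partial>design_measure s) = 0"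
proof -
  have "(\<integral>x. F U x * G x \<partial>design_measure s) =
      (\<integral>x. \<integral>t. F U (upd x i t) * G (upd x i t) \<partial>nu s \<partial>design_measure s)"
    by (rule integral_upd[symmetric]) (rule sq_int_mult[OF sobol_sq_int[OF F] G(1)])
  also have "\<dots> = (\<integral>x. (\<integral>t. F U (upd x i t) \<partial>nu s) * G x \<partial>design_measure s)"
  proof (rule Bochner_Integration.integral_cong[OF refl])
    fix x :: "real ^ 'a" assume "x \<in> space (design_measure s)"
    then have "(\<integral>t. F U (upd x i t) * G (upd x i t) \<partial>nu s) = (\<integral>t. F U (upd x i t) * G x \<partial>nu s)"
      by (intro Bochner_Integration.integral_cong) (auto simp: G(2))
    then show "(\<integral>t. F U (upd x i t) * G (upd x i t) \<partial>nu s) = (\<integral>t. F U (upd x i t) \<partial>nu s) * G x"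
      by simp
  qed
  also have "\<dots> = (\<integral>x. 0 \<partial>(design_measure s :: (real ^ 'a) measure))"
  proof (rule integral_cong_AE)
    have F': "AE x in design_measure s. (\<integral>t. F U (upd x i t) \<partial>nu s) = 0"
      using F i unfolding sobol_hoeffding_def upd_def marginal_eq_nu by blast
    then show "AE x in design_measure s. (\<integral>t. F U (upd x i t) \<partial>nu s) * G x = 0"
      by eventually_elim simp
    have [measurable]: "F U \<in> borel_measurable (bcube s)" "G \<in> borel_measurable (bcube s)"
      using sobol_sq_int[OF F, of U] G(1) by (auto simp: sq_int_def)
    show "(\<lambda>x. (\<integral>t. F U (upd x i t) \<partial>nu s) * G x) \<in> borel_measurable (design_measure s)"
      by measurable
  qed simp
  finally show ?thesis by simp
qed

lemma sobol_local:
  assumes "sobol_hoeffding s f F" "i \<notin> U" "x \<in> cube s" "t \<in> interval1 s"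
  shows "F U (upd x i t) = F U x"
proof -
  have "\<forall>j\<in>U. upd x i t $ j = x $ j" using assms(2) by (auto simp: upd_nth)
  then show ?thesis using assms upd_cube[OF assms(3,4)] unfolding sobol_hoeffding_def by blast
qed

lemma sobol_orth:
  assumes F: "sobol_hoeffding s f F" and G: "sobol_hoeffding s g G" and UV: "U \<noteq> V"
  shows "(\<integral>x. F U x * G V x \<partial>design_measure s) = 0"
proof -
  from UV obtain i where "i \<in> U \<and> i \<notin> V \<or> i \<in> V \<and> i \<notin> U" by blast
  then show ?thesis
  proof
    assume i: "i \<in> U \<and> i \<notin> V"
    show ?thesis
      by (rule sobol_orth_aux[OF F _ sobol_sq_int[OF G]]) (use i sobol_local[OF G] in auto)
  next
    assume i: "i \<in> V \<and> i \<notin> U"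
    have "(\<integral>x. G V x * F U x \<partial>design_measure s) = 0"
      by (rule sobol_orth_aux[OF G _ sobol_sq_int[OF F]]) (use i sobol_local[OF F] in auto)
    then show ?thesis by (simp add: mult.commute)
  qed
qed

lemma integral_square_sum_orth:
  assumes "finite I" and H: "\<And>U. U \<in> I \<Longrightarrow> sq_int M (H U)"
    and orth: "\<And>U V. U \<in> I \<Longrightarrow> V \<in> I \<Longrightarrow> U \<noteq> V \<Longrightarrow> (\<integral>x. H U x * H V x \<partial>M) = 0"
  shows "(\<integral>x. (\<Sum>U\<in>I. H U x)\<^sup>2 \<partial>M) = (\<Sum>U\<in>I. \<integral>x. (H U x)\<^sup>2 \<partial>M)"
proof -
  have "(\<integral>x. (\<Sum>U\<in>I. H U x)\<^sup>2 \<partial>M) = (\<integral>x. (\<Sum>U\<in>I. \<Sum>V\<in>I. H U x * H V x) \<partial>M)"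
    by (simp add: power2_eq_square sum_product)
  also have "\<dots> = (\<Sum>U\<in>I. \<Sum>V\<in>I. \<integral>x. H U x * H V x \<partial>M)"
    using H by (simp add: sq_int_mult Bochner_Integration.integrable_sum)
  also have "\<dots> = (\<Sum>U\<in>I. \<Sum>V\<in>I. if U = V then \<integral>x. (H U x)\<^sup>2 \<partial>M else 0)"
    using orth by (intro sum.cong) (auto simp: power2_eq_square)
  finally show ?thesis using assms(1) by simp
qed

text \<open>Components for different index sets are orthogonal even if one belongs to f and the
  other to g, so the differences are orthogonal too and their energies add up. With g = f it follows
  that any two decompositions agree in mean square.\<close>

lemma sobol_diff:
  assumes F: "sobol_hoeffding s f F" and G: "sobol_hoeffding s g G"
    and fg: "f \<in> borel_measurable (design_measure s)" "g \<in> borel_measurable (design_measure s)"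
  shows "(\<Sum>U\<in>UNIV. \<integral>x. (F U x - G U x)\<^sup>2 \<partial>design_measure s) = (\<integral>x. (f x - g x)\<^sup>2 \<partial>design_measure s)"
proof -
  let ?M = "design_measure s"
  let ?H = "\<lambda>U x. F U x - G U x"
  have sF: "sq_int ?M (F U)" and sG: "sq_int ?M (G U)" for U
    using F G by (auto intro: sobol_sq_int)
  have sH: "sq_int ?M (?H U)" for U
    using sq_int_lincomb(1)[OF sF sG, of _ 1] by simp
  have "(\<integral>x. ?H U x * ?H V x \<partial>?M) = 0" if "U \<noteq> V" for U V
  proof -
    have "?H U x * ?H V x = F U x * F V x - F U x * G V x - G U x * F V x + G U x * G V x" for x
      by (simp add: algebra_simps)
    moreover have "integrable ?M (\<lambda>x. F U x * F V x)" "integrable ?M (\<lambda>x. F U x * G V x)"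
      "integrable ?M (\<lambda>x. G U x * F V x)" "integrable ?M (\<lambda>x. G U x * G V x)"
      by (intro sq_int_mult sF sG)+
    ultimately show ?thesis
      using sobol_orth[OF F F that] sobol_orth[OF F G that] sobol_orth[OF G F that] sobol_orth[OF G G that]
      by simp
  qed
  then have "(\<integral>x. (\<Sum>U\<in>UNIV. ?H U x)\<^sup>2 \<partial>?M) = (\<Sum>U\<in>UNIV. \<integral>x. (?H U x)\<^sup>2 \<partial>?M)"
    using sH by (intro integral_square_sum_orth) auto
  moreover have "(\<integral>x. (\<Sum>U\<in>UNIV. ?H U x)\<^sup>2 \<partial>?M) = (\<integral>x. (f x - g x)\<^sup>2 \<partial>?M)"
  proof (rule integral_cong_AE)
    have "AE x in ?M. f x = (\<Sum>U\<in>UNIV. F U x)" "AE x in ?M. g x = (\<Sum>U\<in>UNIV. G U x)"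
      by (rule sobol_sum[OF F], rule sobol_sum[OF G])
    then show "AE x in ?M. (\<Sum>U\<in>UNIV. ?H U x)\<^sup>2 = (f x - g x)\<^sup>2"
      by eventually_elim (simp add: sum_subtractf)
    have [measurable]: "F U \<in> borel_measurable ?M" "G U \<in> borel_measurable ?M" for U
      using sF[of U] sG[of U] by (auto simp: sq_int_def)
    show "(\<lambda>x. (\<Sum>U\<in>UNIV. ?H U x)\<^sup>2) \<in> borel_measurable ?M" by measurable
    show "(\<lambda>x. (f x - g x)\<^sup>2) \<in> borel_measurable ?M" using fg by measurable
  qed
  ultimately show ?thesis by simp
qed

lemma sobol_component_mean:
  assumes F: "sobol_hoeffding s f F" and U: "U \<noteq> {}"
  shows "mean s (F U) = 0"
proof -
  from U obtain i where "i \<in> U" by blast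
  then have "(\<integral>x. F U x * 1 \<partial>design_measure s) = 0"
    by (rule sobol_orth_aux[OF F]) (auto simp: sq_int_def)
  then show ?thesis by simp
qed

lemma sobol_component_var:
  assumes F: "sobol_hoeffding s f F"
  shows "var s (F U) = (if U = {} then 0 else (\<integral>x. (F U x)\<^sup>2 \<partial>design_measure s))"
proof (cases "U = {}")
  case True
  have "F {} x = mean s f" if "x \<in> cube s" for x
    by (rule sobol_empty[OF F that])
  then have "(\<integral>x. F {} x \<partial>design_measure s) = (\<integral>x. mean s f \<partial>(design_measure s :: (real ^ 'a) measure))"
    by (intro Bochner_Integration.integral_cong) auto
  then have m: "mean s (F {}) = mean s f" by simp
  have "var s (F {}) = (\<integral>x. 0 \<partial>(design_measure s :: (real ^ 'a) measure))"
    unfolding m by (intro Bochner_Integration.integral_cong) (simp_all add: sobol_empty[OF F])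
  then show ?thesis using True by simp
next
  case False
  then show ?thesis using sobol_component_mean[OF F False] by simp
qed

lemma sobol_var:
  assumes F: "sobol_hoeffding s f F" and f: "f \<in> borel_measurable (design_measure s)"
  shows "var s f = (\<Sum>U\<in>UNIV - {{}}. \<integral>x. (F U x)\<^sup>2 \<partial>design_measure s)"
proof -
  let ?M = "design_measure s"
  have sF: "sq_int ?M (F U)" for U using F by (rule sobol_sq_int)
  have [measurable]: "F U \<in> borel_measurable ?M" for U
    using sF[of U] by (auto simp: sq_int_def)
  have "var s f = (\<integral>x. (\<Sum>U\<in>UNIV - {{}}. F U x)\<^sup>2 \<partial>?M)"
  proof (rule integral_cong_AE)
    have "AE x in ?M. f x = (\<Sum>U\<in>UNIV. F U x)" "AE x in ?M. x \<in> cube s"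
      using sobol_sum[OF F] AE_space[of ?M] by simp_all
    then show "AE x in ?M. (f x - mean s f)\<^sup>2 = (\<Sum>U\<in>UNIV - {{}}. F U x)\<^sup>2"
    proof eventually_elim
      case (elim x)
      then have "F {} x = mean s f" by (intro sobol_empty[OF F])
      then have "f x = mean s f + (\<Sum>U\<in>UNIV - {{}}. F U x)"
        using elim by (simp add: sum.remove[of UNIV "{}"])
      then show ?case by simp
    qed
    show "(\<lambda>x. (f x - mean s f)\<^sup>2) \<in> borel_measurable ?M" using f by measurable
    show "(\<lambda>x. (\<Sum>U\<in>UNIV - {{}}. F U x)\<^sup>2) \<in> borel_measurable ?M" by measurable
  qed
  also have "\<dots> = (\<Sum>U\<in>UNIV - {{}}. \<integral>x. (F U x)\<^sup>2 \<partial>?M)"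
    using sF sobol_orth[OF F F] by (intro integral_square_sum_orth) auto
  finally show ?thesis .
qed

text \<open>The ratios are the squares of x = |a_V| / |a_I| and y = |b_V| / |b_I|, both in [0, 1].
  Writing x - y as ((|a_V| - |b_V|) + y (|b_I| - |a_I|)) / |a_I| bounds it by 2 |e| / |a_I|, with
  the norm of a alone in the denominator. The factor x + y <= 2 and squaring produce the constant
  16.\<close>

lemma normalized_energy_stable:
  fixes a b e :: "'i \<Rightarrow> real"
  assumes "finite I" "V \<subseteq> I" and ab: "\<And>i. i \<in> I \<Longrightarrow> \<bar>a i - b i\<bar> \<le> e i"
    and A: "(\<Sum>i\<in>I. (a i)\<^sup>2) > 0" and B: "(\<Sum>i\<in>I. (b i)\<^sup>2) > 0"
  shows "((\<Sum>i\<in>V. (a i)\<^sup>2) / (\<Sum>i\<in>I. (a i)\<^sup>2) - (\<Sum>i\<in>V. (b i)\<^sup>2) / (\<Sum>i\<in>I. (b i)\<^sup>2))\<^sup>2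
     \<le> 16 * (\<Sum>i\<in>I. (e i)\<^sup>2) / (\<Sum>i\<in>I. (a i)\<^sup>2)"
proof -
  have fV: "finite V" using assms(1,2) finite_subset by blast
  define A0 where "A0 = L2_set a I" define B0 where "B0 = L2_set b I" define E where "E = L2_set e I"
  define av where "av = L2_set a V" define bv where "bv = L2_set b V"
  have sq: "A0\<^sup>2 = (\<Sum>i\<in>I. (a i)\<^sup>2)" "B0\<^sup>2 = (\<Sum>i\<in>I. (b i)\<^sup>2)" "E\<^sup>2 = (\<Sum>i\<in>I. (e i)\<^sup>2)"
     "av\<^sup>2 = (\<Sum>i\<in>V. (a i)\<^sup>2)" "bv\<^sup>2 = (\<Sum>i\<in>V. (b i)\<^sup>2)"
    by (simp_all add: A0_def B0_def E_def av_def bv_def L2_set_def sum_nonneg)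
  have pos: "A0 > 0" "B0 > 0" using A B by (simp_all add: A0_def B0_def L2_set_def)
  have nn: "E \<ge> 0" "av \<ge> 0" "bv \<ge> 0" by (simp_all add: E_def av_def bv_def)
  have sub: "L2_set c V \<le> L2_set c I" for c :: "'i \<Rightarrow> real"
    unfolding L2_set_def using assms(1,2) by (intro real_sqrt_le_mono sum_mono2) auto
  have tri: "\<bar>L2_set a W - L2_set b W\<bar> \<le> L2_set e W" if "W \<subseteq> I" for W
  proof -
    have le: "L2_set (\<lambda>i. a i - b i) W \<le> L2_set e W" "L2_set (\<lambda>i. b i - a i) W \<le> L2_set e W"
      unfolding L2_set_def using ab that
      by (auto intro!: real_sqrt_le_mono sum_mono simp: abs_le_square_iff[symmetric])
         (smt (verit) ab subsetD)+
    have "L2_set (\<lambda>i. b i + (a i - b i)) W \<le> L2_set b W + L2_set (\<lambda>i. a i - b i) W"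
      by (rule L2_set_triangle_ineq)
    moreover have "L2_set (\<lambda>i. a i + (b i - a i)) W \<le> L2_set a W + L2_set (\<lambda>i. b i - a i) W"
      by (rule L2_set_triangle_ineq)
    ultimately show ?thesis using le by simp
  qed
  have t1: "\<bar>av - bv\<bar> \<le> E" using tri[OF assms(2)] sub[of e] by (simp add: av_def bv_def E_def)
  have t2: "\<bar>A0 - B0\<bar> \<le> E" using tri[OF subset_refl] by (simp add: A0_def B0_def E_def)
  define x where "x = av / A0" define y where "y = bv / B0"
  have x1: "0 \<le> x" "x \<le> 1" using sub[of a] pos nn by (simp_all add: x_def av_def A0_def)
  have y1: "0 \<le> y" "y \<le> 1" using sub[of b] pos nn by (simp_all add: y_def bv_def B0_def)
  have "x - y = ((av - bv) + y * (B0 - A0)) / A0"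
    using pos by (simp add: x_def y_def field_simps)
  moreover have "\<bar>(av - bv) + y * (B0 - A0)\<bar> \<le> 2 * E"
  proof -
    have "\<bar>y * (B0 - A0)\<bar> \<le> 1 * E"
      unfolding abs_mult using t2 y1 by (intro mult_mono) auto
    then show ?thesis using t1 by linarith
  qed
  ultimately have xy: "\<bar>x - y\<bar> \<le> 2 * E / A0"
    using pos by (simp add: abs_divide divide_right_mono)
  have "\<bar>x\<^sup>2 - y\<^sup>2\<bar> = \<bar>x - y\<bar> * (x + y)"
    using x1 y1 by (simp add: power2_eq_square square_diff_square_factored abs_mult mult.commute)
  also have "\<dots> \<le> (2 * E / A0) * 2"
    using xy x1 y1 by (intro mult_mono) auto
  finally have "(\<bar>x\<^sup>2 - y\<^sup>2\<bar>)\<^sup>2 \<le> (4 * E / A0)\<^sup>2"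
    by (intro power_mono) auto
  then have "(x\<^sup>2 - y\<^sup>2)\<^sup>2 \<le> 16 * E\<^sup>2 / A0\<^sup>2"
    by (simp add: power_divide power_mult_distrib)
  then show ?thesis by (simp add: x_def y_def power_divide sq)
qed

text \<open>A sum over an arbitrary family \<open>W\<close> treats both kinds of indices at once:
  \<open>{U}\<close> gives the Sobol index, the sets meeting \<open>U\<close> give the total-effect
  index. The empty set may occur in \<open>W\<close>, since its component is constant and has
  variance 0.\<close>

lemma index_sum_stable:
  assumes F: "sobol_hoeffding s f F" and G: "sobol_hoeffding s g G"
    and fg: "f \<in> borel_measurable (design_measure s)" "g \<in> borel_measurable (design_measure s)"
    and v: "var s f > 0" "var s g > 0"
  shows "((\<Sum>U\<in>W. var s (F U) / var s f) - (\<Sum>U\<in>W. var s (G U) / var s g))\<^sup>2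
     \<le> 16 * (\<integral>x. (f x - g x)\<^sup>2 \<partial>design_measure s) / var s f"
proof -
  let ?M = "design_measure s"
  define a where "a U = sqrt (\<integral>x. (F U x)\<^sup>2 \<partial>?M)" for U
  define b where "b U = sqrt (\<integral>x. (G U x)\<^sup>2 \<partial>?M)" for U
  define e where "e U = sqrt (\<integral>x. (F U x - G U x)\<^sup>2 \<partial>?M)" for U
  have sq: "(a U)\<^sup>2 = (\<integral>x. (F U x)\<^sup>2 \<partial>?M)" "(b U)\<^sup>2 = (\<integral>x. (G U x)\<^sup>2 \<partial>?M)"
      "(e U)\<^sup>2 = (\<integral>x. (F U x - G U x)\<^sup>2 \<partial>?M)" for U
    by (simp_all add: a_def b_def e_def)
  have vf: "var s f = (\<Sum>U\<in>UNIV - {{}}. (a U)\<^sup>2)" and vg: "var s g = (\<Sum>U\<in>UNIV - {{}}. (b U)\<^sup>2)"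
    unfolding sq using sobol_var[OF F fg(1)] sobol_var[OF G fg(2)] by auto
  have F1: "(\<Sum>U\<in>W. var s (F U) / var s f) = (\<Sum>U\<in>W - {{}}. (a U)\<^sup>2) / (\<Sum>U\<in>UNIV - {{}}. (a U)\<^sup>2)"
    unfolding vf[symmetric] unfolding sum_divide_distrib sq
    by (rule sum.mono_neutral_cong_right) (auto simp: sobol_component_var[OF F])
  have G1: "(\<Sum>U\<in>W. var s (G U) / var s g) = (\<Sum>U\<in>W - {{}}. (b U)\<^sup>2) / (\<Sum>U\<in>UNIV - {{}}. (b U)\<^sup>2)"
    unfolding vg[symmetric] unfolding sum_divide_distrib sq
    by (rule sum.mono_neutral_cong_right) (auto simp: sobol_component_var[OF G])
  have "((\<Sum>U\<in>W. var s (F U) / var s f) - (\<Sum>U\<in>W. var s (G U) / var s g))\<^sup>2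
      \<le> 16 * (\<Sum>U\<in>UNIV - {{}}. (e U)\<^sup>2) / (\<Sum>U\<in>UNIV - {{}}. (a U)\<^sup>2)"
    unfolding F1 G1
  proof (rule normalized_energy_stable)
    fix U
    show "\<bar>a U - b U\<bar> \<le> e U"
      unfolding a_def b_def e_def by (intro minkowski_diff sobol_sq_int[OF F] sobol_sq_int[OF G])
  qed (use v vf vg in auto)
  also have "\<dots> \<le> 16 * (\<integral>x. (f x - g x)\<^sup>2 \<partial>?M) / var s f"
  proof -
    have "(\<Sum>U\<in>UNIV - {{}}. (e U)\<^sup>2) \<le> (\<Sum>U\<in>UNIV. (e U)\<^sup>2)"
      by (intro sum_mono2) auto
    also have "\<dots> = (\<integral>x. (f x - g x)\<^sup>2 \<partial>?M)"
      unfolding sq by (rule sobol_diff[OF F G fg])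
    finally show ?thesis
      unfolding vf[symmetric] using v by (intro divide_right_mono mult_left_mono) auto
  qed
  finally show ?thesis .
qed

lemma index_sum_bounds:
  assumes F: "sobol_hoeffding s f F" and f: "f \<in> borel_measurable (design_measure s)" and v: "var s f > 0"
  shows "0 \<le> (\<Sum>U\<in>W. var s (F U) / var s f)" "(\<Sum>U\<in>W. var s (F U) / var s f) \<le> 1"
proof -
  show "0 \<le> (\<Sum>U\<in>W. var s (F U) / var s f)"
    using v by (intro sum_nonneg divide_nonneg_pos) (auto simp: sobol_component_var[OF F])
  have "(\<Sum>U\<in>W. var s (F U)) \<le> (\<Sum>U\<in>UNIV. var s (F U))"
    by (intro sum_mono2) (auto simp: sobol_component_var[OF F])
  also have "\<dots> = (\<Sum>U\<in>UNIV - {{}}. \<integral>x. (F U x)\<^sup>2 \<partial>design_measure s)"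
    by (rule sum.mono_neutral_cong_right) (auto simp: sobol_component_var[OF F])
  also have "\<dots> = var s f" using sobol_var[OF F f] by simp
  finally show "(\<Sum>U\<in>W. var s (F U) / var s f) \<le> 1"
    using v by (simp add: sum_divide_distrib[symmetric])
qed

lemma measure_nu [simp]: "measure (nu s) (interval1 s) = 1"
  using nu.prob_space[of s] by simp

section \<open>Existence of the Sobol-Hoeffding decomposition\<close>

definition merge_vec :: "'d set \<Rightarrow> real ^ 'd \<Rightarrow> real ^ 'd \<Rightarrow> real ^ 'd" where
  "merge_vec V x y = (\<chi> j. if j \<in> V then x $ j else y $ j)"

lemma merge_vec_nth: "merge_vec V x y $ j = (if j \<in> V then x $ j else y $ j)"
  by (simp add: merge_vec_def)

lemma merge_vec_cube: "x \<in> cube s \<Longrightarrow> y \<in> cube s \<Longrightarrow> merge_vec V x y \<in> cube s"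
  by (simp add: cube_def merge_vec_nth)

lemma merge_vec_measurable [measurable]:
  assumes f: "f \<in> M \<rightarrow>\<^sub>M (bcube s :: (real ^ 'd::finite) measure)"
    and g: "g \<in> M \<rightarrow>\<^sub>M bcube s"
  shows "(\<lambda>x. merge_vec V (f x) (g x)) \<in> M \<rightarrow>\<^sub>M bcube s"
  unfolding vec_measurable_iff
proof
  fix j
  show "(\<lambda>x. merge_vec V (f x) (g x) $ j) \<in> M \<rightarrow>\<^sub>M bint s"
    using f g by (cases "j \<in> V") (simp_all add: merge_vec_nth vec_measurable_iff)
qed

lemma merge_vec_upd_notin: "i \<notin> V \<Longrightarrow> merge_vec V (upd x i t) y = merge_vec V x y"
  by (auto simp: cart_eq_iff merge_vec_nth upd_nth)

lemma merge_vec_upd_in: "i \<notin> V \<Longrightarrow> merge_vec (insert i V) (upd x i t) y = merge_vec V x (upd y i t)"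
  by (auto simp: cart_eq_iff merge_vec_nth upd_nth)

text \<open>The conditional expectation of f given the coordinates in \<open>V\<close>. Integrating
  over merged vectors defines it at every point rather than almost everywhere.\<close>

definition partial_mean :: "setting \<Rightarrow> (real ^ 'd::finite \<Rightarrow> real) \<Rightarrow> 'd set \<Rightarrow> real ^ 'd \<Rightarrow> real" where
  "partial_mean s f V x = (\<integral>y. f (merge_vec V x y) \<partial>design_measure s)"

lemma bdm_merge_vec:
  assumes f: "bdm s f" and x: "x \<in> cube s"
  shows "bdm s (\<lambda>y. f (merge_vec V x y))"
proof -
  have fm [measurable]: "f \<in> borel_measurable (bcube s)"
    using bdm_measurable[OF f] by simp
  have [measurable]: "(\<lambda>y. x) \<in> (bcube s :: (real ^ 'a) measure) \<rightarrow>\<^sub>M bcube s"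
    using x by (intro measurable_const) (simp add: space_restrict_space)
  have "(\<lambda>y. f (merge_vec V x y)) \<in> borel_measurable (bcube s)"
    by measurable
  then show ?thesis
    using f x merge_vec_cube[OF x] unfolding bdm_def by auto
qed

lemma bdm_partial_mean:
  assumes f: "bdm s f"
  shows "bdm s (partial_mean s f V)"
proof -
  obtain B where B: "\<And>x. x \<in> cube s \<Longrightarrow> \<bar>f x\<bar> \<le> B" using f by (auto simp: bdm_def)
  have fm [measurable]: "f \<in> borel_measurable (bcube s)"
    using bdm_measurable[OF f] by simp
  have "partial_mean s f V \<in> borel_measurable (bcube s)"
    unfolding partial_mean_def by measurable
  moreover have "\<bar>partial_mean s f V x\<bar> \<le> B" if x: "x \<in> cube s" for x
  proof -
    have "\<bar>partial_mean s f V x\<bar> \<le> (\<integral>y. \<bar>f (merge_vec V x y)\<bar> \<partial>design_measure s)"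
      unfolding partial_mean_def by (rule integral_abs_bound)
    also have "\<dots> \<le> (\<integral>y. B \<partial>(design_measure s :: (real ^ 'a) measure))"
    proof (rule integral_mono)
      show "integrable (design_measure s) (\<lambda>y. \<bar>f (merge_vec V x y)\<bar>)"
        by (rule integrable_abs[OF bdm_integrable[OF bdm_merge_vec[OF f x]]])
      fix y :: "real ^ 'a" assume "y \<in> space (design_measure s)"
      then show "\<bar>f (merge_vec V x y)\<bar> \<le> B" using B merge_vec_cube[OF x] by simp
    qed simp
    finally show ?thesis by simp
  qed
  ultimately show ?thesis unfolding bdm_def by auto
qed

lemma partial_mean_local:
  assumes "\<forall>i\<in>V. x $ i = y $ i"
  shows "partial_mean s f V x = partial_mean s f V y"
proof -
  have "merge_vec V x z = merge_vec V y z" for z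
    using assms by (auto simp: cart_eq_iff merge_vec_nth)
  then show ?thesis by (simp add: partial_mean_def)
qed

lemma partial_mean_empty: "partial_mean s f {} x = mean s f"
proof -
  have "merge_vec {} x y = y" for y by (simp add: cart_eq_iff merge_vec_nth)
  then show ?thesis by (simp add: partial_mean_def)
qed

lemma partial_mean_UNIV: "partial_mean s f UNIV x = f x"
proof -
  have "merge_vec UNIV x y = x" for y by (simp add: cart_eq_iff merge_vec_nth)
  then show ?thesis by (simp add: partial_mean_def)
qed

lemma integral_partial_mean_notin:
  assumes "i \<notin> V"
  shows "(\<integral>t. partial_mean s f V (upd x i t) \<partial>nu s) = partial_mean s f V x"
  using assms by (simp add: partial_mean_def merge_vec_upd_notin)

text \<open>After the two integrals are exchanged, the inner one resamples coordinate i of the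
  averaged vector, which does not change the outer integral.\<close>

lemma integral_partial_mean_insert:
  assumes f: "bdm s f" and i: "i \<notin> V" and x: "x \<in> cube s"
  shows "(\<integral>t. partial_mean s f (insert i V) (upd x i t) \<partial>nu s) = partial_mean s f V x"
proof -
  interpret pair_prob_space "design_measure s :: (real ^ 'a) measure" "nu s" ..
  define h where "h y = f (merge_vec V x y)" for y
  have h: "integrable (design_measure s) h"
    unfolding h_def by (rule bdm_integrable[OF bdm_merge_vec[OF f x]])
  have "(\<integral>t. partial_mean s f (insert i V) (upd x i t) \<partial>nu s) = (\<integral>t. \<integral>y. h (upd y i t) \<partial>design_measure s \<partial>nu s)"
    by (simp add: partial_mean_def merge_vec_upd_in[OF i] h_def)
  also have "\<dots> = (\<integral>y. \<integral>t. h (upd y i t) \<partial>nu s \<partial>design_measure s)"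
    by (rule Fubini_integral) (rule integrable_upd[OF h])
  also have "\<dots> = (\<integral>y. h y \<partial>design_measure s)" by (rule integral_upd[OF h])
  finally show ?thesis by (simp add: h_def partial_mean_def)
qed

text \<open>Moebius inversion on the lattice of subsets; applied to the conditional expectations it
  gives the Hoeffding components by inclusion and exclusion.\<close>

definition mobius :: "('d::finite set \<Rightarrow> real) \<Rightarrow> 'd set \<Rightarrow> real" where
  "mobius E U = (\<Sum>V\<in>Pow U. (-1) ^ card (U - V) * E V)"

lemma sum_Pow_insert:
  assumes "finite T" "i \<notin> T"
  shows "(\<Sum>V\<in>Pow (insert i T). g V) = (\<Sum>V\<in>Pow T. g V + g (insert i V) :: real)"
proof -
  have "inj_on (insert i) (Pow T)" using assms(2) by (auto simp: inj_on_def)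
  moreover have "Pow T \<inter> insert i ` Pow T = {}" using assms(2) by auto
  ultimately show ?thesis
    using assms(1) by (simp add: Pow_insert sum.union_disjoint sum.reindex sum.distrib)
qed

text \<open>The inversion is an iterated difference, one element at a time. Both the summation
  formula and the vanishing of the integrals of the components come from this recursion.\<close>

lemma mobius_insert:
  assumes "i \<notin> U"
  shows "mobius E (insert i U) = mobius (\<lambda>V. E (insert i V)) U - mobius E U"
proof -
  have "(-1) ^ card (insert i U - V) * E V + (-1) ^ card (insert i U - insert i V) * E (insert i V)
      = (-1) ^ card (U - V) * E (insert i V) - (-1 :: real) ^ card (U - V) * E V" if "V \<in> Pow U" for V
  proof -
    have "insert i U - V = insert i (U - V)" "insert i U - insert i V = U - V" "i \<notin> U - V"
      using assms that by auto
    then show ?thesis by simp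
  qed
  then show ?thesis
    unfolding mobius_def using assms by (simp add: sum_Pow_insert sum_subtractf[symmetric])
qed

lemma sum_mobius: "finite T \<Longrightarrow> (\<Sum>U\<in>Pow T. mobius E U) = E T"
proof (induction T arbitrary: E rule: finite_induct)
  case empty
  then show ?case by (simp add: mobius_def)
next
  case (insert i T)
  have "(\<Sum>U\<in>Pow (insert i T). mobius E U) = (\<Sum>U\<in>Pow T. mobius (\<lambda>V. E (insert i V)) U)"
  proof (subst sum_Pow_insert[OF insert.hyps], rule sum.cong[OF refl])
    fix U assume "U \<in> Pow T"
    then have "i \<notin> U" using insert.hyps by auto
    then show "mobius E U + mobius E (insert i U) = mobius (\<lambda>V. E (insert i V)) U"
      by (simp add: mobius_insert)
  qed
  then show ?case using insert.IH by simp
qed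

text \<open>As \<open>sobol_component\<close> is a choice, nothing can be said about it before some
  decomposition has been exhibited.\<close>

lemma sobol_hoeffding_exists:
  fixes f :: "real ^ 'd::finite \<Rightarrow> real"
  assumes f: "bdm s f"
  shows "sobol_hoeffding s f (\<lambda>U x. mobius (\<lambda>V. partial_mean s f V x) U)"
    (is "sobol_hoeffding s f ?F")
  unfolding sobol_hoeffding_def
proof (intro conjI allI ballI impI)
  have b: "bdm s (?F U)" for U
    unfolding mobius_def by (intro bdm_sum bdm_mult bdm_const bdm_partial_mean f)
  show "?F U \<in> borel_measurable (design_measure s)" for U by (rule bdm_measurable[OF b])
  show "integrable (design_measure s) (\<lambda>x. (?F U x)\<^sup>2)" for U by (rule bdm_integrable[OF bdm_power2[OF b]])
  have "(\<Sum>U\<in>UNIV. ?F U x) = f x" for x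
    using sum_mobius[of UNIV "\<lambda>V. partial_mean s f V x"] by (simp add: partial_mean_UNIV)
  then show "AE x in design_measure s. f x = (\<Sum>U\<in>UNIV. ?F U x)" by simp
  show "?F U x = ?F U y" if "\<forall>i\<in>U. x $ i = y $ i" for U x y
    unfolding mobius_def
  proof (rule sum.cong[OF refl])
    fix V assume "V \<in> Pow U"
    then have "partial_mean s f V x = partial_mean s f V y"
      using that by (intro partial_mean_local) auto
    then show "(-1) ^ card (U - V) * partial_mean s f V x = (-1) ^ card (U - V) * partial_mean s f V y"
      by simp
  qed
  show "?F {} x = mean s f" for x
    by (simp add: mobius_def partial_mean_empty)
  fix U :: "'d set" and i assume i: "i \<in> U"
  show "AE x in design_measure s. (\<integral>t. ?F U (\<chi> j. if j = i then t else x $ j) \<partial>marginal s i) = 0"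
    unfolding marginal_eq_nu upd_def[symmetric]
  proof (rule AE_I2)
    fix x :: "real ^ 'd" assume "x \<in> space (design_measure s)"
    then have x: "x \<in> cube s" by simp
    define T where "T = U - {i}"
    have U: "U = insert i T" "i \<notin> T" using i by (auto simp: T_def)
    have int: "integrable (nu s) (\<lambda>t. partial_mean s f V (upd x i t))" for V
    proof -
      obtain B where B: "\<And>x. x \<in> cube s \<Longrightarrow> \<bar>partial_mean s f V x\<bar> \<le> B"
        using bdm_partial_mean[OF f, of V] by (auto simp: bdm_def)
      have pm [measurable]: "partial_mean s f V \<in> borel_measurable (bcube s)"
        using bdm_measurable[OF bdm_partial_mean[OF f, of V]] by simp
      have [measurable]: "(\<lambda>t. x) \<in> bint s \<rightarrow>\<^sub>M bcube s"
        using x by (intro measurable_const) (simp add: space_restrict_space)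
      have m: "(\<lambda>t. partial_mean s f V (upd x i t)) \<in> borel_measurable (bint s)"
        by measurable
      show ?thesis
      proof (rule nu.integrable_const_bound[where B=B])
        show "AE t in nu s. norm (partial_mean s f V (upd x i t)) \<le> B"
          using B upd_cube[OF x] by (intro AE_I2) simp
        show "(\<lambda>t. partial_mean s f V (upd x i t)) \<in> borel_measurable (nu s)"
          using m by (simp only: measurable_cong_sets[OF sets_nu refl])
      qed
    qed
    have "(\<integral>t. ?F U (upd x i t) \<partial>nu s) = mobius (\<lambda>V. \<integral>t. partial_mean s f V (upd x i t) \<partial>nu s) U"
      unfolding mobius_def
      by (subst Bochner_Integration.integral_sum) (rule integrable_mult_right[OF int], rule sum.cong[OF refl], rule integral_mult_right_zero)
    also have "\<dots> = mobius (\<lambda>V. \<integral>t. partial_mean s f (insert i V) (upd x i t) \<partial>nu s) T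
        - mobius (\<lambda>V. \<integral>t. partial_mean s f V (upd x i t) \<partial>nu s) T"
      unfolding U(1) by (rule mobius_insert[OF U(2)])
    \<comment> \<open>Averaging over coordinate i makes the conditional expectations given
      \<open>V\<close> and given \<open>insert i V\<close> equal, so the difference cancels term by
      term.\<close>
    also have "\<dots> = 0"
    proof -
      have "(\<integral>t. partial_mean s f (insert i V) (upd x i t) \<partial>nu s) = (\<integral>t. partial_mean s f V (upd x i t) \<partial>nu s)"
        if "V \<in> Pow T" for V
      proof -
        have "i \<notin> V" using U(2) that by auto
        then show ?thesis
          by (simp add: integral_partial_mean_insert[OF f _ x] integral_partial_mean_notin)
      qed
      then show ?thesis by (simp add: mobius_def)
    qed
    finally show "(\<integral>t. ?F U (upd x i t) \<partial>nu s) = 0" .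
  qed
qed

lemma sobol_component: "bdm s f \<Longrightarrow> sobol_hoeffding s f (sobol_component s f)"
  unfolding sobol_component_def by (rule someI[where P="sobol_hoeffding s f", OF sobol_hoeffding_exists])

section \<open>Sobol indices of finite expansions\<close>

definition supp :: "('d \<Rightarrow> nat) \<Rightarrow> 'd set" where
  "supp \<alpha> = {i. \<alpha> i \<noteq> 0}"

lemma supp_empty_iff: "supp \<alpha> = {} \<longleftrightarrow> \<alpha> = (\<lambda>_. 0)"
  by (auto simp: supp_def)

lemma psi_0: "psi s 0 t = 1"
proof (cases s)
  case Legendre
  have "legendre_poly 0 = 1" by (simp add: legendre_poly_def)
  moreover have "leg_sqnorm 0 = 1" by (simp add: leg_sqnorm_def leg_int_def calculation measure_nu[of Legendre, simplified])
  ultimately show ?thesis using Legendre by (simp add: psi_legendre)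
qed (simp_all add: psi.simps)

lemma Psi_0: "Psi s (\<lambda>_. 0) x = 1"
  by (simp add: Psi_def psi_0)

lemma Psi_local:
  assumes "\<forall>i\<in>supp \<alpha>. x $ i = y $ i"
  shows "Psi s \<alpha> x = Psi s \<alpha> y"
  unfolding Psi_def
proof (rule prod.cong[OF refl])
  fix i
  show "psi s (\<alpha> i) (x $ i) = psi s (\<alpha> i) (y $ i)"
    using assms by (cases "\<alpha> i = 0") (auto simp: psi_0 supp_def)
qed

lemma Psi_upd: "Psi s \<alpha> (upd x i t) = psi s (\<alpha> i) t * (\<Prod>j\<in>UNIV - {i}. psi s (\<alpha> j) (x $ j))"
  unfolding Psi_def by (subst prod.remove[of _ i]) (auto simp: upd_nth)

lemma integral_psi_0: "a \<noteq> 0 \<Longrightarrow> (\<integral>t. psi s a t \<partial>nu s) = 0"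
  using integral_psi[of s a 0] by (simp add: psi_0)

lemma coef_const_index: "coef s f (\<lambda>_. 0) = mean s f"
  by (simp add: coef_def Psi_0)

text \<open>Grouping the multi-indices by support works because every nonconstant univariate basis
  function is orthogonal to the constant one, that is, has mean 0.\<close>

lemma sobol_hoeffding_lin:
  fixes c :: "('d::finite \<Rightarrow> nat) \<Rightarrow> real"
  assumes A: "finite A"
  shows "sobol_hoeffding s (lin s A c) (\<lambda>U. lin s {\<alpha>\<in>A. supp \<alpha> = U} c)"
  unfolding sobol_hoeffding_def
proof (intro conjI allI ballI impI)
  show "lin s {\<alpha>\<in>A. supp \<alpha> = U} c \<in> borel_measurable (design_measure s)" for U
    by (rule bdm_measurable[OF bdm_lin])
  show "integrable (design_measure s) (\<lambda>x. (lin s {\<alpha>\<in>A. supp \<alpha> = U} c x)\<^sup>2)" for U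
    by (rule bdm_integrable[OF bdm_power2[OF bdm_lin]])
  have "(\<Sum>U\<in>UNIV. lin s {\<alpha>\<in>A. supp \<alpha> = U} c x) = lin s A c x" for x
    unfolding lin_def by (rule sum.group) (use A in auto)
  then show "AE x in design_measure s. lin s A c x = (\<Sum>U\<in>UNIV. lin s {\<alpha>\<in>A. supp \<alpha> = U} c x)"
    by simp
  show "lin s {\<alpha>\<in>A. supp \<alpha> = U} c x = lin s {\<alpha>\<in>A. supp \<alpha> = U} c y" if "\<forall>i\<in>U. x $ i = y $ i" for U :: "'d set" and x y
    unfolding lin_def
  proof (rule sum.cong[OF refl])
    fix \<alpha> assume "\<alpha> \<in> {\<alpha>\<in>A. supp \<alpha> = U}"
    then have "Psi s \<alpha> x = Psi s \<alpha> y" using that by (intro Psi_local) auto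
    then show "c \<alpha> * Psi s \<alpha> x = c \<alpha> * Psi s \<alpha> y" by simp
  qed
  show "lin s {\<alpha>\<in>A. supp \<alpha> = {}} c x = mean s (lin s A c)" for x
  proof -
    have "{\<alpha>\<in>A. supp \<alpha> = {}} = (if (\<lambda>_. 0) \<in> A then {\<lambda>_. 0} else {})"
      by (auto simp: supp_empty_iff)
    moreover have "mean s (lin s A c) = (if (\<lambda>_. 0) \<in> A then c (\<lambda>_. 0) else 0)"
      using coef_lin[OF A, of s c "\<lambda>_. 0"] by (simp add: coef_const_index)
    ultimately show ?thesis by (simp add: lin_def Psi_0)
  qed
  fix U :: "'d set" and i assume i: "i \<in> U"
  have int: "integrable (nu s) (psi s a)" for a
    by (rule integrable_nu_continuous[OF continuous_on_psi])
  have "(\<integral>t. lin s {\<alpha>\<in>A. supp \<alpha> = U} c (upd x i t) \<partial>nu s) = 0" for x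
  proof -
    have "(\<integral>t. lin s {\<alpha>\<in>A. supp \<alpha> = U} c (upd x i t) \<partial>nu s) =
      (\<Sum>\<alpha>\<in>{\<alpha>\<in>A. supp \<alpha> = U}. c \<alpha> * ((\<integral>t. psi s (\<alpha> i) t \<partial>nu s) * (\<Prod>j\<in>UNIV - {i}. psi s (\<alpha> j) (x $ j))))"
      unfolding lin_def Psi_upd
      by (subst Bochner_Integration.integral_sum)
         (intro integrable_mult_right integrable_mult_left int, simp only: integral_mult_right_zero integral_mult_left_zero)
    also have "\<dots> = 0"
    proof (rule sum.neutral, rule ballI)
      fix \<alpha> assume "\<alpha> \<in> {\<alpha>\<in>A. supp \<alpha> = U}"
      then have "\<alpha> i \<noteq> 0" using i by (auto simp: supp_def)
      then show "c \<alpha> * ((\<integral>t. psi s (\<alpha> i) t \<partial>nu s) * (\<Prod>j\<in>UNIV - {i}. psi s (\<alpha> j) (x $ j))) = 0"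
        by (simp add: integral_psi_0)
    qed
    finally show ?thesis .
  qed
  then show "AE x in design_measure s. (\<integral>t. lin s {\<alpha>\<in>A. supp \<alpha> = U} c (\<chi> j. if j = i then t else x $ j) \<partial>marginal s i) = 0"
    unfolding marginal_eq_nu upd_def[symmetric] by simp
qed

lemma var_lin: "finite A \<Longrightarrow> var s (lin s A c) = (\<Sum>\<alpha>\<in>A - {\<lambda>_. 0}. (c \<alpha>)\<^sup>2)"
proof -
  assume A: "finite A"
  have "var s (lin s A c) = (\<Sum>U\<in>UNIV - {{}}. \<integral>x. (lin s {\<alpha>\<in>A. supp \<alpha> = U} c x)\<^sup>2 \<partial>design_measure s)"
    by (rule sobol_var[OF sobol_hoeffding_lin[OF A] bdm_measurable[OF bdm_lin]])
  also have "\<dots> = (\<Sum>U\<in>UNIV - {{}}. \<Sum>\<alpha>\<in>{\<alpha>\<in>A. supp \<alpha> = U}. (c \<alpha>)\<^sup>2)"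
    using A by (simp add: integral_lin_square)
  also have "\<dots> = (\<Sum>U\<in>UNIV - {{}}. \<Sum>\<alpha>\<in>{\<alpha>\<in>A - {\<lambda>_. 0}. supp \<alpha> = U}. (c \<alpha>)\<^sup>2)"
    by (intro sum.cong refl) (auto simp: supp_empty_iff[symmetric])
  also have "\<dots> = (\<Sum>\<alpha>\<in>A - {\<lambda>_. 0}. (c \<alpha>)\<^sup>2)"
    by (rule sum.group) (use A supp_empty_iff in auto)
  finally show ?thesis .
qed

text \<open>The chosen decomposition need not be the grouping by support; comparing both as
  decompositions of the same function shows that their components have equal energy.\<close>

lemma var_sobol_component_lin:
  assumes A: "finite A"
  shows "var s (sobol_component s (lin s A c) U) = (if U = {} then 0 else \<Sum>\<alpha>\<in>{\<alpha>\<in>A. supp \<alpha> = U}. (c \<alpha>)\<^sup>2)"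
proof -
  let ?M = "design_measure s" and ?f = "lin s A c"
  let ?F = "sobol_component s ?f" and ?G = "\<lambda>U. lin s {\<alpha>\<in>A. supp \<alpha> = U} c"
  have F: "sobol_hoeffding s ?f ?F" by (rule sobol_component[OF bdm_lin])
  have G: "sobol_hoeffding s ?f ?G" by (rule sobol_hoeffding_lin[OF A])
  have "(\<Sum>U\<in>UNIV. \<integral>x. (?F U x - ?G U x)\<^sup>2 \<partial>?M) = 0"
    using sobol_diff[OF F G bdm_measurable[OF bdm_lin] bdm_measurable[OF bdm_lin]] by simp
  then have "(\<integral>x. (?F U x - ?G U x)\<^sup>2 \<partial>?M) = 0"
    by (subst (asm) sum_nonneg_eq_0_iff) auto
  then have "sqrt (\<integral>x. (?F U x)\<^sup>2 \<partial>?M) = sqrt (\<integral>x. (?G U x)\<^sup>2 \<partial>?M)"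
    using minkowski_diff[OF sobol_sq_int[OF F, of U] sobol_sq_int[OF G, of U]] by simp
  then show ?thesis
    using A by (simp add: sobol_component_var[OF F] integral_lin_square)
qed

text \<open>Covers both kinds of estimated indices together with the default value for an
  approximation of variance 0.\<close>

definition est_index_sum :: "setting \<Rightarrow> (real ^ 'd::finite \<Rightarrow> real) \<Rightarrow> 'd set set \<Rightarrow> real" where
  "est_index_sum s g W = (if var s g = 0 then 1 / 2 ^ CARD('d) else \<Sum>U\<in>W. sobol_index s g U)"

lemma est_sobol_index_eq: "est_sobol_index s g U = est_index_sum s g {U}"
  by (simp add: est_sobol_index_def est_index_sum_def)

lemma est_total_index_eq: "est_total_index s g U = est_index_sum s g {V. V \<inter> U \<noteq> {}}"
  by (simp add: est_total_index_def est_index_sum_def total_index_def)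

text \<open>Turns a quantity defined through a choice into an explicit function of finitely many
  coefficients, from which its measurability in the sample follows.\<close>

lemma est_index_sum_lin:
  fixes c :: "('d::finite \<Rightarrow> nat) \<Rightarrow> real"
  assumes "finite A"
  shows "est_index_sum s (lin s A c) W =
    (if (\<Sum>\<alpha>\<in>A - {\<lambda>_. 0}. (c \<alpha>)\<^sup>2) = 0 then 1 / 2 ^ CARD('d)
     else \<Sum>U\<in>W. (if U = {} then 0 else \<Sum>\<alpha>\<in>{\<alpha>\<in>A. supp \<alpha> = U}. (c \<alpha>)\<^sup>2) / (\<Sum>\<alpha>\<in>A - {\<lambda>_. 0}. (c \<alpha>)\<^sup>2))"
  unfolding est_index_sum_def sobol_index_def var_lin[OF assms] var_sobol_component_lin[OF assms] ..

text \<open>The first bound serves samples on which the approximation is close. The second, which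
  holds because both indices lie in [0, 1], limits the damage of all other samples.\<close>

lemma index_error:
  fixes f :: "real ^ 'd::finite \<Rightarrow> real"
  assumes f: "bdm s f" and v: "var s f > 0" and g: "bdm s g"
  shows "((\<Sum>U\<in>W. sobol_index s f U) - est_index_sum s g W)\<^sup>2 \<le> 16 * (\<integral>x. (f x - g x)\<^sup>2 \<partial>design_measure s) / var s f"
    and "((\<Sum>U\<in>W. sobol_index s f U) - est_index_sum s g W)\<^sup>2 \<le> 1"
proof -
  let ?M = "design_measure s"
  note F = sobol_component[OF f] and G = sobol_component[OF g]
  note mf = bdm_measurable[OF f] and mg = bdm_measurable[OF g]
  have bf: "0 \<le> (\<Sum>U\<in>W. sobol_index s f U)" "(\<Sum>U\<in>W. sobol_index s f U) \<le> 1"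
    unfolding sobol_index_def by (rule index_sum_bounds[OF F mf v])+
  have vg: "0 \<le> var s g" by simp
  have be: "0 \<le> est_index_sum s g W" "est_index_sum s g W \<le> 1"
  proof -
    have "0 \<le> est_index_sum s g W \<and> est_index_sum s g W \<le> 1"
    proof (cases "var s g = 0")
      case False
      then have "var s g > 0" using vg by linarith
      from index_sum_bounds[OF G mg this, of W] False show ?thesis
        by (simp add: est_index_sum_def sobol_index_def)
    qed (simp add: est_index_sum_def)
    then show "0 \<le> est_index_sum s g W" "est_index_sum s g W \<le> 1" by auto
  qed
  have "\<bar>(\<Sum>U\<in>W. sobol_index s f U) - est_index_sum s g W\<bar> \<le> 1"
    using bf be by linarith
  then have "\<bar>(\<Sum>U\<in>W. sobol_index s f U) - est_index_sum s g W\<bar>\<^sup>2 \<le> 1\<^sup>2"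
    by (intro power_mono) auto
  then show le1: "((\<Sum>U\<in>W. sobol_index s f U) - est_index_sum s g W)\<^sup>2 \<le> 1" by simp
  show "((\<Sum>U\<in>W. sobol_index s f U) - est_index_sum s g W)\<^sup>2 \<le> 16 * (\<integral>x. (f x - g x)\<^sup>2 \<partial>?M) / var s f"
  proof (cases "var s g = 0")
    case False
    then have "var s g > 0" using vg by linarith
    then show ?thesis
      using index_sum_stable[OF F G mf mg v, of W] False by (simp add: est_index_sum_def sobol_index_def)
  next
    \<comment> \<open>The default value says nothing about f. But if g has variance 0, its
      components for nonempty sets vanish in mean square, so the squared distance is at least
      \<open>var s f\<close> and the claimed bound is at least 1.\<close>
    case True
    have "(\<Sum>U\<in>UNIV - {{}}. \<integral>x. (sobol_component s g U x)\<^sup>2 \<partial>?M) = 0"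
      using sobol_var[OF G mg] True by simp
    then have g0: "(\<integral>x. (sobol_component s g U x)\<^sup>2 \<partial>?M) = 0" if "U \<noteq> {}" for U
      using that by (subst (asm) sum_nonneg_eq_0_iff) auto
    have "var s f = (\<Sum>U\<in>UNIV - {{}}. \<integral>x. (sobol_component s f U x)\<^sup>2 \<partial>?M)"
      by (rule sobol_var[OF F mf])
    also have "\<dots> \<le> (\<Sum>U\<in>UNIV - {{}}. \<integral>x. (sobol_component s f U x - sobol_component s g U x)\<^sup>2 \<partial>?M)"
    proof (rule sum_mono)
      fix U :: "'d set" assume "U \<in> UNIV - {{}}"
      then have U: "U \<noteq> {}" by simp
      have "sqrt (\<integral>x. (sobol_component s f U x)\<^sup>2 \<partial>?M) \<le> sqrt (\<integral>x. (sobol_component s f U x - sobol_component s g U x)\<^sup>2 \<partial>?M)"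
        using minkowski_diff[OF sobol_sq_int[OF F, of U] sobol_sq_int[OF G, of U]] g0[OF U] by simp
      then show "(\<integral>x. (sobol_component s f U x)\<^sup>2 \<partial>?M) \<le> (\<integral>x. (sobol_component s f U x - sobol_component s g U x)\<^sup>2 \<partial>?M)"
        by simp
    qed
    also have "\<dots> \<le> (\<Sum>U\<in>UNIV. \<integral>x. (sobol_component s f U x - sobol_component s g U x)\<^sup>2 \<partial>?M)"
      by (intro sum_mono2) auto
    also have "\<dots> = (\<integral>x. (f x - g x)\<^sup>2 \<partial>?M)" by (rule sobol_diff[OF F G mf mg])
    finally have "1 \<le> 16 * (\<integral>x. (f x - g x)\<^sup>2 \<partial>?M) / var s f" using v by simp
    then show ?thesis using le1 by linarith
  qed
qed

section \<open>A sampling inequality on cells\<close>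

lemma len_nonzero [simp]: "len s \<noteq> 0"
  using len_pos[of s] by linarith

section \<open>Operations on one coordinate of an expansion\<close>

lemma sum_Psi_eq_lin:
  fixes \<beta> :: "'j \<Rightarrow> ('d::finite \<Rightarrow> nat)"
  assumes "finite J" "finite A" "\<beta> ` J \<subseteq> A"
  shows "(\<Sum>j\<in>J. w j * Psi s (\<beta> j) x) = lin s A (\<lambda>\<gamma>. \<Sum>j\<in>{j\<in>J. \<beta> j = \<gamma>}. w j) x"
proof -
  have "(\<Sum>j\<in>J. w j * Psi s (\<beta> j) x) = (\<Sum>\<gamma>\<in>A. \<Sum>j\<in>{j\<in>J. \<beta> j = \<gamma>}. w j * Psi s (\<beta> j) x)"
    by (rule sum.group[OF assms, symmetric])
  also have "\<dots> = (\<Sum>\<gamma>\<in>A. (\<Sum>j\<in>{j\<in>J. \<beta> j = \<gamma>}. w j) * Psi s \<gamma> x)"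
    by (simp add: sum_distrib_right)
  finally show ?thesis by (simp add: lin_def)
qed

text \<open>The terms that arise have multi-indices \<open>\<alpha>(i := b)\<close>, many of which
  coincide, so their weights are collected. Used with \<open>K = k\<close> for derivatives and with
  a larger \<open>K\<close> for multiplication by a sine or cosine.\<close>

lemma lin_coordinate_expansion:
  fixes c :: "('d::finite \<Rightarrow> nat) \<Rightarrow> real"
  shows "\<exists>c'. \<forall>x. (\<Sum>\<alpha>\<in>trunc_set k. c \<alpha> * ((\<Sum>b\<le>K. e (\<alpha> i) b * psi s b (x $ i)) * (\<Prod>j\<in>UNIV - {i}. psi s (\<alpha> j) (x $ j))))
      = lin s (trunc_set (max k K)) c' x"
proof -
  let ?J = "trunc_set k \<times> {..K} :: (('d \<Rightarrow> nat) \<times> nat) set"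
  let ?\<beta> = "\<lambda>(\<alpha> :: 'd \<Rightarrow> nat, b). \<alpha>(i := b)"
  have P: "psi s b (x $ i) * (\<Prod>j\<in>UNIV - {i}. psi s (\<alpha> j) (x $ j)) = Psi s (\<alpha>(i := b)) x" for b \<alpha> x
    unfolding Psi_def by (subst (2) prod.remove[of _ i]) auto
  have "(\<Sum>\<alpha>\<in>trunc_set k. c \<alpha> * ((\<Sum>b\<le>K. e (\<alpha> i) b * psi s b (x $ i)) * (\<Prod>j\<in>UNIV - {i}. psi s (\<alpha> j) (x $ j))))
     = (\<Sum>\<alpha>\<in>trunc_set k. \<Sum>b\<le>K. (c \<alpha> * e (\<alpha> i) b) * Psi s (\<alpha>(i := b)) x)" for x
    by (simp add: sum_distrib_right sum_distrib_left P[symmetric] mult.assoc)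
  also have "\<dots> x = (\<Sum>j\<in>?J. (case j of (\<alpha>, b) \<Rightarrow> c \<alpha> * e (\<alpha> i) b) * Psi s (?\<beta> j) x)" for x
    by (simp add: sum.cartesian_product case_prod_beta')
  also have "\<dots> x = lin s (trunc_set (max k K)) (\<lambda>\<gamma>. \<Sum>j\<in>{j\<in>?J. ?\<beta> j = \<gamma>}. (case j of (\<alpha>, b) \<Rightarrow> c \<alpha> * e (\<alpha> i) b)) x" for x
    by (rule sum_Psi_eq_lin, simp, simp) (auto simp: trunc_set_def le_max_iff_disj)
  finally show ?thesis by blast
qed

lemma lin_upd: "lin s A c (upd x i t) = (\<Sum>\<alpha>\<in>A. c \<alpha> * (psi s (\<alpha> i) t * (\<Prod>j\<in>UNIV - {i}. psi s (\<alpha> j) (x $ j))))"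
  by (simp add: lin_def Psi_upd)

lemma lin_partial_derivative:
  fixes c :: "('d::finite \<Rightarrow> nat) \<Rightarrow> real"
  assumes s: "s \<noteq> Chebyshev" and k: "s = Trig \<Longrightarrow> even k"
  obtains c' where "\<And>x t. ((\<lambda>t. lin s (trunc_set k) c (upd x i t)) has_real_derivative
      lin s (trunc_set k) c' (upd x i t)) (at t)"
proof -
  have "\<exists>e. \<forall>a\<le>k. \<forall>t. (psi s a has_real_derivative (\<Sum>b\<le>k. e a b * psi s b t)) (at t)"
    using psi_derivative_expansion[OF s k] by metis
  then obtain e where e: "\<And>a t. a \<le> k \<Longrightarrow> (psi s a has_real_derivative (\<Sum>b\<le>k. e a b * psi s b t)) (at t)"
    by blast
  obtain c' where c': "\<And>x. (\<Sum>\<alpha>\<in>trunc_set k. c \<alpha> * ((\<Sum>b\<le>k. e (\<alpha> i) b * psi s b (x $ i)) * (\<Prod>j\<in>UNIV - {i}. psi s (\<alpha> j) (x $ j))))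
      = lin s (trunc_set (max k k)) c' x"
    using lin_coordinate_expansion[where k=k and K=k and c=c and e=e and i=i and s=s] by blast
  have "((\<lambda>t. lin s (trunc_set k) c (upd x i t)) has_real_derivative lin s (trunc_set k) c' (upd x i t)) (at t)" for x t
  proof -
    have "((\<lambda>t. \<Sum>\<alpha>\<in>trunc_set k. c \<alpha> * (psi s (\<alpha> i) t * (\<Prod>j\<in>UNIV - {i}. psi s (\<alpha> j) (x $ j)))) has_real_derivative
      (\<Sum>\<alpha>\<in>trunc_set k. c \<alpha> * ((\<Sum>b\<le>k. e (\<alpha> i) b * psi s b t) * (\<Prod>j\<in>UNIV - {i}. psi s (\<alpha> j) (x $ j))))) (at t)"
      by (intro DERIV_sum DERIV_cmult DERIV_cmult_right e) (auto simp: trunc_set_def)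
    also have "(\<Sum>\<alpha>\<in>trunc_set k. c \<alpha> * ((\<Sum>b\<le>k. e (\<alpha> i) b * psi s b t) * (\<Prod>j\<in>UNIV - {i}. psi s (\<alpha> j) (x $ j))))
       = lin s (trunc_set k) c' (upd x i t)"
      using c'[of "upd x i t"] by (simp add: upd_nth)
    finally show ?thesis unfolding lin_upd .
  qed
  then show ?thesis by (rule that)
qed

lemma integrable_integral_upd:
  assumes "integrable (design_measure s) (h :: real ^ 'd::finite \<Rightarrow> real)"
  shows "integrable (design_measure s) (\<lambda>x. \<integral>t. h (upd x i t) \<partial>nu s)"
proof -
  interpret pair_prob_space "design_measure s :: (real ^ 'd) measure" "nu s" ..
  show ?thesis using integrable_fst'[OF integrable_upd[OF assms, of i]] by simp
qed

text \<open>Along every line in direction i the expansion is univariate of degree k, so the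
  univariate inequality holds on each slice and is then integrated.\<close>

lemma bernstein_coordinate:
  fixes c c' :: "('d::finite \<Rightarrow> nat) \<Rightarrow> real"
  assumes s: "s \<noteq> Chebyshev" and k: "s = Trig \<Longrightarrow> even k"
    and d: "\<And>x t. ((\<lambda>t. lin s (trunc_set k) c (upd x i t)) has_real_derivative
      lin s (trunc_set k) c' (upd x i t)) (at t)"
  shows "(\<integral>x. (lin s (trunc_set k) c' x)\<^sup>2 \<partial>design_measure s) \<le> (bern s k)\<^sup>2 * (\<integral>x. (lin s (trunc_set k) c x)\<^sup>2 \<partial>design_measure s)"
proof -
  let ?g = "lin s (trunc_set k) c" and ?g' = "lin s (trunc_set k) c'"
  have i: "integrable (design_measure s) (\<lambda>x. (lin s (trunc_set k) b x)\<^sup>2)" for b :: "('d \<Rightarrow> nat) \<Rightarrow> real"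
    by (rule bdm_integrable[OF bdm_power2[OF bdm_lin]])
  have 1: "(\<integral>t. (?g' (upd x i t))\<^sup>2 \<partial>nu s) \<le> (bern s k)\<^sup>2 * (\<integral>t. (?g (upd x i t))\<^sup>2 \<partial>nu s)" for x
  proof (rule bernstein[OF s k])
    define C where "C a = (\<Sum>\<alpha>\<in>{\<alpha>\<in>trunc_set k. \<alpha> i = a}. c \<alpha> * (\<Prod>j\<in>UNIV - {i}. psi s (\<alpha> j) (x $ j)))" for a
    fix t
    have "?g (upd x i t) = (\<Sum>a\<le>k. \<Sum>\<alpha>\<in>{\<alpha>\<in>trunc_set k. \<alpha> i = a}. c \<alpha> * (psi s (\<alpha> i) t * (\<Prod>j\<in>UNIV - {i}. psi s (\<alpha> j) (x $ j))))"
      unfolding lin_upd by (rule sum.group[symmetric], simp, simp) (auto simp: trunc_set_def)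
    also have "\<dots> = (\<Sum>a\<le>k. C a * psi s a t)"
      unfolding C_def sum_distrib_right by (intro sum.cong) auto
    finally show "?g (upd x i t) = (\<Sum>a\<le>k. C a * psi s a t)" .
    show "((\<lambda>t. ?g (upd x i t)) has_real_derivative ?g' (upd x i t)) (at t)" by (rule d)
  qed
  have "(\<integral>x. (?g' x)\<^sup>2 \<partial>design_measure s) = (\<integral>x. \<integral>t. (?g' (upd x i t))\<^sup>2 \<partial>nu s \<partial>design_measure s)"
    by (rule integral_upd[OF i, symmetric])
  also have "\<dots> \<le> (\<integral>x. (bern s k)\<^sup>2 * (\<integral>t. (?g (upd x i t))\<^sup>2 \<partial>nu s) \<partial>design_measure s)"
    by (intro integral_mono integrable_mult_right integrable_integral_upd[OF i] 1)
  also have "\<dots> = (bern s k)\<^sup>2 * (\<integral>x. (?g x)\<^sup>2 \<partial>design_measure s)"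
    using integral_upd[OF i] by simp
  finally show ?thesis .
qed

text \<open>The minimum puts the right end of the interval into the last cell; the floor alone would
  give \<open>m\<close>.\<close>

definition cell :: "setting \<Rightarrow> nat \<Rightarrow> real \<Rightarrow> nat" where
  "cell s m t = min (m - 1) (nat \<lfloor>real m * (t - lo s) / len s\<rfloor>)"

lemma cell_less: "m \<ge> 1 \<Longrightarrow> cell s m t < m"
  by (auto simp: cell_def)

lemma cell_mono: "t \<le> r \<Longrightarrow> cell s m t \<le> cell s m r"
  unfolding cell_def
  by (intro min.mono order_refl nat_mono floor_mono divide_right_mono mult_left_mono) (auto simp: less_imp_le)

lemma cell_eqI:
  assumes "j < m" "lo s + real j * (len s / real m) \<le> t" "t < lo s + (real j + 1) * (len s / real m)"
  shows "cell s m t = j"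
proof -
  have m: "real m > 0" using assms(1) by simp
  have "real j \<le> real m * (t - lo s) / len s" "real m * (t - lo s) / len s < real j + 1"
    using assms(2,3) m by (simp_all add: field_simps)
  then have "\<lfloor>real m * (t - lo s) / len s\<rfloor> = int j" by (simp add: floor_eq_iff)
  then show ?thesis using assms(1) by (simp add: cell_def)
qed

lemma cell_eqD:
  assumes "t \<in> interval1 s" "cell s m t = j" "m \<ge> 1"
  shows "lo s + real j * (len s / real m) \<le> t" "t \<le> lo s + (real j + 1) * (len s / real m)"
proof -
  define u where "u = real m * (t - lo s) / len s"
  have m: "real m > 0" using assms(3) by simp
  have "real m * (t - lo s) \<le> real m * len s" "0 \<le> real m * (t - lo s)"
    using assms(1) m by (auto simp: interval1_lo_len intro!: mult_left_mono)
  then have u: "0 \<le> u" "u \<le> real m"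
    unfolding u_def by (auto simp: divide_le_eq intro!: divide_nonneg_pos)
  have j: "j = min (m - 1) (nat \<lfloor>u\<rfloor>)" using assms(2) by (simp add: cell_def u_def)
  have "real j \<le> real (nat \<lfloor>u\<rfloor>)" using j by simp
  also have "\<dots> \<le> u" using u by simp
  finally have 1: "real j \<le> u" .
  have 2: "u \<le> real j + 1"
  proof (cases "nat \<lfloor>u\<rfloor> \<le> m - 1")
    case True
    then have "j = nat \<lfloor>u\<rfloor>" using j by simp
    then show ?thesis using u by linarith
  next
    case False
    then have "real j + 1 = real m" using j assms(3) by simp
    then show ?thesis using u by simp
  qed
  have t: "t = lo s + u * (len s / real m)" using m by (simp add: u_def)
  show "lo s + real j * (len s / real m) \<le> t" "t \<le> lo s + (real j + 1) * (len s / real m)"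
    unfolding t using 1 2 m
    by (intro add_left_mono mult_right_mono divide_nonneg_nonneg; simp add: less_imp_le)+
qed

lemma cell_measurable [measurable]: "cell s m \<in> borel \<rightarrow>\<^sub>M count_space UNIV"
proof -
  have "(\<lambda>t. \<lfloor>real m * (t - lo s) / len s\<rfloor>) \<in> borel \<rightarrow>\<^sub>M count_space UNIV"
    by measurable
  from measurable_compose[OF this, of "\<lambda>z. min (m - 1) (nat z)" "count_space UNIV"]
  show ?thesis by (simp add: cell_def[abs_def])
qed

definition cellset :: "setting \<Rightarrow> nat \<Rightarrow> nat \<Rightarrow> real set" where
  "cellset s m j = {t \<in> interval1 s. cell s m t = j}"

lemma cellset_borel [measurable, simp]: "cellset s m j \<in> sets borel"
proof -
  have "cellset s m j = interval1 s \<inter> (cell s m -` {j} \<inter> space borel)" by (auto simp: cellset_def)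
  also have "\<dots> \<in> sets borel" by (intro sets.Int interval1_borel measurable_sets[OF cell_measurable]) auto
  finally show ?thesis .
qed

lemma cellset_nu [simp]: "cellset s m j \<in> sets (nu s)"
proof -
  have "cellset s m j \<subseteq> interval1 s" by (auto simp: cellset_def)
  then show ?thesis by (simp add: sets_restrict_space_iff)
qed

text \<open>A cell lies between a half-open and a closed interval with the same ends. Neither
  describes all cells, since only the last one is closed.\<close>

lemma measure_cellset:
  assumes s: "s \<noteq> Chebyshev" and j: "j < m"
  shows "measure (nu s) (cellset s m j) = 1 / real m"
proof -
  define a where "a = lo s + real j * (len s / real m)"
  define b where "b = lo s + (real j + 1) * (len s / real m)"
  have m: "real m > 0" "m \<ge> 1" using j by auto
  have ab: "b - a = len s / real m" "a \<le> b" using m by (simp_all add: a_def b_def field_simps less_imp_le)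
  have bI: "a \<ge> lo s" "b \<le> lo s + len s"
  proof -
    show "a \<ge> lo s" using m by (simp add: a_def less_imp_le)
    have "(real j + 1) * (len s / real m) \<le> real m * (len s / real m)"
      using j m by (intro mult_right_mono) (auto simp: less_imp_le)
    then show "b \<le> lo s + len s" using m by (simp add: b_def)
  qed
  have sub1: "{a..<b} \<subseteq> cellset s m j"
    using cell_eqI[OF j, of s] bI by (auto simp: cellset_def a_def b_def interval1_lo_len)
  have sub2: "cellset s m j \<subseteq> {a..b}"
    using cell_eqD[of _ s m j] m(2) by (auto simp: cellset_def a_def b_def)
  have l1: "emeasure lborel (cellset s m j) \<le> ennreal (b - a)"
    using emeasure_mono[OF sub2, of lborel] ab by simp
  have l2: "ennreal (b - a) \<le> emeasure lborel (cellset s m j)"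
    using emeasure_mono[OF sub1, of lborel] ab by simp
  have "emeasure lborel (cellset s m j) = ennreal (b - a)" using l1 l2 by simp
  then have l: "measure lborel (cellset s m j) = len s / real m" using ab by (simp add: measure_def)
  have "measure (nu s) (cellset s m j) = (\<integral>t. indicator (cellset s m j) t \<partial>nu s)"
    by (simp add: Int_absorb2 cellset_def)
  also have "\<dots> = (\<integral>t. indicator (interval1 s) t *\<^sub>R indicator (cellset s m j) t \<partial>lborel) / len s"
    by (rule integral_nu_lborel[OF s]) (auto intro!: measurable_restrict_space1)
  also have "(\<integral>t. indicator (interval1 s) t *\<^sub>R indicator (cellset s m j) t \<partial>lborel) = (\<integral>t. indicator (cellset s m j) t \<partial>(lborel :: real measure))"
    by (intro Bochner_Integration.integral_cong) (auto simp: cellset_def split: split_indicator)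
  also have "\<dots> = len s / real m" using l by simp
  finally show ?thesis using m by simp
qed

text \<open>The increment is an integral of the derivative over an interval inside the cell, to
  which Cauchy-Schwarz applies: one factor is the mass \<open>1 / m\<close> of the cell. The factor
  \<open>len s\<close>, squared in the end, undoes the normalisation of \<open>nu s\<close>.\<close>

lemma cell_oscillation:
  assumes s: "s \<noteq> Chebyshev" and m: "m \<ge> 1"
    and \<phi>: "\<And>t. (\<phi> has_real_derivative \<phi>' t) (at t)" and c: "continuous_on UNIV \<phi>'"
    and rt: "r \<in> interval1 s" "t \<in> interval1 s" "cell s m r = cell s m t"
  shows "(\<phi> r - \<phi> t)\<^sup>2 \<le> (len s)\<^sup>2 / real m * (\<integral>v. indicator (cellset s m (cell s m t)) v * (\<phi>' v)\<^sup>2 \<partial>nu s)"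
proof -
  have main: "(\<phi> r - \<phi> t)\<^sup>2 \<le> (len s)\<^sup>2 / real m * (\<integral>v. indicator (cellset s m (cell s m t)) v * (\<phi>' v)\<^sup>2 \<partial>nu s)"
    if rt: "r \<in> interval1 s" "t \<in> interval1 s" "cell s m r = cell s m t" and le: "t \<le> r" for r t
  proof -
    let ?C = "cellset s m (cell s m t)"
    \<comment> \<open>Cells are intervals because \<open>cell\<close> is monotone.\<close>
    have sub: "{t..r} \<subseteq> ?C"
    proof
      fix v assume v: "v \<in> {t..r}"
      then have "cell s m t \<le> cell s m v" "cell s m v \<le> cell s m r" by (auto intro: cell_mono)
      then show "v \<in> ?C" using v rt by (auto simp: cellset_def interval1_lo_len)
    qed
    have c': "continuous_on A \<phi>'" for A using c continuous_on_subset by blast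
    have [measurable]: "\<phi>' \<in> borel_measurable borel" using c by (rule borel_measurable_continuous_onI)
    have mi [measurable]: "\<phi>' \<in> borel_measurable (bint s)"
      by (intro measurable_restrict_space1) measurable
    have mind [measurable]: "indicator A \<in> borel_measurable (bint s)"
      if "A \<in> sets borel" for A using that by (intro measurable_restrict_space1) simp
    have int: "integrable (nu s) (\<lambda>v. indicator A v * \<psi> v)"
      if "A \<in> sets borel" "continuous_on UNIV \<psi>" for A and \<psi> :: "real \<Rightarrow> real"
    proof (rule Bochner_Integration.integrable_bound)
      show "integrable (nu s) \<psi>"
        using that(2) continuous_on_subset by (blast intro: integrable_nu_continuous)
      have "\<psi> \<in> borel_measurable borel" using that(2) by (rule borel_measurable_continuous_onI)
      then have "(\<lambda>v. indicator A v * \<psi> v) \<in> borel_measurable (bint s)"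
        using that(1) by (intro measurable_restrict_space1) simp
      then show "(\<lambda>v. indicator A v * \<psi> v) \<in> borel_measurable (nu s)"
        by (simp only: measurable_cong_sets[OF sets_nu refl])
    qed (auto split: split_indicator)
    have cm: "continuous_on UNIV (\<lambda>v. (\<phi>' v)\<^sup>2)" using c by (intro continuous_intros)
    have sq1: "sq_int (nu s) (\<lambda>v. indicator {t..r} v * \<phi>' v)"
    proof -
      have "(indicator {t..r} v * \<phi>' v)\<^sup>2 = indicator {t..r} v * (\<phi>' v)\<^sup>2" for v
        by (auto split: split_indicator)
      then show ?thesis
        using int[of "{t..r}" "\<lambda>v. (\<phi>' v)\<^sup>2"] int[of "{t..r}" \<phi>'] c cm
        unfolding sq_int_def by auto
    qed
    have sq2: "sq_int (nu s) (\<lambda>v. indicator {t..r} v)"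
    proof -
      have "(indicator {t..r} v)\<^sup>2 = indicator {t..r} v * (1::real)" for v :: real
        by (auto split: split_indicator)
      then show ?thesis
        using int[of "{t..r}" "\<lambda>_. 1"] unfolding sq_int_def by auto
    qed
    have "\<phi> r - \<phi> t = len s * (\<integral>v. indicator {t..r} v * \<phi>' v \<partial>nu s)"
    proof -
      have "(\<integral>v. indicator {t..r} v * \<phi>' v \<partial>nu s) = (\<integral>v. indicator (interval1 s) v *\<^sub>R (indicator {t..r} v * \<phi>' v) \<partial>lborel) / len s"
        by (rule integral_nu_lborel[OF s]) (use sq1 in \<open>simp add: sq_int_def\<close>)
      also have "(\<integral>v. indicator (interval1 s) v *\<^sub>R (indicator {t..r} v * \<phi>' v) \<partial>lborel) = (\<integral>v. indicator {t..r} v *\<^sub>R \<phi>' v \<partial>lborel)"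
        using rt by (intro Bochner_Integration.integral_cong) (auto simp: interval1_lo_len split: split_indicator)
      also have "\<dots> = \<phi> r - \<phi> t"
        by (rule integral_FTC_atLeastAtMost[OF le])
           (auto intro!: c' has_field_derivative_at_within \<phi> simp: has_real_derivative_iff_has_vector_derivative[symmetric])
      finally show ?thesis by simp
    qed
    moreover have "\<bar>\<integral>v. indicator {t..r} v * \<phi>' v \<partial>nu s\<bar> \<le>
       sqrt (\<integral>v. (indicator {t..r} v * \<phi>' v)\<^sup>2 \<partial>nu s) * sqrt (\<integral>v. (indicator {t..r} v)\<^sup>2 \<partial>nu s)"
    proof -
      have e: "(indicator {t..r} v * \<phi>' v) * indicator {t..r} v = indicator {t..r} v * \<phi>' v"
              "(indicator {t..r} v * - \<phi>' v) * indicator {t..r} v = - (indicator {t..r} v * \<phi>' v)"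
              "(indicator {t..r} v * - \<phi>' v)\<^sup>2 = (indicator {t..r} v * \<phi>' v)\<^sup>2" for v
        by (auto split: split_indicator)
      have sq1': "sq_int (nu s) (\<lambda>v. indicator {t..r} v * - \<phi>' v)"
        using sq1 unfolding sq_int_def e by auto
      show ?thesis
        using cauchy_schwarz[OF sq1 sq2] cauchy_schwarz[OF sq1' sq2] unfolding e by (simp add: abs_le_iff)
    qed
    ultimately have "\<bar>\<phi> r - \<phi> t\<bar> \<le> len s * (sqrt (\<integral>v. (indicator {t..r} v * \<phi>' v)\<^sup>2 \<partial>nu s) * sqrt (\<integral>v. (indicator {t..r} v)\<^sup>2 \<partial>nu s))"
      by (simp add: abs_mult less_imp_le)
    also have "\<dots> \<le> len s * (sqrt (\<integral>v. indicator ?C v * (\<phi>' v)\<^sup>2 \<partial>nu s) * sqrt (1 / real m))"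
    proof (intro mult_left_mono mult_mono real_sqrt_le_mono)
      show "(\<integral>v. (indicator {t..r} v * \<phi>' v)\<^sup>2 \<partial>nu s) \<le> (\<integral>v. indicator ?C v * (\<phi>' v)\<^sup>2 \<partial>nu s)"
        using sq1 int[OF cellset_borel cm, of s m "cell s m t"] sub
        by (intro integral_mono) (auto simp: sq_int_def split: split_indicator)
      have "(\<integral>v. (indicator {t..r} v)\<^sup>2 \<partial>nu s) \<le> (\<integral>v. indicator ?C v * (1::real) \<partial>nu s)"
        using sq2 int[OF cellset_borel continuous_on_const, of s m "cell s m t" 1] sub
        by (intro integral_mono) (auto simp: sq_int_def split: split_indicator)
      also have "\<dots> = measure (nu s) ?C"
        by (simp add: Int_absorb2 cellset_def)
      also have "\<dots> = 1 / real m" by (rule measure_cellset[OF s cell_less[OF m]])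
      finally show "(\<integral>v. (indicator {t..r} v)\<^sup>2 \<partial>nu s) \<le> 1 / real m" .
    qed (auto simp: less_imp_le)
    finally have "\<bar>\<phi> r - \<phi> t\<bar>\<^sup>2 \<le> (len s * (sqrt (\<integral>v. indicator ?C v * (\<phi>' v)\<^sup>2 \<partial>nu s) * sqrt (1 / real m)))\<^sup>2"
      by (intro power_mono) auto
    also have "\<dots> = (len s)\<^sup>2 / real m * (\<integral>v. indicator ?C v * (\<phi>' v)\<^sup>2 \<partial>nu s)"
      by (simp add: power_mult_distrib)
    finally show ?thesis by simp
  qed
  show ?thesis
  proof (cases "t \<le> r")
    case True
    then show ?thesis using main rt by blast
  next
    case False
    then show ?thesis using main[of t r] rt by (simp add: power2_commute)
  qed
qed

section \<open>Cells of the cube and the change from integrals to sums over cells\<close>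

definition cellvec :: "setting \<Rightarrow> nat \<Rightarrow> real ^ 'd \<Rightarrow> 'd \<Rightarrow> nat" where
  "cellvec s m x i = cell s m (x $ i)"

lemma cellvec_upd: "t \<in> cellset s m (cell s m (x $ i)) \<Longrightarrow> cellvec s m (upd x i t) = cellvec s m x"
  by (auto simp: cellvec_def upd_nth cellset_def fun_eq_iff)

lemma cellvec_in: "m \<ge> 1 \<Longrightarrow> cellvec s m x \<in> trunc_set (m - 1)"
  using cell_less[of m s] by (auto simp: trunc_set_def cellvec_def less_Suc_eq_le[symmetric])

lemma cellvec_eq_borel: "{x \<in> cube s. cellvec s m x = J} \<in> sets (design_measure s :: (real ^ 'd::finite) measure)"
proof -
  have "{x \<in> cube s. cellvec s m x = J} = (\<Inter>i\<in>UNIV. (\<lambda>x. x $ i) -` cellset s m (J i) \<inter> space (bcube s :: (real ^ 'd) measure))"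
    by (auto simp: cellvec_def cellset_def fun_eq_iff space_restrict_space cube_def)
  also have "\<dots> \<in> sets (bcube s)"
    using cellset_nu[of s m] by (intro sets.finite_INT measurable_sets[OF nth_measurable]) auto
  finally show ?thesis by simp
qed

lemma measure_cellvec:
  assumes s: "s \<noteq> Chebyshev" and J: "J \<in> trunc_set (m - 1)" and m: "m \<ge> 1"
  shows "measure (design_measure s :: (real ^ 'd::finite) measure) {x \<in> cube s. cellvec s m x = J} = 1 / real m ^ CARD('d)"
proof -
  let ?M = "design_measure s :: (real ^ 'd) measure"
  have e: "emeasure (nu s) (cellset s m (J i)) = ennreal (1 / real m)" for i
  proof -
    have "J i < m" using J m by (auto simp: trunc_set_def less_Suc_eq_le[symmetric])
    then show ?thesis using measure_cellset[OF s] by (simp add: nu.emeasure_eq_measure)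
  qed
  have "emeasure ?M {x \<in> cube s. cellvec s m x = J} = (\<integral>\<^sup>+x. indicator {x \<in> cube s. cellvec s m x = J} x \<partial>?M)"
    using cellvec_eq_borel[of s m J] by (simp del: sets_design)
  also have "\<dots> = (\<integral>\<^sup>+x. (\<Prod>i\<in>UNIV. indicator (cellset s m (J i)) (x $ i)) \<partial>?M)"
  proof (rule nn_integral_cong)
    fix x :: "real ^ 'd" assume x: "x \<in> space ?M"
    have "x \<in> {x \<in> cube s. cellvec s m x = J} \<longleftrightarrow> (\<forall>i. x $ i \<in> cellset s m (J i))"
      using x by (auto simp: cellvec_def cellset_def fun_eq_iff cube_def)
    then show "indicator {x \<in> cube s. cellvec s m x = J} x = (\<Prod>i\<in>UNIV. indicator (cellset s m (J i)) (x $ i) :: ennreal)"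
      by (auto split: split_indicator)
  qed
  also have "\<dots> = (\<Prod>i\<in>UNIV. \<integral>\<^sup>+t. indicator (cellset s m (J i)) t \<partial>nu s)"
    by (rule nn_integral_design_prod) (simp add: measurable_restrict_space1)
  also have "\<dots> = (\<Prod>i\<in>(UNIV::'d set). ennreal (1 / real m))"
    by (intro prod.cong refl) (simp add: nn_integral_indicator[OF cellset_nu] e del: sets_nu)
  also have "\<dots> = ennreal ((1 / real m) ^ CARD('d))"
    by (simp add: ennreal_power)
  finally show ?thesis by (simp add: measure_def power_one_over)
qed

text \<open>Whatever the points are, the map takes finitely many values, each on a measurable union
  of cells.\<close>

lemma cell_representative_measurable:
  fixes \<xi> :: "('d::finite \<Rightarrow> nat) \<Rightarrow> real ^ 'd"
  assumes "\<And>J. \<xi> J \<in> cube s" and m: "m \<ge> 1"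
  shows "(\<lambda>x. \<xi> (cellvec s m x)) \<in> (bcube s) \<rightarrow>\<^sub>M bcube s"
proof -
  let ?R = "bcube s :: (real ^ 'd) measure"
  have "cellvec s m \<in> ?R \<rightarrow>\<^sub>M count_space (trunc_set (m - 1))"
  proof (subst measurable_count_space_eq2)
    show "cellvec s m \<in> space ?R \<rightarrow> trunc_set (m - 1) \<and> (\<forall>a\<in>trunc_set (m - 1). cellvec s m -` {a} \<inter> space ?R \<in> sets ?R)"
    proof (intro conjI ballI)
      fix a
      have "cellvec s m -` {a} \<inter> space ?R = {x \<in> cube s. cellvec s m x = a}"
        by (auto simp: space_restrict_space)
      then show "cellvec s m -` {a} \<inter> space ?R \<in> sets ?R" using cellvec_eq_borel[of s m a] by simp
    qed (use cellvec_in[OF m] in auto)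
  qed simp
  moreover have "\<xi> \<in> count_space (trunc_set (m - 1)) \<rightarrow>\<^sub>M ?R"
    using assms by (auto simp: measurable_count_space_eq1 space_restrict_space)
  ultimately show ?thesis by (rule measurable_compose)
qed

text \<open>One step of the interpolation between the integral and the sum over cells.\<close>

lemma hybrid_step:
  fixes c c' :: "('d::finite \<Rightarrow> nat) \<Rightarrow> real"
  assumes s: "s \<noteq> Chebyshev" and m: "m \<ge> 1" and i: "i \<notin> A"
    and \<xi>: "\<And>J. \<xi> J \<in> cube s" "\<And>J. J \<in> trunc_set (m - 1) \<Longrightarrow> cellvec s m (\<xi> J) = J"
    and d: "\<And>x t. ((\<lambda>t. lin s (trunc_set k) c (upd x i t)) has_real_derivative
      lin s (trunc_set k) c' (upd x i t)) (at t)"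
    and cont: "\<And>x. continuous_on UNIV (\<lambda>t. lin s (trunc_set k) c' (upd x i t))"
  shows "\<bar>sqrt (\<integral>x. (lin s (trunc_set k) c (merge_vec (insert i A) (\<xi> (cellvec s m x)) x))\<^sup>2 \<partial>design_measure s)
       - sqrt (\<integral>x. (lin s (trunc_set k) c (merge_vec A (\<xi> (cellvec s m x)) x))\<^sup>2 \<partial>design_measure s)\<bar>
     \<le> len s / real m * sqrt (\<integral>x. (lin s (trunc_set k) c' (merge_vec A (\<xi> (cellvec s m x)) x))\<^sup>2 \<partial>design_measure s)"
proof -
  let ?M = "design_measure s :: (real ^ 'd) measure"
  let ?g = "lin s (trunc_set k) c" and ?g' = "lin s (trunc_set k) c'"
  define Y where "Y A x = merge_vec A (\<xi> (cellvec s m x)) x" for A x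
  have \<xi>m [measurable]: "(\<lambda>x. \<xi> (cellvec s m x)) \<in> (bcube s) \<rightarrow>\<^sub>M bcube s"
    by (rule cell_representative_measurable[OF \<xi>(1) m])
  have Ym [measurable]: "Y A \<in> bcube s \<rightarrow>\<^sub>M bcube s" for A
    unfolding Y_def by measurable
  have gm [measurable]: "lin s (trunc_set k) b \<in> borel_measurable (bcube s)" for b :: "('d \<Rightarrow> nat) \<Rightarrow> real"
    using bdm_measurable[OF bdm_lin[of s "trunc_set k" b]] by simp
  have Yc: "Y A x \<in> cube s" if "x \<in> cube s" for A x
    unfolding Y_def using that \<xi>(1) by (intro merge_vec_cube)
  have bdY: "bdm s (\<lambda>x. lin s (trunc_set k) b (Y A x))" for b A
  proof -
    obtain B where "\<And>x. x \<in> cube s \<Longrightarrow> \<bar>lin s (trunc_set k) b x\<bar> \<le> B"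
      using bdm_lin[of s "trunc_set k" b] by (auto simp: bdm_def)
    moreover have "(\<lambda>x. lin s (trunc_set k) b (Y A x)) \<in> borel_measurable (bcube s)"
      by measurable
    ultimately show ?thesis using Yc unfolding bdm_def by auto
  qed
  have sqY: "sq_int ?M (\<lambda>x. lin s (trunc_set k) b (Y A x))" for b A
    unfolding sq_int_def using bdm_measurable[OF bdY] bdm_integrable[OF bdm_power2[OF bdY]] by blast
  define H where "H x = (?g' (Y A x))\<^sup>2" for x
  have Hm [measurable]: "H \<in> borel_measurable (bcube s)"
    unfolding H_def by measurable
  have H0: "H x \<ge> 0" for x by (simp add: H_def)
  let ?I = "\<lambda>t v. indicator (cellset s m (cell s m t)) v :: ennreal"
  have point: "ennreal ((?g (Y (insert i A) x) - ?g (Y A x))\<^sup>2) \<le>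
      ennreal ((len s)\<^sup>2 / real m) * (\<integral>\<^sup>+v. ?I (x $ i) v * ennreal (H (upd x i v)) \<partial>nu s)" if x: "x \<in> cube s" for x
  proof -
    define J where "J = cellvec s m x"
    have J: "cellvec s m (\<xi> J) = J" unfolding J_def by (intro \<xi>(2) cellvec_in m)
    define y where "y = Y A x"
    have yi: "y $ i = x $ i" using i by (simp add: y_def Y_def merge_vec_nth)
    have y1: "Y (insert i A) x = upd y i (\<xi> J $ i)"
      using i by (auto simp: cart_eq_iff y_def Y_def J_def merge_vec_nth upd_nth)
    have y2: "Y A x = upd y i (x $ i)" unfolding yi[symmetric] by (simp add: y_def)
    \<comment> \<open>Moving coordinate i inside its cell leaves the cell vector unchanged, hence
      also the representatives that occupy the coordinates in \<open>A\<close>.\<close>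
    have y3: "Y A (upd x i v) = upd y i v" if "v \<in> cellset s m (cell s m (x $ i))" for v
    proof -
      have "cellvec s m (upd x i v) = cellvec s m x" by (rule cellvec_upd[OF that])
      then show ?thesis
        using i by (auto simp: cart_eq_iff y_def Y_def merge_vec_nth upd_nth)
    qed
    have cellJ: "cell s m (\<xi> J $ i) = cell s m (x $ i)"
      using J by (metis J_def cellvec_def)
    let ?C = "cellset s m (cell s m (x $ i))"
    have xi: "x $ i \<in> interval1 s" "\<xi> J $ i \<in> interval1 s" using x \<xi>(1)[of J] by (auto simp: cube_def)
    have "(?g (Y (insert i A) x) - ?g (Y A x))\<^sup>2 \<le> (len s)\<^sup>2 / real m * (\<integral>v. indicator ?C v * (?g' (upd y i v))\<^sup>2 \<partial>nu s)"
      unfolding y1 y2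
      by (rule cell_oscillation[OF s m d cont]) (use xi cellJ in auto)
    also have "(\<integral>v. indicator ?C v * (?g' (upd y i v))\<^sup>2 \<partial>nu s) = (\<integral>v. indicator ?C v * H (upd x i v) \<partial>nu s)"
      by (intro Bochner_Integration.integral_cong) (auto simp: H_def y3 split: split_indicator)
    finally have 1: "(?g (Y (insert i A) x) - ?g (Y A x))\<^sup>2 \<le> (len s)\<^sup>2 / real m * (\<integral>v. indicator ?C v * H (upd x i v) \<partial>nu s)" .
    have "integrable (nu s) (\<lambda>v. indicator ?C v * H (upd x i v))"
    proof -
      obtain B where B: "\<And>x. x \<in> cube s \<Longrightarrow> \<bar>?g' (Y A x)\<bar> \<le> B"
        using bdY[of c' A] by (auto simp: bdm_def)
      have [measurable]: "(\<lambda>v. x) \<in> bint s \<rightarrow>\<^sub>M bcube s"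
        using x by (intro measurable_const) (simp add: space_restrict_space)
      have [measurable]: "indicator ?C \<in> borel_measurable (bint s)"
        by (intro measurable_restrict_space1) simp
      have mm: "(\<lambda>v. indicator ?C v * H (upd x i v)) \<in> borel_measurable (bint s)"
        by measurable
      show ?thesis
      proof (rule nu.integrable_const_bound[where B="B\<^sup>2"])
        show "(\<lambda>v. indicator ?C v * H (upd x i v)) \<in> borel_measurable (nu s)"
          using mm by (simp only: measurable_cong_sets[OF sets_nu refl])
        show "AE v in nu s. norm (indicator ?C v * H (upd x i v)) \<le> B\<^sup>2"
        proof (rule AE_I2)
          fix v assume "v \<in> space (nu s)"
          then have "\<bar>?g' (Y A (upd x i v))\<bar> \<le> B" using x by (intro B upd_cube) auto
          then have "H (upd x i v) \<le> B\<^sup>2" unfolding H_def by (metis abs_ge_zero power2_abs power_mono)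
          then show "norm (indicator ?C v * H (upd x i v)) \<le> B\<^sup>2"
            using H0[of "upd x i v"] by (auto split: split_indicator)
        qed
      qed
    qed
    then have "(\<integral>\<^sup>+v. ennreal (indicator ?C v * H (upd x i v)) \<partial>nu s) = ennreal (\<integral>v. indicator ?C v * H (upd x i v) \<partial>nu s)"
      by (rule nn_integral_eq_integral) (simp add: H0)
    moreover have "ennreal (indicator ?C v * H (upd x i v)) = ?I (x $ i) v * ennreal (H (upd x i v))" for v
      by (auto split: split_indicator)
    ultimately have 2: "(\<integral>\<^sup>+v. ?I (x $ i) v * ennreal (H (upd x i v)) \<partial>nu s) = ennreal (\<integral>v. indicator ?C v * H (upd x i v) \<partial>nu s)"
      by simp
    show ?thesis
      unfolding 2 by (subst ennreal_mult'[symmetric]) (use 1 in \<open>auto intro!: ennreal_leI\<close>)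
  qed
  have cellI: "?I t v = ?I v t" if "t \<in> interval1 s" "v \<in> interval1 s" for t v
    using that by (auto simp: cellset_def split: split_indicator)
  define W where "W x = (\<integral>\<^sup>+v. ?I (x $ i) v * ennreal (H (upd x i v)) \<partial>nu s)" for x
  \<comment> \<open>Joint measurability of lying in the same cell, seen as equality of two cell
    numbers.\<close>
  have Im: "(\<lambda>z. ?I (fst z) (snd z)) \<in> borel_measurable (bint s \<Otimes>\<^sub>M bint s)"
  proof -
    let ?N = "bint s \<Otimes>\<^sub>M bint s"
    have cm: "cell s m \<in> bint s \<rightarrow>\<^sub>M count_space UNIV"
      by (intro measurable_restrict_space1 cell_measurable)
    have rm: "(\<lambda>t. real (cell s m t)) \<in> borel_measurable (bint s)"
      by (rule measurable_compose[OF cm]) simp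
    have [measurable]: "(\<lambda>z. real (cell s m (fst z))) \<in> borel_measurable ?N" "(\<lambda>z. real (cell s m (snd z))) \<in> borel_measurable ?N"
      by (rule measurable_compose[OF measurable_fst rm], rule measurable_compose[OF measurable_snd rm])
    have "(\<lambda>z. if real (cell s m (fst z)) = real (cell s m (snd z)) then 1 else 0 :: ennreal) \<in> borel_measurable ?N"
      by measurable
    then show ?thesis
      by (rule measurable_cong[THEN iffD1, rotated])
         (auto simp: space_pair_measure space_restrict_space cellset_def)
  qed
  have Im2 [measurable]: "(\<lambda>w. ?I (f w) (g w)) \<in> borel_measurable N"
    if f: "f \<in> N \<rightarrow>\<^sub>M bint s" and g: "g \<in> N \<rightarrow>\<^sub>M bint s" for f g and N :: "'z measure"
    using measurable_compose[OF measurable_Pair[OF f g] Im] by simp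
  have Wm [measurable]: "W \<in> borel_measurable (bcube s)"
    unfolding W_def by measurable
  \<comment> \<open>Source of a second factor \<open>1 / m\<close>: once the integrals are
    exchanged, the original position of coordinate i within its cell is averaged out. Together with
    the oscillation bound this makes \<open>(len s / real m)\<^sup>2\<close>.\<close>
  have W: "(\<integral>\<^sup>+x. W x \<partial>?M) = ennreal (1 / real m) * (\<integral>\<^sup>+x. ennreal (H x) \<partial>?M)"
  proof -
    have "(\<integral>\<^sup>+x. W x \<partial>?M) = (\<integral>\<^sup>+x. \<integral>\<^sup>+t. W (upd x i t) \<partial>nu s \<partial>?M)"
      by (rule nn_integral_upd[symmetric]) simp
    also have "\<dots> = (\<integral>\<^sup>+x. ennreal (1 / real m) * (\<integral>\<^sup>+v. ennreal (H (upd x i v)) \<partial>nu s) \<partial>?M)"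
    proof (rule nn_integral_cong)
      fix x assume "x \<in> space ?M"
      then have x: "x \<in> cube s" by simp
      interpret pair_sigma_finite "nu s" "nu s" ..
      have [measurable]: "(\<lambda>v. x) \<in> N \<rightarrow>\<^sub>M bcube s" for N :: "'z measure"
        using x by (intro measurable_const) (simp add: space_restrict_space)
      have "(\<integral>\<^sup>+t. W (upd x i t) \<partial>nu s) = (\<integral>\<^sup>+t. \<integral>\<^sup>+v. ?I t v * ennreal (H (upd x i v)) \<partial>nu s \<partial>nu s)"
        by (simp add: W_def upd_nth)
      also have "\<dots> = (\<integral>\<^sup>+v. \<integral>\<^sup>+t. ?I t v * ennreal (H (upd x i v)) \<partial>nu s \<partial>nu s)"
        by (rule Fubini'[symmetric]) measurable
      also have "\<dots> = (\<integral>\<^sup>+v. ennreal (1 / real m) * ennreal (H (upd x i v)) \<partial>nu s)"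
      proof (rule nn_integral_cong)
        fix v assume v: "v \<in> space (nu s)"
        have "(\<integral>\<^sup>+t. ?I t v * ennreal (H (upd x i v)) \<partial>nu s) = (\<integral>\<^sup>+t. ?I v t * ennreal (H (upd x i v)) \<partial>nu s)"
          using v by (intro nn_integral_cong) (simp add: cellI)
        also have "\<dots> = (\<integral>\<^sup>+t. ?I v t \<partial>nu s) * ennreal (H (upd x i v))"
          by (rule nn_integral_multc[OF borel_measurable_indicator[OF cellset_nu]])
        also have "(\<integral>\<^sup>+t. ?I v t \<partial>nu s) = ennreal (1 / real m)"
          using measure_cellset[OF s cell_less[OF m]]
          by (simp add: nn_integral_indicator[OF cellset_nu] nu.emeasure_eq_measure del: sets_nu)
        finally show "(\<integral>\<^sup>+t. ?I t v * ennreal (H (upd x i v)) \<partial>nu s) = ennreal (1 / real m) * ennreal (H (upd x i v))" .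
      qed
      also have "\<dots> = ennreal (1 / real m) * (\<integral>\<^sup>+v. ennreal (H (upd x i v)) \<partial>nu s)"
        by (rule nn_integral_cmult) measurable
      finally show "(\<integral>\<^sup>+t. W (upd x i t) \<partial>nu s) = ennreal (1 / real m) * (\<integral>\<^sup>+v. ennreal (H (upd x i v)) \<partial>nu s)" .
    qed
    also have "\<dots> = ennreal (1 / real m) * (\<integral>\<^sup>+x. \<integral>\<^sup>+v. ennreal (H (upd x i v)) \<partial>nu s \<partial>?M)"
      by (rule nn_integral_cmult) measurable
    also have "(\<integral>\<^sup>+x. \<integral>\<^sup>+v. ennreal (H (upd x i v)) \<partial>nu s \<partial>?M) = (\<integral>\<^sup>+x. ennreal (H x) \<partial>?M)"
      by (rule nn_integral_upd) simp
    finally show ?thesis .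
  qed
  have iH: "integrable ?M H" unfolding H_def using sqY[of c' A] by (simp add: sq_int_def)
  have "ennreal (\<integral>x. (?g (Y (insert i A) x) - ?g (Y A x))\<^sup>2 \<partial>?M) = (\<integral>\<^sup>+x. ennreal ((?g (Y (insert i A) x) - ?g (Y A x))\<^sup>2) \<partial>?M)"
    by (rule nn_integral_eq_integral[symmetric])
       (use sq_int_lincomb(1)[OF sqY[of c "insert i A"] sqY[of c A], of 1] in \<open>auto simp: sq_int_def\<close>)
  also have "\<dots> \<le> (\<integral>\<^sup>+x. ennreal ((len s)\<^sup>2 / real m) * W x \<partial>?M)"
    unfolding W_def by (rule nn_integral_mono) (use point in simp)
  also have "\<dots> = ennreal ((len s)\<^sup>2 / real m) * (ennreal (1 / real m) * ennreal (\<integral>x. H x \<partial>?M))"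
    using nn_integral_eq_integral[OF iH] H0 by (subst nn_integral_cmult) (simp_all add: W)
  also have "\<dots> = ennreal ((len s / real m)\<^sup>2 * (\<integral>x. H x \<partial>?M))"
    by (simp add: ennreal_mult'[symmetric] H0 power2_eq_square)
  finally have "(\<integral>x. (?g (Y (insert i A) x) - ?g (Y A x))\<^sup>2 \<partial>?M) \<le> (len s / real m)\<^sup>2 * (\<integral>x. H x \<partial>?M)"
    by (subst (asm) ennreal_le_iff) (auto simp: H0)
  then have "sqrt (\<integral>x. (?g (Y (insert i A) x) - ?g (Y A x))\<^sup>2 \<partial>?M) \<le> sqrt ((len s / real m)\<^sup>2 * (\<integral>x. H x \<partial>?M))"
    by (rule real_sqrt_le_mono)
  also have "\<dots> = len s / real m * sqrt (\<integral>x. H x \<partial>?M)"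
    by (simp add: real_sqrt_mult less_imp_le)
  finally show ?thesis
    using minkowski_diff[OF sqY[of c "insert i A"] sqY[of c A]] unfolding H_def Y_def by linarith
qed

lemma continuous_lin_upd:
  assumes s: "s \<noteq> Chebyshev" and k: "s = Trig \<Longrightarrow> even k"
  shows "continuous_on UNIV (\<lambda>t. lin s (trunc_set k) c (upd x i t))"
proof -
  obtain c' where "\<And>x t. ((\<lambda>t. lin s (trunc_set k) c (upd x i t)) has_real_derivative
      lin s (trunc_set k) c' (upd x i t)) (at t)"
    using lin_partial_derivative[OF s k] by blast
  then show ?thesis
    by (intro continuous_at_imp_continuous_on ballI DERIV_isCont) blast
qed

text \<open>Replacing one more coordinate costs a hybrid norm of the partial derivative, which is
  again an expansion of degree k. This is why the induction runs over all coefficient families at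
  once and carries an upper bound along: that bound, applied to the derivative and followed by
  Bernstein's inequality, leads back to the norm of the expansion itself.\<close>

lemma hybrid_bounds:
  fixes c :: "('d::finite \<Rightarrow> nat) \<Rightarrow> real"
  assumes s: "s \<noteq> Chebyshev" and k: "s = Trig \<Longrightarrow> even k" and m: "m \<ge> 1"
    and \<xi>: "\<And>J. \<xi> J \<in> cube s" "\<And>J. J \<in> trunc_set (m - 1) \<Longrightarrow> cellvec s m (\<xi> J) = J"
  defines "\<delta> \<equiv> len s / real m * bern s k"
    and "nrm \<equiv> \<lambda>c. sqrt (\<integral>x. (lin s (trunc_set k) c x)\<^sup>2 \<partial>design_measure s)"
    and "hyb \<equiv> \<lambda>A c. sqrt (\<integral>x. (lin s (trunc_set k) c (merge_vec A (\<xi> (cellvec s m x)) x))\<^sup>2 \<partial>design_measure s)"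
  shows "hyb A c \<le> (1 + \<delta>) ^ card A * nrm c \<and> (2 - (1 + \<delta>) ^ card A) * nrm c \<le> hyb A c"
proof (induction A arbitrary: c rule: finite_induct[OF finite])
  case 1
  have "merge_vec {} y x = x" for x y :: "real ^ 'd"
    by (simp add: cart_eq_iff merge_vec_nth)
  then show ?case by (simp add: hyb_def nrm_def)
next
  case (2 i A)
  obtain c' where d: "\<And>x t. ((\<lambda>t. lin s (trunc_set k) c (upd x i t)) has_real_derivative
      lin s (trunc_set k) c' (upd x i t)) (at t)"
    using lin_partial_derivative[OF s k] by blast
  have h0: "0 \<le> len s / real m" by (simp add: less_imp_le)
  have b0: "0 \<le> bern s k" by (simp add: bern_def)
  have \<delta>0: "0 \<le> \<delta>" unfolding \<delta>_def by (rule mult_nonneg_nonneg[OF h0 b0])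
  have step: "\<bar>hyb (insert i A) c - hyb A c\<bar> \<le> len s / real m * hyb A c'"
    unfolding hyb_def
    by (rule hybrid_step[OF s m 2(2) \<xi> d continuous_lin_upd[OF s k]])
  have "nrm c' \<le> sqrt ((bern s k)\<^sup>2 * (\<integral>x. (lin s (trunc_set k) c x)\<^sup>2 \<partial>design_measure s))"
    unfolding nrm_def by (intro real_sqrt_le_mono bernstein_coordinate[OF s k d])
  also have "\<dots> = bern s k * nrm c"
    using b0 by (simp add: real_sqrt_mult nrm_def)
  finally have n: "nrm c' \<le> bern s k * nrm c" .
  have "hyb A c' \<le> (1 + \<delta>) ^ card A * nrm c'" using 2(3) by blast
  also have "\<dots> \<le> (1 + \<delta>) ^ card A * (bern s k * nrm c)"
    using n \<delta>0 by (intro mult_left_mono) auto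
  finally have "len s / real m * hyb A c' \<le> len s / real m * ((1 + \<delta>) ^ card A * (bern s k * nrm c))"
    using h0 by (intro mult_left_mono)
  also have "\<dots> = \<delta> * (1 + \<delta>) ^ card A * nrm c" by (simp add: \<delta>_def)
  finally have s1: "\<bar>hyb (insert i A) c - hyb A c\<bar> \<le> \<delta> * (1 + \<delta>) ^ card A * nrm c" using step by linarith
  have ih: "hyb A c \<le> (1 + \<delta>) ^ card A * nrm c" "(2 - (1 + \<delta>) ^ card A) * nrm c \<le> hyb A c"
    using 2(3) by blast+
  have ci: "(1 + \<delta>) ^ card (insert i A) * nrm c = (1 + \<delta>) ^ card A * nrm c + \<delta> * (1 + \<delta>) ^ card A * nrm c"
    using 2(1,2) by (simp add: distrib_right)
  show ?case
  proof
    show "hyb (insert i A) c \<le> (1 + \<delta>) ^ card (insert i A) * nrm c"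
      using s1 ih(1) unfolding ci by linarith
    show "(2 - (1 + \<delta>) ^ card (insert i A)) * nrm c \<le> hyb (insert i A) c"
      using s1 ih(2) unfolding left_diff_distrib ci by linarith
  qed
qed

text \<open>The factor 5 in the fineness condition makes \<open>d * \<delta>\<close> at most 1/5.
  Bernoulli's inequality gives \<open>(1 - \<delta>) ^ d \<ge> 4 / 5\<close>, hence
  \<open>(1 + \<delta>) ^ d \<le> 5 / 4\<close>, so at least 3/4 of the norm survives the passage to
  the cells. Its square 9/16 is rounded down to 1/2.\<close>

lemma cell_sum_lower_bound:
  fixes c :: "('d::finite \<Rightarrow> nat) \<Rightarrow> real"
  assumes s: "s \<noteq> Chebyshev" and k: "s = Trig \<Longrightarrow> even k" and m: "m \<ge> 1"
    and fine: "5 * real CARD('d) * len s * bern s k \<le> real m"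
    and \<xi>: "\<And>J. \<xi> J \<in> cube s" "\<And>J. J \<in> trunc_set (m - 1) \<Longrightarrow> cellvec s m (\<xi> J) = J"
  shows "(\<Sum>\<alpha>\<in>trunc_set k. (c \<alpha>)\<^sup>2) / 2 \<le> (\<Sum>J\<in>trunc_set (m - 1). (lin s (trunc_set k) c (\<xi> J))\<^sup>2) / real m ^ CARD('d)"
proof -
  let ?M = "design_measure s :: (real ^ 'd) measure" and ?g = "lin s (trunc_set k) c"
  define \<delta> where "\<delta> = len s / real m * bern s k"
  define d where "d = CARD('d)"
  have d1: "d \<ge> 1" by (simp add: d_def Suc_le_eq)
  have \<delta>0: "0 \<le> \<delta>" by (simp add: \<delta>_def bern_def less_imp_le)
  have d\<delta>: "real d * \<delta> \<le> 1 / 5"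
    using fine m by (simp add: \<delta>_def d_def field_simps)
  have "1 * \<delta> \<le> real d * \<delta>" using d1 \<delta>0 by (intro mult_right_mono) auto
  then have \<delta>1: "\<delta> \<le> 1 / 5" using d\<delta> by simp
  have "4 / 5 \<le> 1 + real d * (- \<delta>)" using d\<delta> by simp
  also have "\<dots> \<le> (1 + - \<delta>) ^ d" by (rule Bernoulli_inequality) (use \<delta>1 in simp)
  finally have "(1 + \<delta>) ^ d * (4 / 5) \<le> (1 + \<delta>) ^ d * (1 - \<delta>) ^ d"
    using \<delta>0 by (intro mult_left_mono) auto
  also have "\<dots> = (1 - \<delta>\<^sup>2) ^ d"
    by (simp add: power_mult_distrib[symmetric] square_diff_square_factored power2_eq_square ring_distribs)
  also have "\<dots> \<le> 1"
    using \<delta>0 \<delta>1 by (intro power_le_one) (auto simp: power_le_one_iff abs_square_le_1)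
  finally have pow: "(1 + \<delta>) ^ d \<le> 5 / 4" by simp
  define N where "N = (\<Sum>\<alpha>\<in>trunc_set k. (c \<alpha>)\<^sup>2)"
  have N: "(\<integral>x. (?g x)\<^sup>2 \<partial>?M) = N" unfolding N_def by (rule integral_lin_square) simp
  have N0: "N \<ge> 0" by (simp add: N_def sum_nonneg)
  have mU: "merge_vec UNIV y x = y" for x y :: "real ^ 'd"
    by (simp add: cart_eq_iff merge_vec_nth)
  have hb: "(2 - (1 + \<delta>) ^ d) * sqrt N \<le> sqrt (\<integral>x. (?g (\<xi> (cellvec s m x)))\<^sup>2 \<partial>?M)"
    using hybrid_bounds[OF s k m \<xi>, where A=UNIV and c=c] unfolding N mU \<delta>_def[symmetric] d_def[symmetric] by blast
  have "3 / 4 * sqrt N \<le> (2 - (1 + \<delta>) ^ d) * sqrt N"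
    using pow N0 by (intro mult_right_mono) auto
  with hb have "3 / 4 * sqrt N \<le> sqrt (\<integral>x. (?g (\<xi> (cellvec s m x)))\<^sup>2 \<partial>?M)" by linarith
  then have "(3 / 4 * sqrt N)\<^sup>2 \<le> (sqrt (\<integral>x. (?g (\<xi> (cellvec s m x)))\<^sup>2 \<partial>?M))\<^sup>2"
    using N0 by (intro power_mono) auto
  then have "9 / 16 * N \<le> (\<integral>x. (?g (\<xi> (cellvec s m x)))\<^sup>2 \<partial>?M)"
    using N0 by (simp add: power_mult_distrib power_divide)
  then have 1: "N / 2 \<le> (\<integral>x. (?g (\<xi> (cellvec s m x)))\<^sup>2 \<partial>?M)" using N0 by linarith
  have "(\<integral>x. (?g (\<xi> (cellvec s m x)))\<^sup>2 \<partial>?M) =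
      (\<integral>x. (\<Sum>J\<in>trunc_set (m - 1). (?g (\<xi> J))\<^sup>2 * indicator {x \<in> cube s. cellvec s m x = J} x) \<partial>?M)"
  proof (rule Bochner_Integration.integral_cong[OF refl])
    fix x assume "x \<in> space ?M"
    then have x: "x \<in> cube s" by simp
    have "(\<Sum>J\<in>trunc_set (m - 1). (?g (\<xi> J))\<^sup>2 * indicator {x \<in> cube s. cellvec s m x = J} x) =
        (\<Sum>J\<in>trunc_set (m - 1). if J = cellvec s m x then (?g (\<xi> J))\<^sup>2 else 0)"
      using x by (intro sum.cong) (auto split: split_indicator)
    also have "\<dots> = (?g (\<xi> (cellvec s m x)))\<^sup>2"
      using cellvec_in[OF m, of s x] by simp
    finally show "(?g (\<xi> (cellvec s m x)))\<^sup>2 = (\<Sum>J\<in>trunc_set (m - 1). (?g (\<xi> J))\<^sup>2 * indicator {x \<in> cube s. cellvec s m x = J} x)" by simp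
  qed
  also have "\<dots> = (\<Sum>J\<in>trunc_set (m - 1). (?g (\<xi> J))\<^sup>2 * measure ?M {x \<in> cube s. cellvec s m x = J})"
  proof -
    have "integrable ?M (indicator {x \<in> cube s. cellvec s m x = J} :: _ \<Rightarrow> real)" for J
      by (rule integrable_real_indicator[OF cellvec_eq_borel]) (simp add: design.emeasure_eq_measure)
    moreover have "(\<integral>x. indicator {x \<in> cube s. cellvec s m x = J} x \<partial>?M) = measure ?M {x \<in> cube s. cellvec s m x = J}" for J
      by (simp add: Collect_conj_eq Int_absorb2)
    ultimately show ?thesis
      by (subst Bochner_Integration.integral_sum) (auto intro!: sum.cong)
  qed
  also have "\<dots> = (\<Sum>J\<in>trunc_set (m - 1). (?g (\<xi> J))\<^sup>2 * (1 / real m ^ CARD('d)))"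
    by (intro sum.cong refl arg_cong2[where f="(*)"] measure_cellvec[OF s _ m])
  also have "\<dots> = (\<Sum>J\<in>trunc_set (m - 1). (?g (\<xi> J))\<^sup>2) / real m ^ CARD('d)"
    by (simp add: sum_divide_distrib)
  finally show ?thesis using 1 unfolding N_def by linarith
qed

text \<open>The normalised Gram matrix, whose expectation is the identity, has smallest eigenvalue
  at least 1/4. This value combines the factor 1/2 of the cell sums with cells that hold at least
  half of their expected share of points.\<close>

definition good_design :: "setting \<Rightarrow> nat \<Rightarrow> nat \<Rightarrow> (nat \<Rightarrow> real ^ 'd::finite) \<Rightarrow> bool" where
  "good_design s k n x \<longleftrightarrow> (\<forall>c. (\<Sum>\<alpha>\<in>trunc_set k. (c \<alpha>)\<^sup>2) / 4 * real n \<le> (\<Sum>i<n. (lin s (trunc_set k) c (x i))\<^sup>2))"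

text \<open>The inequality for cell sums allows any choice of one point per cell. It is applied to
  the sample points at which the given expansion is smallest in its cell, a choice that depends on
  \<open>c\<close>; every other sample point of the cell contributes at least as much.\<close>

lemma good_designI:
  fixes x :: "nat \<Rightarrow> real ^ 'd::finite"
  assumes s: "s \<noteq> Chebyshev" and k: "s = Trig \<Longrightarrow> even k" and m: "m \<ge> 1" and n: "n \<ge> 1"
    and fine: "5 * real CARD('d) * len s * bern s k \<le> real m"
    and x: "\<And>i. i < n \<Longrightarrow> x i \<in> cube s"
    and count: "\<And>J. J \<in> trunc_set (m - 1) \<Longrightarrow>
      real n / (2 * real m ^ CARD('d)) \<le> real (card {i. i < n \<and> cellvec s m (x i) = J})"
  shows "good_design s k n x"
  unfolding good_design_def
proof
  fix c :: "('d \<Rightarrow> nat) \<Rightarrow> real"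
  let ?g = "lin s (trunc_set k) c"
  let ?I = "\<lambda>J. {i. i < n \<and> cellvec s m (x i) = J}"
  have mp: "real m ^ CARD('d) > 0" using m by simp
  define \<iota> where "\<iota> J = arg_min_on (\<lambda>i. (?g (x i))\<^sup>2) (?I J)" for J
  have ne: "?I J \<noteq> {}" "finite (?I J)" if J: "J \<in> trunc_set (m - 1)" for J
  proof -
    have "real n / (2 * real m ^ CARD('d)) > 0" using mp n by simp
    then have "card (?I J) > 0" using count[OF J] by linarith
    then show "?I J \<noteq> {}" "finite (?I J)" by (auto simp: card_gt_0_iff)
  qed
  have \<iota>: "\<iota> J \<in> ?I J" if J: "J \<in> trunc_set (m - 1)" for J
    unfolding \<iota>_def by (rule arg_min_if_finite(1)[OF ne(2)[OF J] ne(1)[OF J]])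
  have \<iota>min: "(?g (x (\<iota> J)))\<^sup>2 \<le> (?g (x i'))\<^sup>2" if J: "J \<in> trunc_set (m - 1)" "i' \<in> ?I J" for J i'
    unfolding \<iota>_def by (rule arg_min_least[OF ne(2)[OF J(1)] ne(1)[OF J(1)] J(2)])
  \<comment> \<open>For indices that name no cell any point of the cube will do; \<open>x 0\<close>
    is available because \<open>n \<ge> 1\<close>.\<close>
  define \<xi> where "\<xi> J = (if J \<in> trunc_set (m - 1) then x (\<iota> J) else x 0)" for J
  have \<xi>c: "\<xi> J \<in> cube s" for J
  proof (cases "J \<in> trunc_set (m - 1)")
    case True
    from \<iota>[OF this] have "\<iota> J < n" by blast
    then show ?thesis using x True by (simp add: \<xi>_def)
  next
    case False
    then show ?thesis using x[of 0] n by (simp add: \<xi>_def)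
  qed
  have \<xi>J: "cellvec s m (\<xi> J) = J" if "J \<in> trunc_set (m - 1)" for J
    using \<iota>[OF that] that by (simp add: \<xi>_def)
  have "(\<Sum>\<alpha>\<in>trunc_set k. (c \<alpha>)\<^sup>2) / 4 * real n = (\<Sum>\<alpha>\<in>trunc_set k. (c \<alpha>)\<^sup>2) / 2 * (real n / 2)"
    by simp
  also have "\<dots> \<le> (\<Sum>J\<in>trunc_set (m - 1). (?g (\<xi> J))\<^sup>2) / real m ^ CARD('d) * (real n / 2)"
    by (intro mult_right_mono cell_sum_lower_bound[OF s k m fine \<xi>c \<xi>J]) auto
  also have "\<dots> = (\<Sum>J\<in>trunc_set (m - 1). real n / (2 * real m ^ CARD('d)) * (?g (\<xi> J))\<^sup>2)"
    by (simp add: sum_distrib_left[symmetric] sum_divide_distrib[symmetric] mult_ac)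
  also have "\<dots> \<le> (\<Sum>J\<in>trunc_set (m - 1). \<Sum>i\<in>?I J. (?g (x i))\<^sup>2)"
  proof (rule sum_mono)
    fix J :: "'d \<Rightarrow> nat" assume J: "J \<in> trunc_set (m - 1)"
    have "real n / (2 * real m ^ CARD('d)) * (?g (\<xi> J))\<^sup>2 \<le> real (card (?I J)) * (?g (\<xi> J))\<^sup>2"
      by (intro mult_right_mono count[OF J]) auto
    also have "\<dots> = (\<Sum>i\<in>?I J. (?g (\<xi> J))\<^sup>2)" by simp
    also have "\<dots> \<le> (\<Sum>i\<in>?I J. (?g (x i))\<^sup>2)"
      using \<iota>min[OF J] J by (intro sum_mono) (simp add: \<xi>_def)
    finally show "real n / (2 * real m ^ CARD('d)) * (?g (\<xi> J))\<^sup>2 \<le> (\<Sum>i\<in>?I J. (?g (x i))\<^sup>2)" .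
  qed
  also have "\<dots> = (\<Sum>i<n. (?g (x i))\<^sup>2)"
  proof -
    have "(\<Sum>J\<in>trunc_set (m - 1). \<Sum>i\<in>{i \<in> {..<n}. cellvec s m (x i) = J}. (?g (x i))\<^sup>2) = (\<Sum>i<n. (?g (x i))\<^sup>2)"
      by (rule sum.group) (use cellvec_in[OF m] in auto)
    then show ?thesis by simp
  qed
  finally show "(\<Sum>\<alpha>\<in>trunc_set k. (c \<alpha>)\<^sup>2) / 4 * real n \<le> (\<Sum>i<n. (?g (x i))\<^sup>2)" .
qed

text \<open>Markov's inequality for the exponential of minus the count. Each factor has mean
  \<open>1 - q * (1 - exp (-1))\<close>, at most \<open>exp (- (3 / 5 * q))\<close> because
  \<open>exp (-1) \<le> 2 / 5\<close>; the exponent is then 3/5 - 1/2 = 1/10.\<close>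

lemma chernoff_lower_tail:
  assumes P: "prob_space M" and S: "S \<in> sets M" and q: "measure M S = q"
  shows "emeasure (\<Pi>\<^sub>M i\<in>{..<n}. M) {x \<in> space (\<Pi>\<^sub>M i\<in>{..<n}. M). real (card {i. i < n \<and> x i \<in> S}) < real n * q / 2}
     \<le> ennreal (exp (- (real n * q / 10)))"
proof -
  interpret M: prob_space M by (rule P)
  interpret pp: product_prob_space "\<lambda>_::nat. M" by (rule product_prob_spaceI) (rule P)
  let ?P = "\<Pi>\<^sub>M i\<in>{..<n}. M"
  let ?B = "{x \<in> space ?P. real (card {i. i < n \<and> x i \<in> S}) < real n * q / 2}"
  have cnt: "real (card {i. i < n \<and> x i \<in> S}) = (\<Sum>i<n. indicator S (x i))" for x :: "nat \<Rightarrow> 'a"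
  proof -
    have "(\<Sum>i<n. indicator S (x i)) = (\<Sum>i\<in>{i\<in>{..<n}. x i \<in> S}. 1 :: real)"
      by (subst sum.inter_filter) (auto intro!: sum.cong split: split_indicator)
    then show ?thesis by simp
  qed
  have Sm [measurable]: "(\<lambda>x. indicator S (x i) :: real) \<in> borel_measurable ?P" if "i < n" for i
    using measurable_compose[OF measurable_component_singleton[of i "{..<n}" "\<lambda>_. M"] borel_measurable_indicator[OF S]] that
    by simp
  have Bm: "?B \<in> sets ?P"
    unfolding cnt by measurable
  have q01: "0 \<le> q" "q \<le> 1" using q M.prob_le_1[of S] by auto
  define \<rho> where "\<rho> = 1 - q * (1 - exp (-1 :: real))"
  have e: "exp (-1 :: real) \<le> 2 / 5"
  proof -
    have "5 / 2 \<le> exp (1 :: real)" using exp_lower_Taylor_quadratic[of "1::real"] by simp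
    then show ?thesis by (simp add: exp_minus field_simps)
  qed
  have "emeasure ?P ?B = (\<integral>\<^sup>+x. indicator ?B x \<partial>?P)"
    by (rule nn_integral_indicator[OF Bm, symmetric])
  also have "\<dots> \<le> (\<integral>\<^sup>+x. ennreal (exp (real n * q / 2)) * (\<Prod>i<n. ennreal (exp (- indicator S (x i)))) \<partial>?P)"
  proof (rule nn_integral_mono)
    fix x :: "nat \<Rightarrow> 'a"
    define w where "w i = (indicator S (x i) :: real)" for i
    have "(\<Prod>i<n. ennreal (exp (- w i))) = ennreal (\<Prod>i<n. exp (- w i))"
      by (rule prod_ennreal) simp
    also have "(\<Prod>i<n. exp (- w i)) = exp (- (\<Sum>i<n. w i))"
      by (simp only: sum_negf[symmetric] exp_sum finite_lessThan)
    finally have "ennreal (exp (real n * q / 2)) * (\<Prod>i<n. ennreal (exp (- w i))) =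
        ennreal (exp (real n * q / 2) * exp (- (\<Sum>i<n. w i)))"
      by (simp only: ennreal_mult'[symmetric] exp_ge_zero)
    also have "exp (real n * q / 2) * exp (- (\<Sum>i<n. w i)) = exp (real n * q / 2 - (\<Sum>i<n. w i))"
      by (simp only: exp_add[symmetric] diff_conv_add_uminus)
    finally have eq: "ennreal (exp (real n * q / 2)) * (\<Prod>i<n. ennreal (exp (- w i))) =
        ennreal (exp (real n * q / 2 - (\<Sum>i<n. w i)))" .
    have "indicator ?B x \<le> ennreal (exp (real n * q / 2 - (\<Sum>i<n. w i)))"
    proof (cases "x \<in> ?B")
      case True
      then have "(\<Sum>i<n. w i) < real n * q / 2" unfolding w_def cnt by blast
      then have "ennreal 1 \<le> ennreal (exp (real n * q / 2 - (\<Sum>i<n. w i)))"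
        by (intro ennreal_leI) simp
      then show ?thesis using True by simp
    qed simp
    then have "indicator ?B x \<le> ennreal (exp (real n * q / 2)) * (\<Prod>i<n. ennreal (exp (- w i)))"
      by (simp only: eq)
    then show "indicator ?B x \<le> ennreal (exp (real n * q / 2)) * (\<Prod>i<n. ennreal (exp (- indicator S (x i))))"
      by (simp only: w_def)
  qed
  also have "\<dots> = ennreal (exp (real n * q / 2)) * (\<integral>\<^sup>+x. (\<Prod>i<n. ennreal (exp (- indicator S (x i)))) \<partial>?P)"
    by (rule nn_integral_cmult) (auto intro!: borel_measurable_prod_ennreal)
  also have "(\<integral>\<^sup>+x. (\<Prod>i<n. ennreal (exp (- indicator S (x i)))) \<partial>?P) = (\<Prod>i<n. \<integral>\<^sup>+y. ennreal (exp (- indicator S y)) \<partial>M)"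
    using S by (intro pp.product_nn_integral_prod) auto
  also have "(\<integral>\<^sup>+y. ennreal (exp (- indicator S y)) \<partial>M) = ennreal \<rho>"
  proof -
    have e1: "exp (- indicator S y) = 1 - (1 - exp (-1)) * indicator S y" for y :: 'a
      by (auto split: split_indicator)
    have i: "integrable M (indicator S :: _ \<Rightarrow> real)"
      using S by (auto simp: M.emeasure_eq_measure)
    have "(\<integral>\<^sup>+y. ennreal (exp (- indicator S y)) \<partial>M) = ennreal (\<integral>y. exp (- indicator S y) \<partial>M)"
    proof (rule nn_integral_eq_integral)
      show "integrable M (\<lambda>y. exp (- indicator S y :: real))"
        unfolding e1 using i by simp
    qed simp
    also have "(\<integral>y. exp (- indicator S y) \<partial>M) = 1 - (1 - exp (-1)) * measure M (S \<inter> space M)"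
      unfolding e1 using i by (simp add: M.prob_space)
    also have "S \<inter> space M = S" using S sets.sets_into_space by blast
    finally show ?thesis by (simp add: \<rho>_def q mult.commute)
  qed
  also have "(\<Prod>i<n. ennreal \<rho>) = ennreal (\<rho> ^ n)"
  proof -
    have "q * (1 - exp (-1)) \<le> 1 * 1" using q01 by (intro mult_mono) auto
    then have "\<rho> \<ge> 0" by (simp add: \<rho>_def)
    then show ?thesis by (simp add: ennreal_power)
  qed
  also have "ennreal (exp (real n * q / 2)) * ennreal (\<rho> ^ n) = ennreal (exp (real n * q / 2) * \<rho> ^ n)"
    by (rule ennreal_mult'[symmetric]) simp
  also have "\<dots> \<le> ennreal (exp (- (real n * q / 10)))"
  proof (rule ennreal_leI)
    have "q * (3 / 5) \<le> q * (1 - exp (-1))" using e q01 by (intro mult_left_mono) auto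
    then have "\<rho> \<le> 1 + - (3 / 5 * q)" by (simp add: \<rho>_def)
    also have "\<dots> \<le> exp (- (3 / 5 * q))" by (rule exp_ge_add_one_self)
    finally have r: "\<rho> \<le> exp (- (3 / 5 * q))" .
    have "q * (1 - exp (-1)) \<le> 1 * 1" using q01 by (intro mult_mono) auto
    then have "\<rho> \<ge> 0" by (simp add: \<rho>_def)
    then have "\<rho> ^ n \<le> exp (- (3 / 5 * q)) ^ n" using r by (intro power_mono)
    also have "\<dots> = exp (- (3 / 5 * (real n * q)))"
      by (simp add: exp_of_nat_mult[symmetric] mult_ac)
    finally have "exp (real n * q / 2) * \<rho> ^ n \<le> exp (real n * q / 2) * exp (- (3 / 5 * (real n * q)))"
      by (intro mult_left_mono) auto
    also have "\<dots> = exp (- (real n * q / 10))" by (simp add: exp_add[symmetric])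
    finally show "exp (real n * q / 2) * \<rho> ^ n \<le> exp (- (real n * q / 10))" .
  qed
  finally show ?thesis .
qed

text \<open>A union bound over the \<open>m ^ d\<close> cells, each of mass
  \<open>1 / m ^ d\<close>. The event \<open>B\<close> that some cell is underfilled contains all
  bad designs.\<close>

lemma good_design_probability:
  assumes s: "s \<noteq> Chebyshev" and k: "s = Trig \<Longrightarrow> even k" and m: "m \<ge> 1" and n: "n \<ge> 1"
    and fine: "5 * real CARD('d::finite) * len s * bern s k \<le> real m"
  obtains B where "B \<in> sets (\<Pi>\<^sub>M i\<in>{..<n}. design_measure s :: (real ^ 'd) measure)"
    and "emeasure (\<Pi>\<^sub>M i\<in>{..<n}. design_measure s) B \<le> ennreal (real m ^ CARD('d) * exp (- (real n / (10 * real m ^ CARD('d)))))"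
    and "\<And>x. x \<in> space (\<Pi>\<^sub>M i\<in>{..<n}. design_measure s) - B \<Longrightarrow> good_design s k n x"
proof -
  let ?M = "design_measure s :: (real ^ 'd) measure"
  let ?P = "\<Pi>\<^sub>M i\<in>{..<n}. ?M"
  let ?S = "\<lambda>J. {x \<in> cube s. cellvec s m x = J} :: (real ^ 'd) set"
  define q where "q = 1 / real m ^ CARD('d)"
  define BJ where "BJ J = {x \<in> space ?P. real (card {i. i < n \<and> x i \<in> ?S J}) < real n * q / 2}" for J
  define B where "B = (\<Union>J\<in>trunc_set (m - 1). BJ J)"
  have BJm: "BJ J \<in> sets ?P" for J
  proof -
    have cnt: "real (card {i. i < n \<and> x i \<in> ?S J}) = (\<Sum>i<n. indicator (?S J) (x i))" for x :: "nat \<Rightarrow> real ^ 'd"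
    proof -
      have "(\<Sum>i<n. indicator (?S J) (x i)) = (\<Sum>i\<in>{i\<in>{..<n}. x i \<in> ?S J}. 1 :: real)"
        by (subst sum.inter_filter) (auto intro!: sum.cong split: split_indicator)
      then show ?thesis by simp
    qed
    have [measurable]: "(\<lambda>x. indicator (?S J) (x i) :: real) \<in> borel_measurable ?P" if "i < n" for i
      using measurable_compose[OF measurable_component_singleton[of i "{..<n}" "\<lambda>_. ?M"] borel_measurable_indicator[OF cellvec_eq_borel]] that
      by simp
    show ?thesis unfolding BJ_def cnt by measurable
  qed
  have 1: "B \<in> sets ?P" unfolding B_def by (intro sets.finite_UN BJm) simp
  have "emeasure ?P B \<le> (\<Sum>J\<in>trunc_set (m - 1). emeasure ?P (BJ J))"
    unfolding B_def by (rule emeasure_subadditive_finite) (auto simp: BJm)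
  also have "\<dots> \<le> (\<Sum>J\<in>(trunc_set (m - 1) :: ('d \<Rightarrow> nat) set). ennreal (exp (- (real n * q / 10))))"
    unfolding BJ_def
    by (intro sum_mono chernoff_lower_tail[OF prob_space_design cellvec_eq_borel])
       (auto simp: q_def intro!: measure_cellvec[OF s _ m])
  also have "\<dots> = ennreal (real m ^ CARD('d) * exp (- (real n / (10 * real m ^ CARD('d)))))"
    using m by (simp add: card_trunc_set q_def ennreal_of_nat_eq_real_of_nat ennreal_mult'[symmetric] mult.commute)
  finally have 2: "emeasure ?P B \<le> ennreal (real m ^ CARD('d) * exp (- (real n / (10 * real m ^ CARD('d)))))" .
  have 3: "good_design s k n x" if x: "x \<in> space ?P - B" for x
  proof (rule good_designI[OF s k m n fine])
    show xc: "x i \<in> cube s" if "i < n" for i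
      using x that by (auto simp: space_PiM PiE_def Pi_def)
    fix J :: "'d \<Rightarrow> nat" assume "J \<in> trunc_set (m - 1)"
    then have "x \<notin> BJ J" using x by (auto simp: B_def)
    then have "real n * q / 2 \<le> real (card {i. i < n \<and> x i \<in> ?S J})" using x by (auto simp: BJ_def)
    moreover have "{i. i < n \<and> x i \<in> ?S J} = {i. i < n \<and> cellvec s m (x i) = J}" using xc by auto
    ultimately show "real n / (2 * real m ^ CARD('d)) \<le> real (card {i. i < n \<and> cellvec s m (x i) = J})"
      by (simp add: q_def mult.commute)
  qed
  show ?thesis by (rule that[OF 1 2 3])
qed

section \<open>Trigonometric approximation of periodic functions\<close>

declare design_measure.simps [simp del]

definition periodic :: "(real ^ 'd::finite \<Rightarrow> real) \<Rightarrow> bool" where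
  "periodic G \<longleftrightarrow> continuous_on UNIV G \<and> (\<forall>i x t. G (upd x i (t + 1)) = G (upd x i t))"

lemma continuous_upd: "continuous_on S (\<lambda>t. upd x i t)"
  unfolding upd_def
proof (rule continuous_on_vec_lambda)
  fix j
  show "continuous_on S (\<lambda>t. if j = i then t else x $ j)" by (cases "j = i") auto
qed

lemma continuous_upd_vec: "continuous_on S (\<lambda>x. upd x i (x $ i + h))"
  unfolding upd_def
proof (rule continuous_on_vec_lambda)
  fix j
  show "continuous_on S (\<lambda>x. if j = i then x $ i + h else x $ j)"
    by (cases "j = i") (auto intro!: continuous_intros)
qed

lemma periodic_slice: "periodic G \<Longrightarrow> continuous_on S (\<lambda>t. G (upd x i t))"
  unfolding periodic_def
  by (rule continuous_on_compose2[OF _ continuous_upd]) auto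

lemma periodic_bdm: "periodic G \<Longrightarrow> bdm s G"
  unfolding periodic_def by (intro bdm_continuous) (auto intro: continuous_on_subset)

lemma Psi_trig_continuous: "continuous_on UNIV (Psi Trig \<alpha>)"
proof -
  have "continuous_on UNIV (\<lambda>x. psi Trig a (x $ i))" for a i
    by (intro continuous_at_imp_continuous_on ballI isCont_o2[OF _ DERIV_isCont[OF has_derivative_psi_trig]])
       (auto intro!: continuous_intros)
  then show ?thesis unfolding Psi_def by (intro continuous_on_prod)
qed

lemma psi_trig_periodic: "psi Trig a (t + 1) = psi Trig a t"
proof -
  have "sin (2 * pi * real j * (t + 1)) = sin (2 * pi * real j * t) \<and>
        cos (2 * pi * real j * (t + 1)) = cos (2 * pi * real j * t)" for j
  proof -
    have "2 * pi * real j * (t + 1) = 2 * pi * real j * t + 2 * pi * real j" by (simp add: ring_distribs)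
    then show ?thesis
      using sin_int_2pin[of "int j"] cos_int_2pin[of "int j"] by (simp only: sin_add cos_add) simp
  qed
  then show ?thesis by (simp only: psi.simps)
qed

lemma periodic_Psi: "periodic (Psi Trig \<alpha>)"
  unfolding periodic_def Psi_upd psi_trig_periodic using Psi_trig_continuous by simp

lemma periodic_mult: "periodic G \<Longrightarrow> periodic H \<Longrightarrow> periodic (\<lambda>x. G x * H x)"
  unfolding periodic_def by (auto intro!: continuous_intros)

lemma periodic_diff: "periodic G \<Longrightarrow> periodic H \<Longrightarrow> periodic (\<lambda>x. G x - H x)"
  unfolding periodic_def by (auto intro!: continuous_intros)

lemma periodic_shift:
  assumes "periodic G"
  shows "periodic (\<lambda>x. G (upd x i (x $ i + h)))"
proof -
  have c: "continuous_on UNIV (\<lambda>x. G (upd x i (x $ i + h)))"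
    using assms unfolding periodic_def
    by (intro continuous_on_compose2[OF _ continuous_upd_vec]) auto
  have "G (upd (upd x j (t + 1)) i (upd x j (t + 1) $ i + h)) = G (upd (upd x j t) i (upd x j t $ i + h))" for x j t
  proof (cases "j = i")
    case True
    have "G (upd x i ((t + h) + 1)) = G (upd x i (t + h))" using assms unfolding periodic_def by blast
    then show ?thesis using True by (simp add: upd_nth add_ac)
  next
    case False
    have sw: "upd (upd x j r) i v = upd (upd x i v) j r" for r v
      using False by (auto simp: cart_eq_iff upd_nth)
    have "G (upd (upd x i v) j (t + 1)) = G (upd (upd x i v) j t)" for v
      using assms unfolding periodic_def by blast
    then show ?thesis using False by (simp add: upd_nth sw)
  qed
  with c show ?thesis unfolding periodic_def by blast
qed

text \<open>For an antiderivative, the increment over one period has derivative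
  \<open>\<phi> (x + 1) - \<phi> x = 0\<close> and is therefore constant. The antiderivative is
  taken on a bounded interval that contains both periods in question.\<close>

lemma integral_nu_trig_shift:
  fixes \<phi> :: "real \<Rightarrow> real"
  assumes c: "continuous_on UNIV \<phi>" and per: "\<And>t. \<phi> (t + 1) = \<phi> t"
  shows "(\<integral>t. \<phi> (t + h) \<partial>nu Trig) = (\<integral>t. \<phi> t \<partial>nu Trig)"
proof -
  define a where "a = - \<bar>h\<bar>" define b where "b = \<bar>h\<bar> + 1"
  have c': "continuous_on S \<phi>" for S using c continuous_on_subset by blast
  obtain \<Phi> where \<Phi>: "\<And>x. x \<in> {a..b} \<Longrightarrow> (\<Phi> has_vector_derivative \<phi> x) (at x within {a..b})"
    using antiderivative_continuous[OF c'[of "{a..b}"]] by blast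
  have \<Phi>': "(\<Phi> has_real_derivative \<phi> x) (at x within S)" if "x \<in> S" "S \<subseteq> {a..b}" for x S
  proof -
    have "(\<Phi> has_vector_derivative \<phi> x) (at x within S)"
      by (rule has_vector_derivative_within_subset[OF \<Phi>]) (use that in auto)
    then show ?thesis by (simp add: has_real_derivative_iff_has_vector_derivative)
  qed
  have sh: "((\<lambda>t. \<Phi> (t + r)) has_real_derivative \<phi> (x + r)) (at x within S)"
    if "x \<in> S" "(\<lambda>t. t + r) ` S \<subseteq> {a..b}" for x r S
  proof -
    have "((\<Phi> \<circ> (\<lambda>t. t + r)) has_real_derivative \<phi> (x + r) * 1) (at x within S)"
      by (rule DERIV_image_chain) (use that in \<open>auto intro!: \<Phi>' derivative_eq_intros\<close>)
    then show ?thesis by (simp add: o_def)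
  qed
  have I1: "interval1 Trig = {0..1}" "lo Trig = 0" "len Trig = 1"
    by (simp_all add: lo_def len_def)
  have e1: "(\<integral>t. \<phi> (t + h) \<partial>nu Trig) = \<Phi> (1 + h) - \<Phi> h"
  proof -
    have "(\<integral>t. \<phi> (t + h) \<partial>nu Trig) = (\<Phi> ((lo Trig + len Trig) + h) - \<Phi> (lo Trig + h)) / len Trig"
    proof (rule integral_nu_FTC)
      fix t assume "t \<in> interval1 Trig"
      then show "((\<lambda>t. \<Phi> (t + h)) has_real_derivative \<phi> (t + h)) (at t within interval1 Trig)"
        by (intro sh) (auto simp: I1 a_def b_def)
    next
      show "continuous_on (interval1 Trig) (\<lambda>t. \<phi> (t + h))"
        by (rule continuous_on_compose2[OF c]) (auto intro!: continuous_intros)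
    qed simp
    then show ?thesis by (simp add: I1)
  qed
  have e0: "(\<integral>t. \<phi> t \<partial>nu Trig) = \<Phi> 1 - \<Phi> 0"
  proof -
    have "(\<integral>t. \<phi> t \<partial>nu Trig) = (\<Phi> (lo Trig + len Trig) - \<Phi> (lo Trig)) / len Trig"
      by (rule integral_nu_FTC) (auto intro!: \<Phi>' c' simp: I1 a_def b_def)
    then show ?thesis by (simp add: I1)
  qed
  define D where "D x = \<Phi> (x + 1) - \<Phi> x" for x
  define u where "u = min 0 h" define v where "v = max 0 h"
  have uv: "u \<le> v" "a \<le> u" "v + 1 \<le> b" by (auto simp: u_def v_def a_def b_def)
  have "(D has_real_derivative 0) (at x within {u..v})" if x: "x \<in> {u..v}" for x
  proof -
    have "(D has_real_derivative \<phi> (x + 1) - \<phi> x) (at x within {u..v})"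
      unfolding D_def using uv x by (intro DERIV_diff sh \<Phi>') auto
    then show ?thesis by (simp add: per)
  qed
  then obtain C where "\<And>x. x \<in> {u..v} \<Longrightarrow> D x = C"
    using has_field_derivative_zero_constant[of "{u..v}" D] by auto
  then have "D h = D 0" by (simp add: u_def v_def)
  then show ?thesis unfolding e1 e0 D_def by (simp add: add.commute)
qed

lemma integral_shift:
  assumes H: "periodic H"
  shows "(\<integral>x. H (upd x i (x $ i + h)) \<partial>design_measure Trig) = (\<integral>x. H x \<partial>design_measure Trig)"
proof -
  have "(\<integral>x. H (upd x i (x $ i + h)) \<partial>design_measure Trig) =
     (\<integral>x. \<integral>t. H (upd (upd x i t) i (upd x i t $ i + h)) \<partial>nu Trig \<partial>design_measure Trig)"
    by (rule integral_upd[symmetric]) (rule bdm_integrable[OF periodic_bdm[OF periodic_shift[OF H]]])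
  also have "\<dots> = (\<integral>x. \<integral>t. H (upd x i (t + h)) \<partial>nu Trig \<partial>design_measure Trig)"
    by (simp add: upd_nth)
  also have "\<dots> = (\<integral>x. \<integral>t. H (upd x i t) \<partial>nu Trig \<partial>design_measure Trig)"
  proof (rule Bochner_Integration.integral_cong[OF refl])
    fix x
    show "(\<integral>t. H (upd x i (t + h)) \<partial>nu Trig) = (\<integral>t. H (upd x i t) \<partial>nu Trig)"
      by (rule integral_nu_trig_shift[OF periodic_slice[OF H]]) (use H in \<open>simp add: periodic_def\<close>)
  qed
  also have "\<dots> = (\<integral>x. H x \<partial>design_measure Trig)"
    by (rule integral_upd[OF bdm_integrable[OF periodic_bdm[OF H]]])
  finally show ?thesis .
qed

section \<open>Fourier coefficients of differences and derivatives\<close>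

definition pair_index :: "'d \<Rightarrow> ('d \<Rightarrow> nat) \<Rightarrow> 'd \<Rightarrow> nat" where
  "pair_index i \<alpha> = \<alpha>(i := partner (\<alpha> i))"

lemma pair_index_pair_index [simp]: "pair_index i (pair_index i \<alpha>) = \<alpha>"
  by (simp add: pair_index_def)

lemma pair_index_nth: "pair_index i \<alpha> i = partner (\<alpha> i)"
  by (simp add: pair_index_def)

lemma Psi_pair_upd:
  "Psi s (pair_index i \<alpha>) (upd x i t) = psi s (partner (\<alpha> i)) t * (\<Prod>j\<in>UNIV - {i}. psi s (\<alpha> j) (x $ j))"
  unfolding Psi_upd by (simp add: pair_index_def)

lemma psi_trig_difference:
  "psi Trig a (t - h) - psi Trig a (t + h)
     = - (2 * sin (2 * pi * real (freq a) * h)) * sgn_partner a * psi Trig (partner a) t"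
proof -
  consider "a = 0" | j where "a = 2 * j - 1" "j \<ge> 1" | j where "a = 2 * j" "j \<ge> 1" by (rule psi_trig_cases)
  then show ?thesis
  proof cases
    case 1
    then show ?thesis by (simp add: freq_def psi_trig_0)
  next
    case (2 j)
    then have p: "partner a = 2 * j" "freq a = j" "sgn_partner a = 1"
      by (auto simp: partner_def freq_def sgn_partner_def)
    show ?thesis
      unfolding p unfolding 2(1) psi_trig_sin[OF 2(2)] psi_trig_cos[OF 2(2)]
      by (simp add: right_diff_distrib distrib_left sin_diff sin_add)
  next
    case (3 j)
    then have p: "partner a = 2 * j - 1" "freq a = j" "sgn_partner a = -1"
      by (auto simp: partner_def freq_def sgn_partner_def)
    show ?thesis
      unfolding p unfolding 3(1) psi_trig_sin[OF 3(2)] psi_trig_cos[OF 3(2)]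
      by (simp add: right_diff_distrib distrib_left cos_diff cos_add)
  qed
qed

text \<open>Translation invariance moves the shifts from \<open>G\<close> to the basis function,
  where the addition theorems apply.\<close>

lemma coef_difference:
  assumes G: "periodic G"
  shows "coef Trig (\<lambda>x. G (upd x i (x $ i + h)) - G (upd x i (x $ i - h))) \<alpha>
     = - (2 * sin (2 * pi * real (freq (\<alpha> i)) * h)) * sgn_partner (\<alpha> i) * coef Trig G (pair_index i \<alpha>)"
proof -
  let ?M = "design_measure Trig" and ?\<Psi> = "Psi Trig"
  have sh: "(\<integral>x. G (upd x i (x $ i + r)) * ?\<Psi> \<alpha> x \<partial>?M) = (\<integral>x. G x * ?\<Psi> \<alpha> (upd x i (x $ i - r)) \<partial>?M)" for r
  proof -
    define H where "H x = G x * ?\<Psi> \<alpha> (upd x i (x $ i + - r))" for x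
    have H: "periodic H" unfolding H_def by (intro periodic_mult G periodic_shift periodic_Psi)
    have "(\<integral>x. H (upd x i (x $ i + r)) \<partial>?M) = (\<integral>x. H x \<partial>?M)" by (rule integral_shift[OF H])
    then show ?thesis by (simp add: H_def upd_nth)
  qed
  have i1: "integrable ?M (\<lambda>x. G (upd x i (x $ i + r)) * ?\<Psi> \<alpha> x)" for r
    by (intro bdm_integrable periodic_bdm periodic_mult periodic_shift G periodic_Psi)
  have i2: "integrable ?M (\<lambda>x. G x * ?\<Psi> \<alpha> (upd x i (x $ i + r)))" for r
    by (intro bdm_integrable periodic_bdm periodic_mult periodic_shift G periodic_Psi)
  have "coef Trig (\<lambda>x. G (upd x i (x $ i + h)) - G (upd x i (x $ i - h))) \<alpha> =
     (\<integral>x. G (upd x i (x $ i + h)) * ?\<Psi> \<alpha> x - G (upd x i (x $ i + - h)) * ?\<Psi> \<alpha> x \<partial>?M)"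
    by (simp add: coef_def left_diff_distrib)
  also have "\<dots> = (\<integral>x. G x * ?\<Psi> \<alpha> (upd x i (x $ i + - h)) \<partial>?M) - (\<integral>x. G x * ?\<Psi> \<alpha> (upd x i (x $ i + h)) \<partial>?M)"
    using sh[of h] sh[of "- h"] by (simp only: Bochner_Integration.integral_diff[OF i1 i1]) simp
  also have "\<dots> = (\<integral>x. G x * (?\<Psi> \<alpha> (upd x i (x $ i - h)) - ?\<Psi> \<alpha> (upd x i (x $ i + h))) \<partial>?M)"
    by (subst Bochner_Integration.integral_diff[OF i2 i2, symmetric]) (simp add: right_diff_distrib)
  also have "\<dots> = (\<integral>x. (- (2 * sin (2 * pi * real (freq (\<alpha> i)) * h)) * sgn_partner (\<alpha> i)) * (G x * ?\<Psi> (pair_index i \<alpha>) x) \<partial>?M)"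
  proof (rule Bochner_Integration.integral_cong[OF refl])
    fix x
    have "?\<Psi> \<alpha> (upd x i (x $ i - h)) - ?\<Psi> \<alpha> (upd x i (x $ i + h)) =
       (psi Trig (\<alpha> i) (x $ i - h) - psi Trig (\<alpha> i) (x $ i + h)) * (\<Prod>j\<in>UNIV - {i}. psi Trig (\<alpha> j) (x $ j))"
      unfolding Psi_upd by (simp add: left_diff_distrib)
    also have "\<dots> = (- (2 * sin (2 * pi * real (freq (\<alpha> i)) * h)) * sgn_partner (\<alpha> i)) * ?\<Psi> (pair_index i \<alpha>) x"
      using Psi_pair_upd[of Trigonometric i \<alpha> x "x $ i"] unfolding psi_trig_difference by simp
    finally show "G x * (?\<Psi> \<alpha> (upd x i (x $ i - h)) - ?\<Psi> \<alpha> (upd x i (x $ i + h))) =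
       (- (2 * sin (2 * pi * real (freq (\<alpha> i)) * h)) * sgn_partner (\<alpha> i)) * (G x * ?\<Psi> (pair_index i \<alpha>) x)"
      by simp
  qed
  also have "\<dots> = (- (2 * sin (2 * pi * real (freq (\<alpha> i)) * h)) * sgn_partner (\<alpha> i)) * coef Trig G (pair_index i \<alpha>)"
    unfolding coef_def by (rule integral_mult_right_zero)
  finally show ?thesis .
qed

text \<open>The auxiliary function \<open>H\<close> is the derivative, along coordinate i, of the
  product of \<open>G\<close> with the basis function, so periodicity makes its integral vanish on
  every slice.\<close>

lemma coef_derivative:
  assumes G: "periodic G" and G1: "periodic G1"
    and d: "\<And>x t. ((\<lambda>t. G (upd x i t)) has_real_derivative G1 (upd x i t)) (at t)"
  shows "coef Trig G1 \<alpha> = - (sgn_partner (\<alpha> i) * (2 * pi * real (freq (\<alpha> i)))) * coef Trig G (pair_index i \<alpha>)"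
proof -
  let ?M = "design_measure Trig" and ?\<Psi> = "Psi Trig"
  define w where "w = sgn_partner (\<alpha> i) * (2 * pi * real (freq (\<alpha> i)))"
  define H where "H x = G1 x * ?\<Psi> \<alpha> x + w * (G x * ?\<Psi> (pair_index i \<alpha>) x)" for x
  have i1: "bdm Trig (\<lambda>x. G1 x * ?\<Psi> \<alpha> x)" and i2: "bdm Trig (\<lambda>x. G x * ?\<Psi> (pair_index i \<alpha>) x)"
    by (intro periodic_bdm periodic_mult G G1 periodic_Psi)+
  have slice: "(\<integral>t. H (upd x i t) \<partial>nu Trig) = 0" for x
  proof -
    have "(\<integral>t. H (upd x i t) \<partial>nu Trig) =
      (G (upd x i (lo Trig + len Trig)) * ?\<Psi> \<alpha> (upd x i (lo Trig + len Trig))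
       - G (upd x i (lo Trig)) * ?\<Psi> \<alpha> (upd x i (lo Trig))) / len Trig"
    proof (rule integral_nu_FTC)
      fix t
      define R where "R = (\<Prod>j\<in>UNIV - {i}. psi Trig (\<alpha> j) (x $ j))"
      have "((\<lambda>t. ?\<Psi> \<alpha> (upd x i t)) has_real_derivative w * ?\<Psi> (pair_index i \<alpha>) (upd x i t)) (at t)"
        unfolding Psi_upd[of _ \<alpha>] Psi_pair_upd w_def mult.assoc[symmetric]
        by (intro DERIV_cmult_right) (use has_derivative_psi_trig[of "\<alpha> i" t] in \<open>simp add: mult.assoc\<close>)
      from DERIV_mult[OF d this]
      have "((\<lambda>t. G (upd x i t) * ?\<Psi> \<alpha> (upd x i t)) has_real_derivative H (upd x i t)) (at t)"
        by (simp add: H_def mult_ac)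
      then show "((\<lambda>t. G (upd x i t) * ?\<Psi> \<alpha> (upd x i t)) has_real_derivative H (upd x i t)) (at t within interval1 Trig)"
        by (rule has_field_derivative_at_within)
    next
      show "continuous_on (interval1 Trig) (\<lambda>t. H (upd x i t))"
        unfolding H_def by (intro continuous_intros periodic_slice G G1 periodic_Psi)
    qed simp
    moreover have "G (upd x i (0 + 1)) = G (upd x i 0)" "?\<Psi> \<alpha> (upd x i (0 + 1)) = ?\<Psi> \<alpha> (upd x i 0)"
      using G periodic_Psi[of \<alpha>] unfolding periodic_def by blast+
    ultimately show ?thesis by (simp add: lo_def len_def)
  qed
  have "(\<integral>x. H x \<partial>?M) = 0"
  proof -
    have "bdm Trig H"
      unfolding H_def by (intro bdm_add bdm_mult[OF bdm_const] i1 i2)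
    from integral_upd[OF bdm_integrable[OF this], of i] show ?thesis
      by (simp only: slice) simp
  qed
  moreover have "(\<integral>x. H x \<partial>?M) = coef Trig G1 \<alpha> + w * coef Trig G (pair_index i \<alpha>)"
    unfolding H_def coef_def using bdm_integrable[OF i1] bdm_integrable[OF i2] by simp
  ultimately show ?thesis by (simp add: w_def)
qed

text \<open>Smoothness in the form in which the tail estimate consumes it: along one coordinate,
  with periodic derivatives. Increments are restricted to \<open>\<bar>r - t\<bar> \<le> 1\<close>
  so that Lipschitz functions qualify for every exponent up to 1.\<close>

fun smooth_along :: "real \<Rightarrow> 'd \<Rightarrow> nat \<Rightarrow> (real ^ 'd::finite \<Rightarrow> real) \<Rightarrow> bool" where
  "smooth_along \<beta> i 0 G \<longleftrightarrow> periodic G \<and>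
     (\<exists>L. \<forall>x r t. \<bar>r - t\<bar> \<le> 1 \<longrightarrow> \<bar>G (upd x i r) - G (upd x i t)\<bar> \<le> L * \<bar>r - t\<bar> powr \<beta>)"
| "smooth_along \<beta> i (Suc m) G \<longleftrightarrow> periodic G \<and>
     (\<exists>G1. (\<forall>x t. ((\<lambda>t. G (upd x i t)) has_real_derivative G1 (upd x i t)) (at t)) \<and> smooth_along \<beta> i m G1)"

lemma smooth_along_periodic: "smooth_along \<beta> i m G \<Longrightarrow> periodic G"
  by (cases m) auto

lemma sum_pair_index:
  assumes "pair_index i ` B = B"
  shows "(\<Sum>\<alpha>\<in>B. g (pair_index i \<alpha>)) = (\<Sum>\<alpha>\<in>B. g \<alpha> :: real)"
proof -
  have "inj_on (pair_index i) B"
    by (rule inj_on_inverseI[where g="pair_index i"]) simp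
  then show ?thesis
    using sum.reindex[of "pair_index i" B g] assms by simp
qed

lemma sgn_partner_square [simp]: "(sgn_partner a)\<^sup>2 = 1"
  by (simp add: sgn_partner_def)

text \<open>The coefficients of a difference (for \<open>m = 0\<close>) or of the derivative
  dominate those of \<open>G\<close> on a dyadic block. As sines and cosines get exchanged, the
  block has to be closed under \<open>pair_index i\<close>, so that the sums can be reindexed. Each
  derivative gains a factor \<open>1 / K\<close> in the coefficients.\<close>

lemma block_bound:
  fixes G :: "real ^ 'd::finite \<Rightarrow> real"
  assumes \<beta>: "\<beta> > 0"
  shows "smooth_along \<beta> i m G \<Longrightarrow> \<exists>L\<ge>0. \<forall>K B. K \<ge> 1 \<longrightarrow> finite B \<longrightarrow> pair_index i ` B = B \<longrightarrow>
     (\<forall>\<alpha>\<in>B. K < freq (\<alpha> i) \<and> freq (\<alpha> i) \<le> 2 * K) \<longrightarrow>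
     (\<Sum>\<alpha>\<in>B. (coef Trig G \<alpha>)\<^sup>2) \<le> L * real K powr (- 2 * (real m + \<beta>))"
proof (induction m arbitrary: G)
  case 0
  then have G: "periodic G" by simp
  from 0 obtain L where L: "\<And>x r t. \<bar>r - t\<bar> \<le> 1 \<Longrightarrow> \<bar>G (upd x i r) - G (upd x i t)\<bar> \<le> L * \<bar>r - t\<bar> powr \<beta>"
    by auto
  show ?case
  proof (intro exI[of _ "L\<^sup>2"] conjI allI impI)
    fix K :: nat and B :: "('d \<Rightarrow> nat) set"
    assume K: "K \<ge> 1" and B: "finite B" "pair_index i ` B = B" "\<forall>\<alpha>\<in>B. K < freq (\<alpha> i) \<and> freq (\<alpha> i) \<le> 2 * K"
    \<comment> \<open>On the block the argument \<open>2 * pi * freq (\<alpha> i) * h\<close> lies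
      between \<open>pi / 4\<close> and \<open>pi / 2\<close>, so its squared sine is at least
      1/2.\<close>
    define h where "h = 1 / (8 * real K)"
    have h: "0 < h" "h \<le> 1 / 8" using K by (auto simp: h_def field_simps)
    define \<Delta> where "\<Delta> x = G (upd x i (x $ i + h)) - G (upd x i (x $ i - h))" for x
    have \<Delta>: "bdm Trig \<Delta>"
    proof -
      have "periodic (\<lambda>x. G (upd x i (x $ i + h)) - G (upd x i (x $ i + - h)))"
        by (intro periodic_diff periodic_shift G)
      then show ?thesis unfolding \<Delta>_def by (intro periodic_bdm) simp
    qed
    have low: "2 * (coef Trig G (pair_index i \<alpha>))\<^sup>2 \<le> (coef Trig \<Delta> \<alpha>)\<^sup>2" if "\<alpha> \<in> B" for \<alpha>
    proof -
      define y where "y = 2 * pi * real (freq (\<alpha> i)) * h"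
      have y: "pi / 4 \<le> y" "y \<le> pi / 2"
        using B(3) that K by (auto simp: y_def h_def field_simps)
      have "sin (pi / 4) \<le> sin y"
        using y by (intro sin_monotone_2pi_le) auto
      then have "(sin (pi / 4))\<^sup>2 \<le> (sin y)\<^sup>2"
        by (intro power_mono) (auto simp: sin_45)
      then have "1 / 2 \<le> (sin y)\<^sup>2" by (simp add: sin_45 power_divide)
      then have "2 * (coef Trig G (pair_index i \<alpha>))\<^sup>2 \<le> 4 * (sin y)\<^sup>2 * (coef Trig G (pair_index i \<alpha>))\<^sup>2"
        by (intro mult_right_mono) auto
      also have "\<dots> = (coef Trig \<Delta> \<alpha>)\<^sup>2"
        unfolding \<Delta>_def coef_difference[OF G] y_def by (simp add: power_mult_distrib)
      finally show ?thesis .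
    qed
    have "(\<Sum>\<alpha>\<in>B. (coef Trig G \<alpha>)\<^sup>2) = (\<Sum>\<alpha>\<in>B. (coef Trig G (pair_index i \<alpha>))\<^sup>2)"
      by (rule sum_pair_index[OF B(2), symmetric])
    also have "\<dots> \<le> (\<Sum>\<alpha>\<in>B. (coef Trig \<Delta> \<alpha>)\<^sup>2)"
    proof (rule sum_mono)
      fix \<alpha> assume "\<alpha> \<in> B"
      from low[OF this] zero_le_power2[of "coef Trig G (pair_index i \<alpha>)"]
      show "(coef Trig G (pair_index i \<alpha>))\<^sup>2 \<le> (coef Trig \<Delta> \<alpha>)\<^sup>2" by linarith
    qed
    also have "\<dots> \<le> (\<integral>x. (\<Delta> x)\<^sup>2 \<partial>design_measure Trig)" by (rule bessel[OF \<Delta> B(1)])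
    also have "\<dots> \<le> (\<integral>x. L\<^sup>2 * real K powr (- 2 * \<beta>) \<partial>(design_measure Trig :: (real ^ 'd) measure))"
    proof (rule integral_mono[OF bdm_integrable[OF bdm_power2[OF \<Delta>]]])
      fix x :: "real ^ 'd"
      have "\<bar>\<Delta> x\<bar> \<le> L * \<bar>(x $ i + h) - (x $ i - h)\<bar> powr \<beta>"
        unfolding \<Delta>_def using h by (intro L) auto
      then have "\<bar>\<Delta> x\<bar>\<^sup>2 \<le> (L * (2 * h) powr \<beta>)\<^sup>2"
        using h by (intro power_mono) auto
      also have "\<dots> \<le> L\<^sup>2 * (real K powr (- \<beta>))\<^sup>2"
      proof -
        have "(2 * h) powr \<beta> \<le> (1 / real K) powr \<beta>"
          using h K \<beta> by (intro powr_mono2) (auto simp: h_def field_simps)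
        also have "\<dots> = real K powr (- \<beta>)" using K by (simp add: powr_divide powr_minus_divide)
        finally have "((2 * h) powr \<beta>)\<^sup>2 \<le> (real K powr (- \<beta>))\<^sup>2" by (intro power_mono) auto
        then show ?thesis by (simp add: power_mult_distrib mult_left_mono)
      qed
      also have "(real K powr (- \<beta>))\<^sup>2 = real K powr (- 2 * \<beta>)"
        by (simp add: power2_eq_square powr_add[symmetric])
      finally show "(\<Delta> x)\<^sup>2 \<le> L\<^sup>2 * real K powr (- 2 * \<beta>)" by simp
    qed simp
    also have "\<dots> = L\<^sup>2 * real K powr (- 2 * (real 0 + \<beta>))" by simp
    finally show "(\<Sum>\<alpha>\<in>B. (coef Trig G \<alpha>)\<^sup>2) \<le> L\<^sup>2 * real K powr (- 2 * (real 0 + \<beta>))" .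
  qed simp
next
  case (Suc m)
  then have G: "periodic G" by simp
  from Suc.prems obtain G1 where d: "\<And>x t. ((\<lambda>t. G (upd x i t)) has_real_derivative G1 (upd x i t)) (at t)"
    and G1: "smooth_along \<beta> i m G1" by auto
  from Suc.IH[OF G1] obtain L where L: "L \<ge> 0" "\<And>K B. K \<ge> 1 \<Longrightarrow> finite B \<Longrightarrow> pair_index i ` B = B \<Longrightarrow>
     (\<forall>\<alpha>\<in>B. K < freq (\<alpha> i) \<and> freq (\<alpha> i) \<le> 2 * K) \<Longrightarrow>
     (\<Sum>\<alpha>\<in>B. (coef Trig G1 \<alpha>)\<^sup>2) \<le> L * real K powr (- 2 * (real m + \<beta>))" by blast
  show ?case
  proof (intro exI[of _ L] conjI allI impI L(1))
    fix K :: nat and B :: "('d \<Rightarrow> nat) set"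
    assume K: "K \<ge> 1" and B: "finite B" "pair_index i ` B = B" "\<forall>\<alpha>\<in>B. K < freq (\<alpha> i) \<and> freq (\<alpha> i) \<le> 2 * K"
    have low: "(real K)\<^sup>2 * (coef Trig G (pair_index i \<alpha>))\<^sup>2 \<le> (coef Trig G1 \<alpha>)\<^sup>2" if "\<alpha> \<in> B" for \<alpha>
    proof -
      have "1 * real K \<le> (2 * pi) * real (freq (\<alpha> i))"
        using B(3) that pi_gt3 by (intro mult_mono) auto
      then have "(real K)\<^sup>2 \<le> (2 * pi * real (freq (\<alpha> i)))\<^sup>2" by (intro power_mono) auto
      then have "(real K)\<^sup>2 * (coef Trig G (pair_index i \<alpha>))\<^sup>2 \<le>
          (2 * pi * real (freq (\<alpha> i)))\<^sup>2 * (coef Trig G (pair_index i \<alpha>))\<^sup>2"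
        by (intro mult_right_mono) auto
      also have "\<dots> = (coef Trig G1 \<alpha>)\<^sup>2"
        unfolding coef_derivative[OF G smooth_along_periodic[OF G1] d] power2_minus power_mult_distrib by simp
      finally show ?thesis .
    qed
    have "(real K)\<^sup>2 * (\<Sum>\<alpha>\<in>B. (coef Trig G \<alpha>)\<^sup>2) = (\<Sum>\<alpha>\<in>B. (real K)\<^sup>2 * (coef Trig G (pair_index i \<alpha>))\<^sup>2)"
      using sum_pair_index[OF B(2), of "\<lambda>\<alpha>. (real K)\<^sup>2 * (coef Trig G \<alpha>)\<^sup>2"] by (simp add: sum_distrib_left)
    also have "\<dots> \<le> (\<Sum>\<alpha>\<in>B. (coef Trig G1 \<alpha>)\<^sup>2)" by (intro sum_mono low)
    also have "\<dots> \<le> L * real K powr (- 2 * (real m + \<beta>))" by (rule L(2)[OF K B])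
    finally have "(\<Sum>\<alpha>\<in>B. (coef Trig G \<alpha>)\<^sup>2) \<le> L * real K powr (- 2 * (real m + \<beta>)) / (real K)\<^sup>2"
      using K by (simp add: pos_le_divide_eq mult.commute)
    also have "\<dots> = L * real K powr (- 2 * (real (Suc m) + \<beta>))"
    proof -
      have "(real K)\<^sup>2 = real K powr 2" using K by (simp add: powr_numeral)
      then have "real K powr (- 2 * (real m + \<beta>)) / (real K)\<^sup>2 = real K powr (- 2 * (real m + \<beta>) - 2)"
        by (simp only: powr_diff)
      also have "- 2 * (real m + \<beta>) - 2 = - 2 * (real (Suc m) + \<beta>)" by simp
      finally show ?thesis by (simp only: times_divide_eq_right[symmetric])
    qed
    finally show "(\<Sum>\<alpha>\<in>B. (coef Trig G \<alpha>)\<^sup>2) \<le> L * real K powr (- 2 * (real (Suc m) + \<beta>))" .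
  qed
qed

text \<open>Splitting off one dyadic block reduces the tail beyond K to the tail beyond
  \<open>2 * K\<close>. With \<open>\<theta>\<close> the ratio of consecutive block bounds, the
  constant \<open>C = L + \<theta> * C\<close> reproduces itself; it is the sum of the geometric
  series.\<close>

lemma tail_bound:
  fixes G :: "real ^ 'd::finite \<Rightarrow> real"
  assumes \<beta>: "\<beta> > 0" and G: "smooth_along \<beta> i m G"
  shows "\<exists>C\<ge>0. \<forall>K B. K \<ge> 1 \<longrightarrow> finite B \<longrightarrow> pair_index i ` B = B \<longrightarrow>
     (\<forall>\<alpha>\<in>B. K < freq (\<alpha> i)) \<longrightarrow>
     (\<Sum>\<alpha>\<in>B. (coef Trig G \<alpha>)\<^sup>2) \<le> C * real K powr (- 2 * (real m + \<beta>))"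
proof -
  define p where "p = real m + \<beta>"
  have p: "p > 0" using \<beta> by (simp add: p_def)
  from block_bound[OF \<beta> G] obtain L where L: "L \<ge> 0" "\<And>K B. K \<ge> 1 \<Longrightarrow> finite B \<Longrightarrow> pair_index i ` B = B \<Longrightarrow>
     (\<forall>\<alpha>\<in>B. K < freq (\<alpha> i) \<and> freq (\<alpha> i) \<le> 2 * K) \<Longrightarrow>
     (\<Sum>\<alpha>\<in>B. (coef Trig G \<alpha>)\<^sup>2) \<le> L * real K powr (- 2 * p)" unfolding p_def by blast
  define \<theta> where "\<theta> = (2::real) powr (- 2 * p)"
  have \<theta>: "0 < \<theta>" "\<theta> < 1"
    using p powr_less_mono[of "- 2 * p" 0 "2::real"] by (auto simp: \<theta>_def)
  define C where "C = L / (1 - \<theta>)"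
  have C: "C \<ge> 0" "C = L + \<theta> * C" using L(1) \<theta> by (auto simp: C_def field_simps)
  have key: "(\<Sum>\<alpha>\<in>B. (coef Trig G \<alpha>)\<^sup>2) \<le> C * real K powr (- 2 * p)"
    if "K \<ge> 1" "finite B" "pair_index i ` B = B" "\<forall>\<alpha>\<in>B. K < freq (\<alpha> i)" "\<forall>\<alpha>\<in>B. freq (\<alpha> i) \<le> 2 ^ J * K" for K B J
    using that
  proof (induction J arbitrary: K B)
    case 0
    then have "B = {}" by force
    then show ?case using C by simp
  next
    case (Suc J)
    define B1 where "B1 = {\<alpha>\<in>B. freq (\<alpha> i) \<le> 2 * K}"
    define B2 where "B2 = {\<alpha>\<in>B. 2 * K < freq (\<alpha> i)}"
    have fB: "finite B1" "finite B2" using Suc.prems(2) by (auto simp: B1_def B2_def)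
    have inv: "pair_index i \<alpha> \<in> B" if "\<alpha> \<in> B" for \<alpha> using Suc.prems(3) that by blast
    have pb: "pair_index i ` B' = B'" if "\<And>\<alpha>. \<alpha> \<in> B' \<Longrightarrow> pair_index i \<alpha> \<in> B'" for B' :: "('d \<Rightarrow> nat) set"
    proof
      show "pair_index i ` B' \<subseteq> B'" using that by blast
      show "B' \<subseteq> pair_index i ` B'"
      proof
        fix \<alpha> assume "\<alpha> \<in> B'"
        then have "pair_index i (pair_index i \<alpha>) \<in> pair_index i ` B'" using that by blast
        then show "\<alpha> \<in> pair_index i ` B'" by simp
      qed
    qed
    have p1: "pair_index i ` B1 = B1" by (rule pb) (auto simp: B1_def inv pair_index_nth)
    have p2: "pair_index i ` B2 = B2" by (rule pb) (auto simp: B2_def inv pair_index_nth)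
    have "(\<Sum>\<alpha>\<in>B. (coef Trig G \<alpha>)\<^sup>2) = (\<Sum>\<alpha>\<in>B1 \<union> B2. (coef Trig G \<alpha>)\<^sup>2)"
      by (intro sum.cong) (auto simp: B1_def B2_def)
    also have "\<dots> = (\<Sum>\<alpha>\<in>B1. (coef Trig G \<alpha>)\<^sup>2) + (\<Sum>\<alpha>\<in>B2. (coef Trig G \<alpha>)\<^sup>2)"
      by (rule sum.union_disjoint[OF fB]) (auto simp: B1_def B2_def)
    also have "\<dots> \<le> L * real K powr (- 2 * p) + C * real (2 * K) powr (- 2 * p)"
    proof (rule add_mono)
      show "(\<Sum>\<alpha>\<in>B1. (coef Trig G \<alpha>)\<^sup>2) \<le> L * real K powr (- 2 * p)"
        by (rule L(2)[OF Suc.prems(1) fB(1) p1]) (use Suc.prems(4) in \<open>auto simp: B1_def\<close>)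
      show "(\<Sum>\<alpha>\<in>B2. (coef Trig G \<alpha>)\<^sup>2) \<le> C * real (2 * K) powr (- 2 * p)"
        by (rule Suc.IH[OF _ fB(2) p2]) (use Suc.prems(1,5) in \<open>auto simp: B2_def mult_ac\<close>)
    qed
    also have "real (2 * K) powr (- 2 * p) = \<theta> * real K powr (- 2 * p)"
      unfolding \<theta>_def of_nat_mult by (simp add: powr_mult)
    also have "L * real K powr (- 2 * p) + C * (\<theta> * real K powr (- 2 * p)) = (L + \<theta> * C) * real K powr (- 2 * p)"
      by (simp add: distrib_right mult_ac)
    finally show ?case using C(2) by simp
  qed
  show ?thesis
  proof (intro exI[of _ C] conjI allI impI C(1))
    fix K :: nat and B :: "('d \<Rightarrow> nat) set"
    assume a: "K \<ge> 1" "finite B" "pair_index i ` B = B" "\<forall>\<alpha>\<in>B. K < freq (\<alpha> i)"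
    \<comment> \<open>In a finite set the frequencies are bounded, so finitely many doublings
      exhaust it; the constant is the same for any number of them.\<close>
    define N where "N = Max (insert 0 ((\<lambda>\<alpha>. freq (\<alpha> i)) ` B))"
    have "freq (\<alpha> i) \<le> 2 ^ N * K" if "\<alpha> \<in> B" for \<alpha>
    proof -
      have "freq (\<alpha> i) \<le> N" unfolding N_def using a(2) that by (intro Max_ge) auto
      also have "N \<le> 2 ^ N" using less_exp[of N] by simp
      also have "\<dots> \<le> 2 ^ N * K" using a(1) by simp
      finally show ?thesis .
    qed
    then show "(\<Sum>\<alpha>\<in>B. (coef Trig G \<alpha>)\<^sup>2) \<le> C * real K powr (- 2 * (real m + \<beta>))"
      using key[OF a] unfolding p_def by blast
  qed
qed

lemma sum_UN_le:
  fixes g :: "'a \<Rightarrow> real"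
  assumes "finite I" "\<And>i. finite (B i)" "\<And>a. 0 \<le> g a"
  shows "sum g (\<Union>i\<in>I. B i) \<le> (\<Sum>i\<in>I. sum g (B i))"
  using assms(1)
proof (induction I rule: finite_induct)
  case (insert i I)
  have "sum g (B i \<union> (\<Union>i\<in>I. B i)) \<le> sum g (B i) + sum g (\<Union>i\<in>I. B i)"
    using assms(2,3) insert.hyps(1) by (subst sum_Un) (auto intro!: sum_nonneg)
  then show ?case using insert by simp
qed simp

lemma trunc_tail_bound:
  fixes G :: "real ^ 'd::finite \<Rightarrow> real"
  assumes \<beta>: "\<beta> > 0" and G: "\<And>i. smooth_along \<beta> i m G"
  shows "\<exists>C\<ge>0. \<forall>K N. K \<ge> 1 \<longrightarrow> even N \<longrightarrow>
     (\<Sum>\<alpha>\<in>trunc_set N - trunc_set (2 * K). (coef Trig G \<alpha>)\<^sup>2) \<le> C * real K powr (- 2 * (real m + \<beta>))"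
proof -
  define Q where "Q i c \<longleftrightarrow> c \<ge> 0 \<and> (\<forall>K B. K \<ge> 1 \<longrightarrow> finite B \<longrightarrow> pair_index i ` B = B \<longrightarrow>
     (\<forall>\<alpha>\<in>B. K < freq (\<alpha> i)) \<longrightarrow>
     (\<Sum>\<alpha>\<in>B. (coef Trig G \<alpha>)\<^sup>2) \<le> c * real K powr (- 2 * (real m + \<beta>)))" for i c
  have "\<forall>i. \<exists>c. Q i c"
    unfolding Q_def using tail_bound[OF \<beta> G] by (rule allI)
  from choice[OF this] obtain C where "\<forall>i. Q i (C i)" ..
  then have Q: "Q i (C i)" for i by (rule spec)
  have C: "C i \<ge> 0" "K \<ge> 1 \<Longrightarrow> finite B \<Longrightarrow> pair_index i ` B = B \<Longrightarrow>
     (\<forall>\<alpha>\<in>B. K < freq (\<alpha> i)) \<Longrightarrow>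
     (\<Sum>\<alpha>\<in>B. (coef Trig G \<alpha>)\<^sup>2) \<le> C i * real K powr (- 2 * (real m + \<beta>))" for i K B
    using Q[of i] unfolding Q_def by simp_all
  show ?thesis
  proof (intro exI[of _ "\<Sum>i\<in>UNIV. C i"] conjI allI impI)
    show "0 \<le> (\<Sum>i\<in>UNIV. C i)" using C(1) by (simp add: sum_nonneg)
    fix K N :: nat assume K: "K \<ge> 1" and N: "even N"
    \<comment> \<open>Since N is even, \<open>partner\<close> preserves the range of indices, so
      \<open>B i\<close> is closed under \<open>pair_index i\<close>. These sets overlap, which only
      enlarges the sum.\<close>
    define B where "B i = {\<alpha> \<in> trunc_set N. K < freq (\<alpha> i)}" for i :: 'd
    have fB: "finite (B i)" for i by (simp add: B_def)
    have in_B: "pair_index i \<alpha> \<in> B i" if "\<alpha> \<in> B i" for i \<alpha>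
      using that partner_le[OF N] by (auto simp: B_def trunc_set_def pair_index_nth) (auto simp: pair_index_def)
    have pB: "pair_index i ` B i = B i" for i
    proof
      show "pair_index i ` B i \<subseteq> B i" using in_B by blast
      show "B i \<subseteq> pair_index i ` B i"
      proof
        fix \<alpha> assume "\<alpha> \<in> B i"
        then have "pair_index i (pair_index i \<alpha>) \<in> pair_index i ` B i" using in_B by blast
        then show "\<alpha> \<in> pair_index i ` B i" by simp
      qed
    qed
    have sub: "trunc_set N - trunc_set (2 * K) \<subseteq> (\<Union>i\<in>UNIV. B i)"
    proof
      fix \<alpha> :: "'d \<Rightarrow> nat" assume a: "\<alpha> \<in> trunc_set N - trunc_set (2 * K)"
      then obtain i where "2 * K < \<alpha> i" by (auto simp: trunc_set_def not_le)
      then have "K < freq (\<alpha> i)" by (simp add: freq_def)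
      then show "\<alpha> \<in> (\<Union>i\<in>UNIV. B i)" using a by (auto simp: B_def)
    qed
    have "(\<Sum>\<alpha>\<in>trunc_set N - trunc_set (2 * K). (coef Trig G \<alpha>)\<^sup>2) \<le> (\<Sum>\<alpha>\<in>(\<Union>i\<in>UNIV. B i). (coef Trig G \<alpha>)\<^sup>2)"
      using fB by (intro sum_mono2 sub) auto
    also have "\<dots> \<le> (\<Sum>i\<in>UNIV. \<Sum>\<alpha>\<in>B i. (coef Trig G \<alpha>)\<^sup>2)"
      by (rule sum_UN_le) (auto simp: fB)
    also have "\<dots> \<le> (\<Sum>i\<in>UNIV. C i * real K powr (- 2 * (real m + \<beta>)))"
      by (intro sum_mono C(2)[OF K fB pB]) (auto simp: B_def)
    finally show "(\<Sum>\<alpha>\<in>trunc_set N - trunc_set (2 * K). (coef Trig G \<alpha>)\<^sup>2)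
       \<le> (\<Sum>i\<in>UNIV. C i) * real K powr (- 2 * (real m + \<beta>))"
      by (simp add: sum_distrib_right)
  qed
qed

subsection \<open>Density of the trigonometric polynomials\<close>

definition span1 :: "nat \<Rightarrow> (real \<Rightarrow> real) \<Rightarrow> bool" where
  "span1 K \<phi> \<longleftrightarrow> (\<exists>e. \<forall>t. \<phi> t = (\<Sum>b\<le>K. e b * psi Trig b t))"

lemma span1_psi: "b \<le> K \<Longrightarrow> span1 K (psi Trig b)"
  unfolding span1_def
proof (intro exI allI)
  fix t assume "b \<le> K"
  have "(\<Sum>b'\<le>K. (if b' = b then 1 else 0) * psi Trig b' t) = (\<Sum>b'\<le>K. if b' = b then psi Trig b' t else 0)"
    by (intro sum.cong) auto
  then show "psi Trig b t = (\<Sum>b'\<le>K. (if b' = b then 1 else 0) * psi Trig b' t)"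
    using \<open>b \<le> K\<close> by simp
qed

lemma span1_lincomb:
  assumes "span1 K \<phi>" "span1 K \<psi>"
  shows "span1 K (\<lambda>t. a * \<phi> t + b * \<psi> t)"
proof -
  obtain e f where "\<And>t. \<phi> t = (\<Sum>b\<le>K. e b * psi Trig b t)" "\<And>t. \<psi> t = (\<Sum>b\<le>K. f b * psi Trig b t)"
    using assms unfolding span1_def by blast
  then have "a * \<phi> t + b * \<psi> t = (\<Sum>j\<le>K. (a * e j + b * f j) * psi Trig j t)" for t
    by (simp add: sum_distrib_left sum.distrib distrib_right mult.assoc)
  then show ?thesis unfolding span1_def by (intro exI[of _ "\<lambda>j. a * e j + b * f j"] allI)
qed

lemma span1_cos: "2 * j \<le> K \<Longrightarrow> span1 K (\<lambda>t. cos (2 * pi * real j * t))"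
proof (cases "j = 0")
  case True
  then show ?thesis using span1_psi[of 0 K] by (simp add: psi_trig_0)
next
  case False
  assume "2 * j \<le> K"
  from span1_lincomb[OF span1_psi[OF this] span1_psi[OF this], of "1 / sqrt 2" 0]
  show ?thesis using False by (simp add: psi_trig_cos)
qed

lemma span1_sin: "2 * j \<le> K \<Longrightarrow> span1 K (\<lambda>t. sin (2 * pi * real j * t))"
proof (cases "j = 0")
  case True
  have "span1 K (psi Trig 0)" by (rule span1_psi) simp
  from span1_lincomb[OF this this, of 0 0] show ?thesis using True by simp
next
  case False
  assume "2 * j \<le> K"
  then have "2 * j - 1 \<le> K" by simp
  note 1 = span1_psi[OF this]
  have "psi Trig (2 * j - 1) t = sqrt 2 * sin (2 * pi * real j * t)" for t
    using False by (intro psi_trig_sin) simp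
  then show ?thesis using span1_lincomb[OF 1 1, of "1 / sqrt 2" 0] by simp
qed

text \<open>Multiplication by a first harmonic shifts the frequency by one. In terms of indices the
  worst case is the sine \<open>a = 2 * j - 1\<close>, which leads up to
  \<open>2 * (j + 1) = a + 3\<close>.\<close>

lemma span1_mult_psi:
  assumes \<theta>: "\<theta> = cos \<or> \<theta> = sin" and a: "a + 3 \<le> K"
  shows "span1 K (\<lambda>t. \<theta> (2 * pi * t) * psi Trig a t)"
proof -
  have plus: "v * (w * u) = (w / 2) * p + (w / 2) * q" if "u * v = (p + q) / 2" for u v w p q :: real
  proof -
    have "v * (w * u) = w * (u * v)" by simp
    then show ?thesis unfolding that by (simp add: distrib_left add_divide_distrib)
  qed
  have minus: "v * (w * u) = (w / 2) * p + (- (w / 2)) * q" if "u * v = (p - q) / 2" for u v w p q :: real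
  proof -
    have "v * (w * u) = w * (u * v)" by simp
    then show ?thesis unfolding that by (simp add: right_diff_distrib diff_divide_distrib)
  qed
  consider "a = 0" | j where "a = 2 * j - 1" "j \<ge> 1" | j where "a = 2 * j" "j \<ge> 1" by (rule psi_trig_cases)
  then show ?thesis
  proof cases
    case 1
    have "2 * 1 \<le> K" using a by simp
    from span1_cos[OF this] span1_sin[OF this] show ?thesis
      using \<theta> 1 by (auto simp: psi_trig_0)
  next
    case (2 j)
    define l where "l = j - 1"
    have j: "j = Suc l" using 2(2) by (simp add: l_def)
    have K: "2 * (l + 2) \<le> K" "2 * l \<le> K" using 2 a j by auto
    have A: "2 * pi * real j * t + 2 * pi * t = 2 * pi * real (l + 2) * t"
            "2 * pi * real j * t - 2 * pi * t = 2 * pi * real l * t"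
            "2 * pi * t - 2 * pi * real j * t = - (2 * pi * real l * t)"
            "2 * pi * t + 2 * pi * real j * t = 2 * pi * real (l + 2) * t" for t
      by (simp_all add: j algebra_simps)
    have "cos (2 * pi * t) * psi Trig a t =
        (sqrt 2 / 2) * sin (2 * pi * real (l + 2) * t) + (sqrt 2 / 2) * sin (2 * pi * real l * t)" for t
      unfolding 2(1) psi_trig_sin[OF 2(2)]
      by (rule plus) (use sin_times_cos[of "2 * pi * real j * t" "2 * pi * t"] in \<open>simp only: A\<close>)
    moreover have "sin (2 * pi * t) * psi Trig a t =
        (sqrt 2 / 2) * cos (2 * pi * real l * t) + (- (sqrt 2 / 2)) * cos (2 * pi * real (l + 2) * t)" for t
      unfolding 2(1) psi_trig_sin[OF 2(2)]
      by (rule minus) (use sin_times_sin[of "2 * pi * real j * t" "2 * pi * t"] in \<open>simp only: A\<close>)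
    ultimately show ?thesis
      using \<theta> span1_lincomb[OF span1_sin[OF K(1)] span1_sin[OF K(2)], of "sqrt 2 / 2" "sqrt 2 / 2"]
         span1_lincomb[OF span1_cos[OF K(2)] span1_cos[OF K(1)], of "sqrt 2 / 2" "- (sqrt 2 / 2)"] by auto
  next
    case (3 j)
    define l where "l = j - 1"
    have j: "j = Suc l" using 3(2) by (simp add: l_def)
    have K: "2 * (l + 2) \<le> K" "2 * l \<le> K" using 3 a j by auto
    have A: "2 * pi * real j * t + 2 * pi * t = 2 * pi * real (l + 2) * t"
            "2 * pi * real j * t - 2 * pi * t = 2 * pi * real l * t"
            "2 * pi * t - 2 * pi * real j * t = - (2 * pi * real l * t)"
            "2 * pi * t + 2 * pi * real j * t = 2 * pi * real (l + 2) * t" for t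
      by (simp_all add: j algebra_simps)
    have "cos (2 * pi * t) * psi Trig a t =
        (sqrt 2 / 2) * cos (2 * pi * real l * t) + (sqrt 2 / 2) * cos (2 * pi * real (l + 2) * t)" for t
      unfolding 3(1) psi_trig_cos[OF 3(2)]
      by (rule plus) (use cos_times_cos[of "2 * pi * real j * t" "2 * pi * t"] in \<open>simp only: A\<close>)
    moreover have "sin (2 * pi * t) * psi Trig a t =
        (sqrt 2 / 2) * sin (2 * pi * real (l + 2) * t) + (- (sqrt 2 / 2)) * sin (2 * pi * real l * t)" for t
      unfolding 3(1) psi_trig_cos[OF 3(2)]
      by (rule minus) (use cos_times_sin[of "2 * pi * real j * t" "2 * pi * t"] in \<open>simp only: A\<close>)
    ultimately show ?thesis
      using \<theta> span1_lincomb[OF span1_sin[OF K(1)] span1_sin[OF K(2)], of "sqrt 2 / 2" "- (sqrt 2 / 2)"]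
         span1_lincomb[OF span1_cos[OF K(2)] span1_cos[OF K(1)], of "sqrt 2 / 2" "sqrt 2 / 2"] by auto
  qed
qed

text \<open>Even degrees, because the tail estimate works with truncation sets closed under the
  exchange of sine and cosine.\<close>

definition trig_poly :: "(real ^ 'd::finite \<Rightarrow> real) \<Rightarrow> bool" where
  "trig_poly g \<longleftrightarrow> (\<exists>k c. even k \<and> (\<forall>x. g x = lin Trig (trunc_set k) c x))"

lemma trunc_set_mono: "k \<le> l \<Longrightarrow> trunc_set k \<subseteq> trunc_set l"
  by (auto simp: trunc_set_def intro: order_trans)

lemma lin_extend:
  assumes "A \<subseteq> B" "finite B"
  shows "lin s A c x = lin s B (\<lambda>\<alpha>. if \<alpha> \<in> A then c \<alpha> else 0) x"
  unfolding lin_def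
  by (rule sum.mono_neutral_cong_left) (use assms in auto)

lemma trig_poly_add:
  assumes "trig_poly f" "trig_poly g"
  shows "trig_poly (\<lambda>x. f x + g x)"
proof -
  obtain k c where f: "even k" "\<And>x. f x = lin Trig (trunc_set k) c x"
    using assms(1) unfolding trig_poly_def by blast
  obtain l d where g: "even l" "\<And>x. g x = lin Trig (trunc_set l) d x"
    using assms(2) unfolding trig_poly_def by blast
  let ?c = "\<lambda>\<alpha>. if \<alpha> \<in> trunc_set k then c \<alpha> else 0" and ?d = "\<lambda>\<alpha>. if \<alpha> \<in> trunc_set l then d \<alpha> else 0"
  have "f x + g x = lin Trig (trunc_set (k + l)) (\<lambda>\<alpha>. ?c \<alpha> + ?d \<alpha>) x" for x
  proof -
    have "f x = lin Trig (trunc_set (k + l)) ?c x"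
      unfolding f(2) by (rule lin_extend[OF trunc_set_mono]) simp_all
    moreover have "g x = lin Trig (trunc_set (k + l)) ?d x"
      unfolding g(2) by (rule lin_extend[OF trunc_set_mono]) simp_all
    ultimately show ?thesis by (simp add: lin_def sum.distrib distrib_right)
  qed
  moreover have "even (k + l)" using f(1) g(1) by simp
  ultimately show ?thesis unfolding trig_poly_def by blast
qed

lemma trig_poly_const_mult: "trig_poly f \<Longrightarrow> trig_poly (\<lambda>x. r * f x)"
proof -
  assume "trig_poly f"
  then obtain k c where f: "even k" "\<And>x. f x = lin Trig (trunc_set k) c x"
    unfolding trig_poly_def by blast
  have "r * f x = lin Trig (trunc_set k) (\<lambda>\<alpha>. r * c \<alpha>) x" for x
    by (simp add: f(2) lin_def sum_distrib_left mult.assoc)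
  then show ?thesis using f(1) unfolding trig_poly_def by blast
qed

lemma trig_poly_one: "trig_poly (\<lambda>x :: real ^ 'd::finite. 1)"
proof -
  have "(trunc_set 0 :: ('d \<Rightarrow> nat) set) = {\<lambda>_. 0}" by (auto simp: trunc_set_def)
  then have "1 = lin Trig (trunc_set 0) (\<lambda>_. 1) x" for x :: "real ^ 'd"
    by (simp add: lin_def Psi_0)
  then show ?thesis unfolding trig_poly_def by (intro exI[of _ 0] exI[of _ "\<lambda>_. 1"]) simp
qed

lemma trig_poly_mult_cos_sin:
  fixes i :: "'d::finite"
  assumes \<theta>: "\<theta> = cos \<or> \<theta> = sin" and f: "trig_poly f"
  shows "trig_poly (\<lambda>x. \<theta> (2 * pi * x $ i) * f x)"
proof -
  obtain k c where k: "even k" and fk: "\<And>x. f x = lin Trig (trunc_set k) c x"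
    using f unfolding trig_poly_def by blast
  \<comment> \<open>The product has degree at most \<open>k + 3\<close>; \<open>k + 4\<close> keeps
    the degree even.\<close>
  have "\<forall>a. \<exists>e. a \<le> k \<longrightarrow> (\<forall>t. \<theta> (2 * pi * t) * psi Trig a t = (\<Sum>b\<le>k + 4. e b * psi Trig b t))"
  proof
    fix a
    show "\<exists>e. a \<le> k \<longrightarrow> (\<forall>t. \<theta> (2 * pi * t) * psi Trig a t = (\<Sum>b\<le>k + 4. e b * psi Trig b t))"
      using span1_mult_psi[OF \<theta>, of a "k + 4"] unfolding span1_def by (cases "a \<le> k") auto
  qed
  from choice[OF this] obtain e where
    e: "\<And>a t. a \<le> k \<Longrightarrow> \<theta> (2 * pi * t) * psi Trig a t = (\<Sum>b\<le>k + 4. e a b * psi Trig b t)"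
    by blast
  obtain c' where c': "\<And>x. (\<Sum>\<alpha>\<in>trunc_set k. c \<alpha> * ((\<Sum>b\<le>k + 4. e (\<alpha> i) b * psi Trig b (x $ i)) * (\<Prod>j\<in>UNIV - {i}. psi Trig (\<alpha> j) (x $ j))))
      = lin Trig (trunc_set (max k (k + 4))) c' x"
    using lin_coordinate_expansion[where k=k and K="k + 4" and c=c and e=e and i=i and s=Trigonometric] by blast
  have "\<theta> (2 * pi * x $ i) * f x = lin Trig (trunc_set (k + 4)) c' x" for x
  proof -
    have "\<theta> (2 * pi * x $ i) * f x = (\<Sum>\<alpha>\<in>trunc_set k. c \<alpha> * ((\<theta> (2 * pi * x $ i) * psi Trig (\<alpha> i) (x $ i)) * (\<Prod>j\<in>UNIV - {i}. psi Trig (\<alpha> j) (x $ j))))"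
      using lin_upd[of Trigonometric "trunc_set k" c x i "x $ i"] by (simp add: fk sum_distrib_left mult_ac)
    also have "\<dots> = (\<Sum>\<alpha>\<in>trunc_set k. c \<alpha> * ((\<Sum>b\<le>k + 4. e (\<alpha> i) b * psi Trig b (x $ i)) * (\<Prod>j\<in>UNIV - {i}. psi Trig (\<alpha> j) (x $ j))))"
    proof (rule sum.cong[OF refl])
      fix \<alpha> :: "'d \<Rightarrow> nat" assume "\<alpha> \<in> trunc_set k"
      then have "\<alpha> i \<le> k" by (simp add: trunc_set_def)
      then show "c \<alpha> * ((\<theta> (2 * pi * x $ i) * psi Trig (\<alpha> i) (x $ i)) * (\<Prod>j\<in>UNIV - {i}. psi Trig (\<alpha> j) (x $ j))) =
         c \<alpha> * ((\<Sum>b\<le>k + 4. e (\<alpha> i) b * psi Trig b (x $ i)) * (\<Prod>j\<in>UNIV - {i}. psi Trig (\<alpha> j) (x $ j)))"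
        by (simp only: e)
    qed
    finally show ?thesis using c'[of x] by (simp add: max_def)
  qed
  moreover have "even (k + 4)" using k by simp
  ultimately show ?thesis unfolding trig_poly_def by blast
qed

text \<open>Opposite faces of the cube are glued, so that the coordinate functions separate the
  points of the image. On the cube itself no family of periodic functions is separating.\<close>

definition torus_embedding :: "real ^ 'd \<Rightarrow> (real ^ 'd) \<times> (real ^ 'd)" where
  "torus_embedding x = ((\<chi> i. cos (2 * pi * x $ i)), (\<chi> i. sin (2 * pi * x $ i)))"

lemma periodic_int:
  assumes "periodic G"
  shows "G (upd x i (t + of_int n)) = G (upd x i t)"
proof -
  have p: "G (upd x i (t + 1)) = G (upd x i t)" for t using assms unfolding periodic_def by blast
  have nat: "G (upd x i (t + real m)) = G (upd x i t)" for t m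
  proof (induction m)
    case (Suc m)
    then show ?case using p[of "t + real m"] by (simp add: add_ac)
  qed simp
  show ?thesis
  proof (cases "n \<ge> 0")
    case True
    then show ?thesis using nat[of t "nat n"] by simp
  next
    case False
    then show ?thesis using nat[of "t + of_int n" "nat (- n)"] by simp
  qed
qed

text \<open>Points with the same image differ by integers, and periodicity removes these one
  coordinate at a time.\<close>

lemma periodic_torus:
  fixes G :: "real ^ 'd::finite \<Rightarrow> real"
  assumes G: "periodic G" and xy: "torus_embedding x = torus_embedding y"
  shows "G x = G y"
proof -
  have n: "\<exists>n. y $ i = x $ i + of_int n" for i
  proof -
    have "cos (2 * pi * x $ i) = cos (2 * pi * y $ i)" "sin (2 * pi * x $ i) = sin (2 * pi * y $ i)"
      using xy by (auto simp: torus_embedding_def cart_eq_iff)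
    then have "sin (2 * pi * y $ i) = sin (2 * pi * x $ i) \<and> cos (2 * pi * y $ i) = cos (2 * pi * x $ i)" by simp
    then obtain n :: int where "2 * pi * y $ i = 2 * pi * x $ i + 2 * pi * of_int n"
      by (subst (asm) sin_cos_eq_iff) auto
    then have "2 * pi * (y $ i) = 2 * pi * (x $ i + of_int n)" by (simp add: distrib_left)
    then show ?thesis by auto
  qed
  have "G (merge_vec A y x) = G x" for A :: "'d set"
  proof (induction A rule: finite_induct[OF finite])
    case 1
    have "merge_vec {} y x = x" by (simp add: cart_eq_iff merge_vec_nth)
    then show ?case by simp
  next
    case (2 i A)
    obtain n where n: "y $ i = x $ i + of_int n" using n by blast
    have "merge_vec (insert i A) y x = upd (merge_vec A y x) i (x $ i + of_int n)"
      by (auto simp: cart_eq_iff merge_vec_nth upd_nth n)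
    moreover have "upd (merge_vec A y x) i (x $ i) = merge_vec A y x"
      using 2(2) by (auto simp: cart_eq_iff merge_vec_nth upd_nth)
    ultimately show ?case using periodic_int[OF G, of "merge_vec A y x" i "x $ i" n] 2(3) by simp
  qed
  moreover have "merge_vec UNIV y x = y" by (simp add: cart_eq_iff merge_vec_nth)
  ultimately show ?thesis by (metis)
qed

lemma continuous_torus_embedding: "continuous_on S torus_embedding"
  unfolding torus_embedding_def by (intro continuous_on_Pair continuous_on_vec_lambda continuous_intros)

text \<open>Stone-Weierstrass on the compact torus. \<open>P\<close> is a class of multipliers:
  continuous functions which, composed with the embedding, send trigonometric polynomials to
  trigonometric polynomials. Such a class is closed under products at once, and a product of two
  general trigonometric polynomials never has to be expanded.\<close>

lemma trig_poly_dense: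
  fixes G :: "real ^ 'd::finite \<Rightarrow> real"
  assumes G: "periodic G" and \<epsilon>: "\<epsilon> > 0"
  shows "\<exists>g. trig_poly g \<and> (\<forall>x\<in>cube Trig. \<bar>G x - g x\<bar> < \<epsilon>)"
proof -
  let ?C = "cube Trig :: (real ^ 'd) set" and ?e = "torus_embedding :: real ^ 'd \<Rightarrow> _"
  define S where "S = ?e ` ?C"
  have cS: "compact S"
    unfolding S_def by (rule compact_continuous_image[OF continuous_torus_embedding compact_cube])
  \<comment> \<open>The function that \<open>G\<close> induces on the torus; by periodicity the
    choice of the preimage does not affect its value.\<close>
  define F where "F z = G (SOME x. x \<in> ?C \<and> ?e x = z)" for z
  have F: "F (?e x) = G x" if "x \<in> ?C" for x
  proof -
    have "\<exists>y. y \<in> ?C \<and> ?e y = ?e x" using that by blast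
    from someI_ex[OF this] have "?e (SOME y. y \<in> ?C \<and> ?e y = ?e x) = ?e x" by blast
    then show ?thesis unfolding F_def by (rule periodic_torus[OF G])
  qed
  \<comment> \<open>The preimage of a closed set is the image of a compact one, hence closed; this
    replaces a local inverse of the embedding.\<close>
  have cF: "continuous_on S F"
    unfolding continuous_on_closed_invariant
  proof (intro allI impI)
    fix B :: "real set" assume B: "closed B"
    define A where "A = ?e ` (?C \<inter> G -` B)"
    have "continuous_on ?C G" using G unfolding periodic_def by (auto intro: continuous_on_subset)
    then have "closed (?C \<inter> G -` B)"
      by (rule continuous_closed_preimage[OF _ compact_imp_closed[OF compact_cube] B])
    then have "compact (?C \<inter> (?C \<inter> G -` B))" by (rule compact_Int_closed[OF compact_cube])
    moreover have "?C \<inter> (?C \<inter> G -` B) = ?C \<inter> G -` B" by blast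
    ultimately have "compact (?C \<inter> G -` B)" by simp
    then have "compact A"
      unfolding A_def by (rule compact_continuous_image[OF continuous_torus_embedding])
    then have "closed A" by (rule compact_imp_closed)
    moreover have "A \<inter> S = F -` B \<inter> S"
      unfolding A_def S_def using F by auto
    ultimately show "\<exists>A. closed A \<and> A \<inter> S = F -` B \<inter> S" by blast
  qed
  define P where "P p \<longleftrightarrow> continuous_on UNIV p \<and> (\<forall>v. trig_poly v \<longrightarrow> trig_poly (\<lambda>x. p (?e x) * v x))" for p :: "(real ^ 'd) \<times> (real ^ 'd) \<Rightarrow> real"
  have "\<exists>p. P p \<and> (\<forall>z\<in>S. \<bar>F z - p z\<bar> < \<epsilon>)"
  proof (rule Stone_Weierstrass_HOL[OF cS _ _ _ _ _ cF \<epsilon>])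
    show "P (\<lambda>x. c)" for c unfolding P_def by (auto intro: trig_poly_const_mult)
    show "continuous_on S f" if "P f" for f using that unfolding P_def by (auto intro: continuous_on_subset)
    show "P (\<lambda>x. f x + g x)" if "P f \<and> P g" for f g
      using that unfolding P_def by (auto intro!: continuous_intros trig_poly_add simp: distrib_right)
    show "P (\<lambda>x. f x * g x)" if "P f \<and> P g" for f g
      using that unfolding P_def by (auto intro!: continuous_intros simp: mult.assoc)
    fix x y :: "(real ^ 'd) \<times> (real ^ 'd)" assume "x \<in> S \<and> y \<in> S \<and> x \<noteq> y"
    then have "x \<noteq> y" by blast
    then have "(\<exists>i. fst x $ i \<noteq> fst y $ i) \<or> (\<exists>i. snd x $ i \<noteq> snd y $ i)"
      by (auto simp: prod_eq_iff cart_eq_iff)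
    moreover have "P (\<lambda>z. fst z $ i)" for i
      unfolding P_def using trig_poly_mult_cos_sin[of cos _ i]
      by (auto intro!: continuous_intros simp: torus_embedding_def)
    moreover have "P (\<lambda>z. snd z $ i)" for i
      unfolding P_def using trig_poly_mult_cos_sin[of sin _ i]
      by (auto intro!: continuous_intros simp: torus_embedding_def)
    ultimately show "\<exists>f. P f \<and> f x \<noteq> f y" by blast
  qed
  then obtain p where p: "P p" "\<And>z. z \<in> S \<Longrightarrow> \<bar>F z - p z\<bar> < \<epsilon>" by blast
  have "trig_poly (\<lambda>x. p (?e x) * 1)" using p(1) trig_poly_one unfolding P_def by blast
  moreover have "\<bar>G x - p (?e x) * 1\<bar> < \<epsilon>" if "x \<in> ?C" for x
    using p(2)[of "?e x"] F[OF that] that by (simp add: S_def)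
  ultimately show ?thesis by blast
qed

text \<open>For bounded measurable f this is the squared distance from the span. As a difference of
  energies it changes with the degree by a sum of squared coefficients.\<close>

definition trunc_err :: "setting \<Rightarrow> (real ^ 'd::finite \<Rightarrow> real) \<Rightarrow> nat \<Rightarrow> real" where
  "trunc_err s f k = (\<integral>x. (f x)\<^sup>2 \<partial>design_measure s) - (\<Sum>\<alpha>\<in>trunc_set k. (coef s f \<alpha>)\<^sup>2)"

lemma trunc_err_le:
  assumes "bdm s f"
  shows "trunc_err s f k \<le> (\<integral>x. (f x - lin s (trunc_set k) c x)\<^sup>2 \<partial>design_measure s)"
  using pythagoras[OF assms finite_trunc_set, of k c] by (simp add: trunc_err_def sum_nonneg)

lemma trunc_err_eq:
  assumes "bdm s f"
  shows "(\<integral>x. (f x - lin s (trunc_set k) (coef s f) x)\<^sup>2 \<partial>design_measure s) = trunc_err s f k"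
  using pythagoras[OF assms finite_trunc_set, of k "coef s f"] by (simp add: trunc_err_def)

text \<open>The tail estimate controls finite sums only. A trigonometric polynomial within
  \<open>sqrt \<epsilon>\<close> of \<open>G\<close>, of some large degree N, shows that the
  truncation error at N is at most \<open>\<epsilon>\<close>; the coefficients between
  \<open>2 * K\<close> and N are then a finite tail.\<close>

lemma trunc_err_trig:
  fixes G :: "real ^ 'd::finite \<Rightarrow> real"
  assumes \<beta>: "\<beta> > 0" and G: "\<And>i. smooth_along \<beta> i m G"
  shows "\<exists>C\<ge>0. \<forall>K\<ge>1. trunc_err Trig G (2 * K) \<le> C * real K powr (- 2 * (real m + \<beta>))"
proof -
  have per: "periodic G" using smooth_along_periodic[OF G[of undefined]] .
  note bG = periodic_bdm[OF per, of Trigonometric]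
  obtain C where C: "C \<ge> 0" "\<And>K N. K \<ge> 1 \<Longrightarrow> even N \<Longrightarrow>
     (\<Sum>\<alpha>\<in>trunc_set N - trunc_set (2 * K). (coef Trig G \<alpha>)\<^sup>2) \<le> C * real K powr (- 2 * (real m + \<beta>))"
    using trunc_tail_bound[OF \<beta> G] by blast
  show ?thesis
  proof (intro exI[of _ C] conjI allI impI C(1))
    fix K :: nat assume K: "K \<ge> 1"
    show "trunc_err Trig G (2 * K) \<le> C * real K powr (- 2 * (real m + \<beta>))"
    proof (rule field_le_epsilon)
      fix \<epsilon> :: real assume \<epsilon>: "\<epsilon> > 0"
      then have s\<epsilon>: "sqrt \<epsilon> > 0" by simp
      obtain g where g: "trig_poly g" "\<And>x. x \<in> cube Trig \<Longrightarrow> \<bar>G x - g x\<bar> < sqrt \<epsilon>"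
        using trig_poly_dense[OF per s\<epsilon>] by blast
      obtain k c where k: "even k" "\<And>x. g x = lin Trig (trunc_set k) c x"
        using g(1) unfolding trig_poly_def by blast
      define N where "N = k + 2 * K"
      define c' where "c' = (\<lambda>\<alpha>. if \<alpha> \<in> trunc_set k then c \<alpha> else 0)"
      have N: "even N" "trunc_set k \<subseteq> (trunc_set N :: ('d \<Rightarrow> nat) set)" "trunc_set (2 * K) \<subseteq> (trunc_set N :: ('d \<Rightarrow> nat) set)"
        unfolding N_def using k(1) by (simp, intro trunc_set_mono, simp, intro trunc_set_mono, simp)
      have gN: "g x = lin Trig (trunc_set N) c' x" for x
        unfolding k(2) c'_def by (rule lin_extend[OF N(2)]) simp
      have "trunc_err Trig G N \<le> (\<integral>x. (G x - g x)\<^sup>2 \<partial>design_measure Trig)"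
        unfolding gN by (rule trunc_err_le[OF bG])
      also have "\<dots> \<le> (\<integral>x. \<epsilon> \<partial>(design_measure Trig :: (real ^ 'd) measure))"
      proof (rule integral_mono)
        show "integrable (design_measure Trig) (\<lambda>x. (G x - g x)\<^sup>2)"
          unfolding gN by (intro bdm_integrable bdm_power2 bdm_diff bG bdm_lin)
        fix x :: "real ^ 'd" assume "x \<in> space (design_measure Trig)"
        then have "\<bar>G x - g x\<bar> \<le> sqrt \<epsilon>" using g(2)[of x] by simp
        then have "\<bar>G x - g x\<bar>\<^sup>2 \<le> (sqrt \<epsilon>)\<^sup>2" by (intro power_mono) auto
        then show "(G x - g x)\<^sup>2 \<le> \<epsilon>" using \<epsilon> by simp
      qed simp
      finally have 1: "trunc_err Trig G N \<le> \<epsilon>" by simp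
      have "(\<Sum>\<alpha>\<in>trunc_set N. (coef Trig G \<alpha>)\<^sup>2) =
         (\<Sum>\<alpha>\<in>trunc_set N - trunc_set (2 * K). (coef Trig G \<alpha>)\<^sup>2) + (\<Sum>\<alpha>\<in>trunc_set (2 * K). (coef Trig G \<alpha>)\<^sup>2)"
        by (rule sum.subset_diff[OF N(3)]) simp
      then have "trunc_err Trig G (2 * K) = trunc_err Trig G N + (\<Sum>\<alpha>\<in>trunc_set N - trunc_set (2 * K). (coef Trig G \<alpha>)\<^sup>2)"
        by (simp add: trunc_err_def)
      also have "\<dots> \<le> \<epsilon> + C * real K powr (- 2 * (real m + \<beta>))"
        using 1 C(2)[OF K N(1)] by (rule add_mono)
      finally show "trunc_err Trig G (2 * K) \<le> C * real K powr (- 2 * (real m + \<beta>)) + \<epsilon>" by simp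
    qed
  qed
qed

subsection \<open>Transfer to Chebyshev and Legendre expansions\<close>

definition cosv :: "real ^ 'd::finite \<Rightarrow> real ^ 'd" where
  "cosv x = (\<chi> i. cos (2 * pi * x $ i))"

lemma cosv_cube [simp]: "cosv x \<in> cube Chebyshev"
  by (simp add: cosv_def cube_def)

lemma cosv_measurable: "cosv \<in> design_measure Trig \<rightarrow>\<^sub>M (bcube Chebyshev :: (real ^ 'd::finite) measure)"
proof (rule measurable_restrict_space2)
  have cS: "continuous_on S cosv" for S :: "(real ^ 'd) set"
    unfolding cosv_def by (intro continuous_on_vec_lambda continuous_intros)
  show "cosv \<in> borel_measurable (design_measure Trig :: (real ^ 'd) measure)"
    by (subst measurable_cong_sets[OF sets_design refl]) (rule borel_measurable_continuous_on_restrict[OF cS])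
qed simp

lemma integral_cosv:
  fixes h :: "real ^ 'd::finite \<Rightarrow> real"
  assumes "h \<in> borel_measurable (design_measure Chebyshev)"
  shows "(\<integral>x. h x \<partial>design_measure Chebyshev) = (\<integral>x. h (cosv x) \<partial>design_measure Trig)"
proof -
  have d: "distr (design_measure Trig) (bcube Chebyshev) cosv = (design_measure Chebyshev :: (real ^ 'd) measure)"
    unfolding cosv_def[abs_def] by (rule distr_cos)
  show ?thesis
    by (subst d[symmetric], subst integral_distr[OF cosv_measurable]) (use assms in simp_all)
qed

lemma Psi_cosv: "x \<in> cube Trig \<Longrightarrow> Psi Chebyshev \<beta> (cosv x) = Psi Trig (\<lambda>i. 2 * \<beta> i) x"
  unfolding Psi_def cosv_def by (intro prod.cong refl) (simp add: psi_chebyshev_cos cube_def)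

lemma coef_cosv:
  assumes f: "bdm Chebyshev f"
  shows "coef Chebyshev f \<beta> = coef Trig (\<lambda>x. f (cosv x)) (\<lambda>i. 2 * \<beta> i)"
proof -
  have "coef Chebyshev f \<beta> = (\<integral>x. f (cosv x) * Psi Chebyshev \<beta> (cosv x) \<partial>design_measure Trig)"
    unfolding coef_def by (rule integral_cosv[OF bdm_measurable[OF bdm_mult[OF f bdm_Psi]]])
  also have "\<dots> = coef Trig (\<lambda>x. f (cosv x)) (\<lambda>i. 2 * \<beta> i)"
    unfolding coef_def by (intro Bochner_Integration.integral_cong) (simp_all add: Psi_cosv)
  finally show ?thesis .
qed

lemma integral_nu_trig_reflect:
  fixes \<phi> :: "real \<Rightarrow> real"
  assumes c: "continuous_on {0..1} \<phi>"
  shows "(\<integral>t. \<phi> (1 - t) \<partial>nu Trig) = (\<integral>t. \<phi> t \<partial>nu Trig)"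
proof -
  obtain \<Phi> where \<Phi>: "\<And>x. x \<in> {0..1} \<Longrightarrow> (\<Phi> has_vector_derivative \<phi> x) (at x within {0..1})"
    using antiderivative_continuous[OF c] by blast
  have I1: "interval1 Trig = {0..1}" "lo Trig = 0" "len Trig = 1"
    by (simp_all add: lo_def len_def)
  have \<Phi>': "(\<Phi> has_real_derivative \<phi> x) (at x within {0..1})" if "x \<in> {0..1}" for x
    using \<Phi>[OF that] by (simp add: has_real_derivative_iff_has_vector_derivative)
  have im: "(\<lambda>t. 1 - t) ` {0..1} = {0..1::real}"
    by (auto simp: image_iff intro!: bexI[of _ "1 - _"])
  have e1: "(\<integral>t. \<phi> (1 - t) \<partial>nu Trig) = (- \<Phi> (1 - (lo Trig + len Trig)) - - \<Phi> (1 - lo Trig)) / len Trig"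
  proof (rule integral_nu_FTC)
    fix t assume "t \<in> interval1 Trig"
    then have t: "t \<in> {0..1}" by (simp add: I1)
    have "((\<Phi> \<circ> (\<lambda>t. 1 - t)) has_real_derivative \<phi> (1 - t) * (-1)) (at t within {0..1})"
    proof (rule DERIV_image_chain)
      show "(\<Phi> has_real_derivative \<phi> (1 - t)) (at (1 - t) within (\<lambda>t. 1 - t) ` {0..1})"
        unfolding im by (rule \<Phi>') (use t in auto)
    qed (auto intro!: derivative_eq_intros)
    from DERIV_minus[OF this]
    show "((\<lambda>t. - \<Phi> (1 - t)) has_real_derivative \<phi> (1 - t)) (at t within interval1 Trig)"
      by (simp add: o_def I1)
  next
    show "continuous_on (interval1 Trig) (\<lambda>t. \<phi> (1 - t))"
      unfolding I1 by (rule continuous_on_compose2[OF c]) (auto intro!: continuous_intros)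
  qed simp
  have e0: "(\<integral>t. \<phi> t \<partial>nu Trig) = (\<Phi> (lo Trig + len Trig) - \<Phi> (lo Trig)) / len Trig"
    by (rule integral_nu_FTC) (use c \<Phi>' in \<open>auto simp: I1\<close>)
  show ?thesis unfolding e1 e0 I1 by simp
qed

lemma psi_trig_reflect: "odd a \<Longrightarrow> psi Trig a (1 - t) = - psi Trig a t"
proof -
  assume a: "odd a"
  then obtain j where j: "a = 2 * j - 1" "j \<ge> 1" using psi_trig_cases[of a] by (metis dvd_0_right dvd_triv_left)
  have "2 * pi * real j * (1 - t) = 2 * pi * real j - 2 * pi * real j * t" by (simp add: right_diff_distrib)
  then have "sin (2 * pi * real j * (1 - t)) = - sin (2 * pi * real j * t)"
    using sin_int_2pin[of "int j"] cos_int_2pin[of "int j"] by (simp only: sin_diff) simp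
  then show ?thesis unfolding j(1) psi_trig_sin[OF j(2)] by simp
qed

lemma cosv_upd: "cosv (upd x i t) = upd (cosv x) i (cos (2 * pi * t))"
  by (auto simp: cart_eq_iff cosv_def upd_nth)

text \<open>Composition with \<open>cosv\<close> is invariant under \<open>t \<mapsto> 1 - t\<close>
  in each coordinate, whereas odd indices belong to sines, which change sign.\<close>

lemma coef_cosv_odd:
  assumes f: "continuous_on (cube Chebyshev) f" and odd: "odd (\<alpha> i)"
  shows "coef Trig (\<lambda>x. f (cosv x)) \<alpha> = 0"
proof -
  let ?M = "design_measure Trig"
  define H where "H x = f (cosv x) * Psi Trig \<alpha> x" for x
  have cc: "continuous_on UNIV (\<lambda>x. f (cosv x))"
    by (rule continuous_on_compose2[OF f]) (auto simp: cosv_def intro!: continuous_on_vec_lambda continuous_intros simp: cube_def)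
  have cH: "continuous_on UNIV H" unfolding H_def by (intro continuous_on_mult cc Psi_trig_continuous)
  have bH: "bdm Trig H" by (rule bdm_continuous) (use cH continuous_on_subset in blast)
  have "(\<integral>t. H (upd x i t) \<partial>nu Trig) = 0" for x
  proof -
    have "H (upd x i (1 - t)) = - H (upd x i t)" for t
    proof -
      have "2 * pi * (1 - t) = 2 * pi - 2 * pi * t" by (simp add: right_diff_distrib)
      then have "cos (2 * pi * (1 - t)) = cos (2 * pi * t)" by (simp add: cos_diff)
      then show ?thesis unfolding H_def cosv_upd Psi_upd psi_trig_reflect[OF odd] by simp
    qed
    moreover have "(\<integral>t. H (upd x i (1 - t)) \<partial>nu Trig) = (\<integral>t. H (upd x i t) \<partial>nu Trig)"
      by (rule integral_nu_trig_reflect) (rule continuous_on_compose2[OF cH continuous_upd], simp)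
    ultimately show ?thesis by simp
  qed
  then have "(\<integral>x. H x \<partial>?M) = 0"
    using integral_upd[OF bdm_integrable[OF bH], of i] by simp
  then show ?thesis by (simp add: coef_def H_def)
qed

text \<open>Only multi-indices with all entries even have nonzero trigonometric coefficients, and
  \<open>2 * \<beta>\<close> corresponds to the Chebyshev index \<open>\<beta>\<close>. So degree
  \<open>2 * k\<close> on the torus matches degree k on the cube.\<close>

lemma trunc_err_chebyshev:
  fixes f :: "real ^ 'd::finite \<Rightarrow> real"
  assumes f: "continuous_on (cube Chebyshev) f"
  shows "trunc_err Chebyshev f k = trunc_err Trig (\<lambda>x. f (cosv x)) (2 * k)"
proof -
  let ?G = "\<lambda>x. f (cosv x)"
  let ?dbl = "\<lambda>\<beta> :: 'd \<Rightarrow> nat. \<lambda>i. 2 * \<beta> i"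
  have b: "bdm Chebyshev f" by (rule bdm_continuous[OF f])
  have 1: "(\<integral>x. (f x)\<^sup>2 \<partial>design_measure Chebyshev) = (\<integral>x. (?G x)\<^sup>2 \<partial>design_measure Trig)"
    by (rule integral_cosv[OF bdm_measurable[OF bdm_power2[OF b]]])
  have inj: "inj_on ?dbl (trunc_set k)" by (auto simp: inj_on_def fun_eq_iff)
  have "(\<Sum>\<alpha>\<in>trunc_set (2 * k). (coef Trig ?G \<alpha>)\<^sup>2) = (\<Sum>\<alpha>\<in>?dbl ` trunc_set k. (coef Trig ?G \<alpha>)\<^sup>2)"
  proof (rule sum.mono_neutral_right)
    show "?dbl ` trunc_set k \<subseteq> trunc_set (2 * k)" by (auto simp: trunc_set_def)
    show "\<forall>\<alpha>\<in>trunc_set (2 * k) - ?dbl ` trunc_set k. (coef Trig ?G \<alpha>)\<^sup>2 = 0"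
    proof
      fix \<alpha> :: "'d \<Rightarrow> nat" assume a: "\<alpha> \<in> trunc_set (2 * k) - ?dbl ` trunc_set k"
      have "\<exists>i. odd (\<alpha> i)"
      proof (rule ccontr)
        assume "\<nexists>i. odd (\<alpha> i)"
        then have "\<alpha> = ?dbl (\<lambda>i. \<alpha> i div 2)" by auto
        moreover have "(\<lambda>i. \<alpha> i div 2) \<in> trunc_set k"
        proof -
          have "\<alpha> i div 2 \<le> k" for i
          proof -
            have "\<alpha> i \<le> 2 * k" using a by (simp add: trunc_set_def)
            then show ?thesis by presburger
          qed
          then show ?thesis by (simp add: trunc_set_def)
        qed
        ultimately have "\<alpha> \<in> ?dbl ` trunc_set k" by (rule image_eqI)
        then show False using a by simp
      qed
      then show "(coef Trig ?G \<alpha>)\<^sup>2 = 0" using coef_cosv_odd[OF f] by auto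
    qed
  qed simp
  also have "\<dots> = (\<Sum>\<beta>\<in>trunc_set k. (coef Chebyshev f \<beta>)\<^sup>2)"
    by (simp add: sum.reindex[OF inj] coef_cosv[OF b])
  finally show ?thesis by (simp add: trunc_err_def 1)
qed

text \<open>The three-term recurrence of the Chebyshev polynomials. It places the Chebyshev basis in
  the span of the Legendre functions up to the same degree.\<close>

lemma chebyshev_polynomial: "\<exists>q. Polynomial.degree q \<le> k \<and> (\<forall>t\<in>{-1..1}. cos (real k * arccos t) = poly q t)"
proof (induction k rule: less_induct)
  case (less k)
  consider "k = 0" | "k = 1" | l where "k = Suc (Suc l)" by (metis One_nat_def not0_implies_Suc)
  then show ?case
  proof cases
    case 1
    then show ?thesis by (intro exI[of _ 1]) simp
  next
    case 2
    then show ?thesis by (intro exI[of _ "[:0, 1:]"]) auto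
  next
    case (3 l)
    obtain q where q: "Polynomial.degree q \<le> Suc l" "\<And>t. t \<in> {-1..1} \<Longrightarrow> cos (real (Suc l) * arccos t) = poly q t"
      using less[of "Suc l"] 3 by auto
    obtain r where r: "Polynomial.degree r \<le> l" "\<And>t. t \<in> {-1..1} \<Longrightarrow> cos (real l * arccos t) = poly r t"
      using less[of l] 3 by auto
    define w where "w = [:0, 2:] * q - r"
    have "Polynomial.degree ([:0, 2:] * q) \<le> 1 + Suc l"
      by (rule order_trans[OF degree_mult_le]) (use q(1) in simp)
    then have "Polynomial.degree w \<le> k" unfolding w_def using r(1) 3 by (intro degree_diff_le) auto
    moreover have "cos (real k * arccos t) = poly w t" if t: "t \<in> {-1..1}" for t
    proof -
      define a where "a = real (Suc l) * arccos t" define b where "b = arccos t"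
      have e: "real k * arccos t = a + b" "real l * arccos t = a - b"
        by (simp_all add: a_def b_def 3 algebra_simps)
      have "cos b = t" using t by (simp add: b_def)
      have "cos (a + b) = 2 * cos b * cos a - cos (a - b)" by (simp add: cos_add cos_diff)
      then show ?thesis using q(2)[OF t] r(2)[OF t] \<open>cos b = t\<close> unfolding e(1) w_def
        using e(2) by (simp add: a_def)
    qed
    ultimately show ?thesis by blast
  qed
qed

lemma psi_chebyshev_legendre:
  assumes "b \<le> k"
  shows "\<exists>e. \<forall>t\<in>{-1..1}. psi Chebyshev b t = (\<Sum>a\<le>k. e a * psi Legendre a t)"
proof -
  obtain q where q: "Polynomial.degree q \<le> b" "\<And>t. t \<in> {-1..1} \<Longrightarrow> cos (real b * arccos t) = poly q t"
    using chebyshev_polynomial[of b] by blast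
  define r where "r = (if b = 0 then 1 else Polynomial.smult (sqrt 2) q)"
  have "Polynomial.degree r \<le> k" using q(1) assms by (auto simp: r_def)
  from poly_legendre_expansion[OF this] obtain e where e: "\<And>x. poly r x = (\<Sum>a\<le>k. e a * psi Legendre a x)" by blast
  have "psi Chebyshev b t = poly r t" if "t \<in> {-1..1}" for t
    using q(2)[OF that] by (simp add: psi.simps r_def)
  then show ?thesis using e by auto
qed

text \<open>Expanding a product of univariate expansions keeps each coordinate degree at most k,
  which is what truncation by the maximum degree measures.\<close>

lemma lin_chebyshev_legendre:
  fixes c :: "('d::finite \<Rightarrow> nat) \<Rightarrow> real"
  shows "\<exists>c'. \<forall>x\<in>cube Legendre. lin Chebyshev (trunc_set k) c x = lin Legendre (trunc_set k) c' x"
proof -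
  have "\<forall>b. \<exists>e. b \<le> k \<longrightarrow> (\<forall>t\<in>{-1..1}. psi Chebyshev b t = (\<Sum>a\<le>k. e a * psi Legendre a t))"
    using psi_chebyshev_legendre[of _ k] by blast
  from choice[OF this] obtain e where e: "\<And>b t. b \<le> k \<Longrightarrow> t \<in> {-1..1} \<Longrightarrow> psi Chebyshev b t = (\<Sum>a\<le>k. e b a * psi Legendre a t)"
    by blast
  have T: "(trunc_set k :: ('d \<Rightarrow> nat) set) = PiE UNIV (\<lambda>_. {..k})"
    by (auto simp: trunc_set_def PiE_def)
  have P: "Psi Chebyshev \<beta> x = (\<Sum>\<alpha>\<in>trunc_set k. (\<Prod>i\<in>UNIV. e (\<beta> i) (\<alpha> i)) * Psi Legendre \<alpha> x)"
    if "\<beta> \<in> trunc_set k" "x \<in> cube Legendre" for \<beta> :: "'d \<Rightarrow> nat" and x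
  proof -
    have "Psi Chebyshev \<beta> x = (\<Prod>i\<in>UNIV. \<Sum>a\<in>{..k}. e (\<beta> i) a * psi Legendre a (x $ i))"
      unfolding Psi_def by (intro prod.cong refl e) (use that in \<open>auto simp: trunc_set_def cube_def\<close>)
    also have "\<dots> = (\<Sum>\<alpha>\<in>PiE UNIV (\<lambda>_. {..k}). \<Prod>i\<in>UNIV. e (\<beta> i) (\<alpha> i) * psi Legendre (\<alpha> i) (x $ i))"
      by (rule prod_sum_PiE) auto
    finally show ?thesis by (simp add: T Psi_def prod.distrib)
  qed
  have "lin Chebyshev (trunc_set k) c x = lin Legendre (trunc_set k) (\<lambda>\<alpha>. \<Sum>\<beta>\<in>trunc_set k. c \<beta> * (\<Prod>i\<in>UNIV. e (\<beta> i) (\<alpha> i))) x"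
    if x: "x \<in> cube Legendre" for x
  proof -
    have "lin Chebyshev (trunc_set k) c x = (\<Sum>\<beta>\<in>trunc_set k. \<Sum>\<alpha>\<in>trunc_set k. c \<beta> * ((\<Prod>i\<in>UNIV. e (\<beta> i) (\<alpha> i)) * Psi Legendre \<alpha> x))"
      unfolding lin_def by (intro sum.cong refl) (simp add: P x sum_distrib_left)
    also have "\<dots> = (\<Sum>\<alpha>\<in>trunc_set k. \<Sum>\<beta>\<in>trunc_set k. c \<beta> * ((\<Prod>i\<in>UNIV. e (\<beta> i) (\<alpha> i)) * Psi Legendre \<alpha> x))"
      by (rule sum.swap)
    finally show ?thesis by (simp add: lin_def sum_distrib_right mult.assoc)
  qed
  then show ?thesis by blast
qed

text \<open>In each coordinate the constant weight 1/2 is at most \<open>pi / 2\<close> times the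
  Chebyshev weight, as \<open>sqrt (1 - t\<^sup>2) \<le> 1\<close>.\<close>

lemma legendre_le_chebyshev:
  fixes h :: "real ^ 'd::finite \<Rightarrow> real"
  assumes h: "bdm Chebyshev h" "\<And>x. 0 \<le> h x"
  shows "(\<integral>x. h x \<partial>design_measure Legendre) \<le> (pi / 2) ^ CARD('d) * (\<integral>x. h x \<partial>design_measure Chebyshev)"
proof -
  let ?R = "restrict_space lborel (cube Chebyshev) :: (real ^ 'd) measure"
  have cc: "(cube Legendre :: (real ^ 'd) set) = cube Chebyshev" by (simp add: cube_def)
  have hm: "h \<in> borel_measurable ?R"
    using bdm_measurable[OF h(1)] by (subst measurable_cong_sets[where M'="bcube Chebyshev" and N'=borel]) (auto simp: sets_restrict_space)
  have wm: "(\<lambda>x. \<Prod>i\<in>UNIV. wt s (x $ i)) \<in> borel_measurable ?R" for s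
    by (intro measurable_restrict_space1) simp
  have bl: "bdm Legendre h"
  proof -
    have "sets (design_measure Legendre :: (real ^ 'd) measure) = sets (design_measure Chebyshev)" by (simp add: cc)
    then show ?thesis using h(1) unfolding bdm_def cc by (simp cong: measurable_cong_sets)
  qed
  have nn: "(\<integral>\<^sup>+x. ennreal (h x) \<partial>design_measure s) = (\<integral>\<^sup>+x. ennreal (\<Prod>i\<in>UNIV. wt s (x $ i)) * ennreal (h x) \<partial>?R)" if "s \<noteq> Trig" for s
  proof -
    have "(cube s :: (real ^ 'd) set) = cube Chebyshev" using that by (cases s) (simp_all add: cube_def)
    then show ?thesis
      unfolding design_measure_density using wm hm by (subst nn_integral_density) simp_all
  qed
  have "ennreal (\<integral>x. h x \<partial>design_measure Legendre) = (\<integral>\<^sup>+x. ennreal (h x) \<partial>design_measure Legendre)"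
    by (rule nn_integral_eq_integral[symmetric]) (use bdm_integrable[OF bl] h(2) in auto)
  also have "\<dots> = (\<integral>\<^sup>+x. ennreal (\<Prod>i\<in>UNIV. wt Legendre (x $ i)) * ennreal (h x) \<partial>?R)"
    by (rule nn) simp
  also have "\<dots> \<le> (\<integral>\<^sup>+x. ennreal ((pi / 2) ^ CARD('d)) * (ennreal (\<Prod>i\<in>UNIV. wt Chebyshev (x $ i)) * ennreal (h x)) \<partial>?R)"
  proof (rule nn_integral_mono_AE)
    \<comment> \<open>On the faces of the cube the Chebyshev weight is 0 by the convention for
      division by zero, and the comparison of weights fails; hyperplanes are null sets.\<close>
    have "AE x in (lborel :: (real ^ 'd) measure). \<forall>i. x $ i \<noteq> 1 \<and> x $ i \<noteq> -1"
    proof -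
      have "AE x in (lborel :: (real ^ 'd) measure). x $ i \<noteq> a" for i a
      proof -
        have "negligible {x :: real ^ 'd. x $ i = a}" using negligible_standard_hyperplane[of "axis i 1 :: real ^ 'd" a] by (simp add: inner_axis)
        then have n: "{x :: real ^ 'd. x $ i = a} \<in> null_sets lebesgue" by (simp add: negligible_iff_null_sets)
        have "AE x in lebesgue. (x :: real ^ 'd) \<notin> {x. x $ i = a}" by (rule AE_not_in[OF n])
        then show ?thesis by (simp add: AE_completion_iff)
      qed
      then have "AE x in (lborel :: (real ^ 'd) measure). x $ i \<noteq> 1 \<and> x $ i \<noteq> -1" for i by (intro AE_conjI)
      then show ?thesis by (rule eventually_all_finite)
    qed
    then have "AE x in ?R. \<forall>i. x $ i \<noteq> 1 \<and> x $ i \<noteq> -1"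
      by (subst AE_restrict_space_iff) (auto elim: eventually_mono)
    moreover have "AE x in ?R. x \<in> cube Chebyshev" using AE_space[of ?R] by (simp add: space_restrict_space)
    ultimately show "AE x in ?R. ennreal (\<Prod>i\<in>UNIV. wt Legendre (x $ i)) * ennreal (h x)
      \<le> ennreal ((pi / 2) ^ CARD('d)) * (ennreal (\<Prod>i\<in>UNIV. wt Chebyshev (x $ i)) * ennreal (h x))"
    proof eventually_elim
      case (elim x)
      have w: "wt Legendre t \<le> pi / 2 * wt Chebyshev t" if "t \<in> {-1..1}" "t \<noteq> 1" "t \<noteq> -1" for t
      proof -
        have "t\<^sup>2 < 1" using that by (auto simp: abs_square_less_1)
        then have "0 < sqrt (1 - t\<^sup>2)" "sqrt (1 - t\<^sup>2) \<le> 1" by auto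
        then show ?thesis by (simp add: field_simps)
      qed
      have "(\<Prod>i\<in>(UNIV :: 'd set). wt Legendre (x $ i)) \<le> (\<Prod>i\<in>(UNIV :: 'd set). pi / 2 * wt Chebyshev (x $ i))"
        by (rule prod_mono) (use elim w in \<open>auto simp: cube_def\<close>)
      also have "\<dots> = (pi / 2) ^ CARD('d) * (\<Prod>i\<in>UNIV. wt Chebyshev (x $ i))"
        unfolding prod.distrib by simp
      finally have "(\<Prod>i\<in>UNIV. wt Legendre (x $ i)) * h x \<le> (pi / 2) ^ CARD('d) * ((\<Prod>i\<in>UNIV. wt Chebyshev (x $ i)) * h x)"
        using h(2)[of x] by (simp add: mult_right_mono mult.assoc[symmetric])
      then have "ennreal ((\<Prod>i\<in>UNIV. wt Legendre (x $ i)) * h x) \<le> ennreal ((pi / 2) ^ CARD('d) * ((\<Prod>i\<in>UNIV. wt Chebyshev (x $ i)) * h x))"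
        by (rule ennreal_leI)
      moreover have "0 \<le> (\<Prod>i\<in>UNIV. wt Chebyshev (x $ i))"
        by (rule prod_nonneg) (use elim wt_nonneg[of _ Chebyshev] in \<open>auto simp: cube_def simp del: wt.simps\<close>)
      ultimately show ?case
        using h(2)[of x] by (simp add: ennreal_mult prod_nonneg)
    qed
  qed
  also have "\<dots> = ennreal ((pi / 2) ^ CARD('d)) * (\<integral>\<^sup>+x. ennreal (h x) \<partial>design_measure Chebyshev)"
  proof (subst nn_integral_cmult)
    show "(\<lambda>x. ennreal (\<Prod>i\<in>UNIV. wt Chebyshev (x $ i)) * ennreal (h x)) \<in> borel_measurable ?R"
      using wm[of Chebyshev] hm by simp
  qed (simp add: nn)
  also have "(\<integral>\<^sup>+x. ennreal (h x) \<partial>design_measure Chebyshev) = ennreal (\<integral>x. h x \<partial>design_measure Chebyshev)"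
    by (rule nn_integral_eq_integral) (use bdm_integrable[OF h(1)] h(2) in auto)
  finally have "ennreal (\<integral>x. h x \<partial>design_measure Legendre) \<le> ennreal ((pi / 2) ^ CARD('d) * (\<integral>x. h x \<partial>design_measure Chebyshev))"
    by (simp add: ennreal_mult')
  then show ?thesis using h(2) by (subst (asm) ennreal_le_iff) auto
qed

lemma trunc_err_legendre:
  fixes f :: "real ^ 'd::finite \<Rightarrow> real"
  assumes f: "continuous_on (cube Chebyshev) f"
  shows "trunc_err Legendre f k \<le> (pi / 2) ^ CARD('d) * trunc_err Chebyshev f k"
proof -
  have cc: "(cube Legendre :: (real ^ 'd) set) = cube Chebyshev" by (simp add: cube_def)
  let ?q = "lin Chebyshev (trunc_set k) (coef Chebyshev f)"
  obtain c' where c': "\<And>x. x \<in> cube Legendre \<Longrightarrow> ?q x = lin Legendre (trunc_set k) c' x"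
    using lin_chebyshev_legendre by blast
  have bl: "bdm Legendre f" and bc: "bdm Chebyshev f" using f by (auto intro!: bdm_continuous simp: cc)
  have "trunc_err Legendre f k \<le> (\<integral>x. (f x - lin Legendre (trunc_set k) c' x)\<^sup>2 \<partial>design_measure Legendre)"
    by (rule trunc_err_le[OF bl])
  also have "\<dots> = (\<integral>x. (f x - ?q x)\<^sup>2 \<partial>design_measure Legendre)"
    by (intro Bochner_Integration.integral_cong) (simp_all add: c')
  also have "\<dots> \<le> (pi / 2) ^ CARD('d) * (\<integral>x. (f x - ?q x)\<^sup>2 \<partial>design_measure Chebyshev)"
    by (rule legendre_le_chebyshev) (auto intro!: bdm_power2 bdm_diff bc bdm_lin)
  also have "(\<integral>x. (f x - ?q x)\<^sup>2 \<partial>design_measure Chebyshev) = trunc_err Chebyshev f k"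
    by (rule trunc_err_eq[OF bc])
  finally show ?thesis .
qed

subsection \<open>Smooth functions\<close>

lemma upd_add_axis: "y + r *\<^sub>R axis i 1 = upd y i (y $ i + r)"
  by (auto simp: cart_eq_iff upd_nth axis_def)

lemma norm_upd_diff: "norm (upd x i r - upd x i t) = \<bar>r - t\<bar>"
proof -
  have "upd x i r - upd x i t = (r - t) *\<^sub>R axis i 1"
    by (auto simp: cart_eq_iff upd_nth axis_def)
  then show ?thesis by simp
qed

definition pure_index :: "'d \<Rightarrow> nat \<Rightarrow> 'd \<Rightarrow> nat" where
  "pure_index i l = (\<lambda>_. 0)(i := l)"

lemma sum_pure_index [simp]: "(\<Sum>j\<in>UNIV. pure_index (i :: 'd::finite) l j) = l"
  by (simp add: pure_index_def fun_upd_def)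

lemma pure_index_Suc: "(pure_index i l)(i := Suc (pure_index i l i)) = pure_index i (Suc l)"
  by (simp add: pure_index_def)

lemma pure_index_0: "pure_index i 0 = (\<lambda>_. 0)"
  by (auto simp: pure_index_def)

text \<open>Restricts the family of partial derivatives to pure ones, \<open>D i l\<close> being the
  one of order l along coordinate i, and expresses steps along an axis by \<open>upd\<close>. In
  this form one-dimensional calculus applies.\<close>

lemma p_smooth_onD:
  fixes f :: "real ^ 'd::finite \<Rightarrow> real"
  assumes "p_smooth_on p X f"
  obtains m \<beta> D where "0 < \<beta>" "\<beta> \<le> 1" "p = real m + \<beta>"
    and "\<And>i x. x \<in> X \<Longrightarrow> D i 0 x = f x"
    and "\<And>i l x. l < m \<Longrightarrow> x \<in> X \<Longrightarrow>
      ((\<lambda>t. D i l (upd x i (x $ i + t))) has_real_derivative D i (Suc l) x) (at 0 within {t. upd x i (x $ i + t) \<in> X})"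
    and "\<And>i l. l \<le> m \<Longrightarrow> continuous_on X (D i l)"
    and "\<And>i. \<exists>\<gamma>>0. \<forall>x\<in>X. \<forall>y\<in>X. \<bar>D i m x - D i m y\<bar> \<le> \<gamma> * norm (x - y) powr \<beta>"
proof -
  from assms obtain m :: nat and \<beta> :: real and D :: "('d \<Rightarrow> nat) \<Rightarrow> real ^ 'd \<Rightarrow> real" where
    b: "0 < \<beta>" "\<beta> \<le> 1" "p = real m + \<beta>" and D0: "\<forall>x\<in>X. D (\<lambda>_. 0) x = f x"
    and D1: "\<forall>\<alpha> i. (\<Sum>j\<in>UNIV. \<alpha> j) < m \<longrightarrow>
           (\<forall>x\<in>X. ((\<lambda>t. D \<alpha> (x + t *\<^sub>R axis i 1)) has_real_derivative D (\<alpha>(i := Suc (\<alpha> i))) x)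
                     (at 0 within {t. x + t *\<^sub>R axis i 1 \<in> X}))"
    and D2: "\<forall>\<alpha>. (\<Sum>j\<in>UNIV. \<alpha> j) \<le> m \<longrightarrow> continuous_on X (D \<alpha>)"
    and D3: "\<forall>\<alpha>. (\<Sum>j\<in>UNIV. \<alpha> j) = m \<longrightarrow>
           (\<exists>\<gamma>>0. \<forall>x\<in>X. \<forall>x0\<in>X. \<bar>D \<alpha> x - D \<alpha> x0\<bar> \<le> \<gamma> * norm (x - x0) powr \<beta>)"
    unfolding p_smooth_on_def by (elim exE conjE) (rule that)
  define D' where "D' i l = D (pure_index i l)" for i l
  show ?thesis
  proof (rule that[of \<beta> m D'])
    show "D' i 0 x = f x" if "x \<in> X" for i x
      using D0 that by (simp add: D'_def pure_index_0)
    show "((\<lambda>t. D' i l (upd x i (x $ i + t))) has_real_derivative D' i (Suc l) x) (at 0 within {t. upd x i (x $ i + t) \<in> X})"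
      if "l < m" "x \<in> X" for i l x
      using D1[rule_format, of "pure_index i l" x i] that
      unfolding D'_def pure_index_Suc upd_add_axis by simp
    show "continuous_on X (D' i l)" if "l \<le> m" for i l
      using D2 that by (simp add: D'_def)
    show "\<exists>\<gamma>>0. \<forall>x\<in>X. \<forall>y\<in>X. \<bar>D' i m x - D' i m y\<bar> \<le> \<gamma> * norm (x - y) powr \<beta>" for i
      using D3[rule_format, of "pure_index i m"] by (simp add: D'_def)
  qed (rule b)+
qed

lemma periodic_lincomb: "periodic G \<Longrightarrow> periodic H \<Longrightarrow> periodic (\<lambda>x. a * G x + b * H x)"
  unfolding periodic_def by (auto intro!: continuous_intros)

lemma smooth_along_lincomb:
  "smooth_along \<beta> i m G \<Longrightarrow> smooth_along \<beta> i m H \<Longrightarrow> smooth_along \<beta> i m (\<lambda>x. a * G x + b * H x)"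
proof (induction m arbitrary: G H)
  case 0
  then obtain L1 L2 where L: "\<And>x r t. \<bar>r - t\<bar> \<le> 1 \<Longrightarrow> \<bar>G (upd x i r) - G (upd x i t)\<bar> \<le> L1 * \<bar>r - t\<bar> powr \<beta>"
     "\<And>x r t. \<bar>r - t\<bar> \<le> 1 \<Longrightarrow> \<bar>H (upd x i r) - H (upd x i t)\<bar> \<le> L2 * \<bar>r - t\<bar> powr \<beta>" by auto
  have "\<bar>(a * G (upd x i r) + b * H (upd x i r)) - (a * G (upd x i t) + b * H (upd x i t))\<bar> \<le> (\<bar>a\<bar> * L1 + \<bar>b\<bar> * L2) * \<bar>r - t\<bar> powr \<beta>"
    if "\<bar>r - t\<bar> \<le> 1" for x r t
  proof -
    have "\<bar>(a * G (upd x i r) + b * H (upd x i r)) - (a * G (upd x i t) + b * H (upd x i t))\<bar>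
        = \<bar>a * (G (upd x i r) - G (upd x i t)) + b * (H (upd x i r) - H (upd x i t))\<bar>"
      by (simp add: right_diff_distrib)
    also have "\<dots> \<le> \<bar>a\<bar> * \<bar>G (upd x i r) - G (upd x i t)\<bar> + \<bar>b\<bar> * \<bar>H (upd x i r) - H (upd x i t)\<bar>"
      using abs_triangle_ineq by (simp add: abs_mult[symmetric])
    also have "\<dots> \<le> \<bar>a\<bar> * (L1 * \<bar>r - t\<bar> powr \<beta>) + \<bar>b\<bar> * (L2 * \<bar>r - t\<bar> powr \<beta>)"
      by (intro add_mono mult_left_mono L that) auto
    finally show ?thesis by (simp add: distrib_right mult.assoc)
  qed
  moreover have "periodic (\<lambda>x. a * G x + b * H x)" using 0 by (intro periodic_lincomb) auto
  ultimately show ?case by auto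
next
  case (Suc m)
  then obtain G1 H1 where d: "\<And>x t. ((\<lambda>t. G (upd x i t)) has_real_derivative G1 (upd x i t)) (at t)"
      "\<And>x t. ((\<lambda>t. H (upd x i t)) has_real_derivative H1 (upd x i t)) (at t)"
    and s: "smooth_along \<beta> i m G1" "smooth_along \<beta> i m H1" by auto
  have "((\<lambda>t. a * G (upd x i t) + b * H (upd x i t)) has_real_derivative a * G1 (upd x i t) + b * H1 (upd x i t)) (at t)" for x t
    by (intro DERIV_add DERIV_cmult d)
  moreover have "periodic (\<lambda>x. a * G x + b * H x)" using Suc.prems by (intro periodic_lincomb) auto
  ultimately show ?case using Suc.IH[OF s]
    by (simp only: smooth_along.simps) (intro conjI exI[of _ "\<lambda>x. a * G1 x + b * H1 x"] allI, auto)
qed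

lemma smooth_periodic_smooth_along:
  fixes g :: "real ^ 'd::finite \<Rightarrow> real"
  assumes g: "p_smooth_on p UNIV g" and per: "\<And>x i. g (x + axis i 1) = g x"
  shows "\<exists>m \<beta>. 0 < \<beta> \<and> p = real m + \<beta> \<and> (\<forall>i. smooth_along \<beta> i m g)"
proof -
  obtain m \<beta> D where b: "0 < \<beta>" "\<beta> \<le> 1" "p = real m + \<beta>"
    and D0: "\<And>i x. x \<in> UNIV \<Longrightarrow> D i 0 x = g x"
    and D1: "\<And>i l x. l < m \<Longrightarrow> x \<in> UNIV \<Longrightarrow>
      ((\<lambda>t. D i l (upd x i (x $ i + t))) has_real_derivative D i (Suc l) x) (at 0 within {t. upd x i (x $ i + t) \<in> UNIV})"
    and D2: "\<And>i l. l \<le> m \<Longrightarrow> continuous_on UNIV (D i l)"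
    and D3: "\<And>i. \<exists>\<gamma>>0. \<forall>x\<in>UNIV. \<forall>y\<in>UNIV. \<bar>D i m x - D i m y\<bar> \<le> \<gamma> * norm (x - y) powr \<beta>"
    by (rule p_smooth_onD[OF g]) blast
  have d0: "((\<lambda>t. D i l (upd x i (x $ i + t))) has_real_derivative D i (Suc l) x) (at 0)" if "l < m" for i l x
    using D1[OF that, of x i] by simp
  have dt: "((\<lambda>t. D i l (upd x i t)) has_real_derivative D i (Suc l) (upd x i t)) (at t)" if "l < m" for i l x t
  proof -
    have "((\<lambda>r. D i l (upd x i (t + r))) has_real_derivative D i (Suc l) (upd x i t)) (at 0)"
      using d0[OF that, of i "upd x i t"] by (simp add: upd_nth)
    then show ?thesis
      using DERIV_shift[of "\<lambda>t. D i l (upd x i t)" "D i (Suc l) (upd x i t)" 0 t] by (simp add: add.commute)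
  qed
  \<comment> \<open>The derivatives inherit the period because derivatives are unique.\<close>
  have D_per: "D i l (x + axis j 1) = D i l x" if "l \<le> m" for i l j x
    using that
  proof (induction l arbitrary: x)
    case 0
    then show ?case by (simp add: D0 per)
  next
    case (Suc l)
    have sh: "upd (x + axis j 1) i ((x + axis j 1) $ i + t) = upd x i (x $ i + t) + axis j 1" for t
      by (auto simp: cart_eq_iff upd_nth)
    have "((\<lambda>t. D i l (upd (x + axis j 1) i ((x + axis j 1) $ i + t))) has_real_derivative D i (Suc l) (x + axis j 1)) (at 0)"
      by (rule d0) (use Suc.prems in simp)
    then have "((\<lambda>t. D i l (upd x i (x $ i + t))) has_real_derivative D i (Suc l) (x + axis j 1)) (at 0)"
      unfolding sh using Suc by simp
    moreover have "((\<lambda>t. D i l (upd x i (x $ i + t))) has_real_derivative D i (Suc l) x) (at 0)"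
      by (rule d0) (use Suc.prems in simp)
    ultimately show ?case by (rule DERIV_unique)
  qed
  have pD: "periodic (D i l)" if "l \<le> m" for i l
    unfolding periodic_def
  proof (intro conjI allI D2[OF that])
    fix j :: 'd and x :: "real ^ 'd" and t :: real
    have "upd x j (t + 1) = upd x j t + axis j 1"
      by (auto simp: cart_eq_iff upd_nth axis_def)
    then show "D i l (upd x j (t + 1)) = D i l (upd x j t)" by (simp add: D_per[OF that])
  qed
  \<comment> \<open>Induction on the number r of derivatives still to be taken, starting from the
    Hoelder condition at order m.\<close>
  have sm: "smooth_along \<beta> i r (D i (m - r))" if "r \<le> m" for i r
    using that
  proof (induction r)
    case 0
    obtain \<gamma> where "\<And>x y. \<bar>D i m x - D i m y\<bar> \<le> \<gamma> * norm (x - y) powr \<beta>" using D3[of i] by blast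
    then have "\<bar>D i m (upd x i r) - D i m (upd x i t)\<bar> \<le> \<gamma> * \<bar>r - t\<bar> powr \<beta>" for x r t
      using norm_upd_diff[of x i r t] by metis
    then show ?case using pD[of m i] by auto
  next
    case (Suc r)
    have e: "Suc (m - Suc r) = m - r" using Suc.prems by simp
    have "((\<lambda>t. D i (m - Suc r) (upd x i t)) has_real_derivative D i (m - r) (upd x i t)) (at t)" for x t
      using dt[of "m - Suc r" i x t] Suc.prems unfolding e by simp
    then show ?case using Suc pD[of "m - Suc r" i] by auto
  qed
  have "smooth_along \<beta> i m g" for i
  proof -
    have "D i 0 = g" using D0 by auto
    then show ?thesis using sm[of m i] by simp
  qed
  then show ?thesis using b by blast
qed

lemma lipschitz_of_derivative:
  fixes \<phi> :: "real \<Rightarrow> real"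
  assumes "\<And>t. (\<phi> has_real_derivative \<phi>' t) (at t)" "\<And>t. \<bar>\<phi>' t\<bar> \<le> B"
  shows "\<bar>\<phi> r - \<phi> t\<bar> \<le> B * \<bar>r - t\<bar>"
  using field_differentiable_bound[of UNIV \<phi> \<phi>' B r t] assms by simp

lemma le_powr_of_le_1: "0 \<le> u \<Longrightarrow> u \<le> 1 \<Longrightarrow> 0 < \<beta> \<Longrightarrow> \<beta> \<le> 1 \<Longrightarrow> u \<le> u powr (\<beta> :: real)"
  using powr_mono'[of \<beta> 1 u] by (cases "u = 0") auto

definition sin_cos_power :: "nat \<Rightarrow> nat \<Rightarrow> real \<Rightarrow> real" where
  "sin_cos_power a b t = sin (2 * pi * t) ^ a * cos (2 * pi * t) ^ b"

text \<open>For \<open>a = 0\<close> or \<open>b = 0\<close> the truncated subtraction in the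
  exponent is harmless, since the term carries the factor 0.\<close>

lemma sin_cos_power_derivative:
  "(sin_cos_power a b has_real_derivative
     2 * pi * real a * sin_cos_power (a - 1) (b + 1) t + - (2 * pi * real b) * sin_cos_power (a + 1) (b - 1) t) (at t)"
proof -
  have "((\<lambda>t. sin (2 * pi * t) ^ a * cos (2 * pi * t) ^ b) has_real_derivative
     (real a * sin (2 * pi * t) ^ (a - 1) * (cos (2 * pi * t) * (2 * pi))) * cos (2 * pi * t) ^ b
     + (real b * cos (2 * pi * t) ^ (b - 1) * (- sin (2 * pi * t) * (2 * pi))) * sin (2 * pi * t) ^ a) (at t)"
    by (rule DERIV_mult) (auto intro!: derivative_eq_intros)
  then show ?thesis
    unfolding sin_cos_power_def[abs_def] by (simp add: mult_ac)
qed

lemma sin_cos_power_bound: "\<bar>sin_cos_power a b t\<bar> \<le> 1"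
  unfolding sin_cos_power_def abs_mult power_abs
  by (intro mult_le_one power_le_one) auto

lemma sin_cos_power_lipschitz: "\<bar>sin_cos_power a b r - sin_cos_power a b t\<bar> \<le> 2 * pi * (real a + real b) * \<bar>r - t\<bar>"
proof (rule lipschitz_of_derivative[OF sin_cos_power_derivative])
  fix t
  have "\<bar>2 * pi * real a * sin_cos_power (a - 1) (b + 1) t\<bar> \<le> 2 * pi * real a * 1"
    unfolding abs_mult[of "2 * pi * real a"] by (intro mult_mono sin_cos_power_bound) auto
  moreover have "\<bar>- (2 * pi * real b) * sin_cos_power (a + 1) (b - 1) t\<bar> \<le> 2 * pi * real b * 1"
    unfolding abs_mult[of "- (2 * pi * real b)"] by (intro mult_mono sin_cos_power_bound) auto
  ultimately show "\<bar>2 * pi * real a * sin_cos_power (a - 1) (b + 1) t + - (2 * pi * real b) * sin_cos_power (a + 1) (b - 1) t\<bar> \<le> 2 * pi * (real a + real b)"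
    by (simp add: distrib_left)
qed

lemma periodic_sin_cos_power: "periodic (\<lambda>x. sin_cos_power a b (x $ i))"
proof -
  have "sin_cos_power a b (t + 1) = sin_cos_power a b t" for t
  proof -
    have "2 * pi * (t + 1) = 2 * pi * t + 2 * pi" by (simp add: distrib_left)
    then show ?thesis by (simp add: sin_cos_power_def)
  qed
  moreover have "continuous_on UNIV (\<lambda>x. sin_cos_power a b (x $ i))"
    unfolding sin_cos_power_def by (intro continuous_intros)
  ultimately show ?thesis unfolding periodic_def by (auto simp: upd_nth)
qed

text \<open>At the faces of the cube the derivatives of f are one-sided. The path
  \<open>cos (2 * pi * t)\<close> never leaves the interval, however, so the chain rule relative to
  the cube yields two-sided derivatives of the composition everywhere, each with a new sine as a
  factor.\<close>

lemma smooth_cosv_smooth_along: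
  fixes f :: "real ^ 'd::finite \<Rightarrow> real"
  assumes f: "p_smooth_on p (cube Chebyshev) f"
  shows "\<exists>m \<beta>. 0 < \<beta> \<and> p = real m + \<beta> \<and> (\<forall>i. smooth_along \<beta> i m (\<lambda>x. f (cosv x)))"
proof -
  let ?X = "cube Chebyshev :: (real ^ 'd) set"
  obtain m \<beta> D where b: "0 < \<beta>" "\<beta> \<le> 1" "p = real m + \<beta>"
    and D0: "\<And>i x. x \<in> ?X \<Longrightarrow> D i 0 x = f x"
    and D1: "\<And>i l x. l < m \<Longrightarrow> x \<in> ?X \<Longrightarrow>
      ((\<lambda>t. D i l (upd x i (x $ i + t))) has_real_derivative D i (Suc l) x) (at 0 within {t. upd x i (x $ i + t) \<in> ?X})"
    and D2: "\<And>i l. l \<le> m \<Longrightarrow> continuous_on ?X (D i l)"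
    and D3: "\<And>i. \<exists>\<gamma>>0. \<forall>x\<in>?X. \<forall>y\<in>?X. \<bar>D i m x - D i m y\<bar> \<le> \<gamma> * norm (x - y) powr \<beta>"
    by (rule p_smooth_onD[OF f]) blast
  have updX: "upd z i t \<in> ?X \<longleftrightarrow> t \<in> {-1..1}" if "z \<in> ?X" for z i t
    using that by (auto simp: cube_def upd_nth)
  \<comment> \<open>The given derivative is taken at 0 in the length of the step; translating by
    \<open>\<tau>\<close> turns it into one in the coordinate itself.\<close>
  have dw: "((\<lambda>r. D i l (upd z i r)) has_real_derivative D i (Suc l) (upd z i \<tau>)) (at \<tau> within {-1..1})"
    if "l < m" "z \<in> ?X" "\<tau> \<in> {-1..1}" for i l z \<tau>
  proof -
    define y where "y = upd z i \<tau>"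
    have y: "y \<in> ?X" unfolding y_def using updX[OF that(2)] that(3) by blast
    have yu: "upd y i v = upd z i v" "y $ i = \<tau>" for v by (simp_all add: y_def upd_nth)
    have im: "(\<lambda>r. r - \<tau>) ` {-1..1} = {t. upd y i (y $ i + t) \<in> ?X}"
      unfolding yu updX[OF that(2)] by (auto simp: image_iff intro!: bexI[of _ "\<tau> + _"])
    have "((\<lambda>t. D i l (upd y i (y $ i + t))) \<circ> (\<lambda>r. r - \<tau>) has_real_derivative D i (Suc l) y * 1) (at \<tau> within {-1..1})"
    proof (rule DERIV_image_chain)
      show "((\<lambda>t. D i l (upd y i (y $ i + t))) has_real_derivative D i (Suc l) y) (at (\<tau> - \<tau>) within (\<lambda>r. r - \<tau>) ` {-1..1})"
        unfolding im using D1[OF that(1) y, of i] by simp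
    qed (auto intro!: derivative_eq_intros)
    then show ?thesis by (simp add: o_def yu) (simp add: y_def)
  qed
  define H where "H i l x = D i l (cosv x)" for i l x
  have cH: "continuous_on UNIV (H i l)" if "l \<le> m" for i l
    unfolding H_def
    by (rule continuous_on_compose2[OF D2[OF that]])
       (auto simp: cosv_def cube_def intro!: continuous_on_vec_lambda continuous_intros)
  have pH: "periodic (H i l)" if "l \<le> m" for i l
  proof -
    have "cos (2 * pi * (t + 1)) = cos (2 * pi * t)" for t
    proof -
      have "2 * pi * (t + 1) = 2 * pi * t + 2 * pi" by (simp add: distrib_left)
      then show ?thesis by simp
    qed
    then show ?thesis using cH[OF that] unfolding periodic_def H_def cosv_upd by simp
  qed
  have dH: "((\<lambda>t. H i l (upd x i t)) has_real_derivative H i (Suc l) (upd x i t) * (- (sin (2 * pi * t) * (2 * pi)))) (at t)"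
    if "l < m" for i l x t
  proof -
    have "((\<lambda>r. D i l (upd (cosv x) i r)) \<circ> (\<lambda>t. cos (2 * pi * t)) has_real_derivative
        D i (Suc l) (upd (cosv x) i (cos (2 * pi * t))) * (- (sin (2 * pi * t) * (2 * pi)))) (at t)"
    proof (rule DERIV_image_chain)
      show "((\<lambda>r. D i l (upd (cosv x) i r)) has_real_derivative D i (Suc l) (upd (cosv x) i (cos (2 * pi * t))))
          (at (cos (2 * pi * t)) within range (\<lambda>t. cos (2 * pi * t)))"
        by (rule has_field_derivative_subset[OF dw[OF that cosv_cube]]) auto
    qed (auto intro!: derivative_eq_intros)
    then show ?thesis by (simp add: o_def H_def cosv_upd)
  qed
  have bH: "\<exists>B\<ge>0. \<forall>x. \<bar>H i l x\<bar> \<le> B" if "l \<le> m" for i l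
  proof -
    have "bdm Chebyshev (D i l)" by (rule bdm_continuous[OF D2[OF that]])
    then obtain B where "\<And>x. x \<in> ?X \<Longrightarrow> \<bar>D i l x\<bar> \<le> B" by (auto simp: bdm_def)
    then have "\<bar>H i l x\<bar> \<le> B" for x by (simp add: H_def)
    moreover have "0 \<le> B" using calculation[of 0] abs_ge_zero order_trans by blast
    ultimately show ?thesis by blast
  qed
  \<comment> \<open>At order m this is the Hoelder condition on f composed with the Lipschitz
    function cosine. Below m the function is Lipschitz, the next derivative being bounded, and steps
    of length at most 1 turn that into a Hoelder condition.\<close>
  have hH: "\<exists>L\<ge>0. \<forall>x r t. \<bar>r - t\<bar> \<le> 1 \<longrightarrow> \<bar>H i l (upd x i r) - H i l (upd x i t)\<bar> \<le> L * \<bar>r - t\<bar> powr \<beta>" if "l \<le> m" for i l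
  proof (cases "l = m")
    case True
    obtain \<gamma> where \<gamma>: "\<gamma> > 0" "\<And>x y. x \<in> ?X \<Longrightarrow> y \<in> ?X \<Longrightarrow> \<bar>D i m x - D i m y\<bar> \<le> \<gamma> * norm (x - y) powr \<beta>"
      using D3[of i] by blast
    have "\<bar>H i l (upd x i r) - H i l (upd x i t)\<bar> \<le> \<gamma> * (2 * pi) powr \<beta> * \<bar>r - t\<bar> powr \<beta>" for x r t
    proof -
      have c: "\<bar>cos (2 * pi * r) - cos (2 * pi * t)\<bar> \<le> 2 * pi * \<bar>r - t\<bar>"
      proof (rule lipschitz_of_derivative)
        show "((\<lambda>t. cos (2 * pi * t)) has_real_derivative - (sin (2 * pi * t) * (2 * pi))) (at t)" for t
          by (auto intro!: derivative_eq_intros)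
        show "\<bar>- (sin (2 * pi * t) * (2 * pi))\<bar> \<le> 2 * pi" for t
          using abs_sin_le_one[of "2 * pi * t"] by (simp add: abs_mult)
      qed
      have "\<bar>H i l (upd x i r) - H i l (upd x i t)\<bar> \<le> \<gamma> * norm (cosv (upd x i r) - cosv (upd x i t)) powr \<beta>"
        unfolding H_def True by (intro \<gamma>(2)) auto
      also have "norm (cosv (upd x i r) - cosv (upd x i t)) = \<bar>cos (2 * pi * r) - cos (2 * pi * t)\<bar>"
        unfolding cosv_upd by (rule norm_upd_diff)
      also have "\<gamma> * \<bar>cos (2 * pi * r) - cos (2 * pi * t)\<bar> powr \<beta> \<le> \<gamma> * (2 * pi * \<bar>r - t\<bar>) powr \<beta>"
        using \<gamma>(1) b(1) c by (intro mult_left_mono powr_mono2) auto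
      also have "(2 * pi * \<bar>r - t\<bar>) powr \<beta> = (2 * pi) powr \<beta> * \<bar>r - t\<bar> powr \<beta>"
        by (rule powr_mult)
      finally show ?thesis by simp
    qed
    then show ?thesis using \<gamma>(1) by (intro exI[of _ "\<gamma> * (2 * pi) powr \<beta>"]) simp
  next
    case False
    then have l: "l < m" "Suc l \<le> m" using that by auto
    obtain B where B: "B \<ge> 0" "\<And>x. \<bar>H i (Suc l) x\<bar> \<le> B" using bH[OF l(2)] by blast
    have "\<bar>H i l (upd x i r) - H i l (upd x i t)\<bar> \<le> B * (2 * pi) * \<bar>r - t\<bar> powr \<beta>" if rt: "\<bar>r - t\<bar> \<le> 1" for x r t
    proof -
      have "\<bar>H i l (upd x i r) - H i l (upd x i t)\<bar> \<le> B * (2 * pi) * \<bar>r - t\<bar>"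
      proof (rule lipschitz_of_derivative[OF dH[OF l(1)]])
        fix t
        have "\<bar>sin (2 * pi * t)\<bar> * (2 * pi) \<le> 1 * (2 * pi)" by (intro mult_right_mono) auto
        then show "\<bar>H i (Suc l) (upd x i t) * (- (sin (2 * pi * t) * (2 * pi)))\<bar> \<le> B * (2 * pi)"
          using mult_mono[OF B(2)[of "upd x i t"] _ B(1), of "\<bar>sin (2 * pi * t)\<bar> * (2 * pi)" "2 * pi"]
          by (simp add: abs_mult mult.assoc)
      qed
      also have "\<dots> \<le> B * (2 * pi) * \<bar>r - t\<bar> powr \<beta>"
        using B(1) rt b by (intro mult_left_mono le_powr_of_le_1) auto
      finally show ?thesis .
    qed
    then show ?thesis using B(1) by (intro exI[of _ "B * (2 * pi)"]) simp
  qed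
  \<comment> \<open>The derivatives of \<open>f \<circ> cosv\<close> along a coordinate are combinations of \<open>H i l\<close> with such
    trigonometric weights, a class which is closed under differentiation.\<close>
  have claim: "smooth_along \<beta> i r (\<lambda>x. sin_cos_power a b' (x $ i) * H i l x)" if "l + r \<le> m" for i r l a b'
    using that
  proof (induction r arbitrary: l a b')
    case 0
    then have l: "l \<le> m" by simp
    obtain B where B: "B \<ge> 0" "\<And>x. \<bar>H i l x\<bar> \<le> B" using bH[OF l] by blast
    obtain L where L: "L \<ge> 0" "\<And>x r t. \<bar>r - t\<bar> \<le> 1 \<Longrightarrow> \<bar>H i l (upd x i r) - H i l (upd x i t)\<bar> \<le> L * \<bar>r - t\<bar> powr \<beta>"
      using hH[OF l] by blast
    let ?w = "sin_cos_power a b'"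
    define c where "c = 2 * pi * (real a + real b')"
    have "\<bar>?w (upd x i r $ i) * H i l (upd x i r) - ?w (upd x i t $ i) * H i l (upd x i t)\<bar> \<le> (c * B + L) * \<bar>r - t\<bar> powr \<beta>"
      if rt: "\<bar>r - t\<bar> \<le> 1" for x r t
    proof -
      have "?w (upd x i r $ i) * H i l (upd x i r) - ?w (upd x i t $ i) * H i l (upd x i t)
          = (?w r - ?w t) * H i l (upd x i r) + ?w t * (H i l (upd x i r) - H i l (upd x i t))"
        by (simp add: upd_nth left_diff_distrib right_diff_distrib)
      also have "\<bar>\<dots>\<bar> \<le> \<bar>?w r - ?w t\<bar> * \<bar>H i l (upd x i r)\<bar> + \<bar>?w t\<bar> * \<bar>H i l (upd x i r) - H i l (upd x i t)\<bar>"
        using abs_triangle_ineq by (simp add: abs_mult[symmetric])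
      also have "\<dots> \<le> (c * \<bar>r - t\<bar>) * B + 1 * (L * \<bar>r - t\<bar> powr \<beta>)"
        unfolding c_def
        by (intro add_mono mult_mono sin_cos_power_lipschitz B sin_cos_power_bound L rt) auto
      also have "(c * \<bar>r - t\<bar>) * B \<le> (c * \<bar>r - t\<bar> powr \<beta>) * B"
        using B(1) rt b by (intro mult_right_mono mult_left_mono le_powr_of_le_1) (auto simp: c_def)
      finally show ?thesis by (simp add: distrib_right mult_ac)
    qed
    then show ?case
      using periodic_mult[OF periodic_sin_cos_power pH[OF l], of a b' i] by auto
  next
    case (Suc r)
    then have l: "l < m" "l \<le> m" "l + r \<le> m" "Suc l + r \<le> m" by auto
    define W where "W a b l x = sin_cos_power a b (x $ i) * H i l x" for a b l x
    \<comment> \<open>The product rule, nested so that two-term linear combinations apply; hence the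
      leading factor 1.\<close>
    define G1 where "G1 x = 1 * ((2 * pi * real a) * W (a - 1) (b' + 1) l x + (- (2 * pi * real b')) * W (a + 1) (b' - 1) l x)
        + (- (2 * pi)) * W (a + 1) b' (Suc l) x" for x
    have "smooth_along \<beta> i r G1"
      unfolding G1_def W_def by (intro smooth_along_lincomb Suc.IH l)
    moreover have "((\<lambda>t. sin_cos_power a b' (upd x i t $ i) * H i l (upd x i t)) has_real_derivative G1 (upd x i t)) (at t)" for x t
    proof -
      have w: "sin_cos_power (Suc a) b' t = sin (2 * pi * t) * sin_cos_power a b' t"
        by (simp add: sin_cos_power_def)
      have "((\<lambda>t. sin_cos_power a b' t * H i l (upd x i t)) has_real_derivative G1 (upd x i t)) (at t)"
        by (rule DERIV_cong[OF DERIV_mult[OF sin_cos_power_derivative dH[OF l(1)]]])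
          (unfold G1_def W_def upd_nth, simp add: w ring_distribs mult_ac)
      then show ?thesis by (simp add: upd_nth)
    qed
    moreover have "periodic (\<lambda>x. sin_cos_power a b' (x $ i) * H i l x)"
      by (rule periodic_mult[OF periodic_sin_cos_power pH[OF l(2)]])
    ultimately show ?case by auto
  qed
  have "smooth_along \<beta> i m (\<lambda>x. f (cosv x))" for i
    using claim[of 0 m i 0 0] by (simp add: sin_cos_power_def H_def D0)
  then show ?thesis using b by blast
qed

lemma target_class_continuous:
  fixes f :: "real ^ 'd::finite \<Rightarrow> real"
  assumes "target_class s p f"
  shows "continuous_on (cube s) f"
proof -
  have "p_smooth_on p (cube s) f" using assms by (simp add: target_class_def)
  then obtain D :: "'d \<Rightarrow> nat \<Rightarrow> real ^ 'd \<Rightarrow> real" and m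
    where D: "\<And>i x. x \<in> cube s \<Longrightarrow> D i 0 x = f x" "\<And>i l. l \<le> m \<Longrightarrow> continuous_on (cube s) (D i l)"
    by (rule p_smooth_onD) blast
  have "continuous_on (cube s) (D undefined 0)" by (rule D(2)) simp
  then show ?thesis using D(1) by (simp cong: continuous_on_cong)
qed

text \<open>The trigonometric estimate is in terms of half the degree, which costs the factor
  \<open>2 powr (2 * p)\<close>. The factor \<open>(pi / 2) ^ d\<close> in the Legendre case comes
  from the comparison of densities.\<close>

lemma trunc_err_target:
  fixes f :: "real ^ 'd::finite \<Rightarrow> real"
  assumes f: "target_class s p f"
  shows "\<exists>C\<ge>0. \<forall>k\<ge>2. (s = Trig \<longrightarrow> even k) \<longrightarrow> trunc_err s f k \<le> C * real k powr (- 2 * p)"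
proof (cases s)
  case Trigonometric
  obtain g where g: "p_smooth_on p UNIV g" "\<And>x i. g (x + axis i 1) = g x" "\<And>x. x \<in> cube s \<Longrightarrow> g x = f x"
    using f Trigonometric unfolding target_class_def by blast
  obtain m \<beta> where \<beta>: "0 < \<beta>" "p = real m + \<beta>" "\<And>i. smooth_along \<beta> i m g"
    using smooth_periodic_smooth_along[OF g(1,2)] by blast
  obtain C where C: "C \<ge> 0" "\<And>K. K \<ge> 1 \<Longrightarrow> trunc_err Trig g (2 * K) \<le> C * real K powr (- 2 * p)"
    using trunc_err_trig[OF \<beta>(1,3)] unfolding \<beta>(2) by blast
  have c: "coef s f = coef s g"
    unfolding coef_def[abs_def] by (intro ext Bochner_Integration.integral_cong) (simp_all add: g(3))
  have "(\<integral>x. (f x)\<^sup>2 \<partial>design_measure s) = (\<integral>x. (g x)\<^sup>2 \<partial>design_measure s)"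
    by (intro Bochner_Integration.integral_cong) (simp_all add: g(3))
  then have fg: "trunc_err s f k = trunc_err Trig g k" for k
    using c Trigonometric by (simp add: trunc_err_def)
  show ?thesis
  proof (intro exI[of _ "C * 2 powr (2 * p)"] conjI allI impI)
    fix k :: nat assume k: "2 \<le> k" and ev: "s = Trig \<longrightarrow> even k"
    then obtain K where K: "k = 2 * K" using Trigonometric by auto
    have "trunc_err s f k \<le> C * real K powr (- 2 * p)"
      unfolding fg K by (rule C(2)) (use k K in simp)
    also have "real K powr (- 2 * p) = 2 powr (2 * p) * real k powr (- 2 * p)"
      using k by (simp add: K powr_mult powr_minus field_simps)
    finally show "trunc_err s f k \<le> C * 2 powr (2 * p) * real k powr (- 2 * p)" by simp
  qed (use C(1) in simp)
next
  case Chebyshev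
  note cf = target_class_continuous[OF f, unfolded Chebyshev]
  obtain m \<beta> where \<beta>: "0 < \<beta>" "p = real m + \<beta>" "\<And>i. smooth_along \<beta> i m (\<lambda>x. f (cosv x))"
    using smooth_cosv_smooth_along[of p f] f Chebyshev by (auto simp: target_class_def)
  obtain C where C: "C \<ge> 0" "\<And>K. K \<ge> 1 \<Longrightarrow> trunc_err Trig (\<lambda>x. f (cosv x)) (2 * K) \<le> C * real K powr (- 2 * p)"
    using trunc_err_trig[OF \<beta>(1,3)] unfolding \<beta>(2) by blast
  show ?thesis
    using C unfolding Chebyshev trunc_err_chebyshev[OF cf] by (intro exI[of _ C]) auto
next
  case Legendre
  have cc: "(cube Legendre :: (real ^ 'd) set) = cube Chebyshev" by (simp add: cube_def)
  have cf: "continuous_on (cube Chebyshev) f"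
    using target_class_continuous[OF f] unfolding Legendre cc .
  obtain m \<beta> where \<beta>: "0 < \<beta>" "p = real m + \<beta>" "\<And>i. smooth_along \<beta> i m (\<lambda>x. f (cosv x))"
    using smooth_cosv_smooth_along[of p f] f Legendre by (auto simp: target_class_def cc)
  obtain C where C: "C \<ge> 0" "\<And>K. K \<ge> 1 \<Longrightarrow> trunc_err Trig (\<lambda>x. f (cosv x)) (2 * K) \<le> C * real K powr (- 2 * p)"
    using trunc_err_trig[OF \<beta>(1,3)] unfolding \<beta>(2) by blast
  show ?thesis
  proof (intro exI[of _ "(pi / 2) ^ CARD('d) * C"] conjI allI impI)
    fix k :: nat assume k: "2 \<le> k"
    have "trunc_err s f k \<le> (pi / 2) ^ CARD('d) * trunc_err Chebyshev f k"
      unfolding Legendre by (rule trunc_err_legendre[OF cf])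
    also have "\<dots> \<le> (pi / 2) ^ CARD('d) * (C * real k powr (- 2 * p))"
      unfolding trunc_err_chebyshev[OF cf] using k by (intro mult_left_mono C(2)) auto
    finally show "trunc_err s f k \<le> (pi / 2) ^ CARD('d) * C * real k powr (- 2 * p)" by simp
  qed (use C(1) in simp)
qed

section \<open>Risk of the estimators\<close>

lemma integral_pair_mult:
  fixes f :: "'a \<Rightarrow> real" and g :: "'b \<Rightarrow> real"
  assumes "prob_space M" "prob_space N" and f: "integrable M f" and g: "integrable N g"
  shows "integrable (M \<Otimes>\<^sub>M N) (\<lambda>z. f (fst z) * g (snd z))"
    and "(\<integral>z. f (fst z) * g (snd z) \<partial>(M \<Otimes>\<^sub>M N)) = (\<integral>x. f x \<partial>M) * (\<integral>y. g y \<partial>N)"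
proof -
  interpret M: prob_space M by fact
  interpret N: prob_space N by fact
  interpret pair_sigma_finite M N ..
  note [measurable] = borel_measurable_integrable[OF f] borel_measurable_integrable[OF g]
  show i: "integrable (M \<Otimes>\<^sub>M N) (\<lambda>z. f (fst z) * g (snd z))"
    by (rule Fubini_integrable) (use f g in \<open>auto simp: abs_mult\<close>)
  show "(\<integral>z. f (fst z) * g (snd z) \<partial>(M \<Otimes>\<^sub>M N)) = (\<integral>x. f x \<partial>M) * (\<integral>y. g y \<partial>N)"
    using integral_fst'[OF i] by simp
qed

lemma integral_PiM_component:
  fixes g :: "'a \<Rightarrow> real"
  assumes M: "prob_space M" and i: "i \<in> I" and g: "integrable M g"
  shows "integrable (\<Pi>\<^sub>M i\<in>I. M) (\<lambda>x. g (x i))" "(\<integral>x. g (x i) \<partial>(\<Pi>\<^sub>M i\<in>I. M)) = (\<integral>x. g x \<partial>M)"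
proof -
  have d: "distr (\<Pi>\<^sub>M i\<in>I. M) M (\<lambda>x. x i) = M"
    using distr_PiM_component[of I "\<lambda>_. M" i] M i by simp
  have m: "(\<lambda>x. x i) \<in> (\<Pi>\<^sub>M i\<in>I. M) \<rightarrow>\<^sub>M M" using i by (rule measurable_component_singleton)
  have gm: "g \<in> borel_measurable M" using g by (rule borel_measurable_integrable)
  show "integrable (\<Pi>\<^sub>M i\<in>I. M) (\<lambda>x. g (x i))"
    using g integrable_distr_eq[OF m gm] unfolding d by simp
  show "(\<integral>x. g (x i) \<partial>(\<Pi>\<^sub>M i\<in>I. M)) = (\<integral>x. g x \<partial>M)"
    using integral_distr[OF m gm] unfolding d by simp
qed

lemma integral_PiM_two_components:
  fixes a b :: "'a \<Rightarrow> real"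
  assumes M: "prob_space M" and I: "finite I" "i \<in> I" "j \<in> I" "i \<noteq> j" and a: "integrable M a" and b: "integrable M b"
  shows "integrable (\<Pi>\<^sub>M i\<in>I. M) (\<lambda>x. a (x i) * b (x j))"
    and "(\<integral>x. a (x i) * b (x j) \<partial>(\<Pi>\<^sub>M i\<in>I. M)) = (\<integral>x. a x \<partial>M) * (\<integral>x. b x \<partial>M)"
proof -
  interpret M: prob_space M by fact
  interpret product_sigma_finite "\<lambda>_. M" ..
  define f where "f l = (if l = i then a else if l = j then b else (\<lambda>_. 1))" for l
  have fi: "integrable M (f l)" for l unfolding f_def using a b by auto
  have p: "(\<Prod>l\<in>I. F l) = F i * F j" if "\<And>l. l \<in> I - {i, j} \<Longrightarrow> F l = 1" for F :: "_ \<Rightarrow> real"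
  proof -
    have "(\<Prod>l\<in>I. F l) = (\<Prod>l\<in>{i, j}. F l)"
      using I that by (intro prod.mono_neutral_right) auto
    then show ?thesis using I by simp
  qed
  have e: "(\<lambda>x. \<Prod>l\<in>I. f l (x l)) = (\<lambda>x. a (x i) * b (x j))"
    by (rule ext, subst p) (use I in \<open>auto simp: f_def\<close>)
  show "integrable (\<Pi>\<^sub>M i\<in>I. M) (\<lambda>x. a (x i) * b (x j))"
    using product_integrable_prod[of I f] fi I unfolding e by simp
  have "(\<integral>x. a (x i) * b (x j) \<partial>(\<Pi>\<^sub>M i\<in>I. M)) = (\<Prod>l\<in>I. integral\<^sup>L M (f l))"
    using product_integral_prod[of I f] fi I unfolding e by simp
  also have "\<dots> = (\<integral>x. a x \<partial>M) * (\<integral>x. b x \<partial>M)"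
    by (subst p) (use I in \<open>auto simp: f_def M.prob_space\<close>)
  finally show "(\<integral>x. a (x i) * b (x j) \<partial>(\<Pi>\<^sub>M i\<in>I. M)) = (\<integral>x. a x \<partial>M) * (\<integral>x. b x \<partial>M)" .
qed

lemma noise_law_facts:
  assumes "noise_law \<nu> \<sigma>2"
  shows "prob_space \<nu>" "sets \<nu> = sets borel" "integrable \<nu> (\<lambda>t. t)" "integrable \<nu> (\<lambda>t. t * t)"
    "(\<integral>t. t \<partial>\<nu>) = 0" "(\<integral>t. t * t \<partial>\<nu>) = \<sigma>2"
  using assms by (auto simp: noise_law_def power2_eq_square)

lemma prob_space_sample: "noise_law \<nu> \<sigma>2 \<Longrightarrow> prob_space (sample_measure s \<nu> n :: ((nat \<Rightarrow> real ^ 'd::finite) \<times> _) measure)"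
  unfolding sample_measure_def
  by (intro prob_space_pair prob_space_PiM) (auto simp: noise_law_facts(1) intro: prob_space_design)

lemma sample_design_measurable:
  assumes "i < n" and "g \<in> borel_measurable (design_measure s)"
  shows "(\<lambda>\<omega>. g (fst \<omega> i)) \<in> borel_measurable (sample_measure s \<nu> n)"
proof -
  have "(\<lambda>\<omega>. fst \<omega> i) \<in> sample_measure s \<nu> n \<rightarrow>\<^sub>M design_measure s"
    unfolding sample_measure_def
    by (rule measurable_compose[OF measurable_fst measurable_component_singleton]) (use assms in simp)
  from measurable_compose[OF this assms(2)] show ?thesis .
qed

lemma sample_noise_measurable:
  assumes "i < n" and "noise_law \<nu> \<sigma>2"
  shows "(\<lambda>\<omega>. snd \<omega> i) \<in> borel_measurable (sample_measure s \<nu> n)"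
proof -
  have "(\<lambda>\<omega>. snd \<omega> i) \<in> sample_measure s \<nu> n \<rightarrow>\<^sub>M \<nu>"
    unfolding sample_measure_def
    by (rule measurable_compose[OF measurable_snd measurable_component_singleton]) (use assms in simp)
  then show ?thesis using noise_law_facts(2)[OF assms(2)] measurable_cong_sets by blast
qed

text \<open>One formula for all second moments that occur: coefficient errors of the projection
  estimator (both functions present), residuals at design points (g = 0) and weighted noise (h = 0).
  Mixed terms vanish since the noise is centred and independent of the design.\<close>

lemma integral_sample_pair:
  fixes h g h' g' :: "real ^ 'd::finite \<Rightarrow> real"
  assumes nl: "noise_law \<nu> \<sigma>2" and ij: "i < n" "j < n"
    and b: "bdm s h" "bdm s g" "bdm s h'" "bdm s g'"
  defines "S \<equiv> sample_measure s \<nu> n"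
  shows "integrable S (\<lambda>\<omega>. (h (fst \<omega> i) + g (fst \<omega> i) * snd \<omega> i) * (h' (fst \<omega> j) + g' (fst \<omega> j) * snd \<omega> j))"
    and "(\<integral>\<omega>. (h (fst \<omega> i) + g (fst \<omega> i) * snd \<omega> i) * (h' (fst \<omega> j) + g' (fst \<omega> j) * snd \<omega> j) \<partial>S) =
      (if i = j then (\<integral>x. h x * h' x \<partial>design_measure s) + \<sigma>2 * (\<integral>x. g x * g' x \<partial>design_measure s)
       else (\<integral>x. h x \<partial>design_measure s) * (\<integral>x. h' x \<partial>design_measure s))"
proof -
  let ?M = "design_measure s :: (real ^ 'd) measure"
  let ?P = "\<Pi>\<^sub>M i\<in>{..<n}. ?M" and ?Q = "\<Pi>\<^sub>M i\<in>{..<n}. \<nu>"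
  note nf = noise_law_facts[OF nl]
  interpret P: prob_space ?P by (intro prob_space_PiM prob_space_design)
  interpret Q: prob_space ?Q by (intro prob_space_PiM nf)
  note PQ = P.prob_space_axioms Q.prob_space_axioms
  have X: "integrable ?P (\<lambda>x. u (x i) * v (x j)) \<and> (\<integral>x. u (x i) * v (x j) \<partial>?P) =
      (if i = j then (\<integral>x. u x * v x \<partial>?M) else (\<integral>x. u x \<partial>?M) * (\<integral>x. v x \<partial>?M))"
    if "bdm s u" "bdm s v" for u v
  proof (cases "i = j")
    case True
    then show ?thesis
      using integral_PiM_component[OF prob_space_design[of s], of i "{..<n}" "\<lambda>x. u x * v x"] ij bdm_integrable[OF bdm_mult[OF that]] by simp
  next
    case False
    then show ?thesis
      using integral_PiM_two_components[OF prob_space_design[of s] finite_lessThan, of i n j u v] ij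
        bdm_integrable[OF that(1)] bdm_integrable[OF that(2)] by simp
  qed
  have E1: "integrable ?Q (\<lambda>e. e l) \<and> (\<integral>e. e l \<partial>?Q) = 0" if "l < n" for l
    using integral_PiM_component[OF nf(1), of l "{..<n}" "\<lambda>t. t"] nf that by simp
  have E2: "integrable ?Q (\<lambda>e. e i * e j) \<and> (\<integral>e. e i * e j \<partial>?Q) = (if i = j then \<sigma>2 else 0)"
  proof (cases "i = j")
    case True
    then show ?thesis using integral_PiM_component[OF nf(1), of i "{..<n}" "\<lambda>t. t * t"] nf ij by simp
  next
    case False
    then show ?thesis using integral_PiM_two_components[OF nf(1) finite_lessThan, of i n j "\<lambda>t. t" "\<lambda>t. t"] nf ij by simp
  qed
  note X1 = X[THEN conjunct1] and X2 = X[THEN conjunct2]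
  note A = integral_pair_mult[OF PQ X1[OF b(1,3)] Q.integrable_const[of 1]]
  note B = integral_pair_mult[OF PQ X1[OF b(1,4)] E1[OF ij(2), THEN conjunct1]]
  note C = integral_pair_mult[OF PQ X1[OF b(2,3)] E1[OF ij(1), THEN conjunct1]]
  note D = integral_pair_mult[OF PQ X1[OF b(2,4)] E2[THEN conjunct1]]
  have e: "(\<lambda>\<omega>. (h (fst \<omega> i) + g (fst \<omega> i) * snd \<omega> i) * (h' (fst \<omega> j) + g' (fst \<omega> j) * snd \<omega> j)) =
    (\<lambda>\<omega>. ((h (fst \<omega> i) * h' (fst \<omega> j) * 1 + h (fst \<omega> i) * g' (fst \<omega> j) * snd \<omega> j) + g (fst \<omega> i) * h' (fst \<omega> j) * snd \<omega> i)
       + g (fst \<omega> i) * g' (fst \<omega> j) * (snd \<omega> i * snd \<omega> j))"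
    by (rule ext) (simp add: algebra_simps)
  note AB = Bochner_Integration.integrable_add[OF A(1) B(1)]
  note ABC = Bochner_Integration.integrable_add[OF AB C(1)]
  show "integrable S (\<lambda>\<omega>. (h (fst \<omega> i) + g (fst \<omega> i) * snd \<omega> i) * (h' (fst \<omega> j) + g' (fst \<omega> j) * snd \<omega> j))"
    unfolding S_def sample_measure_def e by (intro Bochner_Integration.integrable_add[OF ABC D(1)])
  show "(\<integral>\<omega>. (h (fst \<omega> i) + g (fst \<omega> i) * snd \<omega> i) * (h' (fst \<omega> j) + g' (fst \<omega> j) * snd \<omega> j) \<partial>S) =
      (if i = j then (\<integral>x. h x * h' x \<partial>?M) + \<sigma>2 * (\<integral>x. g x * g' x \<partial>?M)
       else (\<integral>x. h x \<partial>?M) * (\<integral>x. h' x \<partial>?M))"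
    unfolding S_def sample_measure_def e
    unfolding Bochner_Integration.integral_add[OF ABC D(1)] Bochner_Integration.integral_add[OF AB C(1)] Bochner_Integration.integral_add[OF A(1) B(1)]
      A(2) B(2) C(2) D(2) X2[OF b(1,3)] X2[OF b(2,4)]
    using E1[OF ij(1)] E1[OF ij(2)] E2 Q.prob_space by simp
qed

text \<open>With h centred, the contributions of different observations are uncorrelated, so only
  the diagonal of the double sum remains.\<close>

lemma integral_sample_sum_square:
  fixes h g :: "real ^ 'd::finite \<Rightarrow> real"
  assumes nl: "noise_law \<nu> \<sigma>2" and b: "bdm s h" "bdm s g" and c: "(\<integral>x. h x \<partial>design_measure s) = 0"
  shows "integrable (sample_measure s \<nu> n) (\<lambda>\<omega>. (\<Sum>i<n. h (fst \<omega> i) + g (fst \<omega> i) * snd \<omega> i)\<^sup>2)"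
    and "(\<integral>\<omega>. (\<Sum>i<n. h (fst \<omega> i) + g (fst \<omega> i) * snd \<omega> i)\<^sup>2 \<partial>sample_measure s \<nu> n) =
      real n * ((\<integral>x. (h x)\<^sup>2 \<partial>design_measure s) + \<sigma>2 * (\<integral>x. (g x)\<^sup>2 \<partial>design_measure s))"
proof -
  let ?Z = "\<lambda>i \<omega>. h (fst \<omega> i) + g (fst \<omega> i) * snd \<omega> i"
  have e: "(\<lambda>\<omega>. (\<Sum>i<n. ?Z i \<omega>)\<^sup>2) = (\<lambda>\<omega>. \<Sum>i<n. \<Sum>j<n. ?Z i \<omega> * ?Z j \<omega>)"
    by (simp add: power2_eq_square sum_product)
  note I = integral_sample_pair[OF nl _ _ b b]
  show "integrable (sample_measure s \<nu> n) (\<lambda>\<omega>. (\<Sum>i<n. ?Z i \<omega>)\<^sup>2)"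
    unfolding e by (intro Bochner_Integration.integrable_sum I) auto
  have "(\<integral>\<omega>. (\<Sum>i<n. ?Z i \<omega>)\<^sup>2 \<partial>sample_measure s \<nu> n) = (\<Sum>i<n. \<Sum>j<n. \<integral>\<omega>. ?Z i \<omega> * ?Z j \<omega> \<partial>sample_measure s \<nu> n)"
    unfolding e by (subst Bochner_Integration.integral_sum, (intro Bochner_Integration.integrable_sum I; simp))
      (intro sum.cong refl Bochner_Integration.integral_sum I; simp)
  also have "\<dots> = (\<Sum>i<n. \<Sum>j<n. if i = j then (\<integral>x. h x * h x \<partial>design_measure s) + \<sigma>2 * (\<integral>x. g x * g x \<partial>design_measure s) else 0)"
    by (intro sum.cong refl) (subst I(2), auto simp: c)
  also have "\<dots> = real n * ((\<integral>x. h x * h x \<partial>design_measure s) + \<sigma>2 * (\<integral>x. g x * g x \<partial>design_measure s))"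
    by (simp add: sum.delta)
  finally show "(\<integral>\<omega>. (\<Sum>i<n. ?Z i \<omega>)\<^sup>2 \<partial>sample_measure s \<nu> n) =
      real n * ((\<integral>x. (h x)\<^sup>2 \<partial>design_measure s) + \<sigma>2 * (\<integral>x. (g x)\<^sup>2 \<partial>design_measure s))"
    by (simp add: power2_eq_square)
qed

section \<open>Estimators as families of coefficients\<close>

lemma bij_trunc_enum:
  "bij_betw (trunc_enum k) {..<card (trunc_set k :: ('d::finite \<Rightarrow> nat) set)} (trunc_set k :: ('d \<Rightarrow> nat) set)"
  unfolding trunc_enum_def by (rule bij_betw_from_nat_into_finite) simp

lemma trunc_enum_in: "j < card (trunc_set k :: ('d::finite \<Rightarrow> nat) set) \<Longrightarrow> (trunc_enum k j :: 'd \<Rightarrow> nat) \<in> trunc_set k"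
  using bij_trunc_enum bij_betwE by blast

text \<open>Translates positions in a vector back into multi-indices, so that the approximation
  becomes an expansion and the enumeration disappears from view.\<close>

definition coef_of :: "nat \<Rightarrow> real Matrix.vec \<Rightarrow> ('d::finite \<Rightarrow> nat) \<Rightarrow> real" where
  "coef_of k v \<alpha> = vec_index v (inv_into {..<card (trunc_set k :: ('d \<Rightarrow> nat) set)} (trunc_enum k) \<alpha>)"

lemma coef_of_enum:
  assumes "j < card (trunc_set k :: ('d::finite \<Rightarrow> nat) set)"
  shows "coef_of k v (trunc_enum k j :: 'd \<Rightarrow> nat) = vec_index v j"
  unfolding coef_of_def using bij_trunc_enum[where 'd='d, of k] assms by (simp add: bij_betw_def)

lemma sum_trunc_enum:
  "(\<Sum>j<card (trunc_set k :: ('d::finite \<Rightarrow> nat) set). h (trunc_enum k j)) = (\<Sum>\<alpha>\<in>(trunc_set k :: ('d \<Rightarrow> nat) set). h \<alpha>)"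
  by (rule sum.reindex_bij_betw[OF bij_trunc_enum])

lemma trunc_set_cases:
  assumes "\<alpha> \<in> (trunc_set k :: ('d::finite \<Rightarrow> nat) set)"
  obtains j where "j < card (trunc_set k :: ('d \<Rightarrow> nat) set)" "\<alpha> = trunc_enum k j"
  using assms bij_trunc_enum[where 'd='d, of k] by (auto simp: bij_betw_def)

lemma sum_vec_index_eq_lin:
  "(\<Sum>j<card (trunc_set k :: ('d::finite \<Rightarrow> nat) set). vec_index v j * Psi s (trunc_enum k j) z) = lin s (trunc_set k :: ('d \<Rightarrow> nat) set) (coef_of k v) z"
proof -
  have "lin s (trunc_set k :: ('d \<Rightarrow> nat) set) (coef_of k v) z =
      (\<Sum>j<card (trunc_set k :: ('d \<Rightarrow> nat) set). coef_of k v (trunc_enum k j :: 'd \<Rightarrow> nat) * Psi s (trunc_enum k j) z)"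
    unfolding lin_def by (rule sum_trunc_enum[symmetric])
  also have "\<dots> = (\<Sum>j<card (trunc_set k :: ('d \<Rightarrow> nat) set). vec_index v j * Psi s (trunc_enum k j) z)"
    by (intro sum.cong refl) (simp add: coef_of_enum)
  finally show ?thesis by simp
qed

definition est_coef ::
  "setting \<Rightarrow> coef_estimator \<Rightarrow> (real ^ 'd \<Rightarrow> real) \<Rightarrow> nat \<Rightarrow> nat
     \<Rightarrow> (nat \<Rightarrow> real ^ 'd) \<times> (nat \<Rightarrow> real) \<Rightarrow> ('d::finite \<Rightarrow> nat) \<Rightarrow> real" where
  "est_coef s est f k n \<omega> = coef_of k (est (Phi s k n (fst \<omega>)) (observations f n (fst \<omega>) (snd \<omega>)))"

lemma fhat_eq_lin: "fhat s est f k n \<omega> = lin s (trunc_set k) (est_coef s est f k n \<omega>)"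
  unfolding fhat_def est_coef_def Let_def case_prod_beta sum_vec_index_eq_lin ..

lemma Phi_carrier: "Phi s k n (x :: nat \<Rightarrow> real ^ 'd::finite) \<in> carrier_mat n (card (trunc_set k :: ('d \<Rightarrow> nat) set))"
  by (simp add: Phi_def)

lemma Phi_index:
  "i < n \<Longrightarrow> j < card (trunc_set k :: ('d \<Rightarrow> nat) set) \<Longrightarrow> Phi s k n (x :: nat \<Rightarrow> real ^ 'd::finite) $$ (i, j) = Psi s (trunc_enum k j) (x i)"
  by (simp add: Phi_def)

lemma observations_carrier: "observations f n x \<eta> \<in> carrier_vec n"
  by (simp add: observations_def)

lemma Phi_mult_vec:
  fixes x :: "nat \<Rightarrow> real ^ 'd::finite"
  assumes v: "v \<in> carrier_vec (card (trunc_set k :: ('d \<Rightarrow> nat) set))" and i: "i < n"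
  shows "vec_index (Phi s k n x *\<^sub>v v) i = lin s (trunc_set k) (coef_of k v) (x i)"
proof -
  have "vec_index (Phi s k n x *\<^sub>v v) i = (\<Sum>j<card (trunc_set k :: ('d \<Rightarrow> nat) set). Phi s k n x $$ (i, j) * vec_index v j)"
    using v i Phi_carrier[of s k n x] by (auto simp: scalar_prod_def lessThan_atLeast0)
  also have "\<dots> = (\<Sum>j<card (trunc_set k :: ('d \<Rightarrow> nat) set). vec_index v j * Psi s (trunc_enum k j) (x i))"
    using i by (intro sum.cong refl) (simp add: Phi_index)
  finally show ?thesis unfolding sum_vec_index_eq_lin .
qed

lemma Phi_transpose_mult_vec:
  fixes x :: "nat \<Rightarrow> real ^ 'd::finite"
  assumes j: "j < card (trunc_set k :: ('d \<Rightarrow> nat) set)"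
  shows "vec_index (transpose_mat (Phi s k n x) *\<^sub>v observations f n x \<eta>) j =
    (\<Sum>i<n. Psi s (trunc_enum k j) (x i) * (f (x i) + \<eta> i))"
  using j Phi_carrier[of s k n x] by (auto simp: scalar_prod_def lessThan_atLeast0 observations_def Phi_index intro!: sum.cong)

lemma est_coef_projection:
  fixes f :: "real ^ 'd::finite \<Rightarrow> real"
  assumes "\<alpha> \<in> trunc_set k"
  shows "est_coef s projection f k n \<omega> \<alpha> = (\<Sum>i<n. Psi s \<alpha> (fst \<omega> i) * (f (fst \<omega> i) + snd \<omega> i)) / real n"
proof -
  obtain j where j: "j < card (trunc_set k :: ('d \<Rightarrow> nat) set)" "\<alpha> = trunc_enum k j"
    using assms by (rule trunc_set_cases)
  have r: "dim_row (Phi s k n (fst \<omega>)) = n" using Phi_carrier[of s k n "fst \<omega>"] by auto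
  have d: "j < dim_vec (transpose_mat (Phi s k n (fst \<omega>)) *\<^sub>v observations f n (fst \<omega>) (snd \<omega>))"
    using j Phi_carrier[of s k n "fst \<omega>"] by simp
  show ?thesis
    unfolding est_coef_def j(2) coef_of_enum[OF j(1)] projection_def index_smult_vec(1)[OF d] Phi_transpose_mult_vec[OF j(1)] r by simp
qed

section \<open>Measurability of the estimators and the normal equations\<close>

lemma det_measurable:
  fixes A :: "'a \<Rightarrow> real Matrix.mat"
  assumes c: "\<And>\<omega>. A \<omega> \<in> carrier_mat N N"
    and m: "\<And>i j. i < N \<Longrightarrow> j < N \<Longrightarrow> (\<lambda>\<omega>. A \<omega> $$ (i, j)) \<in> borel_measurable M"
  shows "(\<lambda>\<omega>. Determinant.det (A \<omega>)) \<in> borel_measurable M"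
proof -
  have "(\<lambda>\<omega>. \<Sum>p \<in> {p. p permutes {0 ..< N}}. signof p * (\<Prod> i = 0 ..< N. A \<omega> $$ (i, p i))) \<in> borel_measurable M"
  proof (intro borel_measurable_sum borel_measurable_times borel_measurable_const borel_measurable_prod m)
    fix p i assume "p \<in> {p. p permutes {0..<N}}" "i \<in> {0..<N}"
    then show "p i < N" using permutes_in_image[of p "{0..<N}" i] by simp
  qed simp
  then show ?thesis unfolding det_def'[OF c] .
qed

lemma cofactor_measurable:
  fixes A :: "'a \<Rightarrow> real Matrix.mat"
  assumes c: "\<And>\<omega>. A \<omega> \<in> carrier_mat N N"
    and m: "\<And>i j. i < N \<Longrightarrow> j < N \<Longrightarrow> (\<lambda>\<omega>. A \<omega> $$ (i, j)) \<in> borel_measurable M"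
  shows "(\<lambda>\<omega>. cofactor (A \<omega>) a b) \<in> borel_measurable M"
  unfolding cofactor_def
proof (intro borel_measurable_times borel_measurable_const det_measurable[of _ "N - 1"] mat_delete_carrier c)
  fix i j assume ij: "i < N - 1" "j < N - 1"
  then have e: "(\<lambda>\<omega>. mat_delete (A \<omega>) a b $$ (i, j)) = (\<lambda>\<omega>. A \<omega> $$ (if i < a then i else Suc i, if j < b then j else Suc j))"
    using c by (intro ext) (auto simp: mat_delete_def carrier_matD[OF c])
  show "(\<lambda>\<omega>. mat_delete (A \<omega>) a b $$ (i, j)) \<in> borel_measurable M"
    unfolding e by (intro m) (use ij in auto)
qed

text \<open>\<open>mat_inverse\<close> is the outcome of an elimination procedure. Solving through
  the adjugate, as in Cramer's rule, exhibits each coefficient as a quotient of polynomials in the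
  data, from which measurability follows; the normal equations serve the error analysis.\<close>

lemma least_squares_solution:
  fixes A :: "real Matrix.mat"
  assumes A: "A \<in> carrier_mat n N" and y: "y \<in> carrier_vec n" and d: "Determinant.det (transpose_mat A * A) \<noteq> 0"
  shows "least_squares A y \<in> carrier_vec N"
    and "(transpose_mat A * A) *\<^sub>v least_squares A y = transpose_mat A *\<^sub>v y"
    and "j < N \<Longrightarrow> vec_index (least_squares A y) j =
      (\<Sum>l<N. cofactor (transpose_mat A * A) l j * vec_index (transpose_mat A *\<^sub>v y) l) / Determinant.det (transpose_mat A * A)"
proof -
  define G where "G = transpose_mat A * A"
  define b where "b = transpose_mat A *\<^sub>v y"
  have G: "G \<in> carrier_mat N N" and b: "b \<in> carrier_vec N" using A y by (auto simp: G_def b_def)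
  have "G \<in> Units (ring_mat TYPE(real) N ())" using det_non_zero_imp_unit[OF G] d by (simp add: G_def)
  then obtain B where B: "mat_inverse G = Some B" using mat_inverse(1)[OF G, of "()"] by (cases "mat_inverse G") auto
  then have inv: "G * B = 1\<^sub>m N" "B * G = 1\<^sub>m N" "B \<in> carrier_mat N N" using mat_inverse(2)[OF G B] by auto
  have ls: "least_squares A y = B *\<^sub>v b"
    using d B by (simp add: least_squares_def G_def b_def Let_def)
  show 1: "least_squares A y \<in> carrier_vec N" unfolding ls using inv b by simp
  have Gls: "G *\<^sub>v least_squares A y = b"
    unfolding ls using assoc_mult_mat_vec[OF G inv(3) b] inv b by simp
  then show "(transpose_mat A * A) *\<^sub>v least_squares A y = transpose_mat A *\<^sub>v y" by (simp add: G_def b_def)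
  show "vec_index (least_squares A y) j =
      (\<Sum>l<N. cofactor (transpose_mat A * A) l j * vec_index (transpose_mat A *\<^sub>v y) l) / Determinant.det (transpose_mat A * A)"
    if j: "j < N"
  proof -
    have "adj_mat G *\<^sub>v b = (adj_mat G * G) *\<^sub>v least_squares A y"
      unfolding Gls[symmetric] using assoc_mult_mat_vec[OF adj_mat(1)[OF G] G 1] by simp
    also have "\<dots> = Determinant.det G \<cdot>\<^sub>v least_squares A y"
      unfolding adj_mat(3)[OF G] using 1 by (intro eq_vecI) (auto simp: row_smult)
    finally have "vec_index (adj_mat G *\<^sub>v b) j = Determinant.det G * vec_index (least_squares A y) j"
      using 1 j by simp
    moreover have "vec_index (adj_mat G *\<^sub>v b) j = (\<Sum>l<N. cofactor G l j * vec_index b l)"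
      using G b j by (auto simp: adj_mat_def scalar_prod_def lessThan_atLeast0)
    ultimately show ?thesis using d by (simp add: G_def b_def field_simps)
  qed
qed

lemma borel_measurable_Psi: "Psi s \<alpha> \<in> borel_measurable (design_measure s)"
  by (rule bdm_measurable[OF bdm_Psi])

lemma est_coef_projection_measurable:
  fixes f :: "real ^ 'd::finite \<Rightarrow> real"
  assumes nl: "noise_law \<nu> \<sigma>2" and f: "f \<in> borel_measurable (design_measure s)" and \<alpha>: "\<alpha> \<in> trunc_set k"
  shows "(\<lambda>\<omega>. est_coef s projection f k n \<omega> \<alpha>) \<in> borel_measurable (sample_measure s \<nu> n)"
  unfolding est_coef_projection[OF \<alpha>]
  by (intro borel_measurable_divide borel_measurable_sum borel_measurable_times borel_measurable_add borel_measurable_const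
      sample_design_measurable[OF _ f] sample_design_measurable[OF _ borel_measurable_Psi] sample_noise_measurable[OF _ nl]) auto

lemma est_coef_least_squares_measurable:
  fixes f :: "real ^ 'd::finite \<Rightarrow> real"
  assumes nl: "noise_law \<nu> \<sigma>2" and f: "f \<in> borel_measurable (design_measure s)" and \<alpha>: "\<alpha> \<in> trunc_set k"
  shows "(\<lambda>\<omega>. est_coef s least_squares f k n \<omega> \<alpha>) \<in> borel_measurable (sample_measure s \<nu> n)"
proof -
  let ?N = "card (trunc_set k :: ('d \<Rightarrow> nat) set)" and ?S = "sample_measure s \<nu> n"
  obtain j where j: "j < ?N" "\<alpha> = trunc_enum k j" using \<alpha> by (rule trunc_set_cases)
  define G where "G \<omega> = transpose_mat (Phi s k n (fst \<omega>)) * Phi s k n (fst \<omega>)" for \<omega> :: "(nat \<Rightarrow> real ^ 'd) \<times> (nat \<Rightarrow> real)"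
  have G: "G \<omega> \<in> carrier_mat ?N ?N" for \<omega> unfolding G_def using Phi_carrier[of s k n "fst \<omega>"] by auto
  have Gi: "(\<lambda>\<omega>. G \<omega> $$ (a, b)) \<in> borel_measurable ?S" if ab: "a < ?N" "b < ?N" for a b
  proof -
    have "G \<omega> $$ (a, b) = (\<Sum>i<n. Psi s (trunc_enum k a) (fst \<omega> i) * Psi s (trunc_enum k b) (fst \<omega> i))" for \<omega>
      unfolding G_def using ab Phi_carrier[of s k n "fst \<omega>"]
      by (auto simp: scalar_prod_def lessThan_atLeast0 Phi_index intro!: sum.cong)
    then show ?thesis
      by (simp only:) (intro borel_measurable_sum borel_measurable_times sample_design_measurable[OF _ borel_measurable_Psi]; simp)
  qed
  define b where "b \<omega> l = (\<Sum>i<n. Psi s (trunc_enum k l) (fst \<omega> i) * (f (fst \<omega> i) + snd \<omega> i))" for \<omega> :: "(nat \<Rightarrow> real ^ 'd) \<times> (nat \<Rightarrow> real)" and l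
  have b: "(\<lambda>\<omega>. b \<omega> l) \<in> borel_measurable ?S" for l
    unfolding b_def
    by (intro borel_measurable_sum borel_measurable_times borel_measurable_add
      sample_design_measurable[OF _ f] sample_design_measurable[OF _ borel_measurable_Psi] sample_noise_measurable[OF _ nl]) auto
  have e: "est_coef s least_squares f k n \<omega> \<alpha> =
      (if Determinant.det (G \<omega>) = 0 then 0 else (\<Sum>l<?N. cofactor (G \<omega>) l j * b \<omega> l) / Determinant.det (G \<omega>))" for \<omega>
  proof (cases "Determinant.det (G \<omega>) = 0")
    case True
    then have "est_coef s least_squares f k n \<omega> \<alpha> = vec_index (0\<^sub>v ?N) j"
      unfolding est_coef_def j(2) coef_of_enum[OF j(1)] using Phi_carrier[of s k n "fst \<omega>"]
      by (simp add: least_squares_def G_def)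
    then show ?thesis using True j by simp
  next
    case False
    have "est_coef s least_squares f k n \<omega> \<alpha> = (\<Sum>l<?N. cofactor (G \<omega>) l j *
        vec_index (transpose_mat (Phi s k n (fst \<omega>)) *\<^sub>v observations f n (fst \<omega>) (snd \<omega>)) l) / Determinant.det (G \<omega>)"
      unfolding est_coef_def j(2) coef_of_enum[OF j(1)] G_def
      by (rule least_squares_solution(3)[OF Phi_carrier observations_carrier _ j(1)]) (use False in \<open>simp add: G_def\<close>)
    also have "\<dots> = (\<Sum>l<?N. cofactor (G \<omega>) l j * b \<omega> l) / Determinant.det (G \<omega>)"
      by (intro arg_cong2[where f="(/)"] sum.cong refl) (simp add: Phi_transpose_mult_vec b_def)
    finally show ?thesis using False by simp
  qed
  note [measurable] = det_measurable[OF G Gi] cofactor_measurable[OF G Gi] b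
  show ?thesis unfolding e by measurable
qed

text \<open>A vector in the kernel of the Gram matrix has empirical norm 0, so on a good design it
  vanishes. Hence the determinant is nonzero, the default value is not taken, and the normal
  equations can be tested against any expansion \<open>c\<close>.\<close>

lemma least_squares_normal:
  fixes f :: "real ^ 'd::finite \<Rightarrow> real"
  assumes good: "good_design s k n (fst \<omega>)" and n: "n \<ge> 1"
  shows "(\<Sum>i<n. lin s (trunc_set k) c (fst \<omega> i) *
    (f (fst \<omega> i) + snd \<omega> i - lin s (trunc_set k) (est_coef s least_squares f k n \<omega>) (fst \<omega> i))) = 0"
proof -
  let ?N = "card (trunc_set k :: ('d \<Rightarrow> nat) set)"
  define A where "A = Phi s k n (fst \<omega>)"
  define y where "y = observations f n (fst \<omega>) (snd \<omega>)"
  have A: "A \<in> carrier_mat n ?N" unfolding A_def by (rule Phi_carrier)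
  have y: "y \<in> carrier_vec n" unfolding y_def by (rule observations_carrier)
  have Av: "A *\<^sub>v v \<in> carrier_vec n" if "v \<in> carrier_vec ?N" for v using A that by simp
  have adj: "scalar_prod (A *\<^sub>v v) w = scalar_prod v (transpose_mat A *\<^sub>v w)" if "v \<in> carrier_vec ?N" "w \<in> carrier_vec n" for v w
    using transpose_vec_mult_scalar[OF A that] comm_scalar_prod[OF Av[OF that(1)] that(2)]
      comm_scalar_prod[of v ?N "transpose_mat A *\<^sub>v w"] A that by simp
  have AA: "(transpose_mat A * A) *\<^sub>v v = transpose_mat A *\<^sub>v (A *\<^sub>v v)" if "v \<in> carrier_vec ?N" for v
    by (rule assoc_mult_mat_vec) (use A that in auto)
  have lin_eq: "vec_index (A *\<^sub>v v) i = lin s (trunc_set k) (coef_of k v) (fst \<omega> i)" if "v \<in> carrier_vec ?N" "i < n" for v i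
    unfolding A_def by (rule Phi_mult_vec[OF that])
  have sp: "scalar_prod (A *\<^sub>v v) w = (\<Sum>i<n. lin s (trunc_set k) (coef_of k v) (fst \<omega> i) * vec_index w i)"
    if "v \<in> carrier_vec ?N" "w \<in> carrier_vec n" for v w
    using that lin_eq by (auto simp: scalar_prod_def lessThan_atLeast0 intro!: sum.cong)
  have d: "Determinant.det (transpose_mat A * A) \<noteq> 0"
  proof
    assume "Determinant.det (transpose_mat A * A) = 0"
    then obtain v where v: "v \<in> carrier_vec ?N" "v \<noteq> 0\<^sub>v ?N" "(transpose_mat A * A) *\<^sub>v v = 0\<^sub>v ?N"
      using det_0_iff_vec_prod_zero_field[of "transpose_mat A * A" ?N] A by auto
    have "(\<Sum>i<n. (lin s (trunc_set k) (coef_of k v) (fst \<omega> i))\<^sup>2) = scalar_prod (A *\<^sub>v v) (A *\<^sub>v v)"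
      using sp[OF v(1) Av[OF v(1)]] lin_eq[OF v(1)] by (simp add: power2_eq_square)
    also have "\<dots> = 0" unfolding adj[OF v(1) Av[OF v(1)]] AA[OF v(1), symmetric] v(3) using v(1) by simp
    finally have "(\<Sum>\<alpha>\<in>(trunc_set k :: ('d \<Rightarrow> nat) set). (coef_of k v \<alpha>)\<^sup>2) / 4 * real n \<le> 0"
      using good unfolding good_design_def by metis
    then have "(\<Sum>\<alpha>\<in>(trunc_set k :: ('d \<Rightarrow> nat) set). (coef_of k v \<alpha>)\<^sup>2) \<le> 0" using n by (simp add: mult_le_0_iff)
    then have "(\<Sum>\<alpha>\<in>(trunc_set k :: ('d \<Rightarrow> nat) set). (coef_of k v \<alpha>)\<^sup>2) = 0"
      by (intro antisym sum_nonneg) auto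
    then have z: "coef_of k v \<alpha> = 0" if "\<alpha> \<in> (trunc_set k :: ('d \<Rightarrow> nat) set)" for \<alpha>
      using that by (simp add: sum_nonneg_eq_0_iff)
    have "v = 0\<^sub>v ?N"
    proof (rule eq_vecI)
      fix j assume "j < dim_vec (0\<^sub>v ?N :: real Matrix.vec)"
      then have j: "j < ?N" by simp
      then show "vec_index v j = vec_index (0\<^sub>v ?N) j"
        using z[OF trunc_enum_in[OF j]] coef_of_enum[OF j, of v] by simp
    qed (use v in auto)
    with v show False by simp
  qed
  define cv where "cv = Matrix.vec ?N (\<lambda>j. c (trunc_enum k j :: 'd \<Rightarrow> nat))"
  have cv: "cv \<in> carrier_vec ?N" by (simp add: cv_def)
  have lc: "lin s (trunc_set k) (coef_of k cv) z = lin s (trunc_set k) c z" for z :: "real ^ 'd"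
    unfolding lin_def
  proof (intro sum.cong refl)
    fix \<alpha> :: "'d \<Rightarrow> nat" assume "\<alpha> \<in> trunc_set k"
    then obtain j where "j < ?N" "\<alpha> = trunc_enum k j" by (rule trunc_set_cases)
    then show "coef_of k cv \<alpha> * Psi s \<alpha> z = c \<alpha> * Psi s \<alpha> z" by (simp add: coef_of_enum cv_def)
  qed
  define h where "h = least_squares A y"
  note ls = least_squares_solution(1,2)[OF A y d, folded h_def]
  have "scalar_prod (A *\<^sub>v cv) y = scalar_prod (A *\<^sub>v cv) (A *\<^sub>v h)"
    unfolding adj[OF cv y] adj[OF cv Av[OF ls(1)]] AA[OF ls(1), symmetric] ls(2) ..
  moreover have "est_coef s least_squares f k n \<omega> = coef_of k h"
    by (simp add: est_coef_def h_def A_def y_def)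
  ultimately show ?thesis
    using sp[OF cv y] sp[OF cv Av[OF ls(1)]] lin_eq[OF ls(1)]
    by (simp add: lc y_def observations_def right_diff_distrib sum_subtractf)
qed

text \<open>Young's inequality is used twice, with weights such that each use costs at most a
  quarter of the empirical energy \<open>Q\<close>; for the noise term this rests on
  \<open>V / 4 * real n \<le> Q\<close>. The remaining half of Q is bounded below by the same
  inequality, which leads to the constants 8 = 4 * 2 and 32 = 4 * 8.\<close>

lemma least_squares_coef_error:
  fixes f :: "real ^ 'd::finite \<Rightarrow> real"
  assumes good: "good_design s k n (fst \<omega>)" and n: "n \<ge> 1"
  shows "(\<Sum>\<alpha>\<in>trunc_set k. (est_coef s least_squares f k n \<omega> \<alpha> - c \<alpha>)\<^sup>2) \<le>
    8 / real n * (\<Sum>i<n. (f (fst \<omega> i) - lin s (trunc_set k) c (fst \<omega> i))\<^sup>2)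
    + 32 / (real n)\<^sup>2 * (\<Sum>\<alpha>\<in>trunc_set k. (\<Sum>i<n. Psi s \<alpha> (fst \<omega> i) * snd \<omega> i)\<^sup>2)"
proof -
  let ?T = "trunc_set k :: ('d \<Rightarrow> nat) set"
  define v where "v \<alpha> = est_coef s least_squares f k n \<omega> \<alpha> - c \<alpha>" for \<alpha>
  define L where "L i = lin s ?T v (fst \<omega> i)" for i
  define r where "r i = f (fst \<omega> i) - lin s ?T c (fst \<omega> i)" for i
  define E where "E \<alpha> = (\<Sum>i<n. Psi s \<alpha> (fst \<omega> i) * snd \<omega> i)" for \<alpha>
  define Q where "Q = (\<Sum>i<n. (L i)\<^sup>2)"
  define V where "V = (\<Sum>\<alpha>\<in>?T. (v \<alpha>)\<^sup>2)"
  define R where "R = (\<Sum>i<n. (r i)\<^sup>2)"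
  have VQ: "V / 4 * real n \<le> Q"
    using good unfolding good_design_def V_def Q_def L_def by blast
  \<comment> \<open>Test the normal equations with the coefficient error \<open>v\<close> itself.\<close>
  have "lin s ?T (est_coef s least_squares f k n \<omega>) z = lin s ?T c z + lin s ?T v z" for z
    by (simp add: lin_def v_def sum.distrib[symmetric] distrib_right[symmetric])
  then have "(\<Sum>i<n. L i * (r i + snd \<omega> i - L i)) = 0"
    using least_squares_normal[OF good n, of v f] by (simp add: L_def r_def algebra_simps)
  then have "Q = (\<Sum>i<n. L i * r i) + (\<Sum>i<n. L i * snd \<omega> i)"
    by (simp add: Q_def right_diff_distrib distrib_left sum_subtractf sum.distrib power2_eq_square)
  also have "(\<Sum>i<n. L i * r i) \<le> Q / 4 + R"
    unfolding Q_def R_def sum_divide_distrib sum.distrib[symmetric]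
  proof (rule sum_mono)
    fix i show "L i * r i \<le> (L i)\<^sup>2 / 4 + (r i)\<^sup>2"
      using zero_le_power2[of "L i / 2 - r i"] by (simp add: power2_diff power_divide)
  qed
  also have "(\<Sum>i<n. L i * snd \<omega> i) = (\<Sum>\<alpha>\<in>?T. v \<alpha> * E \<alpha>)"
    unfolding L_def lin_def E_def sum_distrib_left sum_distrib_right
    by (subst sum.swap) (simp add: mult_ac)
  also have "\<dots> \<le> (\<Sum>\<alpha>\<in>?T. real n / 16 * (v \<alpha>)\<^sup>2 + 4 / real n * (E \<alpha>)\<^sup>2)"
  proof (rule sum_mono)
    fix \<alpha>
    have "0 \<le> (real n * v \<alpha> - 8 * E \<alpha>)\<^sup>2 / (16 * real n)" by simp
    also have "\<dots> = (real n / 16 * (v \<alpha>)\<^sup>2 + 4 / real n * (E \<alpha>)\<^sup>2) - v \<alpha> * E \<alpha>"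
      using n by (simp add: field_simps power2_eq_square)
    finally show "v \<alpha> * E \<alpha> \<le> real n / 16 * (v \<alpha>)\<^sup>2 + 4 / real n * (E \<alpha>)\<^sup>2" by simp
  qed
  also have "\<dots> = V / 4 * real n / 4 + 4 / real n * (\<Sum>\<alpha>\<in>?T. (E \<alpha>)\<^sup>2)"
    by (simp add: V_def sum.distrib sum_distrib_left sum_distrib_right sum_divide_distrib mult_ac)
  finally have "V / 4 * real n \<le> 2 * R + 8 / real n * (\<Sum>\<alpha>\<in>?T. (E \<alpha>)\<^sup>2)"
    using VQ by simp
  then have "V / 4 * real n * (4 / real n) \<le> (2 * R + 8 / real n * (\<Sum>\<alpha>\<in>?T. (E \<alpha>)\<^sup>2)) * (4 / real n)"
    by (rule mult_right_mono) simp
  then have "V \<le> 8 / real n * R + 32 / (real n)\<^sup>2 * (\<Sum>\<alpha>\<in>?T. (E \<alpha>)\<^sup>2)"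
    using n by (simp add: field_simps power2_eq_square)
  then show ?thesis unfolding V_def R_def v_def r_def E_def .
qed

section \<open>From coefficient errors to risks\<close>

lemma est_index_sum_measurable:
  fixes f :: "real ^ 'd::finite \<Rightarrow> real"
  assumes m: "\<And>\<alpha>. \<alpha> \<in> trunc_set k \<Longrightarrow> (\<lambda>\<omega>. est_coef s est f k n \<omega> \<alpha>) \<in> borel_measurable S"
  shows "(\<lambda>\<omega>. est_index_sum s (fhat s est f k n \<omega>) W) \<in> borel_measurable S"
proof -
  have 1: "(\<lambda>\<omega>. \<Sum>\<alpha>\<in>A. (est_coef s est f k n \<omega> \<alpha>)\<^sup>2) \<in> borel_measurable S" if "A \<subseteq> trunc_set k" for A
    using that by (intro borel_measurable_sum borel_measurable_power m) auto
  note [measurable] = 1[of "trunc_set k - {\<lambda>_. 0}"] 1[of "{\<alpha> \<in> trunc_set k. supp \<alpha> = U}" for U]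
  have [measurable]: "(\<lambda>\<omega>. \<Sum>U\<in>W. (if U = {} then 0 else \<Sum>\<alpha>\<in>{\<alpha>\<in>trunc_set k. supp \<alpha> = U}. (est_coef s est f k n \<omega> \<alpha>)\<^sup>2) / (\<Sum>\<alpha>\<in>trunc_set k - {\<lambda>_. 0}. (est_coef s est f k n \<omega> \<alpha>)\<^sup>2)) \<in> borel_measurable S"
    by (auto intro!: borel_measurable_sum borel_measurable_divide borel_measurable_power m)
  have [measurable]: "(\<lambda>\<omega>. \<Sum>\<alpha>\<in>trunc_set k - {\<lambda>_. 0}. (est_coef s est f k n \<omega> \<alpha>)\<^sup>2) \<in> borel_measurable S"
    by (intro 1) auto
  show ?thesis
    unfolding fhat_eq_lin est_index_sum_lin[OF finite_trunc_set] by measurable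
qed

text \<open>On \<open>B\<close> the index error is at most 1, which contributes the probability of
  \<open>B\<close>. Elsewhere stability applies, with a random majorant \<open>D\<close> of which
  only the expectation counts.\<close>

lemma index_sum_risk:
  fixes f :: "real ^ 'd::finite \<Rightarrow> real" and W :: "'d set set"
  assumes nl: "noise_law \<nu> \<sigma>2" and f: "bdm s f" and v: "var s f > 0"
    and m: "\<And>\<alpha>. \<alpha> \<in> trunc_set k \<Longrightarrow> (\<lambda>\<omega>. est_coef s est f k n \<omega> \<alpha>) \<in> borel_measurable (sample_measure s \<nu> n)"
    and B: "B \<in> sets (sample_measure s \<nu> n)" and D: "integrable (sample_measure s \<nu> n) D" "\<And>\<omega>. D \<omega> \<ge> 0"
    and le: "\<And>\<omega>. \<omega> \<in> space (sample_measure s \<nu> n) - B \<Longrightarrow>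
      trunc_err s f k + (\<Sum>\<alpha>\<in>trunc_set k. (est_coef s est f k n \<omega> \<alpha> - coef s f \<alpha>)\<^sup>2) \<le> D \<omega>"
  defines "e \<equiv> \<lambda>\<omega> :: (nat \<Rightarrow> real ^ 'd) \<times> (nat \<Rightarrow> real). ((\<Sum>U\<in>W. sobol_index s f U) - est_index_sum s (fhat s est f k n \<omega>) W)\<^sup>2"
  shows "integrable (sample_measure s \<nu> n) e"
    and "(\<integral>\<omega>. e \<omega> \<partial>sample_measure s \<nu> n) \<le> measure (sample_measure s \<nu> n) B + 16 / var s f * (\<integral>\<omega>. D \<omega> \<partial>sample_measure s \<nu> n)"
proof -
  let ?S = "sample_measure s \<nu> n :: ((nat \<Rightarrow> real ^ 'd) \<times> (nat \<Rightarrow> real)) measure"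
  interpret S: prob_space ?S by (rule prob_space_sample[OF nl])
  have em: "e \<in> borel_measurable ?S"
    unfolding e_def by (intro borel_measurable_power borel_measurable_diff borel_measurable_const est_index_sum_measurable m)
  have e1: "e \<omega> \<le> 1" for \<omega> unfolding e_def fhat_eq_lin by (rule index_error(2)[OF f v bdm_lin])
  have e0: "e \<omega> \<ge> 0" for \<omega> by (simp add: e_def)
  show ei: "integrable ?S e" by (rule S.integrable_const_bound[of _ 1]) (use em e1 e0 in auto)
  have iB: "integrable ?S (\<lambda>\<omega>. indicator B \<omega> :: real)" by (rule S.integrable_const_bound[of _ 1]) (use B in auto)
  have "(\<integral>\<omega>. e \<omega> \<partial>?S) \<le> (\<integral>\<omega>. indicator B \<omega> + 16 / var s f * D \<omega> \<partial>?S)"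
  proof (rule integral_mono[OF ei])
    show "integrable ?S (\<lambda>\<omega>. indicator B \<omega> + 16 / var s f * D \<omega>)" using iB D by auto
    fix \<omega> assume \<omega>: "\<omega> \<in> space ?S"
    show "e \<omega> \<le> indicator B \<omega> + 16 / var s f * D \<omega>"
    proof (cases "\<omega> \<in> B")
      case True
      then show ?thesis using e1[of \<omega>] D(2)[of \<omega>] v by (simp add: add_increasing2)
    next
      case False
      have "e \<omega> \<le> 16 * (\<integral>x. (f x - fhat s est f k n \<omega> x)\<^sup>2 \<partial>design_measure s) / var s f"
        unfolding e_def fhat_eq_lin by (rule index_error(1)[OF f v bdm_lin])
      also have "(\<integral>x. (f x - fhat s est f k n \<omega> x)\<^sup>2 \<partial>design_measure s) \<le> D \<omega>"
        using le[of \<omega>] \<omega> False unfolding fhat_eq_lin pythagoras[OF f finite_trunc_set] trunc_err_def by simp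
      finally show ?thesis using False v by (simp add: field_simps)
    qed
  qed
  also have "\<dots> = measure ?S B + 16 / var s f * (\<integral>\<omega>. D \<omega> \<partial>?S)"
    using iB D B sets.sets_into_space[OF B] by (simp add: Int_absorb2)
  finally show "(\<integral>\<omega>. e \<omega> \<partial>?S) \<le> measure ?S B + 16 / var s f * (\<integral>\<omega>. D \<omega> \<partial>?S)" .
qed

lemma risks_leI:
  fixes f :: "real ^ 'd::finite \<Rightarrow> real"
  assumes nl: "noise_law \<nu> \<sigma>2" and f: "bdm s f" and v: "var s f > 0"
    and m: "\<And>\<alpha>. \<alpha> \<in> trunc_set k \<Longrightarrow> (\<lambda>\<omega>. est_coef s est f k n \<omega> \<alpha>) \<in> borel_measurable (sample_measure s \<nu> n)"
    and B: "B \<in> sets (sample_measure s \<nu> n)" and D: "integrable (sample_measure s \<nu> n) D" "\<And>\<omega>. D \<omega> \<ge> 0"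
    and le: "\<And>\<omega>. \<omega> \<in> space (sample_measure s \<nu> n) - B \<Longrightarrow>
      trunc_err s f k + (\<Sum>\<alpha>\<in>trunc_set k. (est_coef s est f k n \<omega> \<alpha> - coef s f \<alpha>)\<^sup>2) \<le> D \<omega>"
    and R: "measure (sample_measure s \<nu> n) B + 16 / var s f * (\<integral>\<omega>. D \<omega> \<partial>sample_measure s \<nu> n) \<le> R"
  shows "risks_le s est f \<nu> k n U R"
proof -
  note r = index_sum_risk[OF nl f v m B D le]
  have "est_sobol_index s g U = est_index_sum s g {U}" for g by (rule est_sobol_index_eq)
  then show ?thesis
    using r[of "{U}"] r[of "{V. V \<inter> U \<noteq> {}}"] R
    unfolding risks_le_def Let_def est_sobol_index_eq est_total_index_eq total_index_def
    by auto
qed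

text \<open>Serves the finitely many small n: with the whole space as the exceptional event, the
  risk is at most 1.\<close>

lemma risks_le_trivial:
  fixes f :: "real ^ 'd::finite \<Rightarrow> real"
  assumes nl: "noise_law \<nu> \<sigma>2" and f: "bdm s f" and v: "var s f > 0"
    and m: "\<And>\<alpha>. \<alpha> \<in> trunc_set k \<Longrightarrow> (\<lambda>\<omega>. est_coef s est f k n \<omega> \<alpha>) \<in> borel_measurable (sample_measure s \<nu> n)"
    and R: "R \<ge> 1"
  shows "risks_le s est f \<nu> k n U R"
proof (rule risks_leI[OF nl f v m, of "space (sample_measure s \<nu> n)" "\<lambda>_. 0"])
  interpret prob_space "sample_measure s \<nu> n :: ((nat \<Rightarrow> real ^ 'd) \<times> _) measure" by (rule prob_space_sample[OF nl])
  show "measure (sample_measure s \<nu> n) (space (sample_measure s \<nu> n :: ((nat \<Rightarrow> real ^ 'd) \<times> _) measure)) + 16 / var s f * (\<integral>\<omega>. 0 \<partial>(sample_measure s \<nu> n :: ((nat \<Rightarrow> real ^ 'd) \<times> _) measure)) \<le> R"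
    using R by (simp add: prob_space)
qed auto

lemma integral_Psi_square: "(\<integral>x. (Psi s \<alpha> x)\<^sup>2 \<partial>design_measure s) = 1"
  using integral_Psi_Psi[of s \<alpha> \<alpha>] by (simp add: power2_eq_square)

text \<open>The variance of the design part of one coefficient is at most the second moment of
  \<open>Psi s \<alpha> x * f x\<close>, hence at most \<open>K\<close> because the basis function
  has norm 1. There are \<open>(k + 1) ^ d\<close> coefficients, each averaged over n
  observations.\<close>

lemma projection_risk:
  fixes f :: "real ^ 'd::finite \<Rightarrow> real"
  assumes nl: "noise_law \<nu> \<sigma>2" and f: "bdm s f" and v: "var s f > 0" and n: "n \<ge> 1"
    and K: "\<And>x. x \<in> cube s \<Longrightarrow> (f x)\<^sup>2 \<le> K"
    and R: "16 / var s f * (trunc_err s f k + (real k + 1) ^ CARD('d) * (K + \<sigma>2) / real n) \<le> R"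
  shows "risks_le s projection f \<nu> k n U R"
proof -
  let ?M = "design_measure s :: (real ^ 'd) measure" and ?S = "sample_measure s \<nu> n :: ((nat \<Rightarrow> real ^ 'd) \<times> (nat \<Rightarrow> real)) measure"
  let ?T = "trunc_set k :: ('d \<Rightarrow> nat) set"
  interpret S: prob_space ?S by (rule prob_space_sample[OF nl])
  define h where "h \<alpha> x = Psi s \<alpha> x * f x - coef s f \<alpha>" for \<alpha> x
  define E where "E \<alpha> \<omega> = (\<Sum>i<n. h \<alpha> (fst \<omega> i) + Psi s \<alpha> (fst \<omega> i) * snd \<omega> i)\<^sup>2" for \<alpha> and \<omega> :: "(nat \<Rightarrow> real ^ 'd) \<times> (nat \<Rightarrow> real)"
  have bh: "bdm s (h \<alpha>)" for \<alpha> unfolding h_def by (intro bdm_diff bdm_mult bdm_Psi f bdm_const)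
  have bp: "bdm s (\<lambda>x. Psi s \<alpha> x * f x)" for \<alpha> by (intro bdm_mult bdm_Psi f)
  have mean_h: "(\<integral>x. h \<alpha> x \<partial>?M) = 0" for \<alpha>
    unfolding h_def using bdm_integrable[OF bp[of \<alpha>]] by (simp add: coef_def mult.commute design.prob_space)
  have h2: "(\<integral>x. (h \<alpha> x)\<^sup>2 \<partial>?M) \<le> K" for \<alpha>
  proof -
    have i1: "integrable ?M (\<lambda>x. (Psi s \<alpha> x * f x)\<^sup>2)" by (rule bdm_integrable[OF bdm_power2[OF bp]])
    have "(h \<alpha> x)\<^sup>2 = (Psi s \<alpha> x * f x)\<^sup>2 - (2 * coef s f \<alpha>) * (Psi s \<alpha> x * f x) + (coef s f \<alpha>)\<^sup>2" for x
      by (simp add: h_def power2_diff)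
    then have "(\<integral>x. (h \<alpha> x)\<^sup>2 \<partial>?M) = (\<integral>x. (Psi s \<alpha> x * f x)\<^sup>2 \<partial>?M) - (2 * coef s f \<alpha>) * (\<integral>x. Psi s \<alpha> x * f x \<partial>?M) + (coef s f \<alpha>)\<^sup>2"
      using i1 bdm_integrable[OF bp[of \<alpha>]] by (simp add: design.prob_space)
    also have "\<dots> = (\<integral>x. (Psi s \<alpha> x * f x)\<^sup>2 \<partial>?M) - (coef s f \<alpha>)\<^sup>2"
      by (simp add: coef_def mult.commute power2_eq_square)
    also have "\<dots> \<le> (\<integral>x. (Psi s \<alpha> x * f x)\<^sup>2 \<partial>?M)" by simp
    also have "\<dots> \<le> (\<integral>x. (Psi s \<alpha> x)\<^sup>2 * K \<partial>?M)"
    proof (rule integral_mono[OF i1])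
      show "integrable ?M (\<lambda>x. (Psi s \<alpha> x)\<^sup>2 * K)"
        using bdm_integrable[OF bdm_power2[OF bdm_Psi[of s \<alpha>]]] by simp
    qed (auto simp: power_mult_distrib intro!: mult_left_mono K)
    also have "\<dots> = K" using integral_Psi_square[of s \<alpha>] by simp
    finally show ?thesis .
  qed
  have E: "integrable ?S (E \<alpha>)" "(\<integral>\<omega>. E \<alpha> \<omega> \<partial>?S) = real n * ((\<integral>x. (h \<alpha> x)\<^sup>2 \<partial>?M) + \<sigma>2)" for \<alpha>
    using integral_sample_sum_square[OF nl bh[of \<alpha>] bdm_Psi[of s \<alpha>] mean_h[of \<alpha>], of n]
    by (simp_all add: E_def[abs_def] integral_Psi_square)
  have err: "(est_coef s projection f k n \<omega> \<alpha> - coef s f \<alpha>)\<^sup>2 = E \<alpha> \<omega> / (real n)\<^sup>2" if "\<alpha> \<in> ?T" for \<alpha> \<omega>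
  proof -
    have "est_coef s projection f k n \<omega> \<alpha> - coef s f \<alpha> = (\<Sum>i<n. h \<alpha> (fst \<omega> i) + Psi s \<alpha> (fst \<omega> i) * snd \<omega> i) / real n"
      using n by (simp add: est_coef_projection[OF that] h_def sum.distrib sum_subtractf distrib_left field_simps)
    then show ?thesis by (simp add: E_def power_divide)
  qed
  define D where "D \<omega> = trunc_err s f k + (\<Sum>\<alpha>\<in>?T. E \<alpha> \<omega> / (real n)\<^sup>2)" for \<omega>
  have te: "trunc_err s f k \<ge> 0" unfolding trunc_err_eq[OF f, symmetric] by simp
  show ?thesis
  proof (rule risks_leI[OF nl f v, of _ _ _ "{}" D])
    show "integrable ?S D" unfolding D_def using E(1) by auto
    show "D \<omega> \<ge> 0" for \<omega> unfolding D_def using te by (intro add_nonneg_nonneg sum_nonneg) (auto simp: E_def)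
    show "(\<lambda>\<omega>. est_coef s projection f k n \<omega> \<alpha>) \<in> borel_measurable ?S" if "\<alpha> \<in> ?T" for \<alpha>
      by (rule est_coef_projection_measurable[OF nl bdm_measurable[OF f] that])
    show "trunc_err s f k + (\<Sum>\<alpha>\<in>?T. (est_coef s projection f k n \<omega> \<alpha> - coef s f \<alpha>)\<^sup>2) \<le> D \<omega>" for \<omega>
      unfolding D_def by (simp add: err)
    have "(\<integral>\<omega>. D \<omega> \<partial>?S) = trunc_err s f k + (\<Sum>\<alpha>\<in>?T. (\<integral>\<omega>. E \<alpha> \<omega> \<partial>?S) / (real n)\<^sup>2)"
      unfolding D_def using E(1) by (simp add: S.prob_space)
    also have "\<dots> \<le> trunc_err s f k + (\<Sum>\<alpha>\<in>?T. (K + \<sigma>2) / real n)"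
    proof (intro add_left_mono sum_mono)
      fix \<alpha>
      have "(\<integral>\<omega>. E \<alpha> \<omega> \<partial>?S) / (real n)\<^sup>2 = ((\<integral>x. (h \<alpha> x)\<^sup>2 \<partial>?M) + \<sigma>2) / real n"
        unfolding E(2) using n by (simp add: power2_eq_square)
      also have "\<dots> \<le> (K + \<sigma>2) / real n" using h2[of \<alpha>] by (intro divide_right_mono) auto
      finally show "(\<integral>\<omega>. E \<alpha> \<omega> \<partial>?S) / (real n)\<^sup>2 \<le> (K + \<sigma>2) / real n" .
    qed
    also have "\<dots> = trunc_err s f k + (real k + 1) ^ CARD('d) * (K + \<sigma>2) / real n"
      by (simp add: card_trunc_set add.commute)
    finally have "16 / var s f * (\<integral>\<omega>. D \<omega> \<partial>?S) \<le> 16 / var s f * (trunc_err s f k + (real k + 1) ^ CARD('d) * (K + \<sigma>2) / real n)"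
      using v by (intro mult_left_mono) auto
    then show "measure ?S {} + 16 / var s f * (\<integral>\<omega>. D \<omega> \<partial>?S) \<le> R" using R by simp
  qed simp
qed

section \<open>The probability of a bad design\<close>

lemma good_design_sets:
  "{x \<in> space (\<Pi>\<^sub>M i\<in>{..<n}. design_measure s). good_design s k n (x :: nat \<Rightarrow> real ^ 'd::finite)} \<in> sets (\<Pi>\<^sub>M i\<in>{..<n}. design_measure s)"
proof -
  let ?P = "\<Pi>\<^sub>M i\<in>{..<n}. (design_measure s :: (real ^ 'd) measure)"
  let ?T = "trunc_set k :: ('d \<Rightarrow> nat) set"
  \<comment> \<open>Both sides of the defining inequality are continuous in the coefficients, so
    rational coefficients decide it, and there are countably many of those.\<close>
  define Q where "Q = (?T \<rightarrow>\<^sub>E (\<rat> :: real set))"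
  have cQ: "countable Q" unfolding Q_def by (intro countable_PiE finite_trunc_set countable_rat)
  define G where "G c x \<longleftrightarrow> (\<Sum>\<alpha>\<in>?T. (c \<alpha>)\<^sup>2) / 4 * real n \<le> (\<Sum>i<n. (lin s ?T c (x i))\<^sup>2)" for c and x :: "nat \<Rightarrow> real ^ 'd"
  have "good_design s k n x \<longleftrightarrow> (\<forall>c\<in>Q. G c x)" for x :: "nat \<Rightarrow> real ^ 'd"
  proof
    assume "good_design s k n x"
    then show "\<forall>c\<in>Q. G c x" by (auto simp: good_design_def G_def)
  next
    assume q: "\<forall>c\<in>Q. G c x"
    show "good_design s k n x" unfolding good_design_def
    proof
      fix c :: "('d \<Rightarrow> nat) \<Rightarrow> real"
      have "\<exists>r. (\<forall>m. r m \<in> \<rat>) \<and> r \<longlonglongrightarrow> t" for t :: real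
      proof -
        have "t \<in> closure (\<rat> :: real set)"
          unfolding closure_approachable using Rats_dense_in_real[of t] by (metis dist_commute dist_real_def abs_of_pos diff_gt_0_iff_gt less_diff_eq less_add_same_cancel1 add.commute diff_less_eq)
        then show ?thesis unfolding closure_sequential by blast
      qed
      then obtain r where r: "\<And>t m. r t m \<in> \<rat>" "\<And>t :: real. r t \<longlonglongrightarrow> t" by metis
      define q where "q m = restrict (\<lambda>\<alpha>. r (c \<alpha>) m) ?T" for m
      have "(\<lambda>m. (\<Sum>\<alpha>\<in>?T. (q m \<alpha>)\<^sup>2) / 4 * real n) \<longlonglongrightarrow> (\<Sum>\<alpha>\<in>?T. (c \<alpha>)\<^sup>2) / 4 * real n"
        unfolding q_def by (intro tendsto_intros) (simp_all add: r)
      moreover have "(\<lambda>m. \<Sum>i<n. (lin s ?T (q m) (x i))\<^sup>2) \<longlonglongrightarrow> (\<Sum>i<n. (lin s ?T c (x i))\<^sup>2)"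
        unfolding q_def lin_def by (intro tendsto_intros) (simp_all add: r)
      moreover have "q m \<in> Q" for m by (simp add: q_def Q_def r)
      then have "(\<Sum>\<alpha>\<in>?T. (q m \<alpha>)\<^sup>2) / 4 * real n \<le> (\<Sum>i<n. (lin s ?T (q m) (x i))\<^sup>2)" for m
        using \<open>\<forall>c\<in>Q. G c x\<close> unfolding G_def by blast
      ultimately show "(\<Sum>\<alpha>\<in>?T. (c \<alpha>)\<^sup>2) / 4 * real n \<le> (\<Sum>i<n. (lin s ?T c (x i))\<^sup>2)"
        using LIMSEQ_le by blast
    qed
  qed
  then have e: "{x \<in> space ?P. good_design s k n x} = {x \<in> space ?P. \<forall>c\<in>Q. G c x}" by simp
  have "Measurable.pred ?P (G c)" for c
  proof -
    have [measurable]: "(\<lambda>x. lin s ?T c (x i)) \<in> borel_measurable ?P" if "i < n" for i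
    proof -
      have "(\<lambda>x. x i) \<in> ?P \<rightarrow>\<^sub>M design_measure s" by (rule measurable_component_singleton) (use that in simp)
      from measurable_compose[OF this bdm_measurable[OF bdm_lin]] show ?thesis .
    qed
    have [measurable]: "(\<lambda>x. \<Sum>i<n. (lin s ?T c (x i))\<^sup>2) \<in> borel_measurable ?P" by measurable
    show ?thesis unfolding G_def by measurable
  qed
  then have "{x \<in> space ?P. G c x} \<in> sets ?P" for c by (rule predE)
  then have "space ?P - (\<Union>c\<in>Q. space ?P - {x \<in> space ?P. G c x}) \<in> sets ?P"
    by (intro sets.compl_sets sets.countable_UN' cQ) auto
  also have "space ?P - (\<Union>c\<in>Q. space ?P - {x \<in> space ?P. G c x}) = {x \<in> space ?P. \<forall>c\<in>Q. G c x}" by auto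
  finally show ?thesis unfolding e .
qed

text \<open>A Chebyshev expansion of degree k pulls back to a trigonometric one of degree
  \<open>2 * k\<close> on the even multi-indices; extending its coefficients by 0 does not change
  their energy.\<close>

lemma good_design_cosv:
  fixes u :: "nat \<Rightarrow> real ^ 'd::finite"
  assumes good: "good_design Trig (2 * k) n u" and u: "\<And>i. i < n \<Longrightarrow> u i \<in> cube Trig"
    and x: "\<And>i. i < n \<Longrightarrow> x i = cosv (u i)"
  shows "good_design Chebyshev k n x"
  unfolding good_design_def
proof
  fix c :: "('d \<Rightarrow> nat) \<Rightarrow> real"
  let ?dbl = "\<lambda>\<beta> :: 'd \<Rightarrow> nat. (\<lambda>i. 2 * \<beta> i)"
  define c' where "c' \<alpha> = (if \<alpha> \<in> ?dbl ` trunc_set k then c (\<lambda>i. \<alpha> i div 2) else 0)" for \<alpha>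
  have inj: "inj_on ?dbl (trunc_set k)" by (auto simp: inj_on_def fun_eq_iff)
  have sub: "?dbl ` trunc_set k \<subseteq> trunc_set (2 * k)" by (auto simp: trunc_set_def)
  have s1: "(\<Sum>\<alpha>\<in>trunc_set (2 * k). F (c' \<alpha>) \<alpha>) = (\<Sum>\<beta>\<in>trunc_set k. F (c \<beta>) (?dbl \<beta>))"
    if "\<And>\<alpha>. F 0 \<alpha> = 0" for F :: "real \<Rightarrow> ('d \<Rightarrow> nat) \<Rightarrow> real"
  proof -
    have "(\<Sum>\<alpha>\<in>trunc_set (2 * k). F (c' \<alpha>) \<alpha>) = (\<Sum>\<alpha>\<in>?dbl ` trunc_set k. F (c' \<alpha>) \<alpha>)"
      by (rule sum.mono_neutral_right[OF finite_trunc_set sub]) (simp add: c'_def that)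
    also have "\<dots> = (\<Sum>\<beta>\<in>trunc_set k. F (c' (?dbl \<beta>)) (?dbl \<beta>))" by (simp add: sum.reindex[OF inj])
    also have "\<dots> = (\<Sum>\<beta>\<in>trunc_set k. F (c \<beta>) (?dbl \<beta>))" by (intro sum.cong refl) (simp add: c'_def)
    finally show ?thesis .
  qed
  have "lin Trig (trunc_set (2 * k)) c' (u i) = lin Chebyshev (trunc_set k) c (x i)" if "i < n" for i
    unfolding lin_def x[OF that] Psi_cosv[OF u[OF that]] by (rule s1) simp
  then have "(\<Sum>i<n. (lin Trig (trunc_set (2 * k)) c' (u i))\<^sup>2) = (\<Sum>i<n. (lin Chebyshev (trunc_set k) c (x i))\<^sup>2)" by simp
  moreover have "(\<Sum>\<alpha>\<in>trunc_set (2 * k). (c' \<alpha>)\<^sup>2) = (\<Sum>\<beta>\<in>trunc_set k. (c \<beta>)\<^sup>2)"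
    using s1[of "\<lambda>t _. t\<^sup>2"] by simp
  ultimately show "(\<Sum>\<alpha>\<in>trunc_set k. (c \<alpha>)\<^sup>2) / 4 * real n \<le> (\<Sum>i<n. (lin Chebyshev (trunc_set k) c (x i))\<^sup>2)"
    using good unfolding good_design_def by metis
qed

text \<open>The thresholds are \<open>5 * d * len s * bern s k\<close> evaluated: length 2 and
  constant \<open>(k + 1)\<^sup>2\<close> for Legendre, and length 1 and constant
  \<open>2 * pi * (2 * k)\<close> for Chebyshev, whose designs are images of trigonometric ones for
  the doubled degree. The trigonometric setting shares the latter threshold.\<close>

lemma bad_design_probability:
  assumes k: "s = Trig \<Longrightarrow> even k" and m: "m \<ge> 1" and n: "n \<ge> 1"
    and fine: "(if s = Legendre then 10 * real CARD('d::finite) * (real k + 1)\<^sup>2 else 20 * pi * real CARD('d) * real k) \<le> real m"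
  shows "emeasure (\<Pi>\<^sub>M i\<in>{..<n}. design_measure s) {x \<in> space (\<Pi>\<^sub>M i\<in>{..<n}. design_measure s). \<not> good_design s k n (x :: nat \<Rightarrow> real ^ 'd)}
    \<le> ennreal (real m ^ CARD('d) * exp (- (real n / (10 * real m ^ CARD('d)))))"
proof -
  let ?b = "ennreal (real m ^ CARD('d) * exp (- (real n / (10 * real m ^ CARD('d)))))"
  let ?P = "\<lambda>s. \<Pi>\<^sub>M i\<in>{..<n}. (design_measure s :: (real ^ 'd) measure)"
  have main: "emeasure (?P s) A \<le> ?b"
    if s: "s \<noteq> Chebyshev" and k: "s = Trig \<Longrightarrow> even k" and fine: "5 * real CARD('d) * len s * bern s k \<le> real m"
      and A: "\<And>x. x \<in> A \<Longrightarrow> x \<in> space (?P s) \<and> \<not> good_design s k n x" for s k A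
  proof -
    obtain B where B: "B \<in> sets (?P s)" "emeasure (?P s) B \<le> ?b" "\<And>x. x \<in> space (?P s) - B \<Longrightarrow> good_design s k n x"
      using good_design_probability[OF s k m n fine] by blast
    have "A \<subseteq> B" using A B(3) by blast
    then show ?thesis using emeasure_mono[OF _ B(1)] B(2) order_trans by blast
  qed
  show ?thesis
  proof (cases s)
    case Legendre
    show ?thesis by (rule main) (use Legendre fine in \<open>auto simp: len_def bern_def lo_def\<close>)
  next
    case Trigonometric
    have "0 \<le> real CARD('d) * (pi * real k)" by simp
    moreover have "20 * (real CARD('d) * (pi * real k)) \<le> real m" using fine Trigonometric by (simp add: mult_ac)
    ultimately have "10 * (real CARD('d) * (pi * real k)) \<le> real m" by linarith
    then show ?thesis by (intro main) (use Trigonometric k in \<open>auto simp: len_def bern_def lo_def\<close>)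
  next
    case Chebyshev
    define A where "A = {x \<in> space (?P Chebyshev). \<not> good_design Chebyshev k n x}"
    \<comment> \<open>Measurability of the exact event is what allows it to be pulled back along the
      image measure.\<close>
    have Am: "A \<in> sets (?P Chebyshev)"
      proof -
      have "A = space (?P Chebyshev) - {x \<in> space (?P Chebyshev). good_design Chebyshev k n x}" by (auto simp: A_def)
      then show ?thesis using sets.compl_sets[OF good_design_sets[of n Chebyshev k]] by simp
    qed
    let ?C = "bcube Chebyshev :: (real ^ 'd) measure"
    have d: "distr (design_measure Trig) (design_measure Chebyshev) cosv = (design_measure Chebyshev :: (real ^ 'd) measure)"
      using distr_cos[where 'd='d] unfolding cosv_def[abs_def, symmetric]
      by (subst distr_cong[OF refl sets_design refl]) simp
    have cm: "cosv \<in> design_measure Trig \<rightarrow>\<^sub>M (design_measure Chebyshev :: (real ^ 'd) measure)"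
      using cosv_measurable measurable_cong_sets[OF refl sets_design[of Chebyshev]] by blast
    have D: "distr (?P Trig) (?P Chebyshev) (compose {..<n} cosv) = ?P Chebyshev"
    proof -
      have "distr (?P Trig) (?P Chebyshev) (compose {..<n} cosv) =
          (\<Pi>\<^sub>M i\<in>{..<n}. distr (design_measure Trig) (design_measure Chebyshev) cosv)"
        by (rule distr_PiM_finite_prob_space') (use prob_space_design cm in auto)
      then show ?thesis unfolding d .
    qed
    have Dm: "compose {..<n} cosv \<in> ?P Trig \<rightarrow>\<^sub>M ?P Chebyshev"
      unfolding compose_def
    proof (rule measurable_restrict)
      fix i assume "i \<in> {..<n}"
      then have "(\<lambda>x. x i) \<in> ?P Trig \<rightarrow>\<^sub>M design_measure Trig" by (rule measurable_component_singleton)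
      from measurable_compose[OF this cm] show "(\<lambda>x. cosv (x i)) \<in> ?P Trig \<rightarrow>\<^sub>M design_measure Chebyshev" .
    qed
    have "emeasure (?P Chebyshev) A = emeasure (?P Trig) (compose {..<n} cosv -` A \<inter> space (?P Trig))"
      using emeasure_distr[OF Dm Am] unfolding D .
    also have "\<dots> \<le> ?b"
    proof (rule main[of Trigonometric "2 * k"])
      show "5 * real CARD('d) * len Trig * bern Trig (2 * k) \<le> real m"
        using fine Chebyshev by (simp add: len_def bern_def lo_def mult_ac)
      fix u assume u: "u \<in> compose {..<n} cosv -` A \<inter> space (?P Trig)"
      then have "\<not> good_design Chebyshev k n (compose {..<n} cosv u)" by (simp add: A_def)
      moreover have "u i \<in> cube Trig" if "i < n" for i
        using u that by (auto simp: space_PiM PiE_iff)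
      ultimately show "u \<in> space (?P Trig) \<and> \<not> good_design Trig (2 * k) n u"
        using good_design_cosv[of k n u "compose {..<n} cosv u"] u by (auto simp: compose_def)
    qed auto
    finally show ?thesis using Chebyshev by (simp add: A_def)
  qed
qed

text \<open>At each design point the residual of the best approximation has expected square
  \<open>trunc_err s f k\<close>, so the residual sum contributes 8 times that error and the
  truncation itself once more, in total 9. The noise sums have second moment
  \<open>n * \<sigma>2\<close> for each of the \<open>(k + 1) ^ d\<close> coefficients.\<close>

lemma least_squares_risk:
  fixes f :: "real ^ 'd::finite \<Rightarrow> real"
  assumes nl: "noise_law \<nu> \<sigma>2" and f: "bdm s f" and v: "var s f > 0" and n: "n \<ge> 1"
    and k: "s = Trig \<Longrightarrow> even k" and m: "m \<ge> 1"
    and fine: "(if s = Legendre then 10 * real CARD('d) * (real k + 1)\<^sup>2 else 20 * pi * real CARD('d) * real k) \<le> real m"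
    and R: "real m ^ CARD('d) * exp (- (real n / (10 * real m ^ CARD('d))))
      + 16 / var s f * (9 * trunc_err s f k + 32 * \<sigma>2 * (real k + 1) ^ CARD('d) / real n) \<le> R"
  shows "risks_le s least_squares f \<nu> k n U R"
proof -
  let ?M = "design_measure s :: (real ^ 'd) measure" and ?S = "sample_measure s \<nu> n :: ((nat \<Rightarrow> real ^ 'd) \<times> (nat \<Rightarrow> real)) measure"
  let ?P = "\<Pi>\<^sub>M i\<in>{..<n}. ?M" and ?Q = "\<Pi>\<^sub>M i\<in>{..<n}. \<nu>"
  let ?T = "trunc_set k :: ('d \<Rightarrow> nat) set"
  interpret S: prob_space ?S by (rule prob_space_sample[OF nl])
  interpret P: prob_space ?P by (intro prob_space_PiM prob_space_design)
  interpret Q: prob_space ?Q by (intro prob_space_PiM noise_law_facts(1)[OF nl])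
  define A where "A = {x \<in> space ?P. \<not> good_design s k n x}"
  have Am: "A \<in> sets ?P"
    proof -
    have "A = space ?P - {x \<in> space ?P. good_design s k n x}" by (auto simp: A_def)
    then show ?thesis using sets.compl_sets[OF good_design_sets[of n s k]] by simp
  qed
  \<comment> \<open>Being good concerns the design alone, so the exceptional event is a cylinder in
    the joint space.\<close>
  have "emeasure ?S (A \<times> space ?Q) = emeasure ?P A"
    unfolding sample_measure_def using Q.emeasure_pair_measure_Times[OF Am sets.top] by (simp add: Q.emeasure_space_1)
  also have "\<dots> \<le> ennreal (real m ^ CARD('d) * exp (- (real n / (10 * real m ^ CARD('d)))))"
    unfolding A_def by (rule bad_design_probability[OF k m n fine])
  finally have PA: "measure ?S (A \<times> space ?Q) \<le> real m ^ CARD('d) * exp (- (real n / (10 * real m ^ CARD('d))))"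
    by (simp add: S.emeasure_eq_measure)
  define r where "r x = f x - lin s ?T (coef s f) x" for x
  have br: "bdm s r" unfolding r_def by (intro bdm_diff f bdm_lin)
  have b0: "bdm s (\<lambda>_. 0)" by (rule bdm_const)
  have r2: "integrable ?S (\<lambda>\<omega>. (r (fst \<omega> i))\<^sup>2)" "(\<integral>\<omega>. (r (fst \<omega> i))\<^sup>2 \<partial>?S) = trunc_err s f k" if "i < n" for i
    using integral_sample_pair[OF nl that that br b0 br b0] trunc_err_eq[OF f, of k] by (simp_all add: power2_eq_square r_def)
  define E where "E \<alpha> \<omega> = (\<Sum>i<n. Psi s \<alpha> (fst \<omega> i) * snd \<omega> i)\<^sup>2" for \<alpha> and \<omega> :: "(nat \<Rightarrow> real ^ 'd) \<times> (nat \<Rightarrow> real)"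
  have E: "integrable ?S (E \<alpha>)" "(\<integral>\<omega>. E \<alpha> \<omega> \<partial>?S) = real n * \<sigma>2" for \<alpha>
    using integral_sample_sum_square[OF nl b0 bdm_Psi[of s \<alpha>], of n] by (simp_all add: E_def[abs_def] integral_Psi_square)
  define D where "D \<omega> = trunc_err s f k + (8 / real n * (\<Sum>i<n. (r (fst \<omega> i))\<^sup>2) + 32 / (real n)\<^sup>2 * (\<Sum>\<alpha>\<in>?T. E \<alpha> \<omega>))" for \<omega>
  have te: "trunc_err s f k \<ge> 0" unfolding trunc_err_eq[OF f, symmetric] by simp
  show ?thesis
  proof (rule risks_leI[OF nl f v, of _ _ _ "A \<times> space ?Q" D])
    show "integrable ?S D" unfolding D_def
      by (intro Bochner_Integration.integrable_add integrable_mult_right Bochner_Integration.integrable_sum r2(1) E(1)) auto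
    show "D \<omega> \<ge> 0" for \<omega> unfolding D_def using te by (intro add_nonneg_nonneg mult_nonneg_nonneg sum_nonneg) (auto simp: E_def)
    show "(\<lambda>\<omega>. est_coef s least_squares f k n \<omega> \<alpha>) \<in> borel_measurable ?S" if "\<alpha> \<in> ?T" for \<alpha>
      by (rule est_coef_least_squares_measurable[OF nl bdm_measurable[OF f] that])
    show "A \<times> space ?Q \<in> sets ?S" unfolding sample_measure_def using Am by auto
    show "trunc_err s f k + (\<Sum>\<alpha>\<in>?T. (est_coef s least_squares f k n \<omega> \<alpha> - coef s f \<alpha>)\<^sup>2) \<le> D \<omega>"
      if "\<omega> \<in> space ?S - A \<times> space ?Q" for \<omega>
    proof -
      have "good_design s k n (fst \<omega>)" using that by (auto simp: A_def sample_measure_def space_pair_measure)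
      from least_squares_coef_error[OF this n, of f "coef s f"] show ?thesis by (simp add: D_def r_def E_def)
    qed
    have ir: "integrable ?S (\<lambda>\<omega>. \<Sum>i<n. (r (fst \<omega> i))\<^sup>2)" and iE: "integrable ?S (\<lambda>\<omega>. \<Sum>\<alpha>\<in>?T. E \<alpha> \<omega>)"
      by (auto intro!: Bochner_Integration.integrable_sum r2(1) E(1))
    have "(\<integral>\<omega>. (\<Sum>i<n. (r (fst \<omega> i))\<^sup>2) \<partial>?S) = (\<Sum>i<n. trunc_err s f k)"
      by (subst Bochner_Integration.integral_sum) (auto simp: r2)
    moreover have "(\<integral>\<omega>. (\<Sum>\<alpha>\<in>?T. E \<alpha> \<omega>) \<partial>?S) = (\<Sum>\<alpha>\<in>?T. real n * \<sigma>2)"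
      by (subst Bochner_Integration.integral_sum) (auto simp: E)
    ultimately have "(\<integral>\<omega>. D \<omega> \<partial>?S) = trunc_err s f k + (8 / real n * (\<Sum>i<n. trunc_err s f k) + 32 / (real n)\<^sup>2 * (\<Sum>\<alpha>\<in>?T. real n * \<sigma>2))"
      unfolding D_def using ir iE by (simp add: S.prob_space)
    also have "\<dots> = 9 * trunc_err s f k + 32 * \<sigma>2 * (real k + 1) ^ CARD('d) / real n"
      using n by (simp add: card_trunc_set add.commute power2_eq_square)
    finally show "measure ?S (A \<times> space ?Q) + 16 / var s f * (\<integral>\<omega>. D \<omega> \<partial>?S) \<le> R" using PA R by simp
  qed
qed

section \<open>Rates of convergence\<close>

text \<open>An even degree is admissible in every setting, so one choice serves all three; the
  rounding stays within constant factors of t.\<close>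

definition even_floor :: "real \<Rightarrow> nat" where
  "even_floor t = 2 * nat \<lfloor>t\<rfloor>"

lemma even_floor_bounds:
  assumes "t \<ge> 1"
  shows "t \<le> real (even_floor t)" "real (even_floor t) + 1 \<le> 3 * t" "even_floor t \<ge> 2"
proof -
  have f: "\<lfloor>t\<rfloor> \<ge> 1" using assms by linarith
  then have e: "real (even_floor t) = 2 * of_int \<lfloor>t\<rfloor>" by (simp add: even_floor_def)
  show "t \<le> real (even_floor t)" "real (even_floor t) + 1 \<le> 3 * t"
    unfolding e using f assms by linarith+
  have "nat \<lfloor>t\<rfloor> \<ge> 1" using f by linarith
  then show "even_floor t \<ge> 2" by (simp add: even_floor_def)
qed

lemma trunc_err_even_floor:
  assumes C: "\<forall>k\<ge>2. (s = Trig \<longrightarrow> even k) \<longrightarrow> trunc_err s f k \<le> C * real k powr (- 2 * p)"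
    and "C \<ge> 0" "p > 0" "t \<ge> 1"
  shows "trunc_err s f (even_floor t) \<le> C * t powr (- 2 * p)"
proof -
  note b = even_floor_bounds[OF assms(4)]
  have "trunc_err s f (even_floor t) \<le> C * real (even_floor t) powr (- 2 * p)"
    by (intro C[rule_format] b(3)) (simp add: even_floor_def)
  also have "\<dots> \<le> C * t powr (- 2 * p)"
    using assms b by (intro mult_left_mono powr_mono2') auto
  finally show ?thesis .
qed

lemma even_floor_power:
  assumes "t \<ge> 1"
  shows "(real (even_floor t) + 1) ^ d \<le> 3 ^ d * t powr real d"
proof -
  have "(real (even_floor t) + 1) ^ d \<le> (3 * t) ^ d"
    using even_floor_bounds[OF assms] by (intro power_mono) auto
  then show ?thesis using assms by (simp add: power_mult_distrib powr_realpow)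
qed

lemma target_class_bdm: "target_class s p f \<Longrightarrow> bdm s f"
  by (rule bdm_continuous) (rule target_class_continuous)

lemma noise_law_nonneg: "noise_law \<nu> \<sigma>2 \<Longrightarrow> \<sigma>2 \<ge> 0"
  using noise_law_facts(6)[of \<nu> \<sigma>2] Bochner_Integration.integral_nonneg[of \<nu> "\<lambda>t. t * t"] by simp

lemma projection_rate:
  fixes f :: "real ^ 'd::finite \<Rightarrow> real"
  assumes p: "p > 0" and f: "target_class s p f" and v: "var s f > 0"
  shows "\<exists>C. \<forall>\<nu> U n. noise_law \<nu> \<sigma>2 \<and> n \<ge> 2 \<longrightarrow>
    risks_le s projection f \<nu> (even_floor (real n powr (1 / (2 * p + real CARD('d))))) n U
      (C * real n powr (- 2 * p / (2 * p + real CARD('d))))"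
proof -
  define D where "D = 2 * p + real CARD('d)"
  have D: "D > 0" using p by (simp add: D_def add_pos_nonneg)
  note b = target_class_bdm[OF f]
  obtain B where B: "\<And>x. x \<in> cube s \<Longrightarrow> \<bar>f x\<bar> \<le> B" using b by (auto simp: bdm_def)
  have K: "(f x)\<^sup>2 \<le> B\<^sup>2" if "x \<in> cube s" for x using B[OF that] by (rule abs_le_square_iff[THEN iffD1, OF order_trans]) simp
  obtain C where C: "C \<ge> 0" "\<forall>k\<ge>2. (s = Trig \<longrightarrow> even k) \<longrightarrow> trunc_err s f k \<le> C * real k powr (- 2 * p)"
    using trunc_err_target[OF f] by blast
  define C' where "C' = 16 / var s f * (C + 3 ^ CARD('d) * (B\<^sup>2 + \<sigma>2))"
  have "risks_le s projection f \<nu> (even_floor (real n powr (1 / D))) n U (C' * real n powr (- 2 * p / D))"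
    if nl: "noise_law \<nu> \<sigma>2" and n: "n \<ge> 2" for \<nu> U n
  proof (rule projection_risk[OF nl b v _ K])
    \<comment> \<open>The point of balance between \<open>t powr (- 2 * p)\<close> and
      \<open>t powr d / n\<close>; both equal the claimed rate.\<close>
    let ?t = "real n powr (1 / D)"
    have t: "?t \<ge> 1" using n D by (intro ge_one_powr_ge_zero) auto
    have \<sigma>: "\<sigma>2 \<ge> 0" by (rule noise_law_nonneg[OF nl])
    have 1: "?t powr (- 2 * p) = real n powr (- 2 * p / D)" by (simp add: powr_powr)
    have "?t powr real CARD('d) / real n = real n powr (real CARD('d) / D) / real n powr 1"
      using n by (simp add: powr_powr)
    also have "\<dots> = real n powr (real CARD('d) / D - 1)" by (rule powr_diff[symmetric])
    also have "real CARD('d) / D - 1 = - 2 * p / D" using D by (simp add: D_def field_simps)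
    finally have 2: "?t powr real CARD('d) / real n = real n powr (- 2 * p / D)" .
    have "(real (even_floor ?t) + 1) ^ CARD('d) * (B\<^sup>2 + \<sigma>2) / real n \<le> (3 ^ CARD('d) * ?t powr real CARD('d)) * (B\<^sup>2 + \<sigma>2) / real n"
      using even_floor_power[OF t, of "CARD('d)"] \<sigma> by (intro divide_right_mono mult_right_mono) auto
    also have "\<dots> = (3 ^ CARD('d) * (B\<^sup>2 + \<sigma>2)) * (?t powr real CARD('d) / real n)" by simp
    finally have "trunc_err s f (even_floor ?t) + (real (even_floor ?t) + 1) ^ CARD('d) * (B\<^sup>2 + \<sigma>2) / real n
        \<le> C * real n powr (- 2 * p / D) + (3 ^ CARD('d) * (B\<^sup>2 + \<sigma>2)) * real n powr (- 2 * p / D)"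
      using trunc_err_even_floor[OF C(2,1) p t] unfolding 1 2 by (rule add_mono[rotated])
    then have "16 / var s f * (trunc_err s f (even_floor ?t) + (real (even_floor ?t) + 1) ^ CARD('d) * (B\<^sup>2 + \<sigma>2) / real n)
        \<le> 16 / var s f * (C * real n powr (- 2 * p / D) + (3 ^ CARD('d) * (B\<^sup>2 + \<sigma>2)) * real n powr (- 2 * p / D))"
      using v by (intro mult_left_mono) auto
    also have "\<dots> = C' * real n powr (- 2 * p / D)" unfolding C'_def by (simp only: distrib_right mult.assoc)
    finally show "16 / var s f * (trunc_err s f (even_floor ?t) + (real (even_floor ?t) + 1) ^ CARD('d) * (B\<^sup>2 + \<sigma>2) / real n)
        \<le> C' * real n powr (- 2 * p / D)" .
  qed (use n in auto)
  then show ?thesis unfolding D_def by blast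
qed

text \<open>The number of cells per coordinate has to be of the order of the constant in the Bernstein
  inequality, hence of the squared degree in the Legendre setting.\<close>

definition resolution_exponent :: "setting \<Rightarrow> real" where
  "resolution_exponent s = (if s = Legendre then 2 else 1)"

text \<open>Separates the choice of the degree from the risk bound: only asymptotic comparisons of
  \<open>t\<close> with \<open>rate\<close> are left to check, because for finitely many n the error
  is at most 1 and the rate is positive. \<open>M * T n\<close> bounds the number of cells.\<close>

lemma least_squares_rate:
  fixes f :: "real ^ 'd::finite \<Rightarrow> real" and t rate :: "nat \<Rightarrow> real" and \<sigma>2 :: real and s :: setting
  defines "M \<equiv> (161 * real CARD('d)) ^ CARD('d)"
    and "T \<equiv> \<lambda>n. t n powr (resolution_exponent s * real CARD('d))"
  assumes p: "p > 0" and f: "target_class s p f" and v: "var s f > 0"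
    and rate: "\<And>n. n \<ge> 2 \<Longrightarrow> rate n > 0"
    and t: "eventually (\<lambda>n. 1 \<le> t n) sequentially"
    and bad: "eventually (\<lambda>n. M * T n * exp (- (real n / (10 * (M * T n)))) \<le> rate n) sequentially"
    and approx: "eventually (\<lambda>n. t n powr (- 2 * p) \<le> A1 * rate n) sequentially"
    and noise: "eventually (\<lambda>n. \<sigma>2 * (t n powr real CARD('d) / real n) \<le> A2 * rate n) sequentially"
  shows "\<exists>C. \<forall>\<nu> U n. noise_law \<nu> \<sigma>2 \<and> n \<ge> 2 \<longrightarrow>
    risks_le s least_squares f \<nu> (even_floor (t n)) n U (C * rate n)"
proof -
  note b = target_class_bdm[OF f]
  let ?d = "real CARD('d)" and ?q = "resolution_exponent s"
  obtain C where C: "C \<ge> 0" "\<forall>k\<ge>2. (s = Trig \<longrightarrow> even k) \<longrightarrow> trunc_err s f k \<le> C * real k powr (- 2 * p)"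
    using trunc_err_target[OF f] by blast
  define C1 where "C1 = 1 + 16 / var s f * (9 * (C * A1) + 32 * 3 ^ CARD('d) * A2)"
  have "eventually (\<lambda>n. n \<ge> 2 \<and> 1 \<le> t n \<and> M * T n * exp (- (real n / (10 * (M * T n)))) \<le> rate n \<and>
      t n powr (- 2 * p) \<le> A1 * rate n \<and> \<sigma>2 * (t n powr ?d / real n) \<le> A2 * rate n) sequentially"
    by (intro eventually_conj t bad approx noise eventually_ge_at_top)
  then obtain n0 where n0: "\<And>n. n \<ge> n0 \<Longrightarrow> n \<ge> 2 \<and> 1 \<le> t n \<and> M * T n * exp (- (real n / (10 * (M * T n)))) \<le> rate n \<and>
      t n powr (- 2 * p) \<le> A1 * rate n \<and> \<sigma>2 * (t n powr ?d / real n) \<le> A2 * rate n"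
    unfolding eventually_sequentially by blast
  \<comment> \<open>A sum of positive terms dominates each of them, so \<open>C2\<close> is at least
    the reciprocal rate at every small n.\<close>
  define C2 where "C2 = (\<Sum>n\<in>{2..<n0}. 1 / rate n)"
  have C2: "1 \<le> C2 * rate n" if "n \<ge> 2" "n < n0" for n
  proof -
    have "1 / rate n \<le> C2" unfolding C2_def
      by (rule member_le_sum) (use that rate in \<open>auto intro: less_imp_le\<close>)
    then show ?thesis using rate[OF that(1)] by (simp add: field_simps)
  qed
  have "risks_le s least_squares f \<nu> (even_floor (t n)) n U (max C1 C2 * rate n)"
    if nl: "noise_law \<nu> \<sigma>2" and n: "n \<ge> 2" for \<nu> U n
  proof (cases "n < n0")
    case True
    have "1 \<le> C2 * rate n" by (rule C2[OF n True])
    also have "\<dots> \<le> max C1 C2 * rate n" using rate[OF n] by (intro mult_right_mono) auto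
    finally show ?thesis
      by (intro risks_le_trivial[OF nl b v] est_coef_least_squares_measurable[OF nl bdm_measurable[OF b]])
  next
    case False
    then have n': "n \<ge> n0" by simp
    have t1: "t n \<ge> 1" and bd: "M * T n * exp (- (real n / (10 * (M * T n)))) \<le> rate n"
      and ap: "t n powr (- 2 * p) \<le> A1 * rate n" and no: "\<sigma>2 * (t n powr ?d / real n) \<le> A2 * rate n"
      using n0[OF n'] by auto
    \<comment> \<open>The factor 160 covers both forms of the fineness condition:
      \<open>20 * pi * 2 \<le> 160\<close> for a degree up to \<open>2 * t\<close>, and
      \<open>10 * 9 \<le> 160\<close> for Legendre, where
      \<open>(k + 1)\<^sup>2 \<le> 9 * t\<^sup>2\<close>. Rounding up turns it into 161, the
      constant in \<open>M\<close>.\<close>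
    define m where "m = nat \<lceil>160 * ?d * t n powr ?q\<rceil>"
    have d1: "?d \<ge> 1" using zero_less_card_finite[where 'a='d] by linarith
    have tq: "t n powr ?q \<ge> 1" using t1 by (intro ge_one_powr_ge_zero) (auto simp: resolution_exponent_def)
    have dtq: "?d * t n powr ?q \<ge> 1" using mult_mono[OF d1 tq] by simp
    have m1: "160 * ?d * t n powr ?q \<le> real m" unfolding m_def by linarith
    have m2: "real m \<le> 161 * ?d * t n powr ?q"
    proof -
      have "real m < 160 * ?d * t n powr ?q + 1" unfolding m_def using dtq by linarith
      then show ?thesis using dtq by linarith
    qed
    have m0: "m \<ge> 1" using m1 dtq by linarith
    have "real m ^ CARD('d) \<le> (161 * ?d * t n powr ?q) ^ CARD('d)" using m2 by (rule power_mono) simp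
    also have "\<dots> = M * T n"
      using t1 by (simp add: M_def T_def power_mult_distrib powr_realpow[symmetric] powr_powr)
    finally have mM: "real m ^ CARD('d) \<le> M * T n" .
    have mp: "real m ^ CARD('d) > 0" using m0 by simp
    \<comment> \<open>The failure bound increases with the number of cells, so that number may be
      replaced by \<open>M * T n\<close>.\<close>
    have "real n / (10 * (M * T n)) \<le> real n / (10 * real m ^ CARD('d))"
    proof -
      have "real n / (10 * Y) \<le> real n / (10 * X)" if "0 < X" "X \<le> Y" for X Y :: real
        using that by (intro divide_left_mono) auto
      from this[OF mp mM] show ?thesis .
    qed
    then have "real m ^ CARD('d) * exp (- (real n / (10 * real m ^ CARD('d)))) \<le> M * T n * exp (- (real n / (10 * (M * T n))))"
      using mM mp order.trans[OF less_imp_le[OF mp] mM] by (intro mult_mono) auto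
    then have 1: "real m ^ CARD('d) * exp (- (real n / (10 * real m ^ CARD('d)))) \<le> rate n" using bd by linarith
    have te: "trunc_err s f (even_floor (t n)) \<le> C * A1 * rate n"
      using trunc_err_even_floor[OF C(2,1) p t1] mult_left_mono[OF ap C(1)] by (simp add: mult.assoc)
    have \<sigma>: "\<sigma>2 \<ge> 0" by (rule noise_law_nonneg[OF nl])
    have "32 * \<sigma>2 * (real (even_floor (t n)) + 1) ^ CARD('d) / real n \<le> 32 * \<sigma>2 * (3 ^ CARD('d) * t n powr ?d) / real n"
      using even_floor_power[OF t1, of "CARD('d)"] \<sigma> by (intro divide_right_mono mult_left_mono) auto
    also have "\<dots> = 32 * 3 ^ CARD('d) * (\<sigma>2 * (t n powr ?d / real n))" by simp
    also have "\<dots> \<le> 32 * 3 ^ CARD('d) * (A2 * rate n)" using no by (rule mult_left_mono) simp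
    finally have va: "32 * \<sigma>2 * (real (even_floor (t n)) + 1) ^ CARD('d) / real n \<le> 32 * 3 ^ CARD('d) * A2 * rate n" by simp
    have fine: "(if s = Legendre then 10 * ?d * (real (even_floor (t n)) + 1)\<^sup>2 else 20 * pi * ?d * real (even_floor (t n))) \<le> real m"
    proof (cases "s = Legendre")
      case True
      have "10 * ?d * (real (even_floor (t n)) + 1)\<^sup>2 \<le> 10 * ?d * (9 * t n powr ?q)"
        using even_floor_power[OF t1, of 2] True by (intro mult_left_mono) (auto simp: resolution_exponent_def)
      also have "\<dots> \<le> real m" using m1 dtq by linarith
      finally show ?thesis using True by simp
    next
      case False
      have k2: "real (even_floor (t n)) \<le> 2 * t n" unfolding even_floor_def using t1 by linarith
      have "20 * pi * ?d * real (even_floor (t n)) \<le> 20 * 4 * ?d * (2 * t n)"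
        using k2 pi_less_4 by (intro mult_mono) auto
      also have "\<dots> \<le> real m" using m1 False t1 by (simp add: resolution_exponent_def)
      finally show ?thesis using False by simp
    qed
    have "9 * trunc_err s f (even_floor (t n)) + 32 * \<sigma>2 * (real (even_floor (t n)) + 1) ^ CARD('d) / real n
        \<le> 9 * (C * A1 * rate n) + 32 * 3 ^ CARD('d) * A2 * rate n"
      using te va by linarith
    then have "16 / var s f * (9 * trunc_err s f (even_floor (t n)) + 32 * \<sigma>2 * (real (even_floor (t n)) + 1) ^ CARD('d) / real n)
        \<le> 16 / var s f * (9 * (C * A1 * rate n) + 32 * 3 ^ CARD('d) * A2 * rate n)"
      using v by (intro mult_left_mono) auto
    with 1 have "real m ^ CARD('d) * exp (- (real n / (10 * real m ^ CARD('d)))) + 16 / var s f * (9 * trunc_err s f (even_floor (t n)) + 32 * \<sigma>2 * (real (even_floor (t n)) + 1) ^ CARD('d) / real n)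
        \<le> rate n + 16 / var s f * (9 * (C * A1 * rate n) + 32 * 3 ^ CARD('d) * A2 * rate n)" by (rule add_mono)
    also have "\<dots> = C1 * rate n" unfolding C1_def by (simp only: distrib_right distrib_left mult.assoc mult_1_left)
    also have "\<dots> \<le> max C1 C2 * rate n" using rate[OF n] by (intro mult_right_mono) auto
    finally show ?thesis
      by (intro least_squares_risk[OF nl b v _ _ m0 fine]) (use n in \<open>auto simp: even_floor_def\<close>)
  qed
  then show ?thesis by blast
qed

section \<open>Degrees as functions of the sample size\<close>

lemma over_ln_bounds:
  assumes "n \<ge> (2::nat)"
  shows "real n / ln (real n) \<ge> 1" and "n \<ge> 3 \<Longrightarrow> real n / ln (real n) \<le> real n"
proof -
  have l: "ln (real n) > 0" using assms by simp
  have "ln (real n) \<le> real n" using ln_le_minus_one[of "real n"] assms by linarith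
  then show "real n / ln (real n) \<ge> 1" using l by simp
  assume "n \<ge> 3"
  then have "exp 1 \<le> real n" using exp_le by linarith
  then have "ln (real n) \<ge> 1" using assms by (subst ln_ge_iff) auto
  then show "real n / ln (real n) \<le> real n" using l assms by (simp add: field_simps)
qed

text \<open>The constant \<open>c\<close> makes the exponential, which comes from the probability of a bad design, equal
  to \<open>n powr - (1 + 2 * p / d)\<close>.\<close>

lemma eventually_over_ln_degree:
  fixes q d p :: real
  assumes q: "q \<ge> 1" and d: "d > 0" and p: "p > 0" and M: "M > 0"
  defines "c \<equiv> 1 / (10 * M * (1 + 2 * p / d))"
  defines "t \<equiv> \<lambda>n. (c * (real n / ln (real n))) powr (1 / (q * d))"
    and "b \<equiv> 2 * p / (q * d)"
  shows "eventually (\<lambda>n. 1 \<le> t n) sequentially"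
    and "eventually (\<lambda>n. M * t n powr (q * d) * exp (- (real n / (10 * (M * t n powr (q * d))))) \<le> (real n / ln (real n)) powr (- b)) sequentially"
    and "eventually (\<lambda>n. t n powr (- 2 * p) \<le> c powr (- b) * (real n / ln (real n)) powr (- b)) sequentially"
    and "b \<le> 1 - 1 / q \<Longrightarrow> eventually (\<lambda>n. t n powr d / real n \<le> c powr (1 / q) * (real n / ln (real n)) powr (- b)) sequentially"
proof -
  let ?x = "\<lambda>n :: nat. real n / ln (real n)"
  define r where "r = 1 + 2 * p / d"
  have r: "r \<ge> 1" using p d by (simp add: r_def)
  have c: "c > 0" unfolding c_def using M r by (simp add: r_def)
  have qd: "q * d > 0" using q d by simp
  have inf: "filterlim (\<lambda>n::nat. c * ?x n) at_top sequentially" using c by real_asymp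
  have "eventually (\<lambda>n. 1 \<le> c * ?x n) sequentially" using inf unfolding filterlim_at_top by blast
  then show "eventually (\<lambda>n. 1 \<le> t n) sequentially"
    by (rule eventually_mono) (unfold t_def, rule ge_one_powr_ge_zero, use qd in auto)
  have T: "t n powr (q * d) = c * ?x n" if "n \<ge> 2" for n
    unfolding t_def using q d c that over_ln_bounds(1)[OF that] by (simp add: powr_powr)
  have "M * t n powr (q * d) * exp (- (real n / (10 * (M * t n powr (q * d))))) \<le> ?x n powr (- b)" if n: "n \<ge> 3" for n
  proof -
    have n2: "n \<ge> 2" using n by simp
    note x1 = over_ln_bounds(1)[OF n2] and xn = over_ln_bounds(2)[OF n2 n]
    have l: "ln (real n) > 0" using n by simp
    have Mc: "M * c = 1 / (10 * r)" using M by (simp add: c_def r_def)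
    have "10 * (M * t n powr (q * d)) = ?x n / r"
      unfolding T[OF n2] using Mc r by (simp add: mult.assoc[symmetric])
    then have "exp (- (real n / (10 * (M * t n powr (q * d))))) = real n powr (- r)"
      using n l by (simp add: powr_def field_simps)
    then have "M * t n powr (q * d) * exp (- (real n / (10 * (M * t n powr (q * d))))) = 1 / (10 * r) * ?x n * real n powr (- r)"
      unfolding T[OF n2] mult.assoc[symmetric] Mc by simp
    \<comment> \<open>The number of cells is at most n and uses up one of the r powers; what remains
      is the exponent \<open>2 * p / d\<close>, at least \<open>b\<close>.\<close>
    also have "\<dots> \<le> 1 * real n * real n powr (- r)"
      using xn x1 r by (intro mult_right_mono mult_mono) auto
    also have "\<dots> = real n powr (1 + - r)" using n by (simp only: powr_add) simp
    also have "\<dots> = real n powr (- (2 * p / d))" by (simp add: r_def)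
    also have "\<dots> \<le> ?x n powr (- (2 * p / d))" using xn x1 p d by (intro powr_mono2') auto
    also have "\<dots> \<le> ?x n powr (- b)"
    proof (rule powr_mono)
      have "2 * p / (q * d) \<le> 2 * p / d" using q d p by (intro divide_left_mono) auto
      then show "- (2 * p / d) \<le> - b" by (simp add: b_def)
    qed (rule x1)
    finally show ?thesis .
  qed
  then show "eventually (\<lambda>n. M * t n powr (q * d) * exp (- (real n / (10 * (M * t n powr (q * d))))) \<le> ?x n powr (- b)) sequentially"
    unfolding eventually_sequentially by blast
  have "t n powr (- 2 * p) \<le> c powr (- b) * ?x n powr (- b)" for n
  proof -
    have e: "1 / (q * d) * (- 2 * p) = - (2 * p / (q * d))" by simp
    show ?thesis unfolding t_def b_def powr_powr e powr_mult by (rule order_refl)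
  qed
  then show "eventually (\<lambda>n. t n powr (- 2 * p) \<le> c powr (- b) * ?x n powr (- b)) sequentially"
    by simp
  assume bq: "b \<le> 1 - 1 / q"
  have "t n powr d / real n \<le> c powr (1 / q) * ?x n powr (- b)" if n: "n \<ge> 3" for n
  proof -
    have n2: "n \<ge> 2" using n by simp
    note x1 = over_ln_bounds(1)[OF n2] and xn = over_ln_bounds(2)[OF n2 n]
    have "t n powr d / real n = c powr (1 / q) * (?x n powr (1 / q) / real n)"
    proof -
      have "1 / (q * d) * d = 1 / q" using d by simp
      then show ?thesis unfolding t_def powr_powr powr_mult by (simp only: times_divide_eq_right)
    qed
    \<comment> \<open>Enlarging 1 / n to ln n / n leaves powers of a single quantity.\<close>
    also have "?x n powr (1 / q) / real n \<le> ?x n powr (1 / q) / ?x n"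
      using xn x1 n by (intro divide_left_mono) auto
    also have "\<dots> = ?x n powr (1 / q - 1)" using x1 n ln_gt_zero[of "real n"] by (simp add: powr_diff)
    also have "\<dots> \<le> ?x n powr (- b)" using bq x1 by (intro powr_mono) auto
    finally show ?thesis using c by simp
  qed
  then show "eventually (\<lambda>n. t n powr d / real n \<le> c powr (1 / q) * ?x n powr (- b)) sequentially"
    unfolding eventually_sequentially by blast
qed

text \<open>For \<open>e < 1\<close> each cell expects a positive power of n of the sample points,
  so the failure probability decays faster than any power and no logarithm is lost.\<close>

lemma eventually_power_degree:
  fixes a b e M :: real
  assumes "M > 0" "e < 1"
  shows "eventually (\<lambda>n. M * real n powr e * exp (- (real n / (10 * (M * real n powr e)))) \<le> real n powr b) sequentially"
proof -
  have "1 - e > 0" using assms by simp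
  have "eventually (\<lambda>n::nat. M * real n powr e * exp (- (real n powr (1 - e) / (10 * M))) \<le> real n powr b) sequentially"
    using assms by real_asymp
  moreover have "real n powr (1 - e) / (10 * M) = real n / (10 * (M * real n powr e))" if "n \<ge> 1" for n
    using that by (simp add: powr_diff)
  ultimately show ?thesis
    by (auto elim!: eventually_elim2[OF _ eventually_ge_at_top[of 1]])
qed

theorem mainTheorem7:
  fixes p :: real and s :: setting
  assumes "p > 0"
  shows
    "(\<exists>amax. admissible_degree s amax \<and>
        (\<forall>f :: real ^ 'd \<Rightarrow> real. target_class s p f \<and> var s f > 0 \<longrightarrow>
          (\<exists>C. \<forall>\<nu> U n. noise_law \<nu> 0 \<and> n \<ge> 2 \<longrightarrow>
            risks_le s least_squares f \<nu> (amax n) n U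
              (C * (real n / ln (real n)) powr
                (if s = Legendre then - p / real CARD('d) else - 2 * p / real CARD('d))))))
     \<and>
     (\<exists>amax. admissible_degree s amax \<and>
        (\<forall>f :: real ^ 'd \<Rightarrow> real. target_class s p f \<and> var s f > 0 \<longrightarrow>
          (\<forall>\<sigma>2 \<ge> 0. \<exists>C. \<forall>\<nu> U n. noise_law \<nu> \<sigma>2 \<and> n \<ge> 2 \<longrightarrow>
            risks_le s projection f \<nu> (amax n) n U
              (C * real n powr (- 2 * p / (2 * p + real CARD('d)))))))
     \<and>
     (\<exists>amax. admissible_degree s amax \<and>
        (\<forall>f :: real ^ 'd \<Rightarrow> real. target_class s p f \<and> var s f > 0 \<longrightarrow>
          (\<forall>\<sigma>2 > 0. \<exists>C. \<forall>\<nu> U n. noise_law \<nu> \<sigma>2 \<and> n \<ge> 2 \<longrightarrow>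
            risks_le s least_squares f \<nu> (amax n) n U
              (C * (if s = Legendre \<and> p / real CARD('d) \<le> 1 / 2
                    then (real n / ln (real n)) powr (- p / real CARD('d))
                    else real n powr (- 2 * p / (2 * p + real CARD('d))))))))"
proof (intro conjI)
  let ?d = "real CARD('d)"
  define q where "q = resolution_exponent s"
  define M where "M = (161 * ?d) ^ CARD('d)"
  define c where "c = 1 / (10 * M * (1 + 2 * p / ?d))"
  define t1 where "t1 n = (c * (real n / ln (real n))) powr (1 / (q * ?d))" for n
  define t2 where "t2 n = real n powr (1 / (2 * p + ?d))" for n
  define rate1 where "rate1 n = (real n / ln (real n)) powr (- (2 * p / (q * ?d)))" for n
  define rate2 where "rate2 n = real n powr (- 2 * p / (2 * p + ?d))" for n
  have d: "?d > 0" using zero_less_card_finite[where 'a='d] by linarith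
  have D: "2 * p + ?d > 0" using assms d by simp
  have q: "q \<ge> 1" by (simp add: q_def resolution_exponent_def)
  have M: "M > 0" using d by (simp add: M_def)
  note deg1 = eventually_over_ln_degree[OF q d assms M, folded c_def, folded t1_def, folded rate1_def]
  have pos1: "rate1 n > 0" if "n \<ge> 2" for n using over_ln_bounds(1)[OF that] unfolding rate1_def powr_gt_zero by linarith
  have pos2: "rate2 n > 0" if "n \<ge> 2" for n using that by (simp add: rate2_def)
  have adm: "admissible_degree s (\<lambda>n. even_floor (t n))" for t
    by (simp add: admissible_degree_def even_floor_def)
  have rate1: "(if s = Legendre then - p / ?d else - 2 * p / ?d) = - (2 * p / (q * ?d))"
    by (simp add: q_def resolution_exponent_def)
  \<comment> \<open>The largest degree that stability allows. With noise, the second alternative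
    keeps the variance \<open>t powr d / n\<close> below the truncation error up to constants; it
    reads \<open>p / d \<le> 1 / 2\<close> for Legendre and is false for
    \<open>q = 1\<close>.\<close>
  have low: "\<exists>C. \<forall>\<nu> U n. noise_law \<nu> \<sigma>2 \<and> n \<ge> 2 \<longrightarrow>
      risks_le s least_squares f \<nu> (even_floor (t1 n)) n U (C * rate1 n)"
    if f: "target_class s p f" "var s f > 0" and \<sigma>: "\<sigma>2 = 0 \<or> \<sigma>2 > 0 \<and> 2 * p / (q * ?d) \<le> 1 - 1 / q" for f :: "real ^ 'd \<Rightarrow> real" and \<sigma>2
  proof (rule least_squares_rate[OF assms f, of rate1 t1 _ \<sigma>2 "\<sigma>2 * c powr (1 / q)", OF pos1 deg1(1) _ deg1(3)])
    show "eventually (\<lambda>n. (161 * ?d) ^ CARD('d) * t1 n powr (resolution_exponent s * ?d) *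
        exp (- (real n / (10 * ((161 * ?d) ^ CARD('d) * t1 n powr (resolution_exponent s * ?d))))) \<le> rate1 n) sequentially"
      using deg1(2) unfolding M_def q_def .
    show "eventually (\<lambda>n. \<sigma>2 * (t1 n powr ?d / real n) \<le> \<sigma>2 * c powr (1 / q) * rate1 n) sequentially"
    proof (cases "\<sigma>2 = 0")
      case False
      then have "\<sigma>2 > 0" "2 * p / (q * ?d) \<le> 1 - 1 / q" using \<sigma> by auto
      then show ?thesis unfolding mult.assoc
        by (intro eventually_mono[OF deg1(4)] mult_left_mono) auto
    qed simp
  qed
  \<comment> \<open>The degree that balances bias and variance. It stays below the stability limit
    if \<open>q * d < 2 * p + d\<close>, which always holds for \<open>q = 1\<close> and means
    \<open>p / d > 1 / 2\<close> for Legendre.\<close>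
  have high: "\<exists>C. \<forall>\<nu> U n. noise_law \<nu> \<sigma>2 \<and> n \<ge> 2 \<longrightarrow>
      risks_le s least_squares f \<nu> (even_floor (t2 n)) n U (C * rate2 n)"
    if f: "target_class s p f" "var s f > 0" and e: "q * ?d < 2 * p + ?d" for f :: "real ^ 'd \<Rightarrow> real" and \<sigma>2
  proof (rule least_squares_rate[OF assms f, of rate2 t2 1 \<sigma>2 \<sigma>2, OF pos2])
    show "eventually (\<lambda>n. 1 \<le> t2 n) sequentially"
      using eventually_ge_at_top[of 1] by eventually_elim (use D in \<open>auto simp: t2_def intro!: ge_one_powr_ge_zero\<close>)
    have T: "t2 n powr (resolution_exponent s * ?d) = real n powr (q * ?d / (2 * p + ?d))" for n
      by (simp add: t2_def powr_powr q_def)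
    show "eventually (\<lambda>n. (161 * ?d) ^ CARD('d) * t2 n powr (resolution_exponent s * ?d) *
        exp (- (real n / (10 * ((161 * ?d) ^ CARD('d) * t2 n powr (resolution_exponent s * ?d))))) \<le> rate2 n) sequentially"
      unfolding T rate2_def by (rule eventually_power_degree[OF M[unfolded M_def]]) (use e D in simp)
    show "eventually (\<lambda>n. t2 n powr (- 2 * p) \<le> 1 * rate2 n) sequentially"
      by (simp add: t2_def rate2_def powr_powr)
    have "t2 n powr ?d / real n = rate2 n" if "n \<ge> 1" for n
    proof -
      have "t2 n powr ?d / real n = real n powr (?d / (2 * p + ?d)) / real n powr 1"
        using that by (simp add: t2_def powr_powr)
      also have "\<dots> = real n powr (?d / (2 * p + ?d) - 1)" by (rule powr_diff[symmetric])
      also have "?d / (2 * p + ?d) - 1 = - 2 * p / (2 * p + ?d)" using D by (simp add: field_simps)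
      finally show ?thesis by (simp add: rate2_def)
    qed
    then show "eventually (\<lambda>n. \<sigma>2 * (t2 n powr ?d / real n) \<le> \<sigma>2 * rate2 n) sequentially"
      by (intro eventually_mono[OF eventually_ge_at_top[of 1]]) (simp only: order_refl)
  qed
  show "\<exists>amax. admissible_degree s amax \<and>
      (\<forall>f :: real ^ 'd \<Rightarrow> real. target_class s p f \<and> var s f > 0 \<longrightarrow>
        (\<exists>C. \<forall>\<nu> U n. noise_law \<nu> 0 \<and> n \<ge> 2 \<longrightarrow>
          risks_le s least_squares f \<nu> (amax n) n U
            (C * (real n / ln (real n)) powr (if s = Legendre then - p / ?d else - 2 * p / ?d))))"
    unfolding rate1 rate1_def[symmetric]
    by (intro exI[of _ "\<lambda>n. even_floor (t1 n)"] conjI adm allI impI low) auto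
  show "\<exists>amax. admissible_degree s amax \<and>
      (\<forall>f :: real ^ 'd \<Rightarrow> real. target_class s p f \<and> var s f > 0 \<longrightarrow>
        (\<forall>\<sigma>2 \<ge> 0. \<exists>C. \<forall>\<nu> U n. noise_law \<nu> \<sigma>2 \<and> n \<ge> 2 \<longrightarrow>
          risks_le s projection f \<nu> (amax n) n U (C * real n powr (- 2 * p / (2 * p + ?d)))))"
    by (intro exI[of _ "\<lambda>n. even_floor (real n powr (1 / (2 * p + ?d)))"] conjI adm allI impI projection_rate[OF assms]) auto
  show "\<exists>amax. admissible_degree s amax \<and>
      (\<forall>f :: real ^ 'd \<Rightarrow> real. target_class s p f \<and> var s f > 0 \<longrightarrow>
        (\<forall>\<sigma>2 > 0. \<exists>C. \<forall>\<nu> U n. noise_law \<nu> \<sigma>2 \<and> n \<ge> 2 \<longrightarrow>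
          risks_le s least_squares f \<nu> (amax n) n U
            (C * (if s = Legendre \<and> p / ?d \<le> 1 / 2
                  then (real n / ln (real n)) powr (- p / ?d)
                  else real n powr (- 2 * p / (2 * p + ?d))))))"
  proof (cases "s = Legendre \<and> p / ?d \<le> 1 / 2")
    case True
    then have r: "(real n / ln (real n)) powr (- p / ?d) = rate1 n" for n
      by (simp add: rate1_def q_def resolution_exponent_def)
    have e: "2 * p / (q * ?d) \<le> 1 - 1 / q" using True by (simp add: q_def resolution_exponent_def)
    show ?thesis unfolding if_P[OF True] r
      by (intro exI[of _ "\<lambda>n. even_floor (t1 n)"] conjI adm allI impI low) (use e in auto)
  next
    case False
    then have e: "q * ?d < 2 * p + ?d" using assms d by (auto simp: q_def resolution_exponent_def field_simps)
    show ?thesis unfolding if_not_P[OF False] rate2_def[symmetric]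
      by (intro exI[of _ "\<lambda>n. even_floor (t2 n)"] conjI adm allI impI high) (use e in auto)
  qed
qed

end
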